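(* Let $a$ and $b$ be two second order free random variables in a second order non-commutative probability space $(\mathcal A,\varphi,\varphi^2)$. Then for every $n,m\ge 1$, $$\kappa_{n,m}^{ab+ba}=\sum_{\substack{\pi\in\mathcal J_{2n,2m}\\ \pi=\pi'\sqcup\pi''}}\left(\kappa^a_{\pi'}\,\kappa^b_{\pi''}+\kappa^b_{\pi'}\,\kappa^a_{\pi''}\right)+\sum_{\substack{(\mathcal U,\pi)\in\mathcal X_{2n,2m}\\ \pi=\pi'\sqcup\pi''\sqcup A\sqcup B}}\left(\kappa^a_{|A|,|B|}\,\kappa^a_{\pi'}\,\kappa^b_{\pi''}+\kappa^b_{|A|,|B|}\,\kappa^b_{\pi'}\,\kappa^a_{\pi''}\right).$$
   Context: Permutations are composed right to left; $\#(\pi)$ is the number of cycles of $\pi$; a permutation is also regarded as a partition whose blocks are its cycles; $\vee$ is the join in the lattice of all set partitions. Second order non-commutative probability space: a triple $(\mathcal A,\varphi,\varphi^2)$ with $\mathcal A$ a unital algebra over $\mathbb C$, $\varphi:\mathcal A\to\mathbb C$ a linear functional with $\varphi(1)=1$, and $\varphi^2:\mathcal A\times\mathcal A\to\mathbb C$ bilinear, tracial in each argument, with $\varphi^2(x,1)=0=\varphi^2(1,x)$ for all $x\in\mathcal A$. $NC(p)$: non-crossing partitions of $\{1,\dots,p\}$, each identified with the permutation whose cycles are the blocks in increasing order (similarly for other linearly ordered sets). Put $\gamma_{p,q}=(1,\dots,p)(p+1,\dots,p+q)\in S_{p+q}$. $S_{NC}(p,q)$ (non-crossing annular permutations): all $\pi\in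 S_{p+q}$ such that $\pi\vee\gamma_{p,q}$ is the one-block partition and $\#(\pi)+\#(\pi^{-1}\gamma_{p,q})=p+q$. $S'_{NC}(p,q)$: all pairs $(\mathcal U,\pi)$ with $\pi=\pi_1\times\pi_2$, $\pi_1\in NC(\{1,\dots,p\})$, $\pi_2\in NC(\{p+1,\dots,p+q\})$, and $\mathcal U$ the partition whose blocks are the cycles of $\pi$ except that exactly one cycle $A$ of $\pi_1$ and one cycle $B$ of $\pi_2$ are merged into one block. Cumulants: the free cumulants $\kappa_n$ are the multilinear functionals defined recursively by $\varphi(a_1\cdots a_n)=\sum_{\pi\in NC(n)}\prod_{V\in\pi}\kappa_{|V|}(a_V)$, and the second order free cumulants $\kappa_{p,q}$ are defined recursively by $$\varphi^2(a_1\cdots a_p,a_{p+1}\cdots a_{p+q})=\sum_{\pi\in S_{NC}(p,q)}\prod_{V\in\pi}\kappa_{|V|}(a_V)+\sum_{(\mathcal U,\pi)\in S'_{NC}(p,q)}\kappa_{|A|,|B|}(a_A,a_B)\prod_{V\in\pi\setminus\{A,B\}}\kappa_{|V|}(a_V),$$ where $a_V$ lists the $a_i$, $i\in V$, in the order of the cycle $V$ (increasing order for blocks of non-crossing partitions). Write $\kappa_n^x=\kappa_n(x,\dots,x)$, $\kappa_{n,m}^x=\kappa_{n,m}(x,\dots,x)$, and for a collection $\sigma$ of cycles $\kappa^x_\sigma=\prod_{V\in\sigma}\kappa^x_{|V|}$ (empty product $=1$). Elements $a,b$ are second order free iff all mixed cumulants vanish: $\kappa_n(a_1,\dots,a_n)=0$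 ($n\ge2$) and $\kappa_{n,m}(a_1,\dots,a_{n+m})=0$ ($n,m\ge1$) whenever the $a_i\in\{a,b\}$ are not all equal. Graphs: for a partition $\rho$ of $\{1,\dots,2N\}$, $\mathcal G_\rho$ is the undirected multigraph (loops allowed) whose vertices are the blocks of $\rho$, with, for each $k=1,\dots,N$, an edge joining the block containing $2k-1$ and the block containing $2k$. For a permutation $\pi$, $\mathcal G_\pi$ is the graph of its partition into cycles. Let $\gamma=(1,\dots,2n)(2n+1,\dots,2n+2m)$. A permutation "separates even" if no cycle contains two distinct even numbers. $\mathcal J_{2n,2m}$ is the set of $\pi\in S_{NC}(2n,2m)$ such that $\mathcal G_\pi$ is bipartite and $\pi^{-1}\gamma$ separates even (for such $\pi$ the graph $\mathcal G_\pi$ is connected); $\pi'$ is the set of cycles of $\pi$ at even distance in $\mathcal G_\pi$ from the cycle containing $1$, and $\pi''$ the set of cycles at odd distance. $\mathcal X_{2n,2m}$ is the set of $(\mathcal U,\pi)\in S'_{NC}(2n,2m)$ such that $\mathcal G_{\mathcal U}$ is connected and bipartite; $A,B$ are the two merged cycles, $U=A\cup B$ the merged block, $\pi'$ (resp. $\pi''$) the set of cycles of $\pi\setminus\{A,B\}$ at even (resp. odd) distance from $U$ in $\mathcal G_{\mathcal U}$. *)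

theory Defs
  imports Complex_Main "HOL-Library.Disjoint_Sets" "HOL-Combinatorics.Combinatorics"
begin

section \<open>Second order non-commutative probability spaces\<close>

text \<open>The complex algebra is a ring of class \<open>ring_1\<close> together with an explicit scalar
  multiplication, since the library has no type class of complex algebras.
  Only \<open>\<phi>2\<close> is assumed to be tracial.\<close>

locale second_order_ncps = vector_space scale
  for scale :: "complex \<Rightarrow> 'a::ring_1 \<Rightarrow> 'a" +
  fixes \<phi> :: "'a \<Rightarrow> complex" and \<phi>2 :: "'a \<Rightarrow> 'a \<Rightarrow> complex"
  assumes scale_mult_left: "scale c x * y = scale c (x * y)"
    and scale_mult_right: "x * scale c y = scale c (x * y)"
    and linear_phi: "Vector_Spaces.linear scale (*) \<phi>"
    and phi_one: "\<phi> 1 = 1"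
    and linear_phi2_left: "Vector_Spaces.linear scale (*) (\<lambda>x. \<phi>2 x y)"
    and linear_phi2_right: "Vector_Spaces.linear scale (*) (\<lambda>y. \<phi>2 x y)"
    and tracial_left: "\<phi>2 (x * y) z = \<phi>2 (y * x) z"
    and tracial_right: "\<phi>2 z (x * y) = \<phi>2 z (y * x)"
    and phi2_one_right: "\<phi>2 x 1 = 0"
    and phi2_one_left: "\<phi>2 1 x = 0"


section \<open>Partitions and permutations\<close>

text \<open>The blocks of the join are the classes of the transitive closure of the union of the
  two equivalence relations; the lemma below checks that this is the least upper bound for
  refinement.\<close>

definition partition_join :: "nat set \<Rightarrow> nat set set \<Rightarrow> nat set set \<Rightarrow> nat set set" where
  "partition_join S P Q = S // (\<Union>V\<in>P \<union> Q. V \<times> V)\<^sup>+"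

definition finer :: "nat set set \<Rightarrow> nat set set \<Rightarrow> bool" where
  "finer P Q \<longleftrightarrow> (\<forall>V\<in>P. \<exists>W\<in>Q. V \<subseteq> W)"

lemma partition_join_lub:
  assumes P: "partition_on S P" and Q: "partition_on S Q"
  shows "partition_on S (partition_join S P Q)"
    and "finer P (partition_join S P Q)"
    and "finer Q (partition_join S P Q)"
    and "\<And>R. \<lbrakk>partition_on S R; finer P R; finer Q R\<rbrakk> \<Longrightarrow> finer (partition_join S P Q) R"
proof -
  let ?r = "\<Union>V\<in>P \<union> Q. V \<times> V"
  have sub: "?r \<subseteq> S \<times> S"
    using partition_onD1[OF P] partition_onD1[OF Q] by auto
  have "sym ?r" by (auto simp: sym_def)
  hence sy: "sym (?r\<^sup>+)" by (rule sym_trancl)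
  have subt: "?r\<^sup>+ \<subseteq> S \<times> S" using sub by (rule trancl_subset_Sigma)
  have re: "(x, x) \<in> ?r\<^sup>+" if "x \<in> S" for x
    using that partition_onD1[OF P] by (intro r_into_trancl) auto
  have eq: "equiv S (?r\<^sup>+)"
    using sy subt re by (auto simp: equiv_def refl_on_def)
  show "partition_on S (partition_join S P Q)"
    unfolding partition_join_def using eq by (rule partition_on_quotient)
  have fin: "\<exists>W\<in>partition_join S P Q. V \<subseteq> W" if V: "V \<in> P \<union> Q" for V
  proof -
    have "V \<noteq> {}" using V partition_onD3[OF P] partition_onD3[OF Q] by auto
    then obtain x where x: "x \<in> V" by auto
    have "x \<in> S" using x V partition_onD1[OF P] partition_onD1[OF Q] by auto
    moreover have "V \<subseteq> ?r\<^sup>+ `` {x}"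
    proof
      fix y assume "y \<in> V"
      hence "(x, y) \<in> ?r" using x V by blast
      thus "y \<in> ?r\<^sup>+ `` {x}" by (auto intro: r_into_trancl)
    qed
    ultimately show ?thesis unfolding partition_join_def quotient_def by blast
  qed
  show "finer P (partition_join S P Q)" "finer Q (partition_join S P Q)"
    using fin by (auto simp: finer_def)
  fix R assume R: "partition_on S R" "finer P R" "finer Q R"
  have step: "y \<in> W" if "(x, y) \<in> ?r\<^sup>+" "W \<in> R" "x \<in> W" for x y W
    using that(1)
  proof (induction rule: trancl_induct)
    case (base y)
    then obtain V where V: "V \<in> P \<union> Q" "x \<in> V" "y \<in> V" by auto
    obtain W' where "W' \<in> R" "V \<subseteq> W'" using V(1) R unfolding finer_def by blast
    then have "W' = W"
      using V that(2,3) partition_onD2[OF R(1)] by (auto simp: disjoint_def)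
    thus ?case using V \<open>V \<subseteq> W'\<close> by auto
  next
    case (step y z)
    then obtain V where V: "V \<in> P \<union> Q" "y \<in> V" "z \<in> V" by auto
    obtain W' where "W' \<in> R" "V \<subseteq> W'" using V(1) R unfolding finer_def by blast
    then have "W' = W"
      using V step.IH that(2) partition_onD2[OF R(1)] by (auto simp: disjoint_def)
    thus ?case using V \<open>V \<subseteq> W'\<close> by auto
  qed
  show "finer (partition_join S P Q) R"
    unfolding finer_def
  proof
    fix V assume "V \<in> partition_join S P Q"
    then obtain x where x: "x \<in> S" "V = ?r\<^sup>+ `` {x}"
      unfolding partition_join_def by (auto elim: quotientE)
    obtain W where "W \<in> R" "x \<in> W" using x partition_onD1[OF R(1)] by auto
    thus "\<exists>W\<in>R. V \<subseteq> W" using step x(2) by blast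
  qed
qed

text \<open>The cycles of a permutation of \<open>{1..k}\<close>, fixed points included.\<close>

definition cycles :: "nat \<Rightarrow> (nat \<Rightarrow> nat) \<Rightarrow> nat set set" where
  "cycles k \<pi> = orbit \<pi> ` {1..k}"

definition annular_perm :: "nat \<Rightarrow> nat \<Rightarrow> nat \<Rightarrow> nat" where
  "annular_perm p q = cycle_of_list [1..<p+1] \<circ> cycle_of_list [p+1..<p+q+1]"

definition noncrossing :: "nat set set \<Rightarrow> bool" where
  "noncrossing P \<longleftrightarrow>
     \<not> (\<exists>V\<in>P. \<exists>W\<in>P. V \<noteq> W \<and>
          (\<exists>i\<in>V. \<exists>j\<in>W. \<exists>k\<in>V. \<exists>l\<in>W. i < j \<and> j < k \<and> k < l))"

definition NC :: "nat set \<Rightarrow> nat set set set" where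
  "NC S = {P. partition_on S P \<and> noncrossing P}"

definition S_NC :: "nat \<Rightarrow> nat \<Rightarrow> (nat \<Rightarrow> nat) set" where
  "S_NC p q = {\<pi>. \<pi> permutes {1..p+q} \<and>
     partition_join {1..p+q} (cycles (p+q) \<pi>) (cycles (p+q) (annular_perm p q)) = {{1..p+q}} \<and>
     card (cycles (p+q) \<pi>) + card (cycles (p+q) (inv \<pi> \<circ> annular_perm p q)) = p + q}"

text \<open>In a pair \<open>(U, P)\<close> the second component is the set of cycles of \<open>\<pi>\<^sub>1 \<times> \<pi>\<^sub>2\<close>,
  i.e. the union of the two non-crossing partitions.\<close>

definition S_NC' :: "nat \<Rightarrow> nat \<Rightarrow> (nat set set \<times> nat set set) set" where
  "S_NC' p q = {(U, P). \<exists>P1\<in>NC {1..p}. \<exists>P2\<in>NC {p+1..p+q}. \<exists>A\<in>P1. \<exists>B\<in>P2.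
     P = P1 \<union> P2 \<and> U = insert (A \<union> B) (P - {A, B})}"

text \<open>The two merged cycles are recovered from the pair as the cycles that are not blocks
  of \<open>U\<close>.\<close>

definition merged_left :: "nat \<Rightarrow> nat set set \<Rightarrow> nat set set \<Rightarrow> nat set" where
  "merged_left p U P = (THE A. A \<in> P - U \<and> A \<subseteq> {1..p})"

definition merged_right :: "nat \<Rightarrow> nat set set \<Rightarrow> nat set set \<Rightarrow> nat set" where
  "merged_right p U P = (THE B. B \<in> P - U \<and> B \<subseteq> {p+1..})"

lemma merged_eq:
  assumes P1: "partition_on {1..p} P1" and P2: "partition_on {p+1..p+q} P2"
    and A: "A \<in> P1" and B: "B \<in> P2"
  shows "merged_left p (insert (A \<union> B) (P1 \<union> P2 - {A, B})) (P1 \<union> P2) = A"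
    and "merged_right p (insert (A \<union> B) (P1 \<union> P2 - {A, B})) (P1 \<union> P2) = B"
proof -
  have ne: "A \<noteq> {}" "B \<noteq> {}" using A B partition_onD3[OF P1] partition_onD3[OF P2] by auto
  have sA: "A \<subseteq> {1..p}" and sB: "B \<subseteq> {p+1..p+q}"
    using A B partition_onD1[OF P1] partition_onD1[OF P2] by auto
  have "{1..p} \<inter> {p+1..p+q} = {}" by auto
  then have "A \<inter> B = {}" using sA sB by blast
  hence AB: "A \<union> B \<noteq> A" "A \<union> B \<noteq> B" using ne by blast+
  obtain i j where "i \<in> A" "j \<in> B" using ne by blast
  then have BA: "\<not> B \<subseteq> {1..p}" "\<not> A \<subseteq> {p+1..}" using sA sB
    by (auto dest!: subsetD)
  show "merged_left p (insert (A \<union> B) (P1 \<union> P2 - {A, B})) (P1 \<union> P2) = A"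
    unfolding merged_left_def
    by (rule the_equality) (use A sA AB BA in auto)
  have sB': "B \<subseteq> {p+1..}" using sB by auto
  show "merged_right p (insert (A \<union> B) (P1 \<union> P2 - {A, B})) (P1 \<union> P2) = B"
    unfolding merged_right_def
    by (rule the_equality) (use B sB' AB BA in auto)
qed


section \<open>Cumulants\<close>

text \<open>The arguments \<open>a\<^sub>1, \<dots>, a\<^sub>k\<close> form a list, so \<open>a\<^sub>i\<close> sits at position \<open>i - 1\<close>.\<close>

definition pick :: "'a list \<Rightarrow> nat list \<Rightarrow> 'a list" where
  "pick as is = map (\<lambda>i. as ! (i - 1)) is"

lemma length_pick [simp]: "length (pick as is) = length is"
  by (simp add: pick_def)

lemma card_block_less:
  assumes "partition_on S P" "finite S" "V \<in> P" "P \<noteq> {S}"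
  shows "card V < card S"
proof -
  have "V \<subseteq> S" using assms partition_onD1 by blast
  moreover have "V \<noteq> S"
  proof
    assume [simp]: "V = S"
    have "W = S" if W: "W \<in> P" for W
    proof (rule ccontr)
      assume "W \<noteq> S"
      then have "W \<inter> S = {}"
        using disjointD[OF partition_onD2[OF assms(1)] W assms(3)] by simp
      moreover have "W \<subseteq> S" using W partition_onD1[OF assms(1)] by blast
      ultimately have "W = {}" by blast
      then show False using W partition_onD3[OF assms(1)] by blast
    qed
    thus False using assms(3,4) by blast
  qed
  ultimately show ?thesis using assms(2) by (intro psubset_card_mono) auto
qed

text \<open>The moment-cumulant relation solved for the term of the one-block partition; see
  \<open>moment_cumulant\<close> below.\<close>

function free_cumulant :: "('a::ring_1 \<Rightarrow> complex) \<Rightarrow> 'a list \<Rightarrow> complex" where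
  "free_cumulant \<phi> as = \<phi> (prod_list as) -
     (\<Sum>P \<in> NC {1..length as} - {{{1..length as}}}.
        \<Prod>V\<in>P. free_cumulant \<phi> (pick as (sorted_list_of_set V)))"
  by auto
termination
proof (relation "measure (\<lambda>(\<phi>, as). length as)", goal_cases)
  case (2 \<phi> as P V)
  then show ?case using card_block_less[of "{1..length as}" P V] by (auto simp: NC_def)
qed simp

declare free_cumulant.simps [simp del]

lemma finite_NC: "finite S \<Longrightarrow> finite (NC S)"
  unfolding NC_def using finitely_many_partition_on by (rule rev_finite_subset) auto

lemma pick_all: "pick as (sorted_list_of_set {1..length as}) = as"
  by (rule nth_equalityI) (auto simp: pick_def sorted_list_of_set_range atLeastLessThanSuc_atLeastAtMost[symmetric] simp del: upt_Suc)

lemma moment_cumulant: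
  assumes "as \<noteq> []"
  shows "\<phi> (prod_list as) =
    (\<Sum>P \<in> NC {1..length as}. \<Prod>V\<in>P. free_cumulant \<phi> (pick as (sorted_list_of_set V)))"
proof -
  let ?S = "{1..length as}"
  have "{?S} \<in> NC ?S"
    using assms by (auto simp: NC_def noncrossing_def Suc_le_eq intro!: partition_on_space)
  then show ?thesis
    using pick_all[of as] by (subst sum.remove[of _ "{?S}"])
      (auto simp: finite_NC free_cumulant.simps[of \<phi> as])
qed

text \<open>A cycle \<open>V\<close> of an annular permutation \<open>\<pi>\<close> is listed as
  \<open>i, \<pi> i, \<pi> (\<pi> i), \<dots>\<close> starting at its least element \<open>i\<close>.
  The recursion is the second order moment-cumulant relation solved for the term of
  \<open>S_NC'\<close> in which both cycles are full; see \<open>second_order_moment_cumulant\<close> below.\<close>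

definition annular_cumulant_sum :: "('a::ring_1 \<Rightarrow> complex) \<Rightarrow> 'a list \<Rightarrow> 'a list \<Rightarrow> complex" where
  "annular_cumulant_sum \<phi> as bs =
     (\<Sum>\<pi> \<in> S_NC (length as) (length bs).
        \<Prod>V \<in> cycles (length as + length bs) \<pi>.
          free_cumulant \<phi> (pick (as @ bs) (support \<pi> (Min V))))"

function second_order_cumulant ::
  "('a::ring_1 \<Rightarrow> complex) \<Rightarrow> ('a \<Rightarrow> 'a \<Rightarrow> complex) \<Rightarrow> 'a list \<Rightarrow> 'a list \<Rightarrow> complex" where
  "second_order_cumulant \<phi> \<phi>2 as bs =
     \<phi>2 (prod_list as) (prod_list bs) - annular_cumulant_sum \<phi> as bs -
     (\<Sum>(U, P) \<in> S_NC' (length as) (length bs) -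
         {({{1..length as + length bs}},
           {{1..length as}, {length as + 1..length as + length bs}})}.
        second_order_cumulant \<phi> \<phi>2
          (pick (as @ bs) (sorted_list_of_set (merged_left (length as) U P)))
          (pick (as @ bs) (sorted_list_of_set (merged_right (length as) U P))) *
        (\<Prod>V \<in> P - {merged_left (length as) U P, merged_right (length as) U P}.
          free_cumulant \<phi> (pick (as @ bs) (sorted_list_of_set V))))"
  by auto
termination
proof (relation "measure (\<lambda>(\<phi>, \<phi>2, as, bs). length as + length bs)", goal_cases)
  case (2 \<phi> \<phi>2 as bs x U P)
  let ?p = "length as" and ?q = "length bs"
  let ?S = "{1..?p}" and ?T = "{?p+1..?p+?q}"
  from 2 obtain P1 P2 A B where *: "partition_on ?S P1" "partition_on ?T P2" "A \<in> P1" "B \<in> P2"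
    "P = P1 \<union> P2" "U = insert (A \<union> B) (P - {A, B})"
    unfolding S_NC'_def NC_def by auto
  have m: "merged_left ?p U P = A" "merged_right ?p U P = B"
    using merged_eq[OF *(1-4)] *(5,6) by auto
  have "A \<subseteq> ?S" "B \<subseteq> ?T" using partition_onD1[OF *(1)] partition_onD1[OF *(2)] *(3,4) by auto
  then have le: "card A \<le> ?p" "card B \<le> ?q"
    using card_mono[of ?S A] card_mono[of ?T B] by auto
  have "P1 \<noteq> {?S} \<or> P2 \<noteq> {?T}"
  proof (rule ccontr)
    assume "\<not> ?thesis"
    then have "A = ?S" "B = ?T" "P = {?S, ?T}" using * by auto
    moreover from this have "U = {{1..?p+?q}}" using *(6) by auto
    ultimately show False using 2 by auto
  qed
  then have "card A < ?p \<or> card B < ?q"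
    using card_block_less[OF *(1) _ *(3)] card_block_less[OF *(2) _ *(4)] by auto
  then have "card A + card B < ?p + ?q" using le by linarith
  then show ?case by (simp add: m)
qed simp

declare second_order_cumulant.simps [simp del]

lemma finite_S_NC': "finite (S_NC' p q)"
proof (rule finite_subset)
  show "S_NC' p q \<subseteq> Pow (Pow {1..p+q}) \<times> Pow (Pow {1..p+q})"
  proof clarify
    fix U P assume "(U, P) \<in> S_NC' p q"
    then obtain P1 P2 A B where *: "partition_on {1..p} P1" "partition_on {p+1..p+q} P2"
      "A \<in> P1" "B \<in> P2" "P = P1 \<union> P2" "U = insert (A \<union> B) (P - {A, B})"
      unfolding S_NC'_def NC_def by auto
    have "V \<subseteq> {1..p+q}" if "V \<in> P" for V
    proof -
      have "V \<subseteq> {1..p} \<or> V \<subseteq> {p+1..p+q}"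
        using that *(5) partition_onD1[OF *(1)] partition_onD1[OF *(2)] by blast
      then show ?thesis by fastforce
    qed
    then show "U \<in> Pow (Pow {1..p+q}) \<and> P \<in> Pow (Pow {1..p+q})"
      using *(3-6) by blast
  qed
qed auto

lemma second_order_moment_cumulant:
  assumes "as \<noteq> []" "bs \<noteq> []"
  shows "\<phi>2 (prod_list as) (prod_list bs) = annular_cumulant_sum \<phi> as bs +
    (\<Sum>(U, P) \<in> S_NC' (length as) (length bs).
        second_order_cumulant \<phi> \<phi>2
          (pick (as @ bs) (sorted_list_of_set (merged_left (length as) U P)))
          (pick (as @ bs) (sorted_list_of_set (merged_right (length as) U P))) *
        (\<Prod>V \<in> P - {merged_left (length as) U P, merged_right (length as) U P}.
          free_cumulant \<phi> (pick (as @ bs) (sorted_list_of_set V))))"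
    (is "_ = _ + sum ?f _")
proof -
  let ?p = "length as" and ?q = "length bs"
  let ?S = "{1..?p}" and ?T = "{?p+1..?p+?q}"
  let ?full = "({{1..?p + ?q}}, {?S, ?T})"
  have part: "partition_on ?S {?S}" "partition_on ?T {?T}"
    using assms by (auto simp: Suc_le_eq intro!: partition_on_space)
  have nc: "{?S} \<in> NC ?S" "{?T} \<in> NC ?T"
    unfolding NC_def noncrossing_def using part by blast+
  have un: "{1..?p+?q} = ?S \<union> ?T" by auto
  have full: "?full \<in> S_NC' ?p ?q"
  proof -
    have "{?S, ?T} = {?S} \<union> {?T}" "{{1..?p+?q}} = insert (?S \<union> ?T) ({?S, ?T} - {?S, ?T})"
      unfolding un by blast+
    then show ?thesis unfolding S_NC'_def mem_Collect_eq case_prod_conv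
      by (intro bexI[OF _ nc(1)] bexI[OF _ nc(2)] bexI[of _ ?S] bexI[of _ ?T] conjI singletonI)
  qed
  have "insert (?S \<union> ?T) ({?S} \<union> {?T} - {?S, ?T}) = {{1..?p+?q}}" "{?S} \<union> {?T} = {?S, ?T}"
    unfolding un by blast+
  then have m: "merged_left ?p {{1..?p+?q}} {?S, ?T} = ?S"
      "merged_right ?p {{1..?p+?q}} {?S, ?T} = ?T"
    using merged_eq[OF part, of ?S ?T] by (simp_all only: insertI1)
  have pS: "pick (as @ bs) (sorted_list_of_set ?S) = as"
    by (rule nth_equalityI) (auto simp: pick_def nth_append atLeastLessThanSuc_atLeastAtMost[symmetric] simp del: upt_Suc)
  have pT: "pick (as @ bs) (sorted_list_of_set ?T) = bs"
    by (rule nth_equalityI) (auto simp: pick_def nth_append atLeastLessThanSuc_atLeastAtMost[symmetric] simp del: upt_Suc)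
  have "?f ?full = second_order_cumulant \<phi> \<phi>2 as bs * prod (\<lambda>V. free_cumulant \<phi> (pick (as @ bs) (sorted_list_of_set V))) ({?S, ?T} - {?S, ?T})"
    by (simp only: case_prod_conv m pS pT)
  also have "{?S, ?T} - {?S, ?T} = {}" by blast
  finally have f: "?f ?full = second_order_cumulant \<phi> \<phi>2 as bs"
    by (simp only: prod.empty mult_1_right)
  have sm: "sum ?f (S_NC' ?p ?q) = second_order_cumulant \<phi> \<phi>2 as bs + sum ?f (S_NC' ?p ?q - {?full})"
    unfolding f[symmetric] by (rule sum.remove[OF finite_S_NC' full])
  have rearrange: "x = y + s" if "s = c + t" "c = x - y - t" for x y s c t :: complex
    using that by simp
  show ?thesis
    by (rule rearrange[OF sm]) (rule second_order_cumulant.simps)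
qed

definition cumulant_pow :: "('a::ring_1 \<Rightarrow> complex) \<Rightarrow> 'a \<Rightarrow> nat \<Rightarrow> complex" where
  "cumulant_pow \<phi> x k = free_cumulant \<phi> (replicate k x)"

definition cumulant_pow2 ::
  "('a::ring_1 \<Rightarrow> complex) \<Rightarrow> ('a \<Rightarrow> 'a \<Rightarrow> complex) \<Rightarrow> 'a \<Rightarrow> nat \<Rightarrow> nat \<Rightarrow> complex" where
  "cumulant_pow2 \<phi> \<phi>2 x k l = second_order_cumulant \<phi> \<phi>2 (replicate k x) (replicate l x)"

definition cumulant_blocks :: "('a::ring_1 \<Rightarrow> complex) \<Rightarrow> 'a \<Rightarrow> nat set set \<Rightarrow> complex" where
  "cumulant_blocks \<phi> x \<sigma> = (\<Prod>V\<in>\<sigma>. cumulant_pow \<phi> x (card V))"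

text \<open>A cumulant is mixed when the labels of its arguments (\<open>True\<close> for \<open>a\<close>, \<open>False\<close> for \<open>b\<close>)
  are not all equal. Labels are used instead of the elements themselves so that the
  condition keeps its meaning when \<open>a = b\<close>.\<close>

definition second_order_free ::
  "('a::ring_1 \<Rightarrow> complex) \<Rightarrow> ('a \<Rightarrow> 'a \<Rightarrow> complex) \<Rightarrow> 'a \<Rightarrow> 'a \<Rightarrow> bool" where
  "second_order_free \<phi> \<phi>2 a b \<longleftrightarrow>
     (\<forall>es. length es \<ge> 2 \<and> set es = {True, False} \<longrightarrow>
        free_cumulant \<phi> (map (\<lambda>e. if e then a else b) es) = 0) \<and>
     (\<forall>es fs. length es \<ge> 1 \<and> length fs \<ge> 1 \<and> set (es @ fs) = {True, False} \<longrightarrow>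
        second_order_cumulant \<phi> \<phi>2
          (map (\<lambda>e. if e then a else b) es) (map (\<lambda>e. if e then a else b) fs) = 0)"


section \<open>Graphs\<close>

text \<open>Undirected multigraphs; an edge is a loop iff its set of ends is a singleton.\<close>

record ('v, 'e) multigraph =
  verts :: "'v set"
  edges :: "'e set"
  ends :: "'e \<Rightarrow> 'v set"

definition adj_rel :: "('v, 'e) multigraph \<Rightarrow> ('v \<times> 'v) set" where
  "adj_rel G = {(u, v). \<exists>e\<in>edges G. ends G e = {u, v}}"

definition graph_connected :: "('v, 'e) multigraph \<Rightarrow> bool" where
  "graph_connected G \<longleftrightarrow> (\<forall>u\<in>verts G. \<forall>v\<in>verts G. (u, v) \<in> (adj_rel G)\<^sup>*)"

definition graph_bipartite :: "('v, 'e) multigraph \<Rightarrow> bool" where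
  "graph_bipartite G \<longleftrightarrow>
     (\<exists>X Y. X \<union> Y = verts G \<and> X \<inter> Y = {} \<and>
        (\<forall>e\<in>edges G. \<exists>x\<in>X. \<exists>y\<in>Y. ends G e = {x, y}))"

text \<open>Only meaningful when \<open>u\<close> and \<open>v\<close> are connected.\<close>

definition graph_dist :: "('v, 'e) multigraph \<Rightarrow> 'v \<Rightarrow> 'v \<Rightarrow> nat" where
  "graph_dist G u v = (LEAST d. (u, v) \<in> adj_rel G ^^ d)"

definition block_of :: "nat set set \<Rightarrow> nat \<Rightarrow> nat set" where
  "block_of \<rho> i = (THE V. V \<in> \<rho> \<and> i \<in> V)"

definition partition_graph :: "nat \<Rightarrow> nat set set \<Rightarrow> (nat set, nat) multigraph" where
  "partition_graph N \<rho> = \<lparr>verts = \<rho>, edges = {1..N},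
     ends = (\<lambda>k. {block_of \<rho> (2 * k - 1), block_of \<rho> (2 * k)})\<rparr>"

definition even_part :: "('v, 'e) multigraph \<Rightarrow> 'v \<Rightarrow> 'v set \<Rightarrow> 'v set" where
  "even_part G u \<sigma> = {V \<in> \<sigma>. even (graph_dist G u V)}"

definition odd_part :: "('v, 'e) multigraph \<Rightarrow> 'v \<Rightarrow> 'v set \<Rightarrow> 'v set" where
  "odd_part G u \<sigma> = {V \<in> \<sigma>. odd (graph_dist G u V)}"


section \<open>The index sets of the two sums\<close>

definition separates_even :: "nat \<Rightarrow> (nat \<Rightarrow> nat) \<Rightarrow> bool" where
  "separates_even k \<pi> \<longleftrightarrow>
     (\<forall>V\<in>cycles k \<pi>. \<not> (\<exists>i\<in>V. \<exists>j\<in>V. even i \<and> even j \<and> i \<noteq> j))"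

text \<open>The arguments of \<open>J_set\<close> and \<open>X_set\<close> are \<open>n\<close> and \<open>m\<close>, the numbers of edges
  contributed by the two circles of sizes \<open>2n\<close> and \<open>2m\<close>.\<close>

definition J_set :: "nat \<Rightarrow> nat \<Rightarrow> (nat \<Rightarrow> nat) set" where
  "J_set n m = {\<pi> \<in> S_NC (2*n) (2*m).
     graph_bipartite (partition_graph (n+m) (cycles (2*n + 2*m) \<pi>)) \<and>
     separates_even (2*n + 2*m) (inv \<pi> \<circ> annular_perm (2*n) (2*m))}"

definition J_even :: "nat \<Rightarrow> nat \<Rightarrow> (nat \<Rightarrow> nat) \<Rightarrow> nat set set" where
  "J_even n m \<pi> = even_part (partition_graph (n+m) (cycles (2*n + 2*m) \<pi>))
     (orbit \<pi> 1) (cycles (2*n + 2*m) \<pi>)"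

definition J_odd :: "nat \<Rightarrow> nat \<Rightarrow> (nat \<Rightarrow> nat) \<Rightarrow> nat set set" where
  "J_odd n m \<pi> = odd_part (partition_graph (n+m) (cycles (2*n + 2*m) \<pi>))
     (orbit \<pi> 1) (cycles (2*n + 2*m) \<pi>)"

definition X_set :: "nat \<Rightarrow> nat \<Rightarrow> (nat set set \<times> nat set set) set" where
  "X_set n m = {(U, P) \<in> S_NC' (2*n) (2*m).
     graph_connected (partition_graph (n+m) U) \<and> graph_bipartite (partition_graph (n+m) U)}"

abbreviation X_left :: "nat \<Rightarrow> nat set set \<Rightarrow> nat set set \<Rightarrow> nat set" where
  "X_left n \<equiv> merged_left (2*n)"

abbreviation X_right :: "nat \<Rightarrow> nat set set \<Rightarrow> nat set set \<Rightarrow> nat set" where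
  "X_right n \<equiv> merged_right (2*n)"

definition X_even :: "nat \<Rightarrow> nat \<Rightarrow> nat set set \<Rightarrow> nat set set \<Rightarrow> nat set set" where
  "X_even n m U P = even_part (partition_graph (n+m) U)
     (X_left n U P \<union> X_right n U P) (P - {X_left n U P, X_right n U P})"

definition X_odd :: "nat \<Rightarrow> nat \<Rightarrow> nat set set \<Rightarrow> nat set set \<Rightarrow> nat set set" where
  "X_odd n m U P = odd_part (partition_graph (n+m) U)
     (X_left n U P \<union> X_right n U P) (P - {X_left n U P, X_right n U P})"

end

theory Submission
  imports Defs "HOL-Library.FuncSet"
begin

text \<open>
  Pairs of a partition and a permutation refining it, with equality in the genus inequality over
  \<open>\<gamma>\<close>, give the non-crossing partitions when \<open>\<gamma>\<close> has one cycle and the two index sets of the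
  second order moment-cumulant formula together when it has two. Double every point. Each
  permutation \<open>\<pi>\<close> over the doubled \<open>\<gamma>\<close> factors uniquely through a permutation \<open>\<tau>\<close> of the original
  points such that \<open>\<pi>\<inverse>\<close> composed with the doubled \<open>\<tau>\<close> separates the even points, and the genus
  defects of the two steps add. Expanding the moments of \<open>ab + ba\<close> over the doubled points and
  regrouping by \<open>\<tau>\<close> therefore gives a moment-cumulant relation for \<open>ab + ba\<close>, and comparing top
  terms identifies the cumulants of \<open>ab + ba\<close> with sums over separating pairs. Since mixed cumulants
  vanish, only colourings of the edges survive that come from one of the two proper 2-colourings of
  the connected graph, hence only bipartite graphs contribute.
\<close>

section \<open>Connected components of a relation\<close>

text \<open>Give (U, \<pi>) on S the length |S| - 2#U + #\<pi>. The genus inequality is then a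
  triangle inequality: the one-block partition with \<gamma> is no longer than (U, \<pi>) and the
  complement \<open>inv \<pi> \<circ> \<gamma>\<close> together. \<open>PS S \<gamma>\<close> holds
  the pairs on a geodesic; its constant 2 is twice the single block.

  The partition has to be carried along because the two index sets of the annular formula mix under
  regrouping: a separating annular permutation of the doubled points lies over ({S}, \<gamma>),
  which is a merged pair. So a block of two cycles must receive a cumulant just as a block of one
  cycle does, and the number of cycles of a block selects the order of its weight.

  Comparing top terms takes the place of a Moebius inversion, so no order on the annular pairs is
  studied.

  The two sums of the theorem are cut out by different conditions, separation of the even points and
  connectedness of the graph. Separation always implies connectedness; the converse holds for merged
  pairs, where \<pi> preserves both circles.\<close>

definition conn :: "('a \<times> 'a) set \<Rightarrow> ('a \<times> 'a) set" where
  "conn r = (r \<union> r\<inverse>)\<^sup>*"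

text \<open>\<open>conn r\<close> is closed over the whole type and so is an equivalence without
  side conditions; S only selects the classes that are kept.\<close>

definition comps :: "'a set \<Rightarrow> ('a \<times> 'a) set \<Rightarrow> 'a set set" where
  "comps S r = S // conn r"

lemma conn_refl [simp]: "(x, x) \<in> conn r"
  by (simp add: conn_def)

lemma conn_sym: "(x, y) \<in> conn r \<Longrightarrow> (y, x) \<in> conn r"
  unfolding conn_def by (meson sym_Un_converse sym_rtrancl symD)

lemma conn_trans: "(x, y) \<in> conn r \<Longrightarrow> (y, z) \<in> conn r \<Longrightarrow> (x, z) \<in> conn r"
  unfolding conn_def by (rule rtrancl_trans)

lemma conn_incl: "(x, y) \<in> r \<Longrightarrow> (x, y) \<in> conn r"
  unfolding conn_def by blast

text \<open>Replaces induction along paths in what follows: to bound a class from above, exhibit a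
  function that is constant along edges, usually membership in a set or the class map of another
  relation.\<close>

lemma conn_invariant:
  assumes "\<And>x y. (x, y) \<in> r \<Longrightarrow> f x = f y" and "(x, y) \<in> conn r"
  shows "f x = f y"
  using assms(2) unfolding conn_def
  by (induction rule: rtrancl_induct) (use assms(1) in auto)

lemma equiv_conn: "equiv UNIV (conn r)"
  by (rule equivI) (auto simp: refl_on_def intro: symI transI conn_sym conn_trans)

lemma conn_image_eq_iff: "conn r `` {x} = conn r `` {y} \<longleftrightarrow> (x, y) \<in> conn r"
  by (rule eq_equiv_class_iff[OF equiv_conn]) auto

lemma conn_least:
  assumes "r \<subseteq> conn s" shows "conn r \<subseteq> conn s"
proof clarify
  fix x y assume "(x, y) \<in> conn r"
  then have "conn s `` {x} = conn s `` {y}"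
    by (rule conn_invariant[rotated]) (use assms in \<open>auto simp: conn_image_eq_iff\<close>)
  then show "(x, y) \<in> conn s" by (simp add: conn_image_eq_iff)
qed

lemma conn_mono: "r \<subseteq> s \<Longrightarrow> conn r \<subseteq> conn s"
  by (rule conn_least) (auto intro: conn_incl)

lemma conn_eqI: "r \<subseteq> conn s \<Longrightarrow> s \<subseteq> conn r \<Longrightarrow> conn r = conn s"
  by (intro equalityI conn_least)

lemma conn_closed:
  assumes "r \<subseteq> S \<times> S" "(x, y) \<in> conn r" shows "x \<in> S \<longleftrightarrow> y \<in> S"
  using assms(2) by (rule conn_invariant[where f = "\<lambda>x. x \<in> S", rotated]) (use assms(1) in auto)

lemma comps_iff: "V \<in> comps S r \<longleftrightarrow> (\<exists>x\<in>S. V = conn r `` {x})"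
  by (auto simp: comps_def quotient_def)

lemma comps_image: "comps S r = (\<lambda>x. conn r `` {x}) ` S"
  by (auto simp: comps_iff)

lemma finite_comps [simp]: "finite S \<Longrightarrow> finite (comps S r)"
  by (simp add: comps_image)

lemma partition_on_comps:
  assumes "r \<subseteq> S \<times> S" shows "partition_on S (comps S r)"
proof (rule partition_onI)
  show "\<Union> (comps S r) = S"
    using conn_closed[OF assms] unfolding comps_image by fastforce
  show "{} \<notin> comps S r"
    using conn_refl[of _ r] unfolding comps_image by blast
  show "disjnt p q" if "p \<in> comps S r" "q \<in> comps S r" "p \<noteq> q" for p q
    using that unfolding comps_iff disjnt_def
    by (metis (no_types, lifting) Image_singleton_iff conn_image_eq_iff disjoint_iff)
qed

lemma comps_cong: "conn r = conn s \<Longrightarrow> comps S r = comps S s"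
  by (simp add: comps_def)

lemma card_comps_le:
  assumes "finite S" "conn r \<subseteq> conn s" shows "card (comps S s) \<le> card (comps S r)"
proof -
  have "conn s `` {x} = (conn s `` (conn r `` {x}))" for x
    using assms(2) by (auto intro: conn_trans)
  then have "comps S s = (\<lambda>V. conn s `` V) ` comps S r"
    unfolding comps_image image_image by metis
  then show ?thesis using assms(1) by (simp add: card_image_le)
qed

lemma conn_insert_redundant: "(i, j) \<in> conn r \<Longrightarrow> conn (insert (i, j) r) = conn r"
  by (rule conn_eqI) (auto intro: conn_incl)

text \<open>The classes of i and j fuse and all others survive, so exactly one class is
  lost.\<close>

lemma card_comps_insert:
  assumes "finite S" "i \<in> S" "j \<in> S" "(i, j) \<notin> conn r"
  shows "Suc (card (comps S (insert (i, j) r))) = card (comps S r)"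
proof -
  let ?r = "insert (i, j) r"
  define I J where "I = conn r `` {i}" and "J = conn r `` {j}"
  \<comment> \<open>The expected class of x after the new edge. Being constant along edges it bounds
    the true class from above; monotonicity together with the edge itself gives the other
    inclusion.\<close>
  define f where "f x = (if x \<in> I \<union> J then I \<union> J else conn r `` {x})" for x
  have mono: "conn r \<subseteq> conn ?r" by (rule conn_mono) auto
  have ij: "(i, j) \<in> conn ?r" by (rule conn_incl) auto
  have finv: "f x = f y" if "(x, y) \<in> ?r" for x y
  proof (cases "(x, y) = (i, j)")
    case True
    then show ?thesis by (auto simp: f_def I_def J_def)
  next
    case False
    then have xy: "(x, y) \<in> conn r" using that by (auto intro: conn_incl)
    then have "x \<in> I \<union> J \<longleftrightarrow> y \<in> I \<union> J"
      unfolding I_def J_def by (auto intro: conn_trans conn_sym)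
    then show ?thesis using xy by (auto simp: f_def conn_image_eq_iff)
  qed
  have cl: "conn ?r `` {x} = f x" for x
  proof (intro equalityI subsetI)
    fix y assume "y \<in> conn ?r `` {x}"
    then have "f x = f y" using conn_invariant[of ?r f x y] finv by auto
    moreover have "y \<in> f y" by (auto simp: f_def)
    ultimately show "y \<in> f x" by simp
  next
    fix y assume y: "y \<in> f x"
    have *: "(i, z) \<in> conn ?r" if "z \<in> I \<union> J" for z
      using that mono ij unfolding I_def J_def by (auto intro: conn_trans)
    show "y \<in> conn ?r `` {x}"
    proof (cases "x \<in> I \<union> J")
      case True
      then have "y \<in> I \<union> J" using y by (simp add: f_def)
      then show ?thesis using *[OF True] *[of y] by (auto intro: conn_trans conn_sym)
    next
      case False
      then show ?thesis using y mono by (auto simp: f_def)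
    qed
  qed
  have comp: "comps S ?r = insert (I \<union> J) (comps S r - {I, J})"
  proof (intro equalityI subsetI)
    fix V assume "V \<in> comps S ?r"
    then obtain x where x: "x \<in> S" "V = f x" by (auto simp: comps_iff cl)
    have "conn r `` {x} \<noteq> I" "conn r `` {x} \<noteq> J" if "x \<notin> I \<union> J"
      using that by (auto simp: I_def J_def conn_image_eq_iff intro: conn_sym)
    then show "V \<in> insert (I \<union> J) (comps S r - {I, J})"
      using x by (auto simp: f_def comps_iff)
  next
    fix V assume V: "V \<in> insert (I \<union> J) (comps S r - {I, J})"
    show "V \<in> comps S ?r"
    proof (cases "V = I \<union> J")
      case True
      then have "V = f i" by (auto simp: f_def I_def)
      then show ?thesis using assms(2) by (auto simp: comps_iff cl)
    next
      case False
      then obtain x where x: "x \<in> S" "V = conn r `` {x}" "V \<noteq> I" "V \<noteq> J"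
        using V by (auto simp: comps_iff)
      then have "x \<notin> I \<union> J" by (auto simp: I_def J_def conn_image_eq_iff intro: conn_sym)
      then have "V = f x" using x by (auto simp: f_def)
      then show ?thesis using x by (auto simp: comps_iff cl)
    qed
  qed
  have IJ: "I \<in> comps S r" "J \<in> comps S r" "I \<noteq> J"
    using assms unfolding I_def J_def comps_image conn_image_eq_iff by blast+
  have notin: "I \<union> J \<notin> comps S r - {I, J}"
  proof
    assume "I \<union> J \<in> comps S r - {I, J}"
    then obtain x where "I \<union> J = conn r `` {x}" by (auto simp: comps_iff)
    moreover have "i \<in> I" "j \<in> J" by (auto simp: I_def J_def)
    ultimately have "(x, i) \<in> conn r" "(x, j) \<in> conn r" by auto
    then show False using assms(4) by (auto intro: conn_trans conn_sym)
  qed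
  have fin: "finite (comps S r)" using assms(1) by simp
  have "card (comps S r - {I, J}) = card (comps S r) - 2"
    using IJ fin by (subst card_Diff_subset) auto
  moreover have "card (comps S r) \<ge> card {I, J}" using IJ fin by (intro card_mono) auto
  ultimately show ?thesis using notin fin IJ comp by simp
qed

lemma comps_singletonI:
  assumes "r \<subseteq> S \<times> S" "S \<noteq> {}" "\<And>x y. x \<in> S \<Longrightarrow> y \<in> S \<Longrightarrow> (x, y) \<in> conn r"
  shows "comps S r = {S}"
proof -
  have "conn r `` {x} = S" if "x \<in> S" for x
    using that assms(3) conn_closed[OF assms(1)] by auto
  then show ?thesis using assms(2) by (auto simp: comps_image)
qed

lemma comps_singletonD: "comps S r = {S} \<Longrightarrow> x \<in> S \<Longrightarrow> y \<in> S \<Longrightarrow> (x, y) \<in> conn r"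
  by (metis Image_singleton_iff comps_iff singletonD singletonI)

section \<open>Partitions encoded as relations, so that joins are components of unions\<close>

definition prel :: "'a set set \<Rightarrow> ('a \<times> 'a) set" where
  "prel U = (\<Union>V\<in>U. V \<times> V)"

lemma prel_subset: "partition_on S U \<Longrightarrow> prel U \<subseteq> S \<times> S"
  by (auto simp: prel_def dest: partition_onD1)

lemma partition_on_unique:
  "partition_on S U \<Longrightarrow> V \<in> U \<Longrightarrow> W \<in> U \<Longrightarrow> x \<in> V \<Longrightarrow> x \<in> W \<Longrightarrow> V = W"
  by (auto simp: partition_on_def disjoint_def)

lemma conn_prel:
  assumes "partition_on S U" "V \<in> U" "x \<in> V"
  shows "conn (prel U) `` {x} = V"
proof (intro equalityI subsetI)
  fix y assume "y \<in> conn (prel U) `` {x}"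
  then have "(x, y) \<in> conn (prel U)" by simp
  then have "(x \<in> V) = (y \<in> V)"
    by (rule conn_invariant[where f = "\<lambda>x. x \<in> V", rotated])
      (use assms partition_on_unique[OF assms(1)] in \<open>auto simp: prel_def\<close>)
  then show "y \<in> V" using assms by simp
next
  fix y assume "y \<in> V"
  then show "y \<in> conn (prel U) `` {x}" using assms by (auto simp: prel_def intro!: conn_incl)
qed

lemma comps_prel:
  assumes "partition_on S U" shows "comps S (prel U) = U"
proof -
  have S: "S = \<Union>U" "{} \<notin> U" using assms by (auto simp: partition_on_def)
  show ?thesis
  proof (intro equalityI subsetI)
    fix V assume "V \<in> comps S (prel U)"
    then show "V \<in> U" using conn_prel[OF assms] S by (auto simp: comps_iff)
  next
    fix V assume V: "V \<in> U"
    then obtain x where "x \<in> V" using S by fastforce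
    then show "V \<in> comps S (prel U)" using conn_prel[OF assms V] S V by (auto simp: comps_iff)
  qed
qed

lemma conn_prel_comps:
  assumes "r \<subseteq> S \<times> S" shows "conn (prel (comps S r)) = conn r"
proof (rule conn_eqI)
  show "prel (comps S r) \<subseteq> conn r"
    unfolding prel_def comps_image using conn_trans conn_sym by fast
  show "r \<subseteq> conn (prel (comps S r))"
  proof clarify
    fix x y assume "(x, y) \<in> r"
    then have "x \<in> S" "(x, y) \<in> conn r" using assms by (auto intro: conn_incl)
    then show "(x, y) \<in> conn (prel (comps S r))"
      using conn_refl[of x r] by (intro conn_incl) (unfold prel_def comps_image, blast)
  qed
qed

section \<open>Cycles of permutations\<close>

text \<open>Cycles become connected components of a relation, so permutations and partitions are
  counted by the same lemmas on \<open>comps\<close>.\<close>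

definition gr :: "'a set \<Rightarrow> ('a \<Rightarrow> 'a) \<Rightarrow> ('a \<times> 'a) set" where
  "gr S \<pi> = {(x, \<pi> x) |x. x \<in> S}"

definition cyc :: "'a set \<Rightarrow> ('a \<Rightarrow> 'a) \<Rightarrow> 'a set set" where
  "cyc S \<pi> = comps S (gr S \<pi>)"

lemma gr_iff [simp]: "(x, y) \<in> gr S \<pi> \<longleftrightarrow> x \<in> S \<and> y = \<pi> x"
  by (auto simp: gr_def)

lemma gr_subset: "\<pi> permutes S \<Longrightarrow> gr S \<pi> \<subseteq> S \<times> S"
  by (auto simp: gr_def permutes_in_image)

lemma conn_gr_step: "x \<in> S \<Longrightarrow> (x, \<pi> x) \<in> conn (gr S \<pi>)"
  by (rule conn_incl) simp

lemma partition_on_cyc: "\<pi> permutes S \<Longrightarrow> partition_on S (cyc S \<pi>)"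
  unfolding cyc_def by (intro partition_on_comps gr_subset)

lemma finite_cyc [simp]: "finite S \<Longrightarrow> finite (cyc S \<pi>)"
  by (simp add: cyc_def)

lemma comps_Id: 
  assumes "r \<subseteq> Id" shows "comps S r = (\<lambda>x. {x}) ` S"
proof -
  have "x = y" if "(x, y) \<in> conn r" for x y
    using that by (rule conn_invariant[where f = "\<lambda>x. x", rotated]) (use assms in auto)
  then have "conn r `` {x} = {x}" for x by auto
  then show ?thesis by (auto simp: comps_image)
qed

lemma card_cyc_id: "card (cyc S id) = card S"
  unfolding cyc_def by (subst comps_Id) (auto simp: card_image)

text \<open>On a finite set a forward orbit returns to its start, so closing under inverse steps
  adds nothing.\<close>

lemma conn_gr_orbit:
  assumes "finite S" "\<pi> permutes S"
  shows "conn (gr S \<pi>) `` {x} = orbit \<pi> x"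
proof (intro equalityI subsetI)
  have perm: "permutation \<pi>" using assms permutation_permutes by blast
  fix y assume "y \<in> conn (gr S \<pi>) `` {x}"
  then have "(x, y) \<in> conn (gr S \<pi>)" by simp
  then have "orbit \<pi> x = orbit \<pi> y"
  proof (rule conn_invariant[rotated])
    fix u v assume "(u, v) \<in> gr S \<pi>"
    then have "v \<in> orbit \<pi> u" by (auto intro: orbit.intros)
    then show "orbit \<pi> u = orbit \<pi> v"
      by (metis cyclic_on_orbit' orbit_cyclic_eq3 perm)
  qed
  then show "y \<in> orbit \<pi> x" using permutation_self_in_orbit[OF perm] by simp
next
  fix y assume "y \<in> orbit \<pi> x"
  then show "y \<in> conn (gr S \<pi>) `` {x}"
  proof induction
    case base
    then show ?case using conn_gr_step[of x S \<pi>] permutes_not_in[OF assms(2), of x]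
      by (cases "x \<in> S") auto
  next
    case (step y)
    then have "(x, y) \<in> conn (gr S \<pi>)" by simp
    moreover have "(y, \<pi> y) \<in> conn (gr S \<pi>)"
      using conn_gr_step[of y S \<pi>] permutes_not_in[OF assms(2), of y]
      by (cases "y \<in> S") auto
    ultimately show ?case by (auto intro: conn_trans)
  qed
qed

lemma cyc_orbit: "finite S \<Longrightarrow> \<pi> permutes S \<Longrightarrow> cyc S \<pi> = orbit \<pi> ` S"
  by (simp add: cyc_def comps_image conn_gr_orbit)

section \<open>Effect of a transposition on the cycles of a permutation\<close>

lemma gr_transpose_subset:
  assumes "i \<in> S" "j \<in> S"
  shows "gr S (\<pi> \<circ> transpose i j) \<subseteq> conn (insert (i, j) (gr S \<pi>))"
proof clarsimp
  fix x assume x: "x \<in> S"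
  have st: "(y, \<pi> y) \<in> conn (insert (i, j) (gr S \<pi>))" if "y \<in> S" for y
    using that by (auto intro: conn_incl)
  have ij: "(i, j) \<in> conn (insert (i, j) (gr S \<pi>))" by (auto intro: conn_incl)
  show "(x, \<pi> (transpose i j x)) \<in> conn (insert (i, j) (gr S \<pi>))"
    using x assms st[OF x] st[of i] st[of j] ij
    by (cases "x = i"; cases "x = j") (auto intro: conn_trans conn_sym)
qed

text \<open>After the swap i is sent to \<pi> j. From there the new permutation follows the
  \<pi>-cycle of j, which avoids i, until it arrives at j.\<close>

lemma cyc_transpose_connects:
  assumes "finite S" "\<pi> permutes S" "i \<in> S" "j \<in> S" "(i, j) \<notin> conn (gr S \<pi>)"
  shows "(i, j) \<in> conn (gr S (\<pi> \<circ> transpose i j))"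
proof (rule ccontr)
  define \<rho> where "\<rho> = \<pi> \<circ> transpose i j"
  assume "(i, j) \<notin> conn (gr S (\<pi> \<circ> transpose i j))"
  then have no: "(i, j) \<notin> conn (gr S \<rho>)" by (simp only: \<rho>_def simp_thms)
  have \<rho>: "\<rho> i = \<pi> j" "\<And>y. y \<noteq> i \<Longrightarrow> y \<noteq> j \<Longrightarrow> \<rho> y = \<pi> y" by (simp_all add: \<rho>_def)
  have "(i, y) \<in> conn (gr S \<rho>) \<and> y \<in> S" if "y \<in> orbit \<pi> j" for y
    using that
  proof induction
    case base
    show ?case using conn_gr_step[OF assms(3), of \<rho>] permutes_in_image[OF assms(2), of j] assms(4)
      by (simp add: \<rho>)
  next
    case (step y)
    have "(j, y) \<in> conn (gr S \<pi>)" using step.hyps conn_gr_orbit[OF assms(1,2), of j] by auto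
    then have "y \<noteq> i" using assms(5) by (auto intro: conn_sym)
    moreover have "y \<noteq> j" using step.IH no by auto
    ultimately have "\<rho> y = \<pi> y" using \<rho>(2) by simp
    then have "(y, \<pi> y) \<in> conn (gr S \<rho>)" using conn_gr_step[of y S \<rho>] step.IH by simp
    then show ?case using step.IH assms(2) by (auto simp: permutes_in_image intro: conn_trans)
  qed
  moreover have "j \<in> orbit \<pi> j"
    using assms permutation_permutes permutation_self_in_orbit by metis
  ultimately show False using no by blast
qed

lemma conn_transpose_join:
  assumes "finite S" "\<pi> permutes S" "i \<in> S" "j \<in> S" "(i, j) \<notin> conn (gr S \<pi>)"
  shows "conn (gr S (\<pi> \<circ> transpose i j)) = conn (insert (i, j) (gr S \<pi>))"
proof (rule conn_eqI[OF gr_transpose_subset])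
  \<comment> \<open>Multiplying twice by the transposition restores \<pi>, so the inclusion for one
    multiplication also yields its converse.\<close>
  have "gr S \<pi> = gr S ((\<pi> \<circ> transpose i j) \<circ> transpose i j)" by (simp add: comp_assoc)
  also have "\<dots> \<subseteq> conn (insert (i, j) (gr S (\<pi> \<circ> transpose i j)))"
    by (rule gr_transpose_subset) (use assms in auto)
  also have "\<dots> = conn (gr S (\<pi> \<circ> transpose i j))"
    by (rule conn_insert_redundant) (rule cyc_transpose_connects[OF assms])
  finally show "insert (i, j) (gr S \<pi>) \<subseteq> conn (gr S (\<pi> \<circ> transpose i j))"
    using cyc_transpose_connects[OF assms] by blast
qed (use assms in auto)

lemma card_cyc_join:
  assumes "finite S" "\<pi> permutes S" "i \<in> S" "j \<in> S" "(i, j) \<notin> conn (gr S \<pi>)"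
  shows "Suc (card (cyc S (\<pi> \<circ> transpose i j))) = card (cyc S \<pi>)"
  unfolding cyc_def comps_cong[OF conn_transpose_join[OF assms]]
  using assms by (intro card_comps_insert)

lemma transpose_permutes: "\<pi> permutes S \<Longrightarrow> i \<in> S \<Longrightarrow> j \<in> S \<Longrightarrow> \<pi> \<circ> transpose i j permutes S"
  by (rule permutes_compose[OF permutes_swap_id])

lemma cyc_transpose_separates:
  assumes "finite S" "\<pi> permutes S" "i \<noteq> j" "i \<in> S" "j \<in> S" "(i, j) \<in> conn (gr S \<pi>)"
  shows "(i, j) \<notin> conn (gr S (\<pi> \<circ> transpose i j))"
proof -
  let ?\<rho> = "\<pi> \<circ> transpose i j"
  have "j \<in> orbit \<pi> i" using assms conn_gr_orbit[OF assms(1,2), of i] by auto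
  then obtain k0 where k0: "j = (\<pi> ^^ k0) i" by (auto simp: orbit_altdef)
  define k where "k = (LEAST k. j = (\<pi> ^^ k) i)"
  have k: "j = (\<pi> ^^ k) i" unfolding k_def using k0 by (rule LeastI)
  have kmin: "j \<noteq> (\<pi> ^^ l) i" if "l < k" for l using that not_less_Least unfolding k_def by blast
  \<comment> \<open>The arc from \<pi> i up to j, where k is the first time the orbit of i meets j.
    The swapped permutation sends j back to \<pi> i and agrees with \<pi> on the rest of the arc, so
    the arc is invariant; it contains j but not i.\<close>
  define C where "C = {(\<pi> ^^ l) i |l. 1 \<le> l \<and> l \<le> k}"
  have fin: "finite C" unfolding C_def by simp
  have kpos: "k \<ge> 1" using k assms(3) by (cases k) auto
  have ni: "(\<pi> ^^ l) i \<noteq> i" if "1 \<le> l" "l \<le> k" for l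
  proof
    assume e: "(\<pi> ^^ l) i = i"
    have "(\<pi> ^^ k) i = (\<pi> ^^ (k - l)) ((\<pi> ^^ l) i)"
      using that by (metis comp_apply funpow_add le_add_diff_inverse2)
    then show False using e k kmin[of "k - l"] that by auto
  qed
  have "?\<rho> ` C \<subseteq> C"
  proof clarify
    fix x assume "x \<in> C"
    then obtain l where l: "x = (\<pi> ^^ l) i" "1 \<le> l" "l \<le> k" unfolding C_def by blast
    show "?\<rho> x \<in> C"
    proof (cases "l = k")
      case True
      then have "?\<rho> x = (\<pi> ^^ 1) i" using l k by simp
      then show ?thesis unfolding C_def using kpos by blast
    next
      case False
      then have "x \<noteq> j" "x \<noteq> i" using l kmin[of l] ni[of l] by auto
      then have "?\<rho> x = (\<pi> ^^ Suc l) i" using l by simp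
      then show ?thesis unfolding C_def using l False by (metis (mono_tags, lifting) Suc_leI le_SucI le_neq_implies_less mem_Collect_eq)
    qed
  qed
  moreover have inj: "inj ?\<rho>" using transpose_permutes[OF assms(2,4,5)] permutes_inj by blast
  ultimately have "?\<rho> ` C = C" using fin by (metis endo_inj_surj inj_on_subset subset_UNIV)
  then have "(x \<in> C) = (?\<rho> x \<in> C)" for x using inj by (metis inj_image_mem_iff)
  then have "(x \<in> C) = (y \<in> C)" if "(x, y) \<in> conn (gr S ?\<rho>)" for x y
    using that conn_invariant[of "gr S ?\<rho>" "\<lambda>x. x \<in> C" x y] by auto
  moreover have "j \<in> C" using k kpos unfolding C_def by blast
  moreover have "i \<notin> C" using ni unfolding C_def mem_Collect_eq by metis
  ultimately show ?thesis by blast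
qed

text \<open>The swapped permutation has i and j in different cycles, and a second swap restores
  \<pi>; this is \<open>card_cyc_join\<close> read backwards.\<close>

lemma card_cyc_split:
  assumes "finite S" "\<pi> permutes S" "i \<noteq> j" "i \<in> S" "j \<in> S" "(i, j) \<in> conn (gr S \<pi>)"
  shows "card (cyc S (\<pi> \<circ> transpose i j)) = Suc (card (cyc S \<pi>))"
  using card_cyc_join[OF assms(1) transpose_permutes[OF assms(2,4,5)] assms(4,5)
      cyc_transpose_separates[OF assms]]
  by (simp add: comp_assoc)

lemma card_cyc_transpose_le:
  assumes "finite S" "\<pi> permutes S" "i \<in> S" "j \<in> S"
  shows "card (cyc S (\<pi> \<circ> transpose i j)) \<le> Suc (card (cyc S \<pi>))"
proof (cases "i \<noteq> j \<and> (i, j) \<in> conn (gr S \<pi>)")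
  case True
  then show ?thesis using card_cyc_split[OF assms(1,2) _ assms(3,4)] by simp
next
  case False
  then show ?thesis using card_cyc_join[OF assms] by fastforce
qed

text \<open>For j = \<pi> i different from i, the product \<open>\<pi> \<circ> transpose i j\<close>
  fixes j and moves fewer points. Thus \<pi> is built by transpositions each of which attaches a
  fixed point j to another cycle, and every step lowers the number of cycles by exactly one.\<close>

lemma permutes_leaf_induct [consumes 2, case_names id step]:
  assumes "finite S" "\<pi> permutes S" "P id"
    and step: "\<And>\<rho> i j. \<lbrakk>\<rho> permutes S; i \<in> S; j \<in> S; i \<noteq> j; \<rho> j = j; P \<rho>\<rbrakk> \<Longrightarrow> P (\<rho> \<circ> transpose i j)"
  shows "P \<pi>"
  using assms(2)
proof (induction "card {x \<in> S. \<pi> x \<noteq> x}" arbitrary: \<pi> rule: less_induct)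
  case less
  show ?case
  proof (cases "\<exists>i\<in>S. \<pi> i \<noteq> i")
    case False
    then have "\<pi> = id" using permutes_not_in[OF less.prems] by (metis eq_id_iff)
    then show ?thesis using assms(3) by simp
  next
    case True
    then obtain i where i: "i \<in> S" "\<pi> i \<noteq> i" by blast
    define j where "j = \<pi> i"
    define \<rho> where "\<rho> = \<pi> \<circ> transpose i j"
    have j: "j \<in> S" "i \<noteq> j" using i less.prems by (auto simp: j_def permutes_in_image)
    have p: "\<rho> permutes S" unfolding \<rho>_def using less.prems i j by (intro transpose_permutes)
    have \<rho>j: "\<rho> j = j" by (simp add: \<rho>_def j_def)
    have "\<pi> j \<noteq> j"
      using i j less.prems unfolding j_def by (metis permutes_inj inj_eq)
    have "{x \<in> S. \<rho> x \<noteq> x} \<subseteq> {x \<in> S. \<pi> x \<noteq> x} - {j}"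
      using i \<rho>j by (auto simp: \<rho>_def transpose_def split: if_splits)
    moreover have "j \<in> {x \<in> S. \<pi> x \<noteq> x}" using j \<open>\<pi> j \<noteq> j\<close> by simp
    ultimately have "card {x \<in> S. \<rho> x \<noteq> x} < card {x \<in> S. \<pi> x \<noteq> x}"
      using assms(1) by (intro psubset_card_mono) auto
    from less.hyps[OF this p] have "P (\<rho> \<circ> transpose i j)"
      using p i j \<rho>j by (intro step) auto
    then show ?thesis by (simp add: \<rho>_def comp_assoc)
  qed
qed

lemma fixed_point_not_conn:
  assumes "\<pi> permutes S" "\<pi> j = j" "i \<noteq> j"
  shows "(i, j) \<notin> conn (gr S \<pi>)"
proof
  assume "(i, j) \<in> conn (gr S \<pi>)"
  then have "(i = j) = (j = j)"
    by (rule conn_invariant[where f = "\<lambda>x. x = j", rotated])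
      (use assms in \<open>auto simp: permutes_def\<close>)
  then show False using assms by simp
qed

text \<open>Triangle inequality for partitioned permutations, by building up K. Each transposition
  costs one cycle of K. If i and j are already connected by U and \<gamma>, the product gains at
  most one cycle, which this cost covers, and the join loses no component. Otherwise the product
  loses a cycle too, and these two losses balance the doubled loss of one component.\<close>

lemma genus_inequality:
  assumes "finite S" "partition_on S U" "\<pi> permutes S" "gr S \<pi> \<subseteq> prel U" "K permutes S"
  shows "2 * card U + card (cyc S K) + card (cyc S (\<pi> \<circ> K)) \<le>
    card S + 2 * card (comps S (prel U \<union> gr S (\<pi> \<circ> K))) + card (cyc S \<pi>)"
  using assms(1,5)
proof (induction rule: permutes_leaf_induct)
  case id
  have "prel U \<union> gr S \<pi> = prel U" using assms(4) by auto
  then show ?case using comps_prel[OF assms(2)] by (simp only: comp_id card_cyc_id)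
next
  case (step K i j)
  define \<gamma> where "\<gamma> = \<pi> \<circ> K"
  have \<gamma>: "\<gamma> permutes S" unfolding \<gamma>_def using assms(3) step.hyps(1) by (rule permutes_compose[rotated])
  have \<gamma>': "\<pi> \<circ> (K \<circ> transpose i j) = \<gamma> \<circ> transpose i j" by (simp add: \<gamma>_def comp_assoc)
  let ?\<gamma>' = "\<gamma> \<circ> transpose i j"
  have K: "Suc (card (cyc S (K \<circ> transpose i j))) = card (cyc S K)"
    using assms(1) step.hyps by (intro card_cyc_join fixed_point_not_conn)
  have IH: "2 * card U + card (cyc S K) + card (cyc S \<gamma>) \<le>
    card S + 2 * card (comps S (prel U \<union> gr S \<gamma>)) + card (cyc S \<pi>)"
    using step.IH unfolding \<gamma>_def .
  show ?case
  proof (cases "(i, j) \<in> conn (prel U \<union> gr S \<gamma>)")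
    case True
    have "gr S ?\<gamma>' \<subseteq> conn (insert (i, j) (gr S \<gamma>))"
      using step.hyps by (intro gr_transpose_subset)
    also have "\<dots> \<subseteq> conn (prel U \<union> gr S \<gamma>)"
      using True by (intro conn_least) (auto intro: conn_incl)
    finally have "conn (prel U \<union> gr S ?\<gamma>') \<subseteq> conn (prel U \<union> gr S \<gamma>)"
      by (intro conn_least) (auto intro: conn_incl)
    then have "card (comps S (prel U \<union> gr S \<gamma>)) \<le> card (comps S (prel U \<union> gr S ?\<gamma>'))"
      by (rule card_comps_le[OF assms(1)])
    moreover have "card (cyc S ?\<gamma>') \<le> Suc (card (cyc S \<gamma>))"
      using assms(1) \<gamma> step.hyps by (intro card_cyc_transpose_le)
    ultimately show ?thesis using IH K unfolding \<gamma>' by linarith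
  next
    case False
    then have nc: "(i, j) \<notin> conn (gr S \<gamma>)" using conn_mono[of "gr S \<gamma>" "prel U \<union> gr S \<gamma>"] by auto
    have g: "Suc (card (cyc S ?\<gamma>')) = card (cyc S \<gamma>)"
      using assms(1) \<gamma> step.hyps nc by (intro card_cyc_join)
    have "conn (prel U \<union> gr S ?\<gamma>') \<subseteq> conn (insert (i, j) (prel U \<union> gr S \<gamma>))"
      using gr_transpose_subset[OF step.hyps(2,3), of \<gamma>]
        conn_mono[of "insert (i, j) (gr S \<gamma>)" "insert (i, j) (prel U \<union> gr S \<gamma>)"]
      by (intro conn_least) (auto intro: conn_incl)
    then have "card (comps S (insert (i, j) (prel U \<union> gr S \<gamma>))) \<le> card (comps S (prel U \<union> gr S ?\<gamma>'))"
      by (rule card_comps_le[OF assms(1)])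
    moreover have "Suc (card (comps S (insert (i, j) (prel U \<union> gr S \<gamma>)))) = card (comps S (prel U \<union> gr S \<gamma>))"
      using assms(1) step.hyps False by (intro card_comps_insert)
    ultimately show ?thesis using IH K g unfolding \<gamma>' by linarith
  qed
qed

section \<open>Restriction to invariant sets\<close>

lemma conn_restrict_image:
  assumes "partition_on S \<V>" "r \<subseteq> prel \<V>" "V \<in> \<V>" "x \<in> V"
  shows "conn r `` {x} = conn (r \<inter> V \<times> V) `` {x}"
proof (intro equalityI subsetI)
  \<comment> \<open>Off V the value is the empty set: an edge never leaves a block of the partition,
    so its ends either both lie in V or both receive this value.\<close>
  let ?f = "\<lambda>y. if y \<in> V then conn (r \<inter> V \<times> V) `` {y} else {}"
  fix y assume "y \<in> conn r `` {x}"
  then have "(x, y) \<in> conn r" by simp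
  then have "?f x = ?f y"
  proof (rule conn_invariant[rotated])
    fix u v assume uv: "(u, v) \<in> r"
    then obtain W where W: "W \<in> \<V>" "u \<in> W" "v \<in> W" using assms(2) by (auto simp: prel_def)
    then have "u \<in> V \<longleftrightarrow> v \<in> V" using partition_on_unique[OF assms(1)] assms(3) by blast
    then show "?f u = ?f v" using uv by (auto simp: conn_image_eq_iff intro: conn_incl)
  qed
  then have "conn (r \<inter> V \<times> V) `` {x} = ?f y" using assms(4) by simp
  moreover have "x \<in> conn (r \<inter> V \<times> V) `` {x}" by simp
  ultimately show "y \<in> conn (r \<inter> V \<times> V) `` {x}"
    by (metis Image_singleton_iff conn_sym empty_iff)
next
  fix y assume "y \<in> conn (r \<inter> V \<times> V) `` {x}"
  then show "y \<in> conn r `` {x}" using conn_mono[of "r \<inter> V \<times> V" r] by auto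
qed

lemma comps_UN:
  assumes "partition_on S \<V>" "r \<subseteq> prel \<V>"
  shows "comps S r = (\<Union>V\<in>\<V>. comps V (r \<inter> V \<times> V))"
proof -
  have "comps S r = (\<Union>V\<in>\<V>. comps V r)"
    using partition_onD1[OF assms(1)] by (auto simp: comps_image)
  also have "\<dots> = (\<Union>V\<in>\<V>. comps V (r \<inter> V \<times> V))"
    unfolding comps_image by (intro SUP_cong refl image_cong conn_restrict_image[OF assms])
  finally show ?thesis .
qed

lemma card_comps_sum:
  assumes "finite S" "partition_on S \<V>" "r \<subseteq> prel \<V>"
  shows "card (comps S r) = (\<Sum>V\<in>\<V>. card (comps V (r \<inter> V \<times> V)))"
  unfolding comps_UN[OF assms(2,3)]
proof (rule card_UN_disjoint)
  show "finite \<V>" using finite_elements[OF assms(1,2)] .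
  have "finite V" if "V \<in> \<V>" for V
    using that assms(1) partition_onD1[OF assms(2)] by (meson Union_upper finite_subset)
  then show "\<forall>V\<in>\<V>. finite (comps V (r \<inter> V \<times> V))" by simp
  show "\<forall>V\<in>\<V>. \<forall>W\<in>\<V>. V \<noteq> W \<longrightarrow> comps V (r \<inter> V \<times> V) \<inter> comps W (r \<inter> W \<times> W) = {}"
  proof (intro ballI impI)
    fix V W assume VW: "V \<in> \<V>" "W \<in> \<V>" "V \<noteq> W"
    have p: "partition_on V (comps V (r \<inter> V \<times> V))" for V by (rule partition_on_comps) auto
    have "X \<notin> comps W (r \<inter> W \<times> W)" if X: "X \<in> comps V (r \<inter> V \<times> V)" for X
    proof
      assume "X \<in> comps W (r \<inter> W \<times> W)"
      then have "X \<subseteq> V" "X \<subseteq> W" "X \<noteq> {}"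
        using X partition_onD1[OF p] partition_onD3[OF p] by blast+
      then show False using VW partition_on_unique[OF assms(2)] by blast
    qed
    then show "comps V (r \<inter> V \<times> V) \<inter> comps W (r \<inter> W \<times> W) = {}" by blast
  qed
qed

lemma perm_restrict_permutes:
  assumes "finite V" "\<pi> permutes S" "\<pi> ` V \<subseteq> V"
  shows "perm_restrict \<pi> V permutes V"
proof (rule bij_imp_permutes)
  have "inj_on \<pi> V" using assms(2) by (meson inj_on_subset permutes_inj subset_UNIV)
  then have "bij_betw \<pi> V V" using assms endo_inj_surj[of V \<pi>] unfolding bij_betw_def by blast
  then show "bij_betw (perm_restrict \<pi> V) V V"
    by (subst bij_betw_cong[of V _ \<pi>]) (auto simp: perm_restrict_def)
qed (auto simp: perm_restrict_def)

lemma image_eq_of_subset: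
  assumes "finite V" "\<pi> permutes S" "\<pi> ` V \<subseteq> V" shows "\<pi> ` V = V"
  using assms by (meson endo_inj_surj inj_on_subset permutes_inj subset_UNIV)

lemma inv_image_subset:
  assumes "finite V" "\<pi> permutes S" "\<pi> ` V \<subseteq> V" shows "inv \<pi> ` V \<subseteq> V"
  using image_eq_of_subset[OF assms] permutes_inverses[OF assms(2)]
  by (metis image_inv_f_f assms(2) order_refl permutes_inj)

lemma perm_restrict_comp_subset:
  "g ` V \<subseteq> V \<Longrightarrow> perm_restrict (f \<circ> g) V = perm_restrict f V \<circ> perm_restrict g V"
  by (auto simp: perm_restrict_def fun_eq_iff)

lemma perm_restrict_inv:
  assumes "finite V" "\<pi> permutes S" "\<pi> ` V \<subseteq> V"
  shows "inv (perm_restrict \<pi> V) = perm_restrict (inv \<pi>) V"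
proof (rule inv_equality)
  have i: "inv \<pi> ` V \<subseteq> V" by (rule inv_image_subset[OF assms])
  show "perm_restrict (inv \<pi>) V (perm_restrict \<pi> V x) = x" for x
    using assms(3) permutes_inverses[OF assms(2)] by (auto simp: perm_restrict_def)
  show "perm_restrict \<pi> V (perm_restrict (inv \<pi>) V x) = x" for x
    using i permutes_inverses[OF assms(2)] by (auto simp: perm_restrict_def)
qed

lemma perm_restrict_self: "\<pi> permutes S \<Longrightarrow> perm_restrict \<pi> S = \<pi>"
  by (auto simp: perm_restrict_def fun_eq_iff permutes_not_in)

lemma perm_restrict_subset: "V \<subseteq> W \<Longrightarrow> perm_restrict (perm_restrict \<pi> W) V = perm_restrict \<pi> V"
  by (auto simp: perm_restrict_def fun_eq_iff)

lemma gr_restrict: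
  "V \<subseteq> S \<Longrightarrow> \<pi> ` V \<subseteq> V \<Longrightarrow> gr S \<pi> \<inter> V \<times> V = gr V (perm_restrict \<pi> V)"
  by (auto simp: gr_def perm_restrict_def)

lemma gr_subset_prel_iff:
  assumes "partition_on S \<V>"
  shows "gr S \<pi> \<subseteq> prel \<V> \<longleftrightarrow> (\<forall>V\<in>\<V>. \<pi> ` V \<subseteq> V)"
proof safe
  fix V x assume *: "gr S \<pi> \<subseteq> prel \<V>" "V \<in> \<V>" "x \<in> V"
  then have "x \<in> S" using partition_onD1[OF assms] by blast
  then have "(x, \<pi> x) \<in> prel \<V>" using *(1) by auto
  then show "\<pi> x \<in> V" using * partition_on_unique[OF assms] by (auto simp: prel_def)
next
  fix x y assume *: "\<forall>V\<in>\<V>. \<pi> ` V \<subseteq> V" "(x, y) \<in> gr S \<pi>"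
  then show "(x, y) \<in> prel \<V>" using partition_onD1[OF assms] by (fastforce simp: prel_def)
qed

lemma cyc_UN:
  assumes "partition_on S \<V>" "\<And>V. V \<in> \<V> \<Longrightarrow> \<pi> ` V \<subseteq> V"
  shows "cyc S \<pi> = (\<Union>V\<in>\<V>. cyc V (perm_restrict \<pi> V))"
proof -
  have "V \<subseteq> S" if "V \<in> \<V>" for V using that partition_onD1[OF assms(1)] by blast
  then show ?thesis
    unfolding cyc_def using assms gr_subset_prel_iff[OF assms(1), of \<pi>]
    by (subst comps_UN[OF assms(1)]) (auto simp: gr_restrict)
qed

lemma card_cyc_sum:
  assumes "finite S" "partition_on S \<V>" "\<And>V. V \<in> \<V> \<Longrightarrow> \<pi> ` V \<subseteq> V"
  shows "card (cyc S \<pi>) = (\<Sum>V\<in>\<V>. card (cyc V (perm_restrict \<pi> V)))"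
proof -
  have "V \<subseteq> S" if "V \<in> \<V>" for V using that partition_onD1[OF assms(2)] by blast
  then show ?thesis
    unfolding cyc_def using assms gr_subset_prel_iff[OF assms(2), of \<pi>]
    by (subst card_comps_sum[OF assms(1,2)]) (auto simp: gr_restrict)
qed

section \<open>Planar partitioned permutations\<close>

text \<open>Equality in the genus inequality of Mingo and Speicher for partitioned permutations.\<close>

definition PS :: "'a set \<Rightarrow> ('a \<Rightarrow> 'a) \<Rightarrow> ('a set set \<times> ('a \<Rightarrow> 'a)) set" where
  "PS S \<gamma> = {(U, \<pi>). \<pi> permutes S \<and> partition_on S U \<and> gr S \<pi> \<subseteq> prel U \<and>
     comps S (prel U \<union> gr S \<gamma>) = {S} \<and>
     2 * card U + card (cyc S (inv \<pi> \<circ> \<gamma>)) + card (cyc S \<gamma>) = card S + 2 + card (cyc S \<pi>)}"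

lemma inv_comp_cancel: "\<pi> permutes S \<Longrightarrow> \<pi> \<circ> (inv \<pi> \<circ> \<gamma>) = \<gamma>"
  by (simp add: comp_assoc[symmetric] permutes_inv_o)

lemma genus_inequality_inv:
  assumes "finite S" "partition_on S U" "\<pi> permutes S" "gr S \<pi> \<subseteq> prel U" "\<gamma> permutes S"
  shows "2 * card U + card (cyc S (inv \<pi> \<circ> \<gamma>)) + card (cyc S \<gamma>) \<le>
    card S + 2 * card (comps S (prel U \<union> gr S \<gamma>)) + card (cyc S \<pi>)"
  using genus_inequality[OF assms(1-4) permutes_compose[OF assms(5) permutes_inv[OF assms(3)]]]
  by (simp only: inv_comp_cancel[OF assms(3)])

lemma sum_eq_iff_pointwise:
  fixes f g :: "'a \<Rightarrow> nat"
  assumes "finite A" "\<And>x. x \<in> A \<Longrightarrow> f x \<le> g x"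
  shows "sum f A = sum g A \<longleftrightarrow> (\<forall>x\<in>A. f x = g x)"
  using assms sum_mono_inv[of f A g] by (auto intro: sum.cong)

lemma comps_refines:
  assumes "partition_on S U" "prel U \<subseteq> conn r" "r \<subseteq> S \<times> S" "W \<in> U"
  shows "\<exists>V\<in>comps S r. W \<subseteq> V"
proof -
  obtain x where x: "x \<in> W" using assms(1,4) partition_onD3 by fastforce
  then have "x \<in> S" using assms(1,4) partition_onD1 by blast
  moreover have "W \<subseteq> conn r `` {x}" using assms(2,4) x by (auto simp: prel_def)
  ultimately show ?thesis unfolding comps_image by blast
qed

lemma partition_on_refining:
  assumes "partition_on S U" "partition_on S \<V>" "\<And>W. W \<in> U \<Longrightarrow> \<exists>V\<in>\<V>. W \<subseteq> V" "V \<in> \<V>"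
  shows "partition_on V {W \<in> U. W \<subseteq> V}"
proof (rule partition_onI)
  show "\<Union> {W \<in> U. W \<subseteq> V} = V"
  proof safe
    fix x assume x: "x \<in> V"
    then obtain W where W: "W \<in> U" "x \<in> W"
      using assms(4) partition_onD1[OF assms(1)] partition_onD1[OF assms(2)] by blast
    then have "W \<subseteq> V" using assms(3)[OF W(1)] x partition_on_unique[OF assms(2)] assms(4) by blast
    then show "x \<in> \<Union> {W \<in> U. W \<subseteq> V}" using W by blast
  qed auto
  show "disjnt p q" if "p \<in> {W \<in> U. W \<subseteq> V}" "q \<in> {W \<in> U. W \<subseteq> V}" "p \<noteq> q" for p q
    using that partition_on_unique[OF assms(1)] by (auto simp: disjnt_def)
  show "{} \<notin> {W \<in> U. W \<subseteq> V}" using partition_onD3[OF assms(1)] by blast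
qed

lemma refining_UN:
  assumes "\<And>W. W \<in> U \<Longrightarrow> \<exists>V\<in>\<V>. W \<subseteq> V"
  shows "U = (\<Union>V\<in>\<V>. {W \<in> U. W \<subseteq> V})"
  using assms by blast

lemma refining_disjoint:
  assumes "partition_on S U" "partition_on S \<V>" "V \<in> \<V>" "V' \<in> \<V>" "V \<noteq> V'"
  shows "{W \<in> U. W \<subseteq> V} \<inter> {W \<in> U. W \<subseteq> V'} = {}"
proof -
  have "W \<notin> U" if "W \<subseteq> V" "W \<subseteq> V'" for W
  proof
    assume W: "W \<in> U"
    then have "W \<noteq> {}" using partition_onD3[OF assms(1)] by auto
    then obtain x where "x \<in> V" "x \<in> V'" using \<open>W \<subseteq> V\<close> \<open>W \<subseteq> V'\<close> by auto
    then show False using partition_on_unique[OF assms(2-4)] assms(5) by auto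
  qed
  then show ?thesis by auto
qed

lemma prel_restrict:
  assumes "partition_on S U" "partition_on S \<V>" "\<And>W. W \<in> U \<Longrightarrow> \<exists>V\<in>\<V>. W \<subseteq> V" "V \<in> \<V>"
  shows "prel U \<inter> V \<times> V = prel {W \<in> U. W \<subseteq> V}"
proof safe
  fix x y assume "(x, y) \<in> prel U" "x \<in> V" "y \<in> V"
  then obtain W where W: "W \<in> U" "x \<in> W" "y \<in> W" by (auto simp: prel_def)
  then have "W \<subseteq> V"
    using assms(3)[OF W(1)] \<open>x \<in> V\<close> partition_on_unique[OF assms(2)] assms(4) by blast
  then show "(x, y) \<in> prel {W \<in> U. W \<subseteq> V}" using W by (auto simp: prel_def)
qed (auto simp: prel_def)

text \<open>Equality in the genus inequality is a local property, because the inequality holds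
  on every component and both sides are additive.\<close>

lemma genus_equality_local:
  assumes fin: "finite S" and U: "partition_on S U" and \<pi>: "\<pi> permutes S" and le: "gr S \<pi> \<subseteq> prel U"
    and \<gamma>: "\<gamma> permutes S" and \<V>: "\<V> = comps S (prel U \<union> gr S \<gamma>)"
  shows "2 * card U + card (cyc S (inv \<pi> \<circ> \<gamma>)) + card (cyc S \<gamma>) = card S + 2 * card \<V> + card (cyc S \<pi>)
    \<longleftrightarrow> (\<forall>V\<in>\<V>. ({W \<in> U. W \<subseteq> V}, perm_restrict \<pi> V) \<in> PS V (perm_restrict \<gamma> V))"
proof -
  let ?r = "prel U \<union> gr S \<gamma>"
  have r: "?r \<subseteq> S \<times> S" using prel_subset[OF U] gr_subset[OF \<gamma>] by auto
  have pV: "partition_on S \<V>" unfolding \<V> by (rule partition_on_comps[OF r])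
  have rV: "?r \<subseteq> prel \<V>"
  proof clarify
    fix x y assume "(x, y) \<in> ?r"
    then have "x \<in> S" "(x, y) \<in> conn ?r" using r by (auto intro: conn_incl)
    then show "(x, y) \<in> prel \<V>"
      unfolding \<V> using conn_refl[of x ?r] by (unfold prel_def comps_image, blast)
  qed
  have ref: "\<exists>V\<in>\<V>. W \<subseteq> V" if "W \<in> U" for W
    unfolding \<V> by (rule comps_refines[OF U _ r that]) (auto intro: conn_incl)
  have finV: "finite \<V>" using finite_elements[OF fin pV] .
  have sub: "V \<subseteq> S" "finite V" "V \<noteq> {}" if "V \<in> \<V>" for V
    using that partition_onD1[OF pV] partition_onD3[OF pV] finite_subset[OF _ fin] by blast+
  have p\<pi>: "\<pi> ` V \<subseteq> V" and p\<gamma>: "\<gamma> ` V \<subseteq> V" if "V \<in> \<V>" for V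
    using that rV le gr_subset_prel_iff[OF pV] by (meson Un_subset_iff order_trans)+
  have pi: "inv \<pi> ` V \<subseteq> V" if "V \<in> \<V>" for V
    using inv_image_subset[OF sub(2) \<pi> p\<pi>] that by blast
  define UV where "UV V = {W \<in> U. W \<subseteq> V}" for V
  have pUV: "partition_on V (UV V)" if "V \<in> \<V>" for V
    unfolding UV_def by (rule partition_on_refining[OF U pV ref that])
  have perm: "perm_restrict \<pi> V permutes V" "perm_restrict \<gamma> V permutes V" if "V \<in> \<V>" for V
    using perm_restrict_permutes[OF sub(2) \<pi>] perm_restrict_permutes[OF sub(2) \<gamma>] p\<pi> p\<gamma> that by auto
  have grU: "gr V (perm_restrict \<pi> V) \<subseteq> prel (UV V)" if "V \<in> \<V>" for V
  proof -
    have "gr S \<pi> \<inter> V \<times> V \<subseteq> prel U \<inter> V \<times> V" using le by blast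
    then show ?thesis
      by (simp only: UV_def gr_restrict[OF sub(1)[OF that] p\<pi>[OF that]] prel_restrict[OF U pV ref that])
  qed
  have con: "comps V (prel (UV V) \<union> gr V (perm_restrict \<gamma> V)) = {V}" if V: "V \<in> \<V>" for V
  proof -
    have eq: "prel (UV V) \<union> gr V (perm_restrict \<gamma> V) = ?r \<inter> V \<times> V"
      using prel_restrict[OF U pV ref V] gr_restrict[OF sub(1)[OF V] p\<gamma>[OF V]] unfolding UV_def
      by (simp only: Int_Un_distrib2)
    have "conn (?r \<inter> V \<times> V) `` {x} = V" if "x \<in> V" for x
      using conn_restrict_image[OF pV rV V that] V that unfolding \<V> comps_iff
      by (metis Image_singleton_iff conn_image_eq_iff)
    then show ?thesis unfolding eq comps_image using sub(3)[OF V] by auto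
  qed
  \<comment> \<open>The two sides of the genus inequality on the component V. The join with \<gamma>
    there is the single block V, hence the constant 2 in b.\<close>
  define a where "a V = 2 * card (UV V) + card (cyc V (inv (perm_restrict \<pi> V) \<circ> perm_restrict \<gamma> V))
      + card (cyc V (perm_restrict \<gamma> V))" for V
  define b where "b V = card V + 2 + card (cyc V (perm_restrict \<pi> V))" for V
  have ab: "a V \<le> b V" if "V \<in> \<V>" for V
    using genus_inequality_inv[OF sub(2)[OF that] pUV[OF that] perm(1)[OF that] grU[OF that] perm(2)[OF that]]
    by (simp add: a_def b_def con[OF that])
  have PSiff: "(UV V, perm_restrict \<pi> V) \<in> PS V (perm_restrict \<gamma> V) \<longleftrightarrow> a V = b V" if "V \<in> \<V>" for V
    using pUV[OF that] perm[OF that] grU[OF that] con[OF that] by (simp add: PS_def a_def b_def)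
  have cU: "card U = (\<Sum>V\<in>\<V>. card (UV V))"
  proof -
    have "card U = card (\<Union>V\<in>\<V>. UV V)" unfolding UV_def using refining_UN[OF ref] by simp
    also have "\<dots> = (\<Sum>V\<in>\<V>. card (UV V))"
      using finV refining_disjoint[OF U pV] finite_elements[OF fin U]
      by (intro card_UN_disjoint) (auto simp: UV_def)
    finally show ?thesis .
  qed
  have cS: "card S = (\<Sum>V\<in>\<V>. card V)"
    using sub(2) pV by (simp add: product_partition card_Union_disjoint partition_on_def disjoint_def pairwise_def disjnt_def)
  have restr: "perm_restrict (inv \<pi> \<circ> \<gamma>) V = inv (perm_restrict \<pi> V) \<circ> perm_restrict \<gamma> V"
    if "V \<in> \<V>" for V
    using perm_restrict_comp_subset[OF p\<gamma>[OF that]] perm_restrict_inv[OF sub(2)[OF that] \<pi> p\<pi>[OF that]]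
    by simp
  have cK: "card (cyc S (inv \<pi> \<circ> \<gamma>)) = (\<Sum>V\<in>\<V>. card (cyc V (inv (perm_restrict \<pi> V) \<circ> perm_restrict \<gamma> V)))"
  proof (subst card_cyc_sum[OF fin pV])
    show "(inv \<pi> \<circ> \<gamma>) ` V \<subseteq> V" if "V \<in> \<V>" for V using pi[OF that] p\<gamma>[OF that] by auto
  qed (simp add: restr)
  have c\<gamma>: "card (cyc S \<gamma>) = (\<Sum>V\<in>\<V>. card (cyc V (perm_restrict \<gamma> V)))"
    using p\<gamma> by (intro card_cyc_sum[OF fin pV])
  have c\<pi>: "card (cyc S \<pi>) = (\<Sum>V\<in>\<V>. card (cyc V (perm_restrict \<pi> V)))"
    using p\<pi> by (intro card_cyc_sum[OF fin pV])
  have "2 * card U + card (cyc S (inv \<pi> \<circ> \<gamma>)) + card (cyc S \<gamma>) = sum a \<V>"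
    unfolding a_def cU cK c\<gamma> by (simp add: sum.distrib sum_distrib_left)
  moreover have "card S + 2 * card \<V> + card (cyc S \<pi>) = sum b \<V>"
    unfolding b_def cS c\<pi> by (simp only: sum.distrib sum_constant mult.commute of_nat_id)
  ultimately show ?thesis
    using sum_eq_iff_pointwise[OF finV ab] PSiff unfolding UV_def by simp
qed

section \<open>Doubling\<close>

abbreviation dset :: "'a set \<Rightarrow> ('a \<times> bool) set" where
  "dset S \<equiv> S \<times> UNIV"

text \<open>\<open>(x, False)\<close> stands for the number \<open>2x - 1\<close> and \<open>(x, True)\<close> for \<open>2x\<close>.\<close>

definition dbl :: "'a set \<Rightarrow> ('a \<Rightarrow> 'a) \<Rightarrow> 'a \<times> bool \<Rightarrow> 'a \<times> bool" where
  "dbl S \<gamma> = (\<lambda>(x, b). if x \<in> S then (if b then (\<gamma> x, False) else (x, True)) else (x, b))"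

text \<open>Two doubled permutations differ only in where they send even points, so one is the other
  multiplied on the right by a map of this form; compare \<open>dbl_factor\<close>.\<close>

definition lift :: "('a \<Rightarrow> 'a) \<Rightarrow> 'a \<times> bool \<Rightarrow> 'a \<times> bool" where
  "lift \<kappa> = (\<lambda>(x, b). if b then (\<kappa> x, True) else (x, False))"

text \<open>These pairs become the edges joining 2k - 1 and 2k once the doubled points are
  numbered.\<close>

definition vert :: "'a set \<Rightarrow> (('a \<times> bool) \<times> ('a \<times> bool)) set" where
  "vert S = {((x, False), (x, True)) |x. x \<in> S}"

text \<open>The condition of separating the even points, read on doubled points, where the even ones
  carry \<open>True\<close>.\<close>

definition sep :: "'a set \<Rightarrow> ('a \<times> bool \<Rightarrow> 'a \<times> bool) \<Rightarrow> bool" where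
  "sep S L \<longleftrightarrow> (\<forall>x\<in>S. \<forall>y\<in>S. ((x, True), (y, True)) \<in> conn (gr (dset S) L) \<longrightarrow> x = y)"

lemma finite_dset [simp]: "finite S \<Longrightarrow> finite (dset S)"
  by simp

lemma dbl_permutes:
  assumes "finite S" "\<gamma> permutes S" shows "dbl S \<gamma> permutes dset S"
proof (rule bij_imp_permutes)
  have "inj_on (dbl S \<gamma>) (dset S)"
    using permutes_inj[OF assms(2)] by (auto simp: inj_on_def dbl_def split: if_splits dest: injD)
  moreover have "dbl S \<gamma> ` dset S \<subseteq> dset S"
    by (intro image_subsetI) (auto simp: dbl_def permutes_in_image[OF assms(2)])
  ultimately show "bij_betw (dbl S \<gamma>) (dset S) (dset S)"
    using endo_inj_surj[of "dset S" "dbl S \<gamma>"] assms(1) by (auto simp: bij_betw_def)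
qed (auto simp: dbl_def split: if_splits)

lemma lift_permutes:
  assumes "finite S" "\<kappa> permutes S" shows "lift \<kappa> permutes dset S"
proof (rule bij_imp_permutes)
  have "inj_on (lift \<kappa>) (dset S)"
    using permutes_inj[OF assms(2)] by (auto simp: inj_on_def lift_def split: if_splits dest: injD)
  moreover have "lift \<kappa> ` dset S \<subseteq> dset S"
    by (intro image_subsetI) (auto simp: lift_def permutes_in_image[OF assms(2)])
  ultimately show "bij_betw (lift \<kappa>) (dset S) (dset S)"
    using endo_inj_surj[of "dset S" "lift \<kappa>"] assms(1) by (auto simp: bij_betw_def)
  show "lift \<kappa> z = z" if "z \<notin> dset S" for z
    using that by (cases z) (simp add: lift_def permutes_not_in[OF assms(2)])
qed

text \<open>\<gamma> enters \<open>dbl S \<gamma>\<close> only at even points, which is exactly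
  where \<open>lift \<kappa>\<close> acts.\<close>

lemma dbl_lift: "\<kappa> permutes S \<Longrightarrow> dbl S \<gamma> \<circ> lift \<kappa> = dbl S (\<gamma> \<circ> \<kappa>)"
  using permutes_in_image[of \<kappa> S] permutes_not_in[of \<kappa> S] by (auto simp: dbl_def lift_def fun_eq_iff)

lemma lift_comp: "lift (\<kappa> \<circ> \<mu>) = lift \<kappa> \<circ> lift \<mu>"
  by (auto simp: lift_def fun_eq_iff)

lemma lift_id: "lift id = id"
  by (auto simp: lift_def fun_eq_iff)

lemma lift_transpose: "lift (transpose i j) = transpose (i, True) (j, True)"
  by (auto simp: lift_def fun_eq_iff transpose_def)

lemma dbl_restrict: "V \<subseteq> S \<Longrightarrow> dbl V (perm_restrict \<tau> V) = perm_restrict (dbl S \<tau>) (dset V)"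
  by (auto simp: dbl_def perm_restrict_def fun_eq_iff)

text \<open>Contract every cycle of L to its even point, of which there is at most one. Steps of L
  then disappear and steps of \<open>lift \<kappa>\<close> become steps of \<kappa>, so nothing
  beyond the cycles of \<kappa> can connect two even points.\<close>

lemma conn_lift_comp:
  assumes "finite S" "sep S L" "L permutes dset S" "\<kappa> permutes S" "i \<in> S" "j \<in> S"
    and "((i, True), (j, True)) \<in> conn (gr (dset S) (L \<circ> lift \<kappa>))"
  shows "(i, j) \<in> conn (gr S \<kappa>)"
proof -
  let ?L = "gr (dset S) L" and ?\<kappa> = "gr (dset S) (lift \<kappa>)"
  \<comment> \<open>The contraction: a set with at most one element by \<open>sep S L\<close>, and
    empty for a class without even points.\<close>
  define p where "p z = {x \<in> S. ((x, True), z) \<in> conn ?L}" for z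
  have lk: "lift \<kappa> permutes dset S" using assms by (intro lift_permutes)
  have "conn (gr (dset S) (L \<circ> lift \<kappa>)) \<subseteq> conn (?L \<union> ?\<kappa>)"
  proof (rule conn_least, clarify)
    fix x b z assume "((x, b), z) \<in> gr (dset S) (L \<circ> lift \<kappa>)"
    then have z: "x \<in> S" "z = L (lift \<kappa> (x, b))" by auto
    then have "lift \<kappa> (x, b) \<in> dset S" using permutes_in_image[OF lk, of "(x, b)"] by simp
    then have "((x, b), lift \<kappa> (x, b)) \<in> conn (?L \<union> ?\<kappa>)" "(lift \<kappa> (x, b), z) \<in> conn (?L \<union> ?\<kappa>)"
      using z by (auto intro!: conn_incl)
    then show "((x, b), z) \<in> conn (?L \<union> ?\<kappa>)" by (rule conn_trans)
  qed
  then have "((i, True), (j, True)) \<in> conn (?L \<union> ?\<kappa>)" using assms(7) by blast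
  then have "conn (gr S \<kappa>) `` p (i, True) = conn (gr S \<kappa>) `` p (j, True)"
  proof (rule conn_invariant[rotated])
    have pT: "p (x, True) = {x}" if "x \<in> S" for x
      using assms(2) that unfolding p_def sep_def by auto
    fix u v assume "(u, v) \<in> ?L \<union> ?\<kappa>"
    then consider "(u, v) \<in> ?L" | "u \<in> dset S" "v = lift \<kappa> u" by auto
    then show "conn (gr S \<kappa>) `` p u = conn (gr S \<kappa>) `` p v"
    proof cases
      case 1
      then have uv: "(u, v) \<in> conn ?L" by (auto intro: conn_incl)
      have "p u = p v" unfolding p_def using uv conn_trans[OF _ uv] conn_trans[OF _ conn_sym[OF uv]] by blast
      then show ?thesis by simp
    next
      case 2
      then obtain x b where u: "u = (x, b)" "x \<in> S" by auto
      show ?thesis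
      proof (cases b)
        case True
        have "\<kappa> x \<in> S" using permutes_in_image[OF assms(4)] u(2) by blast
        moreover have "v = (\<kappa> x, True)" "u = (x, True)" using 2(2) u(1) True by (simp_all add: lift_def)
        ultimately have "p u = {x}" "p v = {\<kappa> x}" using pT u(2) by simp_all
        then show ?thesis using conn_gr_step[OF u(2), of \<kappa>] by (simp only: conn_image_eq_iff)
      qed (use 2 u in \<open>simp add: lift_def\<close>)
    qed
  qed
  moreover have "p (i, True) = {i}" "p (j, True) = {j}"
    using assms(2,5,6) unfolding p_def sep_def by auto
  ultimately show ?thesis by (simp add: conn_image_eq_iff)
qed

text \<open>Build \<kappa> by transpositions with a fixed point. Each of them joins two cycles of
  \<kappa> and, by the preceding contraction, two cycles of \<open>L \<circ> lift \<kappa>\<close>,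
  so both counts fall together.\<close>

lemma card_cyc_comp_lift:
  assumes "finite S" "sep S L" "L permutes dset S" "\<kappa> permutes S"
  shows "card (cyc (dset S) (L \<circ> lift \<kappa>)) + card S = card (cyc (dset S) L) + card (cyc S \<kappa>)"
  using assms(1,4)
proof (induction rule: permutes_leaf_induct)
  case id
  show ?case by (simp only: lift_id comp_id card_cyc_id)
next
  case (step \<kappa> i j)
  let ?i = "(i, True)" and ?j = "(j, True)"
  have nc: "(i, j) \<notin> conn (gr S \<kappa>)" using step.hyps by (intro fixed_point_not_conn)
  have p: "L \<circ> lift \<kappa> permutes dset S"
    using assms step.hyps by (intro permutes_compose lift_permutes)
  have nc': "(?i, ?j) \<notin> conn (gr (dset S) (L \<circ> lift \<kappa>))"
    using conn_lift_comp[OF assms(1-3) step.hyps(1-3)] nc by blast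
  have "L \<circ> lift (\<kappa> \<circ> transpose i j) = (L \<circ> lift \<kappa>) \<circ> transpose ?i ?j"
    by (simp only: lift_comp lift_transpose comp_assoc)
  then have "card (cyc (dset S) (L \<circ> lift (\<kappa> \<circ> transpose i j))) = card (cyc (dset S) ((L \<circ> lift \<kappa>) \<circ> transpose ?i ?j))"
    by (simp only:)
  moreover have "Suc (card (cyc (dset S) ((L \<circ> lift \<kappa>) \<circ> transpose ?i ?j))) = card (cyc (dset S) (L \<circ> lift \<kappa>))"
    using assms(1) step.hyps p nc' by (intro card_cyc_join) auto
  moreover have "Suc (card (cyc S (\<kappa> \<circ> transpose i j))) = card (cyc S \<kappa>)"
    using assms(1) step.hyps nc by (intro card_cyc_join)
  ultimately show ?case using step.IH by linarith
qed

section \<open>Existence and uniqueness of the separating permutation of the original points\<close>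

lemma card_cyc_le: "finite S \<Longrightarrow> card (cyc S \<pi>) \<le> card S"
  by (simp add: cyc_def comps_image card_image_le)

lemma card_cyc_eq_imp_id:
  assumes "finite S" "\<pi> permutes S" "card (cyc S \<pi>) = card S"
  shows "\<pi> = id"
proof -
  have "inj_on (\<lambda>x. conn (gr S \<pi>) `` {x}) S"
    using assms by (intro eq_card_imp_inj_on) (auto simp: cyc_def comps_image)
  then have "\<pi> x = x" if "x \<in> S" for x
    using that conn_gr_step[of x S \<pi>] permutes_in_image[OF assms(2), of x]
    by (metis conn_image_eq_iff inj_onD)
  then show ?thesis using permutes_not_in[OF assms(2)] by (metis eq_id_iff)
qed

text \<open>As long as two even points share a cycle, a transposition of them splits it. The number
  of cycles grows and is bounded by the number of points, so the process ends.\<close>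

lemma sep_exists:
  assumes "finite S" "K permutes dset S"
  shows "\<exists>\<kappa>. \<kappa> permutes S \<and> sep S (K \<circ> lift \<kappa>)"
  using assms(2)
proof (induction "card (dset S) - card (cyc (dset S) K)" arbitrary: K rule: less_induct)
  case less
  show ?case
  proof (cases "sep S K")
    case True
    then show ?thesis using permutes_id[of S] by (intro exI[of _ id]) (simp only: lift_id comp_id simp_thms)
  next
    case False
    then obtain x y where xy: "x \<in> S" "y \<in> S" "x \<noteq> y" "((x, True), (y, True)) \<in> conn (gr (dset S) K)"
      by (auto simp: sep_def)
    let ?t = "transpose (x, True) (y, True)"
    have "card (cyc (dset S) (K \<circ> ?t)) = Suc (card (cyc (dset S) K))"
      using assms(1) less.prems xy by (intro card_cyc_split) auto
    moreover have p: "K \<circ> ?t permutes dset S" using less.prems xy by (intro transpose_permutes) auto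
    moreover have "card (cyc (dset S) (K \<circ> ?t)) \<le> card (dset S)" using assms(1) by (intro card_cyc_le) auto
    ultimately have "card (dset S) - card (cyc (dset S) (K \<circ> ?t)) < card (dset S) - card (cyc (dset S) K)"
      by linarith
    then obtain \<kappa> where "\<kappa> permutes S" "sep S (K \<circ> ?t \<circ> lift \<kappa>)"
      using less.hyps[OF _ p] by blast
    then show ?thesis
      using permutes_compose[OF _ permutes_swap_id[OF xy(1,2)], of \<kappa>]
      by (metis comp_assoc lift_comp lift_transpose)
  qed
qed

text \<open>Both L and \<open>L \<circ> lift \<mu>\<close> separate, so the cycle count applies to
  \<mu> and to its inverse. Adding the two equations gives \<mu> and \<open>inv \<mu>\<close>
  together 2|S| cycles, which only the identity attains.\<close>

lemma sep_unique:
  assumes "finite S" "L permutes dset S" "\<mu> permutes S" "sep S L" "sep S (L \<circ> lift \<mu>)"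
  shows "\<mu> = id"
proof -
  have p: "L \<circ> lift \<mu> permutes dset S" using assms by (intro permutes_compose lift_permutes)
  have i: "inv \<mu> permutes S" using assms(3) by (rule permutes_inv)
  have "L \<circ> lift \<mu> \<circ> lift (inv \<mu>) = L"
    using permutes_inv_o(1)[OF assms(3)] by (metis comp_assoc comp_id lift_comp lift_id)
  then have "card (cyc (dset S) L) + card S = card (cyc (dset S) (L \<circ> lift \<mu>)) + card (cyc S (inv \<mu>))"
    using card_cyc_comp_lift[OF assms(1,5) p i] by simp
  moreover have "card (cyc (dset S) (L \<circ> lift \<mu>)) + card S = card (cyc (dset S) L) + card (cyc S \<mu>)"
    using assms by (intro card_cyc_comp_lift)
  moreover have "card (cyc S \<mu>) \<le> card S" "card (cyc S (inv \<mu>)) \<le> card S"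
    using assms(1) by (auto intro: card_cyc_le)
  ultimately have "card (cyc S \<mu>) = card S" by linarith
  then show ?thesis by (rule card_cyc_eq_imp_id[OF assms(1,3)])
qed

text \<open>Start from the doubled identity and correct it on the even points; the correction
  \<kappa> is \<tau> itself, because
  \<open>dbl S id \<circ> lift \<kappa> = dbl S \<kappa>\<close>.\<close>

lemma skeleton_exists:
  assumes "finite S" "\<pi> permutes dset S"
  obtains \<tau> where "\<tau> permutes S" "sep S (inv \<pi> \<circ> dbl S \<tau>)"
proof -
  have "inv \<pi> \<circ> dbl S id permutes dset S"
    using assms by (intro permutes_compose permutes_inv dbl_permutes permutes_id)
  then obtain \<kappa> where "\<kappa> permutes S" "sep S (inv \<pi> \<circ> dbl S id \<circ> lift \<kappa>)"
    using sep_exists[OF assms(1)] by blast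
  then show ?thesis using that[of \<kappa>] dbl_lift[of \<kappa> S id] by (simp only: comp_assoc id_comp)
qed

text \<open>The complement over \<gamma> differs from the one over \<tau> by the lifted complement
  of \<tau> in \<gamma>. This is what makes cycle numbers, and hence genus defects, add.\<close>

lemma dbl_factor:
  assumes "\<tau> permutes S" "\<gamma> permutes S"
  shows "\<pi> \<circ> dbl S \<gamma> = (\<pi> \<circ> dbl S \<tau>) \<circ> lift (inv \<tau> \<circ> \<gamma>)"
proof -
  have "dbl S \<tau> \<circ> lift (inv \<tau> \<circ> \<gamma>) = dbl S (\<tau> \<circ> (inv \<tau> \<circ> \<gamma>))"
    using assms by (intro dbl_lift permutes_compose permutes_inv)
  then show ?thesis by (simp only: comp_assoc inv_comp_cancel[OF assms(1)])
qed

lemma skeleton_unique: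
  assumes "finite S" "\<pi> permutes dset S" "\<tau> permutes S" "\<tau>' permutes S"
    "sep S (inv \<pi> \<circ> dbl S \<tau>)" "sep S (inv \<pi> \<circ> dbl S \<tau>')"
  shows "\<tau> = \<tau>'"
proof -
  have "inv \<tau> \<circ> \<tau>' = id"
  proof (rule sep_unique[OF assms(1) _ _ assms(5)])
    show "inv \<pi> \<circ> dbl S \<tau> permutes dset S"
      using assms by (intro permutes_compose permutes_inv dbl_permutes)
    show "inv \<tau> \<circ> \<tau>' permutes S" using assms by (intro permutes_compose permutes_inv)
    show "sep S (inv \<pi> \<circ> dbl S \<tau> \<circ> lift (inv \<tau> \<circ> \<tau>'))"
      using assms(6) dbl_factor[OF assms(3,4)] by metis
  qed
  then show ?thesis using inv_comp_cancel[OF assms(3), of \<tau>'] by simp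
qed

text \<open>Off the top layer the permutation \<open>inv \<pi> \<circ> dbl S \<tau>\<close> stays within a class of the
  relation on the right, and each of its cycles meets the top layer at most once.\<close>

lemma sep_imp_conn:
  assumes "finite S" "\<pi> permutes dset S" "\<tau> permutes S" "sep S (inv \<pi> \<circ> dbl S \<tau>)"
  shows "gr (dset S) (dbl S \<tau>) \<subseteq> conn (gr (dset S) \<pi> \<union> vert S)"
proof -
  define L where "L = inv \<pi> \<circ> dbl S \<tau>"
  let ?R = "gr (dset S) \<pi> \<union> vert S"
  have d: "dbl S \<tau> permutes dset S" using assms by (intro dbl_permutes)
  have pL: "L permutes dset S"
    unfolding L_def using assms d by (intro permutes_compose permutes_inv)
  have fin: "finite (dset S)" using assms(1) by simp
  have 1: "(L z, dbl S \<tau> z) \<in> conn ?R" if "z \<in> dset S" for z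
  proof -
    have "L z \<in> dset S" using that permutes_in_image[OF pL] by blast
    moreover have "\<pi> (L z) = dbl S \<tau> z" by (simp add: L_def permutes_inverses[OF assms(2)])
    ultimately have "(L z, dbl S \<tau> z) \<in> ?R" by (metis UnI1 gr_iff)
    then show ?thesis by (rule conn_incl)
  qed
  have 2: "((x, False), dbl S \<tau> (x, False)) \<in> conn ?R" if "x \<in> S" for x
    using that by (intro conn_incl) (auto simp: vert_def dbl_def)
  have 3: "((x, True), L (x, True)) \<in> conn ?R" if x: "x \<in> S" for x
  proof -
    \<comment> \<open>Follow the orbit of (x, True). From an odd point the next one is reached by a
      vertical edge and a step of \<pi> backwards; the only even point ever met is (x, True), after
      which the walk starts over at its first point.\<close>
    have "(L (x, True), y) \<in> conn ?R \<and> y \<in> dset S" if "y \<in> orbit L (x, True)" for y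
      using that
    proof induction
      case base
      have "L (x, True) \<in> dset S" using x permutes_in_image[OF pL, of "(x, True)"] by simp
      then show ?case by simp
    next
      case (step y)
      then obtain u b where y: "y = (u, b)" "u \<in> S" by auto
      have Ly: "L y \<in> dset S" using step permutes_in_image[OF pL] by blast
      show ?case
      proof (cases b)
        case False
        then have "(y, L y) \<in> conn ?R"
          using 1[of y] 2[of u] y by (auto intro: conn_trans conn_sym)
        then show ?thesis using step.IH Ly by (auto intro: conn_trans)
      next
        case True
        have "((x, True), y) \<in> conn (gr (dset S) L)"
          using step.hyps conn_gr_orbit[OF fin pL, of "(x, True)"] by auto
        then have "u = x" using assms(4) x y True unfolding sep_def L_def by auto
        then show ?thesis using y True Ly by simp
      qed
    qed
    moreover have "(x, True) \<in> orbit L (x, True)"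
      using pL fin permutation_permutes permutation_self_in_orbit by metis
    ultimately show ?thesis by (blast intro: conn_sym)
  qed
  show ?thesis
  proof clarify
    fix x b z assume "((x, b), z) \<in> gr (dset S) (dbl S \<tau>)"
    then have z: "x \<in> S" "z = dbl S \<tau> (x, b)" by auto
    show "((x, b), z) \<in> conn ?R"
    proof (cases b)
      case True
      then show ?thesis using 3[OF z(1)] 1[of "(x, b)"] z by (auto intro: conn_trans)
    qed (use z 2 in simp)
  qed
qed

section \<open>Separating pairs, and the projection to the original points\<close>

lemma finite_PS [simp]:
  assumes "finite S" shows "finite (PS S \<gamma>)"
proof (rule finite_subset)
  show "PS S \<gamma> \<subseteq> {U. partition_on S U} \<times> {\<pi>. \<pi> permutes S}" by (auto simp: PS_def)
  show "finite ({U. partition_on S U} \<times> {\<pi>. \<pi> permutes S})"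
    using assms by (intro finite_cartesian_product finitely_many_partition_on finite_permutations)
qed

text \<open>The doubled pairs whose \<tau> is \<gamma> itself: the pieces from which all doubled
  pairs are assembled.\<close>

definition PSsep :: "'a set \<Rightarrow> ('a \<Rightarrow> 'a) \<Rightarrow> (('a \<times> bool) set set \<times> ('a \<times> bool \<Rightarrow> 'a \<times> bool)) set" where
  "PSsep S \<gamma> = {(U, \<pi>) \<in> PS (dset S) (dbl S \<gamma>). sep S (inv \<pi> \<circ> dbl S \<gamma>)}"

lemma PSsep_subset: "PSsep S \<gamma> \<subseteq> PS (dset S) (dbl S \<gamma>)"
  by (auto simp: PSsep_def)

lemma finite_PSsep [simp]: "finite S \<Longrightarrow> finite (PSsep S \<gamma>)"
  by (rule finite_subset[OF PSsep_subset]) simp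

definition proj :: "(('a \<times> bool) \<times> ('a \<times> bool)) set \<Rightarrow> ('a \<times> 'a) set" where
  "proj R = {(fst u, fst v) |u v. (u, v) \<in> R}"

lemma projI: "((x, b), (y, c)) \<in> R \<Longrightarrow> (x, y) \<in> proj R"
  unfolding proj_def by force

lemma conn_proj: "(u, v) \<in> conn R \<Longrightarrow> (fst u, fst v) \<in> conn (proj R)"
proof -
  assume "(u, v) \<in> conn R"
  then have "conn (proj R) `` {fst u} = conn (proj R) `` {fst v}"
  proof (rule conn_invariant[rotated])
    fix u v assume "(u, v) \<in> R"
    then have "(fst u, fst v) \<in> proj R" unfolding proj_def by blast
    then show "conn (proj R) `` {fst u} = conn (proj R) `` {fst v}"
      unfolding conn_image_eq_iff by (rule conn_incl)
  qed
  then show ?thesis by (simp add: conn_image_eq_iff)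
qed

text \<open>With the vertical edges inside R the second coordinate can be changed at will, so
  classes are full fibres over classes of the projection.\<close>

lemma conn_dset:
  assumes "R \<subseteq> dset S \<times> dset S" "vert S \<subseteq> conn R" "x \<in> S"
  shows "conn R `` {(x, b)} = dset (conn (proj R) `` {x})"
proof (intro equalityI subsetI)
  fix z assume "z \<in> conn R `` {(x, b)}"
  then show "z \<in> dset (conn (proj R) `` {x})" using conn_proj[of "(x, b)" z R] by (cases z) auto
next
  fix z assume "z \<in> dset (conn (proj R) `` {x})"
  then obtain y c where z: "z = (y, c)" "(x, y) \<in> conn (proj R)" by auto
  have v: "((u, False), (u, b)) \<in> conn R" if "u \<in> S" for u b
    using assms(2) that by (cases b) (auto simp: vert_def)
  have sub: "proj R \<subseteq> S \<times> S" using assms(1) by (auto simp: proj_def)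
  from z(2) have "conn R `` {(x, False)} = conn R `` {(y, False)}"
  proof (rule conn_invariant[rotated])
    fix u u' assume "(u, u') \<in> proj R"
    then obtain b b' where bb: "((u, b), (u', b')) \<in> R" by (auto simp: proj_def)
    then have "u \<in> S" "u' \<in> S" using assms(1) by auto
    then show "conn R `` {(u, False)} = conn R `` {(u', False)}"
      using v[of u b] v[of u' b'] conn_incl[OF bb] unfolding conn_image_eq_iff
      by (blast intro: conn_trans conn_sym)
  qed
  then have "((x, False), (y, False)) \<in> conn R" by (simp add: conn_image_eq_iff)
  moreover have "y \<in> S" using conn_closed[OF sub z(2)] assms(3) by simp
  ultimately have "((x, b), (y, c)) \<in> conn R"
    using v[OF assms(3), of b] v[of y c] by (blast intro: conn_trans conn_sym)
  then show "z \<in> conn R `` {(x, b)}" using z by simp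
qed

lemma comps_dset:
  assumes "R \<subseteq> dset S \<times> dset S" "vert S \<subseteq> conn R"
  shows "comps (dset S) R = dset ` comps S (proj R)"
proof -
  have "comps (dset S) R = (\<lambda>z. dset (conn (proj R) `` {fst z})) ` dset S"
    unfolding comps_image
  proof (rule image_cong)
    fix z assume "z \<in> dset S"
    then show "conn R `` {z} = dset (conn (proj R) `` {fst z})"
      using conn_dset[OF assms, of "fst z" "snd z"] by (simp only: mem_Times_iff prod.collapse)
  qed simp
  also have "\<dots> = dset ` comps S (proj R)" unfolding comps_image by force
  finally show ?thesis .
qed

lemma inj_dset: "inj (\<lambda>V. dset V)"
  by (rule injI) auto

lemma dset_image_singleton: "dset ` X = {dset S} \<longleftrightarrow> X = {S}"
  using inj_image_eq_iff[OF inj_dset, of X "{S}"] by simp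

lemma card_cyc_dbl:
  assumes "finite S" "\<gamma> permutes S"
  shows "card (cyc (dset S) (dbl S \<gamma>)) = card (cyc S \<gamma>)"
proof -
  let ?R = "gr (dset S) (dbl S \<gamma>)"
  have "vert S \<subseteq> ?R" by (auto simp: vert_def dbl_def)
  then have v: "vert S \<subseteq> conn ?R" by (auto intro: conn_incl)
  have "proj ?R = gr S \<gamma> \<union> Id_on S"
  proof (intro equalityI subsetI)
    fix z assume "z \<in> proj ?R"
    then show "z \<in> gr S \<gamma> \<union> Id_on S" by (auto simp: proj_def dbl_def split: if_splits)
  next
    fix z assume z: "z \<in> gr S \<gamma> \<union> Id_on S"
    have "((x, True), (\<gamma> x, False)) \<in> ?R" "((x, False), (x, True)) \<in> ?R" if "x \<in> S" for x
      using that by (auto simp: dbl_def)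
    then have "(x, \<gamma> x) \<in> proj ?R" "(x, x) \<in> proj ?R" if "x \<in> S" for x
      using that by (blast intro: projI)+
    then show "z \<in> proj ?R" using z by (cases z) auto
  qed
  moreover have "conn (gr S \<gamma> \<union> Id_on S) = conn (gr S \<gamma>)"
    by (rule conn_eqI) (auto intro: conn_incl)
  ultimately have "comps (dset S) ?R = dset ` comps S (gr S \<gamma>)"
    using comps_dset[OF gr_subset[OF dbl_permutes[OF assms]] v] by (simp add: comps_def)
  then show ?thesis
    unfolding cyc_def using card_image[OF inj_on_subset[OF inj_dset]] by auto
qed

lemma vert_subset_gr: "vert S \<subseteq> gr (dset S) (dbl S \<gamma>)"
  by (auto simp: vert_def dbl_def)

text \<open>The arithmetic of the next lemma. k, L, M are the cycle numbers of the complements of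
  \<pi> over \<gamma>, of \<pi> over \<tau> and of \<tau> over \<gamma>; u, v count the blocks of U
  and U'; t, p, g are the cycle numbers of \<tau>, \<pi>, \<gamma>; N is |S| and C is connectedness.
  Twice N arises as the size of the doubled set.\<close>

lemma additive_equality:
  fixes k N L M u t v p g :: nat
  assumes "k + N = L + M" "2 * u + L + t \<le> 2 * N + 2 * v + p" "C \<Longrightarrow> 2 * v + M + g \<le> N + 2 + t"
    "(2 * u + L + t = 2 * N + 2 * v + p) \<longleftrightarrow> Q" "P \<longleftrightarrow> C \<and> 2 * u + k + g = 2 * N + 2 + p"
    "T \<longleftrightarrow> C \<and> 2 * v + M + g = N + 2 + t"
  shows "P \<longleftrightarrow> T \<and> Q"
proof (cases C)
  case True
  then have "2 * v + M + g \<le> N + 2 + t" by (rule assms(3))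
  then have "2 * u + k + g = 2 * N + 2 + p \<longleftrightarrow>
      2 * u + L + t = 2 * N + 2 * v + p \<and> 2 * v + M + g = N + 2 + t"
    using assms(1,2) by linarith
  then show ?thesis using assms(4-6) True by blast
qed (use assms in simp)

text \<open>The two genus inequalities, for \<open>(U, \<pi>)\<close> over \<open>\<tau>\<close> and for \<open>(U', \<tau>)\<close> over \<open>\<gamma>\<close>, add up to
  the one for \<open>(U, \<pi>)\<close> over \<open>\<gamma>\<close>; so equality in the latter means equality in both.\<close>

lemma PS_double_iff:
  assumes fin: "finite S" and \<gamma>: "\<gamma> permutes S" and \<tau>: "\<tau> permutes S" and \<pi>: "\<pi> permutes dset S"
    and U: "partition_on (dset S) U" and le: "gr (dset S) \<pi> \<subseteq> prel U"
    and sep: "sep S (inv \<pi> \<circ> dbl S \<tau>)"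
    and U': "U' = comps S (proj (prel U \<union> gr (dset S) (dbl S \<tau>)))"
  shows "(U, \<pi>) \<in> PS (dset S) (dbl S \<gamma>) \<longleftrightarrow> (U', \<tau>) \<in> PS S \<gamma> \<and>
    (\<forall>V\<in>dset ` U'. ({W \<in> U. W \<subseteq> V}, perm_restrict \<pi> V) \<in> PS V (perm_restrict (dbl S \<tau>) V))"
proof -
  define R where "R = prel U \<union> gr (dset S) (dbl S \<tau>)"
  define R\<gamma> where "R\<gamma> = prel U \<union> gr (dset S) (dbl S \<gamma>)"
  have find: "finite (dset S)" using fin by simp
  have d\<tau>: "dbl S \<tau> permutes dset S" and d\<gamma>: "dbl S \<gamma> permutes dset S"
    using fin \<tau> \<gamma> by (auto intro: dbl_permutes)
  have sub: "R \<subseteq> dset S \<times> dset S" "R\<gamma> \<subseteq> dset S \<times> dset S"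
    using prel_subset[OF U] gr_subset[OF d\<tau>] gr_subset[OF d\<gamma>] by (auto simp: R_def R\<gamma>_def)
  have v: "vert S \<subseteq> conn R" "vert S \<subseteq> conn R\<gamma>"
    unfolding R_def R\<gamma>_def using vert_subset_gr by (fast intro: conn_incl)+
  have psub: "proj R \<subseteq> S \<times> S" using sub(1) by (auto simp: proj_def)
  have U'R: "U' = comps S (proj R)" using U' by (simp add: R_def)
  have pU': "partition_on S U'" unfolding U'R by (rule partition_on_comps[OF psub])
  have cU': "conn (prel U') = conn (proj R)" unfolding U'R by (rule conn_prel_comps[OF psub])
  have cR: "comps (dset S) R = dset ` U'" unfolding U'R by (rule comps_dset[OF sub(1) v(1)])
  have le': "gr S \<tau> \<subseteq> prel U'"
  proof clarify
    fix x y assume "(x, y) \<in> gr S \<tau>"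
    then have y: "x \<in> S" "y = \<tau> x" by auto
    have "((x, True), (\<tau> x, False)) \<in> R" using y by (auto simp: R_def dbl_def)
    then have "(x, y) \<in> conn (proj R)" using y conn_proj[OF conn_incl] by fastforce
    then show "(x, y) \<in> prel U'"
      using y conn_refl[of x "proj R"] unfolding U'R by (unfold prel_def comps_image, blast)
  qed
  \<comment> \<open>Connectedness is demanded of U with the doubled \<gamma> in one membership and
    of U' with \<gamma> in the other; this identity makes the two demands equivalent.\<close>
  have "conn (proj R\<gamma>) = conn (prel U' \<union> gr S \<gamma>)"
  proof (rule conn_eqI)
    show "proj R\<gamma> \<subseteq> conn (prel U' \<union> gr S \<gamma>)"
    proof clarify
      fix x y assume "(x, y) \<in> proj R\<gamma>"
      then obtain b c where "((x, b), (y, c)) \<in> R\<gamma>" by (auto simp: proj_def)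
      then consider "((x, b), (y, c)) \<in> prel U" | "x \<in> S" "(y, c) = dbl S \<gamma> (x, b)"
        by (auto simp: R\<gamma>_def)
      then show "(x, y) \<in> conn (prel U' \<union> gr S \<gamma>)"
      proof cases
        case 1
        then have "(x, y) \<in> proj R" unfolding R_def by (blast intro: projI)
        then have "(x, y) \<in> conn (prel U')" unfolding cU' by (rule conn_incl)
        then show ?thesis using conn_mono[of "prel U'" "prel U' \<union> gr S \<gamma>"] by auto
      next
        case 2
        then have "y = x \<or> y = \<gamma> x" by (auto simp: dbl_def split: if_splits)
        then show ?thesis using 2 by (auto intro: conn_incl)
      qed
    qed
    have g: "gr S \<gamma> \<subseteq> proj R\<gamma>"
    proof clarify
      fix x y assume "(x, y) \<in> gr S \<gamma>"
      then have "((x, True), (y, False)) \<in> R\<gamma>" by (auto simp: R\<gamma>_def dbl_def)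
      then show "(x, y) \<in> proj R\<gamma>" by (rule projI)
    qed
    \<comment> \<open>Here separation enters: a step of \<open>dbl S \<tau>\<close> is a chain of
      \<pi>-steps and vertical edges, both of which are available over \<gamma> as well.\<close>
    have "R \<subseteq> conn R\<gamma>"
    proof -
      have "gr (dset S) \<pi> \<union> vert S \<subseteq> R\<gamma>" using le vert_subset_gr by (auto simp: R\<gamma>_def)
      then have "gr (dset S) (dbl S \<tau>) \<subseteq> conn R\<gamma>"
        using sep_imp_conn[OF fin \<pi> \<tau> sep] conn_mono by blast
      then show ?thesis by (auto simp: R_def R\<gamma>_def intro: conn_incl)
    qed
    then have "proj R \<subseteq> conn (proj R\<gamma>)"
      using conn_proj unfolding proj_def[of R] by blast
    then have "conn (prel U') \<subseteq> conn (proj R\<gamma>)" unfolding cU' by (rule conn_least)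
    then show "prel U' \<union> gr S \<gamma> \<subseteq> conn (proj R\<gamma>)"
      using g by (auto intro: conn_incl)
  qed
  then have con: "comps (dset S) R\<gamma> = {dset S} \<longleftrightarrow> comps S (prel U' \<union> gr S \<gamma>) = {S}"
    using comps_dset[OF sub(2) v(2)] by (simp add: comps_def dset_image_singleton)
  have pL: "inv \<pi> \<circ> dbl S \<tau> permutes dset S" using \<pi> d\<tau> by (intro permutes_compose permutes_inv)
  have c1: "card (dset S) = 2 * card S" by (simp add: card_cartesian_product)
  have c2: "card (dset ` U') = card U'" by (rule card_image[OF inj_on_subset[OF inj_dset]]) simp
  have "card (cyc (dset S) (inv \<pi> \<circ> dbl S \<gamma>)) + card S =
      card (cyc (dset S) (inv \<pi> \<circ> dbl S \<tau>)) + card (cyc S (inv \<tau> \<circ> \<gamma>))"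
    unfolding dbl_factor[OF \<tau> \<gamma>] using fin sep pL \<gamma> \<tau>
    by (intro card_cyc_comp_lift permutes_compose[OF \<gamma> permutes_inv[OF \<tau>]])
  moreover have "2 * card U + card (cyc (dset S) (inv \<pi> \<circ> dbl S \<tau>)) + card (cyc S \<tau>)
      \<le> 2 * card S + 2 * card U' + card (cyc (dset S) \<pi>)"
    using genus_inequality_inv[OF find U \<pi> le d\<tau>]
    unfolding R_def[symmetric] cR c1 c2 card_cyc_dbl[OF fin \<tau>] .
  moreover have "2 * card U' + card (cyc S (inv \<tau> \<circ> \<gamma>)) + card (cyc S \<gamma>) \<le> card S + 2 + card (cyc S \<tau>)"
    if "comps S (prel U' \<union> gr S \<gamma>) = {S}"
    using genus_inequality_inv[OF fin pU' \<tau> le' \<gamma>] that by simp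
  moreover have "(2 * card U + card (cyc (dset S) (inv \<pi> \<circ> dbl S \<tau>)) + card (cyc S \<tau>)
      = 2 * card S + 2 * card U' + card (cyc (dset S) \<pi>)) \<longleftrightarrow>
    (\<forall>V\<in>dset ` U'. ({W \<in> U. W \<subseteq> V}, perm_restrict \<pi> V) \<in> PS V (perm_restrict (dbl S \<tau>) V))"
    using genus_equality_local[OF find U \<pi> le d\<tau> refl]
    unfolding R_def[symmetric] cR c1 c2 card_cyc_dbl[OF fin \<tau>] .
  moreover have "(U, \<pi>) \<in> PS (dset S) (dbl S \<gamma>) \<longleftrightarrow> comps S (prel U' \<union> gr S \<gamma>) = {S} \<and>
      2 * card U + card (cyc (dset S) (inv \<pi> \<circ> dbl S \<gamma>)) + card (cyc S \<gamma>) = 2 * card S + 2 + card (cyc (dset S) \<pi>)"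
    using U \<pi> le con card_cyc_dbl[OF fin \<gamma>] c1 by (simp add: PS_def R\<gamma>_def)
  moreover have "(U', \<tau>) \<in> PS S \<gamma> \<longleftrightarrow> comps S (prel U' \<union> gr S \<gamma>) = {S} \<and>
      2 * card U' + card (cyc S (inv \<tau> \<circ> \<gamma>)) + card (cyc S \<gamma>) = card S + 2 + card (cyc S \<tau>)"
    using pU' \<tau> le' by (simp add: PS_def)
  ultimately show ?thesis by (rule additive_equality)
qed

section \<open>Gluing\<close>

text \<open>All ways of choosing one pair from X V for every V, assembled into a pair on T.\<close>

definition glue :: "'a set \<Rightarrow> 'a set set \<Rightarrow> ('a set \<Rightarrow> ('a set set \<times> ('a \<Rightarrow> 'a)) set) \<Rightarrow> ('a set set \<times> ('a \<Rightarrow> 'a)) set" where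
  "glue T \<V> X = {(U, \<pi>). \<pi> permutes T \<and> partition_on T U \<and> (\<forall>V\<in>\<V>. \<pi> ` V \<subseteq> V) \<and>
     (\<forall>W\<in>U. \<exists>V\<in>\<V>. W \<subseteq> V) \<and> (\<forall>V\<in>\<V>. ({W \<in> U. W \<subseteq> V}, perm_restrict \<pi> V) \<in> X V)}"

text \<open>Cutting along the blocks and pasting are inverse to each other, so glued pairs
  correspond to functions in \<open>PiE\<close>, and the weight is multiplicative over V. The rest
  is distributivity of product over sum.\<close>

lemma glue_sum:
  fixes w :: "'a set \<Rightarrow> ('a \<Rightarrow> 'a) \<Rightarrow> 'b::comm_semiring_1"
  assumes fin: "finite T" and \<V>: "partition_on T \<V>" and finX: "\<And>V. V \<in> \<V> \<Longrightarrow> finite (X V)"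
    and X: "\<And>V U \<pi>. V \<in> \<V> \<Longrightarrow> (U, \<pi>) \<in> X V \<Longrightarrow> \<pi> permutes V \<and> partition_on V U"
  shows "(\<Sum>(U, \<pi>)\<in>glue T \<V> X. \<Prod>W\<in>U. w W (perm_restrict \<pi> W)) =
    (\<Prod>V\<in>\<V>. \<Sum>(U, \<pi>)\<in>X V. \<Prod>W\<in>U. w W (perm_restrict \<pi> W))"
proof -
  define f where "f = (\<lambda>(U, \<pi>). \<Prod>W\<in>U. w W (perm_restrict \<pi> W))"
  define blk where "blk x = (THE V. V \<in> \<V> \<and> x \<in> V)" for x
  define cut where "cut = (\<lambda>(U, \<pi>). \<lambda>V\<in>\<V>. ({W \<in> U. W \<subseteq> V}, perm_restrict \<pi> V))"
  \<comment> \<open>\<open>blk x\<close> finds the block whose piece moves x; outside T the pasted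
    permutation is the identity.\<close>
  define paste where "paste g = (\<Union>V\<in>\<V>. fst (g V), \<lambda>x. if x \<in> T then snd (g (blk x)) x else x)"
    for g :: "'a set \<Rightarrow> 'a set set \<times> ('a \<Rightarrow> 'a)"
  have fV: "finite \<V>" using finite_elements[OF fin \<V>] .
  have T: "T = \<Union>\<V>" using partition_onD1[OF \<V>] .
  have fVV: "finite V" if "V \<in> \<V>" for V using that fin T by (meson Union_upper finite_subset)
  have blk: "blk x = V" if "V \<in> \<V>" "x \<in> V" for x V
    unfolding blk_def using that partition_on_unique[OF \<V>] by (intro the_equality) auto
  have blkT: "blk x \<in> \<V> \<and> x \<in> blk x" if "x \<in> T" for x using that blk T by auto
  have pg: "paste g \<in> glue T \<V> X \<and> cut (paste g) = g" if g: "g \<in> PiE \<V> X" for g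
  proof -
    have gX: "(fst (g V), snd (g V)) \<in> X V" if "V \<in> \<V>" for V using g that by auto
    have gp: "snd (g V) permutes V" and gU: "partition_on V (fst (g V))" if "V \<in> \<V>" for V
      using X[OF that gX[OF that]] by auto
    define U where "U = (\<Union>V\<in>\<V>. fst (g V))"
    define \<pi> where "\<pi> x = (if x \<in> T then snd (g (blk x)) x else x)" for x
    have paste: "paste g = (U, \<pi>)" by (simp add: paste_def U_def \<pi>_def fun_eq_iff)
    have \<pi>V: "\<pi> x = snd (g V) x" "\<pi> x \<in> V" if "V \<in> \<V>" "x \<in> V" for x V
    proof -
      show "\<pi> x = snd (g V) x" using that blk[OF that] T by (auto simp: \<pi>_def)
      then show "\<pi> x \<in> V" using permutes_in_image[OF gp[OF that(1)]] that by simp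
    qed
    have \<pi>: "\<pi> permutes T"
    proof (rule bij_imp_permutes)
      have "inj_on \<pi> T"
      proof (rule inj_onI)
        fix x y assume xy: "x \<in> T" "y \<in> T" "\<pi> x = \<pi> y"
        then have "blk x = blk y" using \<pi>V blkT blk by metis
        then have "snd (g (blk x)) x = snd (g (blk x)) y" using xy by (simp add: \<pi>_def)
        then show "x = y" using permutes_inj[OF gp, of "blk x"] blkT[OF xy(1)] by (auto dest: injD)
      qed
      moreover have "\<pi> ` T \<subseteq> T" using \<pi>V T by blast
      ultimately show "bij_betw \<pi> T T" using endo_inj_surj[OF fin] unfolding bij_betw_def by blast
    qed (simp add: \<pi>_def)
    have cU: "{W \<in> U. W \<subseteq> V} = fst (g V)" if V: "V \<in> \<V>" for V
    proof (intro equalityI subsetI)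
      fix W assume "W \<in> {W \<in> U. W \<subseteq> V}"
      then obtain V' where V': "V' \<in> \<V>" "W \<in> fst (g V')" "W \<subseteq> V" by (auto simp: U_def)
      have "W \<noteq> {}" using partition_onD3[OF gU[OF V'(1)]] V' by auto
      then obtain x where "x \<in> W" by auto
      moreover have "W \<subseteq> V'" using partition_onD1[OF gU[OF V'(1)]] V' by auto
      ultimately have "V' = V" using V V' partition_on_unique[OF \<V>] by blast
      then show "W \<in> fst (g V)" using V' by simp
    next
      fix W assume "W \<in> fst (g V)"
      then show "W \<in> {W \<in> U. W \<subseteq> V}" using V partition_onD1[OF gU[OF V]] by (auto simp: U_def)
    qed
    have U: "partition_on T U"
    proof (rule partition_onI)
      have "\<Union>U = (\<Union>V\<in>\<V>. \<Union>(fst (g V)))" unfolding U_def by blast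
      also have "\<dots> = (\<Union>V\<in>\<V>. V)" using partition_onD1[OF gU] by (intro SUP_cong refl) simp
      finally show "\<Union>U = T" using T by simp
      show "{} \<notin> U" unfolding U_def using partition_onD3[OF gU] by auto
      fix p q assume pq: "p \<in> U" "q \<in> U" "p \<noteq> q"
      then obtain V V' where VV: "V \<in> \<V>" "p \<in> fst (g V)" "V' \<in> \<V>" "q \<in> fst (g V')" by (auto simp: U_def)
      show "disjnt p q"
      proof (rule ccontr)
        assume "\<not> disjnt p q"
        then obtain x where x: "x \<in> p" "x \<in> q" by (auto simp: disjnt_def)
        then have "x \<in> V" "x \<in> V'" using VV partition_onD1[OF gU] by blast+
        then have "V = V'" using partition_on_unique[OF \<V>] VV by blast
        then show False using pq(3) partition_on_unique[OF gU[OF VV(1)] VV(2) _ x] VV(4) by simp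
      qed
    qed
    have rV: "perm_restrict \<pi> V = snd (g V)" if V: "V \<in> \<V>" for V
      using \<pi>V[OF V] permutes_not_in[OF gp[OF V]] by (auto simp: perm_restrict_def fun_eq_iff)
    have "\<exists>V\<in>\<V>. W \<subseteq> V" if "W \<in> U" for W
      using that partition_onD1[OF gU] unfolding U_def by blast
    then have "paste g \<in> glue T \<V> X"
      using \<pi> U cU rV gX \<pi>V unfolding paste glue_def by auto
    moreover have "cut (paste g) = g"
      unfolding paste cut_def prod.case
    proof (rule extensionalityI[of _ \<V>])
      show "g \<in> extensional \<V>" using g by (auto simp: PiE_def)
    qed (auto simp: cU rV)
    ultimately show ?thesis by simp
  qed
  have ga: "cut a \<in> PiE \<V> X \<and> paste (cut a) = a \<and> f a = (\<Prod>V\<in>\<V>. f (cut a V))"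
    if a: "a \<in> glue T \<V> X" for a
  proof -
    obtain U \<pi> where a': "a = (U, \<pi>)" by (cases a)
    have U\<pi>: "\<pi> permutes T" "partition_on T U" "\<And>W. W \<in> U \<Longrightarrow> \<exists>V\<in>\<V>. W \<subseteq> V"
      "\<And>V. V \<in> \<V> \<Longrightarrow> ({W \<in> U. W \<subseteq> V}, perm_restrict \<pi> V) \<in> X V"
      using a unfolding a' glue_def by auto
    have c: "cut a \<in> PiE \<V> X" unfolding a' cut_def using U\<pi>(4) by auto
    have "(\<Union>V\<in>\<V>. fst (cut a V)) = U"
      unfolding a' cut_def using refining_UN[OF U\<pi>(3)] by auto
    moreover have "(if x \<in> T then snd (cut a (blk x)) x else x) = \<pi> x" for x
      using blkT[of x] permutes_not_in[OF U\<pi>(1), of x] by (auto simp: a' cut_def perm_restrict_def)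
    ultimately have d: "paste (cut a) = a" unfolding paste_def by (simp add: a' fun_eq_iff)
    have "f a = (\<Prod>W\<in>(\<Union>V\<in>\<V>. {W \<in> U. W \<subseteq> V}). w W (perm_restrict \<pi> W))"
      using refining_UN[OF U\<pi>(3)] by (simp add: f_def a')
    also have "\<dots> = (\<Prod>V\<in>\<V>. \<Prod>W\<in>{W \<in> U. W \<subseteq> V}. w W (perm_restrict \<pi> W))"
      using fV finite_elements[OF fin U\<pi>(2)] refining_disjoint[OF U\<pi>(2) \<V>]
      by (intro prod.UNION_disjoint) auto
    also have "\<dots> = (\<Prod>V\<in>\<V>. f (cut a V))"
    proof (rule prod.cong[OF refl])
      fix V assume "V \<in> \<V>"
      then have "f (cut a V) = (\<Prod>W\<in>{W \<in> U. W \<subseteq> V}. w W (perm_restrict (perm_restrict \<pi> V) W))"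
        by (simp add: f_def cut_def a')
      also have "\<dots> = (\<Prod>W\<in>{W \<in> U. W \<subseteq> V}. w W (perm_restrict \<pi> W))"
        by (rule prod.cong[OF refl]) (simp add: perm_restrict_subset)
      finally show "(\<Prod>W\<in>{W \<in> U. W \<subseteq> V}. w W (perm_restrict \<pi> W)) = f (cut a V)" by simp
    qed
    finally have "f a = (\<Prod>V\<in>\<V>. f (cut a V))" .
    then show ?thesis using c d by simp
  qed
  have "(\<Prod>V\<in>\<V>. sum f (X V)) = (\<Sum>g\<in>PiE \<V> X. \<Prod>V\<in>\<V>. f (g V))"
    using fV finX by (rule prod_sum_PiE)
  also have "\<dots> = sum f (glue T \<V> X)"
  proof (rule sum.reindex_bij_witness[of _ cut paste])
    fix g assume g: "g \<in> PiE \<V> X"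
    show "paste g \<in> glue T \<V> X" "cut (paste g) = g" using pg[OF g] by auto
    then show "f (paste g) = (\<Prod>V\<in>\<V>. f (g V))" using ga[of "paste g"] by simp
  qed (use ga in auto)
  finally show ?thesis by (simp add: f_def)
qed

section \<open>The doubled pairs that lie over a given pair\<close>

lemma restrict_prel_gr:
  assumes "partition_on T U" "partition_on T \<V>" "\<And>W. W \<in> U \<Longrightarrow> \<exists>V\<in>\<V>. W \<subseteq> V" "V \<in> \<V>"
    "\<gamma> ` V \<subseteq> V"
  shows "(prel U \<union> gr T \<gamma>) \<inter> V \<times> V = prel {W \<in> U. W \<subseteq> V} \<union> gr V (perm_restrict \<gamma> V)"
proof -
  have "V \<subseteq> T" using assms(2,4) partition_onD1 by blast
  then show ?thesis
    using prel_restrict[OF assms(1-4)] gr_restrict[of V T \<gamma>] assms(5) by (simp only: Int_Un_distrib2)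
qed

lemma partition_on_dset: "partition_on S U \<Longrightarrow> partition_on (dset S) (dset ` U)"
proof (rule partition_onI)
  assume U: "partition_on S U"
  show "\<Union> (dset ` U) = dset S" using partition_onD1[OF U] by blast
  have "dset V \<noteq> {}" if "V \<in> U" for V using that partition_onD3[OF U] by auto
  then have "{} \<noteq> dset V" if "V \<in> U" for V using that by (metis (no_types))
  then show "{} \<notin> dset ` U" by (intro notI) (erule imageE, simp)
  show "disjnt p q" if "p \<in> dset ` U" "q \<in> dset ` U" "p \<noteq> q" for p q
    using that partition_on_unique[OF U] by (fastforce simp: disjnt_def)
qed

text \<open>\<open>inv \<pi> \<circ> dbl S \<tau>\<close> preserves every doubled block, so its
  cycles through a block are those of its restriction, and two even points of different blocks are
  never connected.\<close>

lemma sep_local: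
  assumes fin: "finite S" and U': "partition_on S U'" and \<pi>: "\<pi> permutes dset S" and \<tau>: "\<tau> permutes S"
    and p\<pi>: "\<And>V. V \<in> U' \<Longrightarrow> \<pi> ` dset V \<subseteq> dset V" and p\<tau>: "\<And>V. V \<in> U' \<Longrightarrow> \<tau> ` V \<subseteq> V"
  shows "sep S (inv \<pi> \<circ> dbl S \<tau>) \<longleftrightarrow>
    (\<forall>V\<in>U'. sep V (inv (perm_restrict \<pi> (dset V)) \<circ> dbl V (perm_restrict \<tau> V)))"
proof -
  define L where "L = inv \<pi> \<circ> dbl S \<tau>"
  have sub: "V \<subseteq> S" "finite V" if "V \<in> U'" for V
  proof -
    show "V \<subseteq> S" using that partition_onD1[OF U'] by blast
    then show "finite V" using fin by (rule finite_subset)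
  qed
  have pd: "dbl S \<tau> ` dset V \<subseteq> dset V" if "V \<in> U'" for V
    using p\<tau>[OF that] sub(1)[OF that] by (auto simp: dbl_def split: if_splits)
  have pi: "inv \<pi> ` dset V \<subseteq> dset V" if "V \<in> U'" for V
    using inv_image_subset[OF _ \<pi> p\<pi>[OF that]] sub(2)[OF that] by simp
  have pL: "L ` dset V \<subseteq> dset V" if "V \<in> U'" for V
    unfolding L_def image_comp[symmetric] by (rule order_trans[OF image_mono[OF pd[OF that]] pi[OF that]])
  have LV: "perm_restrict L (dset V) = inv (perm_restrict \<pi> (dset V)) \<circ> dbl V (perm_restrict \<tau> V)"
    if "V \<in> U'" for V
    unfolding L_def perm_restrict_comp_subset[OF pd[OF that]] dbl_restrict[OF sub(1)[OF that]]
    using perm_restrict_inv[OF _ \<pi> p\<pi>[OF that]] sub(2)[OF that] by simp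
  have pdU: "partition_on (dset S) (dset ` U')" by (rule partition_on_dset[OF U'])
  have grL: "gr (dset S) L \<subseteq> prel (dset ` U')"
    using gr_subset_prel_iff[OF pdU] pL by blast
  have cV: "((x, b), (y, c)) \<in> conn (gr (dset S) L) \<longleftrightarrow> ((x, b), (y, c)) \<in> conn (gr (dset V) (perm_restrict L (dset V)))"
    if "V \<in> U'" "x \<in> V" for V x y b c
  proof -
    have "conn (gr (dset S) L) `` {(x, b)} = conn (gr (dset S) L \<inter> dset V \<times> dset V) `` {(x, b)}"
      using that by (intro conn_restrict_image[OF pdU grL]) auto
    also have "gr (dset S) L \<inter> dset V \<times> dset V = gr (dset V) (perm_restrict L (dset V))"
      using sub(1)[OF that(1)] pL[OF that(1)] by (intro gr_restrict) auto
    finally show ?thesis by blast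
  qed
  show ?thesis
    unfolding L_def[symmetric]
  proof safe
    fix V assume "sep S L" and V: "V \<in> U'"
    then show "sep V (inv (perm_restrict \<pi> (dset V)) \<circ> dbl V (perm_restrict \<tau> V))"
      using cV[OF V] sub(1)[OF V] unfolding sep_def LV[OF V, symmetric] by blast
  next
    assume *: "\<forall>V\<in>U'. sep V (inv (perm_restrict \<pi> (dset V)) \<circ> dbl V (perm_restrict \<tau> V))"
    show "sep S L" unfolding sep_def
    proof (intro ballI impI)
      fix x y assume xy: "x \<in> S" "y \<in> S" "((x, True), (y, True)) \<in> conn (gr (dset S) L)"
      obtain V where V: "V \<in> U'" "x \<in> V" using xy(1) partition_onD1[OF U'] by blast
      have c: "((x, True), (y, True)) \<in> conn (gr (dset V) (perm_restrict L (dset V)))"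
        using cV[OF V] xy(3) by blast
      have "y \<in> V"
      proof -
        have "gr (dset V) (perm_restrict L (dset V)) \<subseteq> dset V \<times> dset V"
          using pL[OF V(1)] unfolding gr_def perm_restrict_def by auto
        from conn_closed[OF this c] show ?thesis using V by simp
      qed
      moreover have "sep V (perm_restrict L (dset V))" using * V(1) LV[OF V(1)] by simp
      ultimately show "x = y" using V(2) c unfolding sep_def by blast
    qed
  qed
qed

text \<open>The family given to \<open>glue\<close> is indexed by doubled blocks, so the block
  itself is recovered by projecting with \<open>fst\<close>.\<close>

definition pieces :: "'a set \<Rightarrow> 'a set set \<Rightarrow> ('a \<Rightarrow> 'a) \<Rightarrow> (('a \<times> bool) set set \<times> ('a \<times> bool \<Rightarrow> 'a \<times> bool)) set" where
  "pieces S U' \<tau> = glue (dset S) (dset ` U') (\<lambda>V. PSsep (fst ` V) (perm_restrict \<tau> (fst ` V)))"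

lemma pieces_iff:
  "(U, \<pi>) \<in> pieces S U' \<tau> \<longleftrightarrow> \<pi> permutes dset S \<and> partition_on (dset S) U \<and>
     (\<forall>V\<in>U'. \<pi> ` dset V \<subseteq> dset V) \<and> (\<forall>W\<in>U. \<exists>V\<in>U'. W \<subseteq> dset V) \<and>
     (\<forall>V\<in>U'. ({W \<in> U. W \<subseteq> dset V}, perm_restrict \<pi> (dset V)) \<in> PSsep V (perm_restrict \<tau> V))"
  unfolding pieces_def glue_def by simp

text \<open>Turns the local conditions into the global hypotheses of \<open>PS_double_iff\<close>.
  The second and third facts also show that \<tau> and U' can be recovered from (U, \<pi>).\<close>

lemma pieces_facts:
  assumes fin: "finite S" and \<tau>: "\<tau> permutes S" and U': "partition_on S U'" and le: "gr S \<tau> \<subseteq> prel U'"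
    and mem: "(U, \<pi>) \<in> pieces S U' \<tau>"
  shows "gr (dset S) \<pi> \<subseteq> prel U" and "sep S (inv \<pi> \<circ> dbl S \<tau>)"
    and "U' = comps S (proj (prel U \<union> gr (dset S) (dbl S \<tau>)))"
    and "\<forall>V\<in>dset ` U'. ({W \<in> U. W \<subseteq> V}, perm_restrict \<pi> V) \<in> PS V (perm_restrict (dbl S \<tau>) V)"
proof -
  have m: "\<pi> permutes dset S" "partition_on (dset S) U" "\<And>V. V \<in> U' \<Longrightarrow> \<pi> ` dset V \<subseteq> dset V"
    "\<And>W. W \<in> U \<Longrightarrow> \<exists>V\<in>dset ` U'. W \<subseteq> V"
    "\<And>V. V \<in> U' \<Longrightarrow> ({W \<in> U. W \<subseteq> dset V}, perm_restrict \<pi> (dset V)) \<in> PSsep V (perm_restrict \<tau> V)"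
    using mem unfolding pieces_iff by auto
  have sub: "V \<subseteq> S" if "V \<in> U'" for V using that partition_onD1[OF U'] by blast
  have p\<tau>: "\<tau> ` V \<subseteq> V" if "V \<in> U'" for V using le that gr_subset_prel_iff[OF U'] by blast
  have pd: "dbl S \<tau> ` dset V \<subseteq> dset V" if "V \<in> U'" for V
    using p\<tau>[OF that] sub[OF that] by (auto simp: dbl_def split: if_splits)
  show sep: "sep S (inv \<pi> \<circ> dbl S \<tau>)"
  proof -
    have "\<forall>V\<in>U'. sep V (inv (perm_restrict \<pi> (dset V)) \<circ> dbl V (perm_restrict \<tau> V))"
      using m(5) unfolding PSsep_def by blast
    then show ?thesis using sep_local[OF fin U' m(1) \<tau> m(3) p\<tau>] by blast
  qed
  have loc: "({W \<in> U. W \<subseteq> dset V}, perm_restrict \<pi> (dset V)) \<in> PS (dset V) (perm_restrict (dbl S \<tau>) (dset V))"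
    if "V \<in> U'" for V
    using m(5)[OF that] dbl_restrict[OF sub[OF that], of \<tau>] by (auto simp: PSsep_def)
  then show "\<forall>V\<in>dset ` U'. ({W \<in> U. W \<subseteq> V}, perm_restrict \<pi> V) \<in> PS V (perm_restrict (dbl S \<tau>) V)"
    by blast
  show grU: "gr (dset S) \<pi> \<subseteq> prel U"
  proof clarify
    fix x b z assume "((x, b), z) \<in> gr (dset S) \<pi>"
    then have z: "x \<in> S" "z = \<pi> (x, b)" by auto
    then obtain V where V: "V \<in> U'" "x \<in> V" using partition_onD1[OF U'] by blast
    have "gr (dset V) (perm_restrict \<pi> (dset V)) \<subseteq> prel {W \<in> U. W \<subseteq> dset V}"
      using loc[OF V(1)] by (simp add: PS_def)
    moreover have "((x, b), z) \<in> gr (dset V) (perm_restrict \<pi> (dset V))"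
      using V z by (simp add: perm_restrict_def)
    ultimately have "((x, b), z) \<in> prel {W \<in> U. W \<subseteq> dset V}" by (rule subsetD)
    then show "((x, b), z) \<in> prel U" unfolding prel_def by blast
  qed
  let ?R = "prel U \<union> gr (dset S) (dbl S \<tau>)"
  have pdU: "partition_on (dset S) (dset ` U')" by (rule partition_on_dset[OF U'])
  have R: "?R \<subseteq> prel (dset ` U')"
  proof -
    have "gr (dset S) (dbl S \<tau>) \<subseteq> prel (dset ` U')" using gr_subset_prel_iff[OF pdU] pd by blast
    moreover have "prel U \<subseteq> prel (dset ` U')"
    proof clarify
      fix u v u' v' assume "((u, v), (u', v')) \<in> prel U"
      then obtain W where "W \<in> U" "(u, v) \<in> W" "(u', v') \<in> W" by (auto simp: prel_def)
      moreover from this obtain V where "V \<in> dset ` U'" "W \<subseteq> V" using m(4) by meson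
      ultimately show "((u, v), (u', v')) \<in> prel (dset ` U')" unfolding prel_def by blast
    qed
    ultimately show ?thesis by simp
  qed
  have "comps (dset S) ?R = (\<Union>V\<in>dset ` U'. comps V (?R \<inter> V \<times> V))" by (rule comps_UN[OF pdU R])
  also have "\<dots> = (\<Union>V\<in>U'. {dset V})"
    unfolding image_image UN_simps(10)
  proof (intro SUP_cong refl)
    fix V assume V: "V \<in> U'"
    have "?R \<inter> dset V \<times> dset V = prel {W \<in> U. W \<subseteq> dset V} \<union> gr (dset V) (perm_restrict (dbl S \<tau>) (dset V))"
      using V by (intro restrict_prel_gr[OF m(2) pdU m(4)] pd) auto
    then show "comps (dset V) (?R \<inter> dset V \<times> dset V) = {dset V}" using loc[OF V] by (simp add: PS_def)
  qed
  finally have c: "comps (dset S) ?R = dset ` U'" by auto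
  have "?R \<subseteq> dset S \<times> dset S"
    using prel_subset[OF m(2)] gr_subset[OF dbl_permutes[OF fin \<tau>]] by auto
  moreover have "vert S \<subseteq> conn ?R" using vert_subset_gr by (fast intro: conn_incl)
  ultimately have "comps (dset S) ?R = dset ` comps S (proj ?R)" by (rule comps_dset)
  then show "U' = comps S (proj ?R)" using c inj_image_eq_iff[OF inj_dset] by metis
qed

lemma pieces_in_PS:
  assumes "finite S" "\<gamma> permutes S" "(U', \<tau>) \<in> PS S \<gamma>" "(U, \<pi>) \<in> pieces S U' \<tau>"
  shows "(U, \<pi>) \<in> PS (dset S) (dbl S \<gamma>)"
proof -
  have "\<tau> permutes S" "partition_on S U'" "gr S \<tau> \<subseteq> prel U'" using assms(3) by (auto simp: PS_def)
  note f = pieces_facts[OF assms(1) this assms(4)]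
  have "\<pi> permutes dset S" "partition_on (dset S) U" using assms(4) unfolding pieces_iff by auto
  then show ?thesis
    using PS_double_iff[OF assms(1,2) \<open>\<tau> permutes S\<close> _ _ f(1-3)] f(4) assms(3) by blast
qed

text \<open>\<tau> comes from \<open>skeleton_exists\<close> and U' from the components of U
  together with the doubled \<tau>; \<open>PS_double_iff\<close> splits the geodesic condition, and
  \<open>sep_local\<close> the separation.\<close>

lemma PS_in_pieces:
  assumes fin: "finite S" and \<gamma>: "\<gamma> permutes S" and mem: "(U, \<pi>) \<in> PS (dset S) (dbl S \<gamma>)"
  shows "\<exists>U' \<tau>. (U', \<tau>) \<in> PS S \<gamma> \<and> (U, \<pi>) \<in> pieces S U' \<tau>"
proof -
  have \<pi>: "\<pi> permutes dset S" and U: "partition_on (dset S) U" and le: "gr (dset S) \<pi> \<subseteq> prel U"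
    using mem by (auto simp: PS_def)
  obtain \<tau> where \<tau>: "\<tau> permutes S" "sep S (inv \<pi> \<circ> dbl S \<tau>)" using skeleton_exists[OF fin \<pi>] .
  let ?R = "prel U \<union> gr (dset S) (dbl S \<tau>)"
  define U' where "U' = comps S (proj ?R)"
  have P: "(U', \<tau>) \<in> PS S \<gamma>"
    "\<forall>V\<in>dset ` U'. ({W \<in> U. W \<subseteq> V}, perm_restrict \<pi> V) \<in> PS V (perm_restrict (dbl S \<tau>) V)"
    using PS_double_iff[OF fin \<gamma> \<tau>(1) \<pi> U le \<tau>(2) U'_def] mem by auto
  have pU': "partition_on S U'" "gr S \<tau> \<subseteq> prel U'" using P(1) by (auto simp: PS_def)
  have R: "?R \<subseteq> dset S \<times> dset S"
    using prel_subset[OF U] gr_subset[OF dbl_permutes[OF fin \<tau>(1)]] by auto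
  have "vert S \<subseteq> conn ?R" using vert_subset_gr by (fast intro: conn_incl)
  then have c: "comps (dset S) ?R = dset ` U'" unfolding U'_def by (rule comps_dset[OF R])
  have ref: "\<exists>V\<in>U'. W \<subseteq> dset V" if "W \<in> U" for W
  proof -
    have "prel U \<subseteq> conn ?R" by (auto intro: conn_incl)
    from comps_refines[OF U this R that] show ?thesis unfolding c by blast
  qed
  have sub: "V \<subseteq> S" if "V \<in> U'" for V using that partition_onD1[OF pU'(1)] by blast
  have p\<tau>: "\<tau> ` V \<subseteq> V" if "V \<in> U'" for V using pU' that gr_subset_prel_iff[OF pU'(1)] by blast
  have p\<pi>: "\<pi> ` dset V \<subseteq> dset V" if V: "V \<in> U'" for V
  proof (rule image_subsetI)
    fix z assume z: "z \<in> dset V"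
    have "z \<in> dset S" using sub[OF V] z by auto
    then have "(z, \<pi> z) \<in> prel U" using le by auto
    then obtain W where W: "W \<in> U" "z \<in> W" "\<pi> z \<in> W" by (auto simp: prel_def)
    then obtain V' where V': "V' \<in> U'" "W \<subseteq> dset V'" using ref by blast
    then have "V' = V" using W z V partition_on_unique[OF pU'(1), of V' V "fst z"] by auto
    then show "\<pi> z \<in> dset V" using V' W by blast
  qed
  have "sep V (inv (perm_restrict \<pi> (dset V)) \<circ> dbl V (perm_restrict \<tau> V))" if "V \<in> U'" for V
    using sep_local[OF fin pU'(1) \<pi> \<tau>(1) p\<pi> p\<tau>] \<tau>(2) that by blast
  then have "(U, \<pi>) \<in> pieces S U' \<tau>"
    unfolding pieces_iff using \<pi> U ref p\<pi> P(2) dbl_restrict[OF sub, of _ \<tau>] by (auto simp: PSsep_def)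
  then show ?thesis using P(1) by blast
qed

text \<open>Separation determines \<tau> and connectedness determines U', so the sets
  \<open>pieces\<close> over different pairs are disjoint.\<close>

lemma pieces_unique:
  assumes "finite S" "(U', \<tau>) \<in> PS S \<gamma>" "(U'', \<tau>') \<in> PS S \<gamma>"
    "(U, \<pi>) \<in> pieces S U' \<tau>" "(U, \<pi>) \<in> pieces S U'' \<tau>'"
  shows "U' = U''" "\<tau> = \<tau>'"
proof -
  have 1: "\<tau> permutes S" "partition_on S U'" "gr S \<tau> \<subseteq> prel U'" using assms(2) by (auto simp: PS_def)
  have 2: "\<tau>' permutes S" "partition_on S U''" "gr S \<tau>' \<subseteq> prel U''" using assms(3) by (auto simp: PS_def)
  have "\<pi> permutes dset S" using assms(4) unfolding pieces_iff by auto
  then show "\<tau> = \<tau>'"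
    using pieces_facts(2)[OF assms(1) 1 assms(4)] pieces_facts(2)[OF assms(1) 2 assms(5)] 1(1) 2(1) assms(1)
    by (intro skeleton_unique)
  then show "U' = U''"
    using pieces_facts(3)[OF assms(1) 1 assms(4)] pieces_facts(3)[OF assms(1) 2 assms(5)] by simp
qed

theorem PS_double_sum:
  fixes w :: "('a \<times> bool) set \<Rightarrow> ('a \<times> bool \<Rightarrow> 'a \<times> bool) \<Rightarrow> 'b::comm_semiring_1"
  assumes fin: "finite S" and \<gamma>: "\<gamma> permutes S"
  shows "(\<Sum>(U, \<pi>)\<in>PS (dset S) (dbl S \<gamma>). \<Prod>W\<in>U. w W (perm_restrict \<pi> W)) =
    (\<Sum>(U', \<tau>)\<in>PS S \<gamma>. \<Prod>V\<in>U'. \<Sum>(U, \<pi>)\<in>PSsep V (perm_restrict \<tau> V). \<Prod>W\<in>U. w W (perm_restrict \<pi> W))"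
proof -
  let ?f = "\<lambda>(U, \<pi>). \<Prod>W\<in>U. w W (perm_restrict \<pi> W)"
  have eq: "PS (dset S) (dbl S \<gamma>) = (\<Union>(U', \<tau>)\<in>PS S \<gamma>. pieces S U' \<tau>)"
    using PS_in_pieces[OF fin \<gamma>] pieces_in_PS[OF fin \<gamma>] by fast
  have "sum ?f (PS (dset S) (dbl S \<gamma>)) = (\<Sum>p\<in>PS S \<gamma>. sum ?f (case p of (U', \<tau>) \<Rightarrow> pieces S U' \<tau>))"
    unfolding eq
  proof (rule sum.UNION_disjoint)
    show "finite (PS S \<gamma>)" using fin by simp
    have "finite (PS (dset S) (dbl S \<gamma>))" using fin by simp
    then show "\<forall>p\<in>PS S \<gamma>. finite (case p of (U', \<tau>) \<Rightarrow> pieces S U' \<tau>)"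
      using eq by (auto intro: rev_finite_subset)
    show "\<forall>p\<in>PS S \<gamma>. \<forall>q\<in>PS S \<gamma>. p \<noteq> q \<longrightarrow>
      (case p of (U', \<tau>) \<Rightarrow> pieces S U' \<tau>) \<inter> (case q of (U', \<tau>) \<Rightarrow> pieces S U' \<tau>) = {}"
      using pieces_unique[OF fin, where \<gamma> = \<gamma>] by fastforce
  qed
  also have "\<dots> = (\<Sum>(U', \<tau>)\<in>PS S \<gamma>. \<Prod>V\<in>U'. sum ?f (PSsep V (perm_restrict \<tau> V)))"
  proof (intro sum.cong refl, clarify)
    fix U' \<tau> assume "(U', \<tau>) \<in> PS S \<gamma>"
    then have U': "partition_on S U'" by (simp add: PS_def)
    have finV: "finite V" if "V \<in> U'" for V
      using that partition_onD1[OF U'] fin by (meson Union_upper finite_subset)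
    have "sum ?f (pieces S U' \<tau>) = (\<Prod>V\<in>dset ` U'. sum ?f (PSsep (fst ` V) (perm_restrict \<tau> (fst ` V))))"
      unfolding pieces_def
    proof (rule glue_sum)
      show "partition_on (dset S) (dset ` U')" by (rule partition_on_dset[OF U'])
      show "finite (PSsep (fst ` V) (perm_restrict \<tau> (fst ` V)))" if "V \<in> dset ` U'" for V
        using that finV by auto
      show "\<pi> permutes V \<and> partition_on V U"
        if "V \<in> dset ` U'" "(U, \<pi>) \<in> PSsep (fst ` V) (perm_restrict \<tau> (fst ` V))" for V U \<pi>
        using that by (auto simp: PSsep_def PS_def)
    qed (use fin in simp)
    also have "\<dots> = (\<Prod>V\<in>U'. sum ?f (PSsep V (perm_restrict \<tau> V)))"
      by (subst prod.reindex[OF inj_on_subset[OF inj_dset]]) auto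
    finally show "sum ?f (pieces S U' \<tau>) = (\<Prod>V\<in>U'. sum ?f (PSsep V (perm_restrict \<tau> V)))" .
  qed
  finally show ?thesis .
qed

section \<open>One and two cycles: discs and annuli\<close>

text \<open>Submodularity of the graphic rank |S| minus the number of components: an edge that
  merges two components of the larger relation also merges two components of the smaller
  one.\<close>

lemma card_comps_supermodular:
  assumes "finite S" "s \<subseteq> S \<times> S"
  shows "card (comps S (r \<union> q)) + card (comps S (r \<union> s)) \<le> card (comps S (r \<union> q \<union> s)) + card (comps S r)"
proof -
  have "finite s" using assms finite_subset by blast
  then show ?thesis using assms(2)
  proof (induction rule: finite_induct)
    case empty
    then show ?case by simp
  next
    case (insert e s)
    obtain i j where e: "e = (i, j)" by (cases e)
    have ij: "i \<in> S" "j \<in> S" using insert.prems e by auto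
    have IH: "card (comps S (r \<union> q)) + card (comps S (r \<union> s)) \<le> card (comps S (r \<union> q \<union> s)) + card (comps S r)"
      using insert by auto
    have eqs: "r \<union> insert e s = insert (i, j) (r \<union> s)" "r \<union> q \<union> insert e s = insert (i, j) (r \<union> q \<union> s)"
      using e by auto
    show ?case
    proof (cases "(i, j) \<in> conn (r \<union> q \<union> s)")
      case True
      have "card (comps S (insert (i, j) (r \<union> s))) \<le> card (comps S (r \<union> s))"
        using assms(1) by (intro card_comps_le conn_mono) auto
      then show ?thesis using IH unfolding eqs comps_cong[OF conn_insert_redundant[OF True]] by linarith
    next
      case False
      then have "(i, j) \<notin> conn (r \<union> s)" using conn_mono[of "r \<union> s" "r \<union> q \<union> s"] by auto
      then have "Suc (card (comps S (insert (i, j) (r \<union> s)))) = card (comps S (r \<union> s))"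
        using assms(1) ij by (intro card_comps_insert)
      moreover have "Suc (card (comps S (insert (i, j) (r \<union> q \<union> s)))) = card (comps S (r \<union> q \<union> s))"
        using assms(1) ij False by (intro card_comps_insert)
      ultimately show ?thesis using IH unfolding eqs by linarith
    qed
  qed
qed

lemma gr_subset_prel_cyc:
  assumes "\<pi> permutes S" shows "gr S \<pi> \<subseteq> prel (cyc S \<pi>)"
proof clarify
  fix x y assume "(x, y) \<in> gr S \<pi>"
  then have "x \<in> S" "(x, y) \<in> conn (gr S \<pi>)" by (auto intro: conn_incl)
  then show "(x, y) \<in> prel (cyc S \<pi>)"
    using conn_refl[of x "gr S \<pi>"] unfolding cyc_def by (unfold prel_def comps_image, blast)
qed

lemma conn_prel_cyc: "\<pi> permutes S \<Longrightarrow> conn (prel (cyc S \<pi>)) = conn (gr S \<pi>)"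
  unfolding cyc_def by (intro conn_prel_comps gr_subset)

lemma conn_Un_cong:
  assumes "conn r = conn r'" shows "conn (r \<union> s) = conn (r' \<union> s)"
proof -
  have 1: "conn (r \<union> s) \<subseteq> conn (r' \<union> s)" if "conn r = conn r'" for r r' :: "('a \<times> 'a) set"
  proof (rule conn_least)
    have "r \<subseteq> conn r'" using that by (auto intro: conn_incl)
    then show "r \<union> s \<subseteq> conn (r' \<union> s)"
      using conn_mono[of r' "r' \<union> s"] by (auto intro: conn_incl)
  qed
  show ?thesis using 1[OF assms] 1[OF assms[symmetric]] by (rule equalityI)
qed

lemma genus_inequality_perm:
  assumes "finite S" "\<pi> permutes S" "\<gamma> permutes S"
  shows "card (cyc S \<pi>) + card (cyc S (inv \<pi> \<circ> \<gamma>)) + card (cyc S \<gamma>) \<le>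
    card S + 2 * card (comps S (gr S \<pi> \<union> gr S \<gamma>))"
proof -
  have "comps S (prel (cyc S \<pi>) \<union> gr S \<gamma>) = comps S (gr S \<pi> \<union> gr S \<gamma>)"
    by (rule comps_cong[OF conn_Un_cong[OF conn_prel_cyc[OF assms(2)]]])
  then show ?thesis
    using genus_inequality_inv[OF assms(1) partition_on_cyc[OF assms(2)] assms(2)
        gr_subset_prel_cyc[OF assms(2)] assms(3)] by simp
qed

text \<open>Twice the supermodular inequality for \<pi>, \<gamma> and U plus the genus inequality
  for the permutation \<pi> alone is the inequality whose equality defines \<open>PS\<close>; hence
  both are equalities.\<close>

lemma PS_equalities:
  assumes fin: "finite S" and \<gamma>: "\<gamma> permutes S" and mem: "(U, \<pi>) \<in> PS S \<gamma>"
  shows "card (comps S (gr S \<pi> \<union> gr S \<gamma>)) + card U = 1 + card (cyc S \<pi>)"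
    and "card (cyc S \<pi>) + card (cyc S (inv \<pi> \<circ> \<gamma>)) + card (cyc S \<gamma>) =
      card S + 2 * card (comps S (gr S \<pi> \<union> gr S \<gamma>))"
proof -
  have \<pi>: "\<pi> permutes S" and U: "partition_on S U" and le: "gr S \<pi> \<subseteq> prel U"
    and con: "comps S (prel U \<union> gr S \<gamma>) = {S}"
    and eq: "2 * card U + card (cyc S (inv \<pi> \<circ> \<gamma>)) + card (cyc S \<gamma>) = card S + 2 + card (cyc S \<pi>)"
    using mem by (auto simp: PS_def)
  have "gr S \<pi> \<union> prel U = prel U" "gr S \<pi> \<union> gr S \<gamma> \<union> prel U = prel U \<union> gr S \<gamma>" using le by auto
  then have "card (comps S (gr S \<pi> \<union> gr S \<gamma>)) + card U \<le> 1 + card (cyc S \<pi>)"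
    using card_comps_supermodular[OF fin prel_subset[OF U], of "gr S \<pi>" "gr S \<gamma>"] con comps_prel[OF U]
    by (simp add: cyc_def)
  moreover note genus_inequality_perm[OF fin \<pi> \<gamma>]
  ultimately show "card (comps S (gr S \<pi> \<union> gr S \<gamma>)) + card U = 1 + card (cyc S \<pi>)"
    and "card (cyc S \<pi>) + card (cyc S (inv \<pi> \<circ> \<gamma>)) + card (cyc S \<gamma>) =
      card S + 2 * card (comps S (gr S \<pi> \<union> gr S \<gamma>))"
    using eq by linarith+
qed

text \<open>Sending a block of P to the block of U around it is a map onto U, and the cardinality
  makes it injective; so each block of U contains one block of P and equals it.\<close>

lemma refining_card_imp_eq:
  assumes fin: "finite S" and P: "partition_on S P" and U: "partition_on S U"
    and ref: "\<And>V. V \<in> P \<Longrightarrow> \<exists>W\<in>U. V \<subseteq> W" and card: "card P \<le> card U"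
  shows "P = U"
proof -
  have finP: "finite P" and finU: "finite U" using finite_elements[OF fin] P U by auto
  obtain f where f: "\<And>V. V \<in> P \<Longrightarrow> f V \<in> U \<and> V \<subseteq> f V" using ref by metis
  have sur: "\<exists>V\<in>P. x \<in> V \<and> f V = W" if "W \<in> U" "x \<in> W" for W x
  proof -
    have "x \<in> S" using that partition_onD1[OF U] by blast
    then obtain V where V: "V \<in> P" "x \<in> V" using partition_onD1[OF P] by blast
    then have "x \<in> f V" "f V \<in> U" using f by blast+
    then show ?thesis using V that partition_on_unique[OF U] by blast
  qed
  have ne: "\<exists>x. x \<in> W" if "W \<in> U" for W using that partition_onD3[OF U] by (metis ex_in_conv)
  have "U \<subseteq> f ` P" using sur ne by blast
  then have img: "f ` P = U" using f by blast
  then have inj: "inj_on f P" using card finP by (metis card_image_le eq_card_imp_inj_on le_antisym)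
  have "U \<subseteq> P"
  proof
    fix W assume W: "W \<in> U"
    then obtain x V where V: "V \<in> P" "x \<in> V" "f V = W" using ne sur by blast
    have "W \<subseteq> V"
    proof
      fix y assume "y \<in> W"
      then obtain V' where "V' \<in> P" "y \<in> V'" "f V' = W" using W sur by blast
      then show "y \<in> V" using inj V by (metis inj_onD)
    qed
    then have "V = W" using f V by blast
    then show "W \<in> P" using V by simp
  qed
  then show ?thesis using card_seteq[OF finP] card by blast
qed

lemma partition_on_merge:
  assumes P: "partition_on S P" and A: "A \<in> P" and B: "B \<in> P"
  shows "partition_on S (insert (A \<union> B) (P - {A, B}))"
proof (rule partition_onI)
  show "\<Union> (insert (A \<union> B) (P - {A, B})) = S" using partition_onD1[OF P] A B by blast
  show "{} \<notin> insert (A \<union> B) (P - {A, B})" using partition_onD3[OF P] A by auto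
  have "disjnt (A \<union> B) q" if "q \<in> P - {A, B}" for q
    using that partition_on_unique[OF P] A B unfolding disjnt_def by blast
  moreover have "disjnt p q" if "p \<in> P" "q \<in> P" "p \<noteq> q" for p q
    using that partition_on_unique[OF P] unfolding disjnt_def by blast
  ultimately show "disjnt p q"
    if "p \<in> insert (A \<union> B) (P - {A, B})" "q \<in> insert (A \<union> B) (P - {A, B})" "p \<noteq> q" for p q
    using that disjnt_sym by (metis Diff_iff insert_iff)
qed

lemma Un_notin_partition:
  assumes "partition_on S P" "A \<in> P" "B \<in> P" "A \<noteq> B"
  shows "A \<union> B \<notin> P"
proof
  assume AB: "A \<union> B \<in> P"
  obtain x y where "x \<in> A" "y \<in> B" using assms partition_onD3 by (metis ex_in_conv)
  then have "A \<union> B = A" "A \<union> B = B" using partition_on_unique[OF assms(1) AB] assms by blast+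
  then show False using assms by blast
qed

lemma card_merge:
  assumes "finite S" "partition_on S P" "A \<in> P" "B \<in> P" "A \<noteq> B"
  shows "Suc (card (insert (A \<union> B) (P - {A, B}))) = card P"
proof -
  have fin: "finite P" using finite_elements[OF assms(1,2)] .
  have "A \<union> B \<notin> P - {A, B}" using Un_notin_partition[OF assms(2-5)] by blast
  moreover have "card (P - {A, B}) = card P - 2" using assms(3-5) fin by (subst card_Diff_subset) auto
  moreover have "card {A, B} \<le> card P" using assms(3,4) fin by (intro card_mono) auto
  ultimately show ?thesis using fin assms(5) by simp
qed

text \<open>By counting, two blocks A and B of P lie in the same block of U. Merging them gives a
  partition that still refines U and has as many blocks.\<close>

lemma refining_card_imp_merge:
  assumes fin: "finite S" and P: "partition_on S P" and U: "partition_on S U"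
    and ref: "\<And>V. V \<in> P \<Longrightarrow> \<exists>W\<in>U. V \<subseteq> W" and card: "card P = Suc (card U)"
  obtains A B where "A \<in> P" "B \<in> P" "A \<noteq> B" "U = insert (A \<union> B) (P - {A, B})"
proof -
  obtain f where f: "\<And>V. V \<in> P \<Longrightarrow> f V \<in> U \<and> V \<subseteq> f V" using ref by metis
  have "\<not> inj_on f P"
    using card_inj_on_le[of f P U] f finite_elements[OF fin U] card by fastforce
  then obtain A B where AB: "A \<in> P" "B \<in> P" "A \<noteq> B" "f A = f B" by (auto simp: inj_on_def)
  have "insert (A \<union> B) (P - {A, B}) = U"
  proof (rule refining_card_imp_eq[OF fin partition_on_merge[OF P AB(1,2)] U])
    have "A \<union> B \<subseteq> f A" using f AB by (metis Un_least)
    then show "\<exists>W\<in>U. V \<subseteq> W" if "V \<in> insert (A \<union> B) (P - {A, B})" for V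
      using that f AB ref by blast
    show "card (insert (A \<union> B) (P - {A, B})) \<le> card U"
      using card_merge[OF fin P AB(1-3)] card by simp
  qed
  then show ?thesis using that AB by blast
qed

section \<open>The planar pairs over one cycle and over two cycles\<close>

lemma cyc_refines:
  assumes "\<pi> permutes S" "partition_on S U" "gr S \<pi> \<subseteq> prel U" "V \<in> cyc S \<pi>"
  shows "\<exists>W\<in>U. V \<subseteq> W"
proof -
  obtain x where x: "x \<in> S" "V = conn (gr S \<pi>) `` {x}" using assms(4) by (auto simp: cyc_def comps_iff)
  then obtain W where W: "W \<in> U" "x \<in> W" using partition_onD1[OF assms(2)] by blast
  have "V \<subseteq> conn (prel U) `` {x}" using conn_mono[OF assms(3)] x by blast
  then show ?thesis using conn_prel[OF assms(2) W] W by blast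
qed

text \<open>For a single cycle \<gamma> these are the permutations on a geodesic from the identity
  to \<gamma>; for \<open>csucc\<close> they turn out to be the non-crossing partitions.\<close>

definition disc :: "'a set \<Rightarrow> ('a \<Rightarrow> 'a) \<Rightarrow> ('a \<Rightarrow> 'a) set" where
  "disc S \<gamma> = {\<pi>. \<pi> permutes S \<and> card (cyc S \<pi>) + card (cyc S (inv \<pi> \<circ> \<gamma>)) = card S + 1}"

definition annulus :: "'a set \<Rightarrow> ('a \<Rightarrow> 'a) \<Rightarrow> ('a \<Rightarrow> 'a) set" where
  "annulus S \<gamma> = {\<pi>. \<pi> permutes S \<and> comps S (gr S \<pi> \<union> gr S \<gamma>) = {S} \<and>
     card (cyc S \<pi>) + card (cyc S (inv \<pi> \<circ> \<gamma>)) = card S}"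

lemma comps_Un_singleton:
  assumes "\<pi> permutes S" "\<gamma> permutes S" "cyc S \<gamma> = {S}"
  shows "comps S (gr S \<pi> \<union> gr S \<gamma>) = {S}"
proof (rule comps_singletonI)
  show "gr S \<pi> \<union> gr S \<gamma> \<subseteq> S \<times> S" using gr_subset assms by blast
  show "S \<noteq> {}" using partition_onD3[OF partition_on_cyc[OF assms(2)]] assms(3) by auto
  show "(x, y) \<in> conn (gr S \<pi> \<union> gr S \<gamma>)" if "x \<in> S" "y \<in> S" for x y
    using comps_singletonD[OF assms(3)[unfolded cyc_def] that] conn_mono[of "gr S \<gamma>" "gr S \<pi> \<union> gr S \<gamma>"] by blast
qed

lemma disc_inequality:
  assumes "finite S" "\<pi> permutes S" "\<gamma> permutes S" "cyc S \<gamma> = {S}"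
  shows "card (cyc S \<pi>) + card (cyc S (inv \<pi> \<circ> \<gamma>)) \<le> card S + 1"
  using genus_inequality_perm[OF assms(1-3)] comps_Un_singleton[OF assms(2-4)] assms(4) by simp

lemma PS_cyc_iff:
  assumes "\<pi> permutes S"
  shows "(cyc S \<pi>, \<pi>) \<in> PS S \<gamma> \<longleftrightarrow> comps S (gr S \<pi> \<union> gr S \<gamma>) = {S} \<and>
    card (cyc S \<pi>) + card (cyc S (inv \<pi> \<circ> \<gamma>)) + card (cyc S \<gamma>) = card S + 2"
  using assms partition_on_cyc[OF assms] gr_subset_prel_cyc[OF assms]
    comps_cong[OF conn_Un_cong[OF conn_prel_cyc[OF assms]], of S "gr S \<gamma>"]
  by (auto simp: PS_def)

text \<open>\<pi> and \<gamma> have a single component here, so the first of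
  \<open>PS_equalities\<close> gives U as many blocks as \<pi> has cycles and no cycles are
  merged.\<close>

lemma PS_one_cycle:
  assumes fin: "finite S" and \<gamma>: "\<gamma> permutes S" and one: "cyc S \<gamma> = {S}"
  shows "PS S \<gamma> = (\<lambda>\<pi>. (cyc S \<pi>, \<pi>)) ` disc S \<gamma>"
proof (intro equalityI subsetI)
  fix p assume p: "p \<in> PS S \<gamma>"
  obtain U \<pi> where U\<pi>: "p = (U, \<pi>)" by (cases p)
  have \<pi>: "\<pi> permutes S" and U: "partition_on S U" "gr S \<pi> \<subseteq> prel U"
    using p by (auto simp: PS_def U\<pi>)
  have c: "card (comps S (gr S \<pi> \<union> gr S \<gamma>)) = 1" using comps_Un_singleton[OF \<pi> \<gamma> one] by simp
  have "cyc S \<pi> = U"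
    using PS_equalities(1)[OF fin \<gamma> p[unfolded U\<pi>]] c
    by (intro refining_card_imp_eq[OF fin partition_on_cyc[OF \<pi>] U(1)] cyc_refines[OF \<pi> U]) auto
  moreover have "\<pi> \<in> disc S \<gamma>"
    using PS_equalities(2)[OF fin \<gamma> p[unfolded U\<pi>]] c one \<pi> by (simp add: disc_def)
  ultimately show "p \<in> (\<lambda>\<pi>. (cyc S \<pi>, \<pi>)) ` disc S \<gamma>" using U\<pi> by blast
next
  fix p assume "p \<in> (\<lambda>\<pi>. (cyc S \<pi>, \<pi>)) ` disc S \<gamma>"
  then obtain \<pi> where "p = (cyc S \<pi>, \<pi>)" "\<pi> \<in> disc S \<gamma>" by blast
  then show "p \<in> PS S \<gamma>"
    using PS_cyc_iff[of \<pi> S \<gamma>] comps_Un_singleton[OF _ \<gamma> one] one by (auto simp: disc_def)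
qed

text \<open>An edge of q joining two classes of r would lower the number of components.\<close>

lemma comps_eq_imp_subset:
  assumes "finite S" "q \<subseteq> S \<times> S" "card (comps S r) \<le> card (comps S (q \<union> r))"
  shows "q \<subseteq> conn r"
proof clarify
  fix i j assume ij: "(i, j) \<in> q"
  show "(i, j) \<in> conn r"
  proof (rule ccontr)
    assume "(i, j) \<notin> conn r"
    then have "Suc (card (comps S (insert (i, j) r))) = card (comps S r)"
      using assms(1,2) ij by (intro card_comps_insert) auto
    moreover have "card (comps S (q \<union> r)) \<le> card (comps S (insert (i, j) r))"
      using assms(1) ij by (intro card_comps_le conn_mono) auto
    ultimately show False using assms(3) by simp
  qed
qed

lemma cyc_restrict_singleton:
  assumes "finite S" "\<gamma> permutes S" "V \<in> cyc S \<gamma>"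
  shows "\<gamma> ` V \<subseteq> V" and "cyc V (perm_restrict \<gamma> V) = {V}"
proof -
  have p: "partition_on S (cyc S \<gamma>)" by (rule partition_on_cyc[OF assms(2)])
  have le: "gr S \<gamma> \<subseteq> prel (cyc S \<gamma>)" by (rule gr_subset_prel_cyc[OF assms(2)])
  then show inv: "\<gamma> ` V \<subseteq> V" using gr_subset_prel_iff[OF p] assms(3) by blast
  have VS: "V \<subseteq> S" using assms(3) partition_onD1[OF p] by blast
  have "conn (gr V (perm_restrict \<gamma> V)) `` {x} = V" if "x \<in> V" for x
  proof -
    have "conn (gr S \<gamma>) `` {x} = V"
      using that assms(3) by (auto simp: cyc_def comps_iff intro: conn_trans conn_sym)
    then show ?thesis
      using conn_restrict_image[OF p le assms(3) that] gr_restrict[OF VS inv] by simp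
  qed
  moreover have "V \<noteq> {}" using assms(3) partition_onD3[OF p] by auto
  ultimately show "cyc V (perm_restrict \<gamma> V) = {V}" by (auto simp: cyc_def comps_image)
qed

text \<open>Counterpart of \<open>S_NC'\<close> that keeps the permutation and not only its cycles,
  for any two sets Z and Y.\<close>

definition split_pairs :: "'a set \<Rightarrow> 'a set \<Rightarrow> ('a \<Rightarrow> 'a) \<Rightarrow> ('a set set \<times> ('a \<Rightarrow> 'a)) set" where
  "split_pairs Z Y \<gamma> = {(U, \<pi>). \<pi> permutes (Z \<union> Y) \<and> \<pi> ` Z \<subseteq> Z \<and> \<pi> ` Y \<subseteq> Y \<and>
     perm_restrict \<pi> Z \<in> disc Z (perm_restrict \<gamma> Z) \<and> perm_restrict \<pi> Y \<in> disc Y (perm_restrict \<gamma> Y) \<and>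
     (\<exists>A\<in>cyc Z (perm_restrict \<pi> Z). \<exists>B\<in>cyc Y (perm_restrict \<pi> Y).
        U = insert (A \<union> B) (cyc (Z \<union> Y) \<pi> - {A, B}))}"

text \<open>\<pi> and \<gamma> have one or two components. With one, U has as many blocks as \<pi>
  has cycles, which is the annular case. With two, U has one block fewer, so exactly two cycles are
  merged, and \<pi> preserves both cycles of \<gamma>.\<close>

lemma PS_two_cycles:
  assumes fin: "finite S" and \<gamma>: "\<gamma> permutes S" and two: "cyc S \<gamma> = {Z, Y}" and ZY: "Z \<noteq> Y"
  shows "PS S \<gamma> = (\<lambda>\<pi>. (cyc S \<pi>, \<pi>)) ` annulus S \<gamma> \<union> split_pairs Z Y \<gamma>"
    and "(\<lambda>\<pi>. (cyc S \<pi>, \<pi>)) ` annulus S \<gamma> \<inter> split_pairs Z Y \<gamma> = {}"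
proof -
  have pZY: "partition_on S {Z, Y}" using partition_on_cyc[OF \<gamma>] two by simp
  have S: "S = Z \<union> Y" using partition_onD1[OF pZY] by simp
  have ne: "Z \<noteq> {}" "Y \<noteq> {}" using partition_onD3[OF pZY] by auto
  have dis: "Z \<inter> Y = {}" using partition_on_unique[OF pZY, of Z Y] ZY by auto
  have finZY: "finite Z" "finite Y" using fin S by auto
  have \<gamma>Z: "\<gamma> ` Z \<subseteq> Z" "cyc Z (perm_restrict \<gamma> Z) = {Z}" and \<gamma>Y: "\<gamma> ` Y \<subseteq> Y" "cyc Y (perm_restrict \<gamma> Y) = {Y}"
    using cyc_restrict_singleton[OF fin \<gamma>] two by auto
  have r\<gamma>: "perm_restrict \<gamma> Z permutes Z" "perm_restrict \<gamma> Y permutes Y"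
    using perm_restrict_permutes[OF _ \<gamma>] finZY \<gamma>Z \<gamma>Y by auto
  have c2: "card (cyc S \<gamma>) = 2" using two ZY by simp
  have grZY: "gr S \<gamma> \<subseteq> prel {Z, Y}" using gr_subset_prel_iff[OF pZY] \<gamma>Z \<gamma>Y by blast
  have sums: "card (cyc S \<pi>) = card (cyc Z (perm_restrict \<pi> Z)) + card (cyc Y (perm_restrict \<pi> Y))"
    "card (cyc S (inv \<pi> \<circ> \<gamma>)) = card (cyc Z (inv (perm_restrict \<pi> Z) \<circ> perm_restrict \<gamma> Z)) +
      card (cyc Y (inv (perm_restrict \<pi> Y) \<circ> perm_restrict \<gamma> Y))"
    "cyc S \<pi> = cyc Z (perm_restrict \<pi> Z) \<union> cyc Y (perm_restrict \<pi> Y)"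
    "perm_restrict \<pi> Z permutes Z" "perm_restrict \<pi> Y permutes Y"
    if \<pi>: "\<pi> permutes S" "\<pi> ` Z \<subseteq> Z" "\<pi> ` Y \<subseteq> Y" for \<pi>
  proof -
    show "card (cyc S \<pi>) = card (cyc Z (perm_restrict \<pi> Z)) + card (cyc Y (perm_restrict \<pi> Y))"
      using card_cyc_sum[OF fin pZY, of \<pi>] \<pi> ZY by auto
    show "cyc S \<pi> = cyc Z (perm_restrict \<pi> Z) \<union> cyc Y (perm_restrict \<pi> Y)"
      using cyc_UN[OF pZY, of \<pi>] \<pi> by auto
    show "perm_restrict \<pi> Z permutes Z" "perm_restrict \<pi> Y permutes Y"
      using perm_restrict_permutes[OF _ \<pi>(1)] finZY \<pi> by auto
    have i: "inv \<pi> ` Z \<subseteq> Z" "inv \<pi> ` Y \<subseteq> Y"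
      using inv_image_subset[OF _ \<pi>(1)] finZY \<pi> by auto
    have "(inv \<pi> \<circ> \<gamma>) ` V \<subseteq> V" if "V \<in> {Z, Y}" for V
    proof -
      have "\<gamma> ` V \<subseteq> V" "inv \<pi> ` V \<subseteq> V" using that i \<gamma>Z(1) \<gamma>Y(1) by (elim insertE; simp)+
      then show ?thesis unfolding image_comp[symmetric] by (meson image_mono order_trans)
    qed
    then have "card (cyc S (inv \<pi> \<circ> \<gamma>)) = (\<Sum>V\<in>{Z, Y}. card (cyc V (perm_restrict (inv \<pi> \<circ> \<gamma>) V)))"
      by (rule card_cyc_sum[OF fin pZY])
    then show "card (cyc S (inv \<pi> \<circ> \<gamma>)) = card (cyc Z (inv (perm_restrict \<pi> Z) \<circ> perm_restrict \<gamma> Z)) +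
      card (cyc Y (inv (perm_restrict \<pi> Y) \<circ> perm_restrict \<gamma> Y))"
      using perm_restrict_comp_subset[OF \<gamma>Z(1), of "inv \<pi>"] perm_restrict_comp_subset[OF \<gamma>Y(1), of "inv \<pi>"]
        perm_restrict_inv[OF finZY(1) \<pi>(1,2)] perm_restrict_inv[OF finZY(2) \<pi>(1,3)] ZY by simp
  qed
  have ann: "(cyc S \<pi>, \<pi>) \<in> PS S \<gamma> \<longleftrightarrow> \<pi> \<in> annulus S \<gamma>" if "\<pi> permutes S" for \<pi>
    using PS_cyc_iff[OF that, of \<gamma>] c2 that by (auto simp: annulus_def)
  have split_in: "(U, \<pi>) \<in> PS S \<gamma> \<and> U \<noteq> cyc S \<pi>" if mem: "(U, \<pi>) \<in> split_pairs Z Y \<gamma>" for U \<pi>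
  proof -
    have \<pi>: "\<pi> permutes S" "\<pi> ` Z \<subseteq> Z" "\<pi> ` Y \<subseteq> Y"
      and d: "perm_restrict \<pi> Z \<in> disc Z (perm_restrict \<gamma> Z)" "perm_restrict \<pi> Y \<in> disc Y (perm_restrict \<gamma> Y)"
      using mem unfolding split_pairs_def S[symmetric] by auto
    obtain A B where AB: "A \<in> cyc Z (perm_restrict \<pi> Z)" "B \<in> cyc Y (perm_restrict \<pi> Y)"
      "U = insert (A \<union> B) (cyc S \<pi> - {A, B})"
      using mem unfolding split_pairs_def S[symmetric] by blast
    note s = sums[OF \<pi>]
    have pA: "partition_on Z (cyc Z (perm_restrict \<pi> Z))" "partition_on Y (cyc Y (perm_restrict \<pi> Y))"
      using partition_on_cyc s by auto
    have sub: "A \<subseteq> Z" "B \<subseteq> Y" "A \<noteq> {}" "B \<noteq> {}"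
      using AB partition_onD1[OF pA(1)] partition_onD1[OF pA(2)] partition_onD3[OF pA(1)] partition_onD3[OF pA(2)] by blast+
    have AB': "A \<in> cyc S \<pi>" "B \<in> cyc S \<pi>" "A \<noteq> B" using AB s(3) sub dis by auto
    have U: "partition_on S U" unfolding AB(3) by (rule partition_on_merge[OF partition_on_cyc[OF \<pi>(1)] AB'(1,2)])
    have cU: "Suc (card U) = card (cyc S \<pi>)"
      unfolding AB(3) by (rule card_merge[OF fin partition_on_cyc[OF \<pi>(1)] AB'])
    have le: "gr S \<pi> \<subseteq> prel U"
    proof -
      have "prel (cyc S \<pi>) \<subseteq> prel U" unfolding AB(3) prel_def by blast
      then show ?thesis using gr_subset_prel_cyc[OF \<pi>(1)] by blast
    qed
    have "comps S (prel U \<union> gr S \<gamma>) = {S}"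
    proof (rule comps_singletonI)
      show "prel U \<union> gr S \<gamma> \<subseteq> S \<times> S" using prel_subset[OF U] gr_subset[OF \<gamma>] by blast
      show "S \<noteq> {}" using S ne by blast
      obtain a b where ab: "a \<in> A" "b \<in> B" using sub by blast
      have "(a, b) \<in> prel U" using ab unfolding AB(3) prel_def by blast
      then have ab': "(a, b) \<in> conn (prel U \<union> gr S \<gamma>)" by (auto intro: conn_incl)
      have gm: "conn (gr S \<gamma>) \<subseteq> conn (prel U \<union> gr S \<gamma>)" by (rule conn_mono) auto
      have V: "(x, y) \<in> conn (gr S \<gamma>)" if "V \<in> {Z, Y}" "x \<in> V" "y \<in> V" for x y V
        using that two[symmetric] by (auto simp: cyc_def comps_iff intro: conn_trans conn_sym)
      have "(a, x) \<in> conn (prel U \<union> gr S \<gamma>)" if "x \<in> S" for x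
      proof (cases "x \<in> Z")
        case True
        then show ?thesis using V[of Z a x] ab sub gm by auto
      next
        case False
        then have "(b, x) \<in> conn (gr S \<gamma>)" using V[of Y b x] ab sub that S by auto
        then show ?thesis using ab' gm by (auto intro: conn_trans)
      qed
      then show "(x, y) \<in> conn (prel U \<union> gr S \<gamma>)" if "x \<in> S" "y \<in> S" for x y
        using that by (blast intro: conn_trans conn_sym)
    qed
    moreover have "card S = card Z + card Y" using S dis finZY by (simp add: card_Un_disjoint)
    ultimately have "(U, \<pi>) \<in> PS S \<gamma>"
      using \<pi>(1) U le cU s(1,2) d c2 by (simp add: PS_def disc_def)
    then show ?thesis using cU by auto
  qed
  have in_split: "(U, \<pi>) \<in> split_pairs Z Y \<gamma>" if mem: "(U, \<pi>) \<in> PS S \<gamma>" and neq: "U \<noteq> cyc S \<pi>" for U \<pi>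
  proof -
    have \<pi>: "\<pi> permutes S" and U: "partition_on S U" and le: "gr S \<pi> \<subseteq> prel U"
      and con: "comps S (prel U \<union> gr S \<gamma>) = {S}"
      using mem by (auto simp: PS_def)
    let ?c = "card (comps S (gr S \<pi> \<union> gr S \<gamma>))"
    note e = PS_equalities[OF fin \<gamma> mem]
    have ref: "\<exists>W\<in>U. V \<subseteq> W" if "V \<in> cyc S \<pi>" for V by (rule cyc_refines[OF \<pi> U le that])
    have "\<not> card (cyc S \<pi>) \<le> card U"
      using refining_card_imp_eq[OF fin partition_on_cyc[OF \<pi>] U ref] neq by blast
    moreover have "?c \<le> card (cyc S \<gamma>)"
      unfolding cyc_def using fin by (intro card_comps_le conn_mono) auto
    ultimately have c: "?c = 2" "card (cyc S \<pi>) = Suc (card U)" using e(1) c2 by auto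
    \<comment> \<open>\<gamma> alone has two components as well, so \<pi> adds no connection between
      its cycles.\<close>
    have "gr S \<pi> \<subseteq> conn (gr S \<gamma>)"
      using c c2 unfolding cyc_def by (intro comps_eq_imp_subset[OF fin gr_subset[OF \<pi>]]) simp
    also have "\<dots> \<subseteq> conn (prel {Z, Y})" by (rule conn_mono[OF grZY])
    finally have "gr S \<pi> \<subseteq> prel {Z, Y}"
    proof -
      assume *: "gr S \<pi> \<subseteq> conn (prel {Z, Y})"
      have "\<pi> ` V \<subseteq> V" if "V \<in> {Z, Y}" for V
      proof clarify
        fix x assume "x \<in> V"
        then have "(x, \<pi> x) \<in> conn (prel {Z, Y})" using * that S by auto
        then show "\<pi> x \<in> V" using conn_prel[OF pZY that \<open>x \<in> V\<close>] by auto
      qed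
      then show ?thesis unfolding gr_subset_prel_iff[OF pZY] by (rule ballI)
    qed
    then have p: "\<pi> ` Z \<subseteq> Z" "\<pi> ` Y \<subseteq> Y" unfolding gr_subset_prel_iff[OF pZY] by simp_all
    note s = sums[OF \<pi> p]
    have pA: "partition_on Z (cyc Z (perm_restrict \<pi> Z))" "partition_on Y (cyc Y (perm_restrict \<pi> Y))"
      using partition_on_cyc s by auto
    have "card S = card Z + card Y" using S dis finZY by (simp add: card_Un_disjoint)
    \<comment> \<open>Both disc inequalities hold and their sum is an equality, so each of them is
      one.\<close>
    then have d: "perm_restrict \<pi> Z \<in> disc Z (perm_restrict \<gamma> Z)" "perm_restrict \<pi> Y \<in> disc Y (perm_restrict \<gamma> Y)"
      using disc_inequality[OF finZY(1) s(4) r\<gamma>(1) \<gamma>Z(2)] disc_inequality[OF finZY(2) s(5) r\<gamma>(2) \<gamma>Y(2)]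
        e(2) c(1) c2 s by (simp_all add: disc_def)
    obtain A B where AB: "A \<in> cyc S \<pi>" "B \<in> cyc S \<pi>" "A \<noteq> B" "U = insert (A \<union> B) (cyc S \<pi> - {A, B})"
      using refining_card_imp_merge[OF fin partition_on_cyc[OF \<pi>] U ref c(2)] by blast
    \<comment> \<open>If A and B lay on the same side V, no block of U and no step of \<gamma> would
      leave V, against connectedness.\<close>
    have inv: False if V: "V \<in> {Z, Y}" "A \<subseteq> V" "B \<subseteq> V" for V
    proof -
      have VW: "W \<subseteq> V \<or> W \<inter> V = {}" if "W \<in> U" for W
      proof (cases "W = A \<union> B")
        case False
        then have "W \<in> cyc S \<pi>" using that AB(4) by blast
        then have "W \<subseteq> Z \<or> W \<subseteq> Y" using s(3) partition_onD1[OF pA(1)] partition_onD1[OF pA(2)] by blast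
        then show ?thesis using V(1) dis by blast
      qed (use V in blast)
      have edge: "(x \<in> V) = (y \<in> V)" if "(x, y) \<in> prel U \<union> gr S \<gamma>" for x y
        using that
      proof
        assume "(x, y) \<in> prel U"
        then show ?thesis using VW unfolding prel_def by blast
      next
        assume "(x, y) \<in> gr S \<gamma>"
        then have "(x, y) \<in> prel {Z, Y}" using grZY by blast
        then show ?thesis using V(1) dis unfolding prel_def by blast
      qed
      obtain z y where zy: "z \<in> Z" "y \<in> Y" using ne by blast
      then have "(z, y) \<in> conn (prel U \<union> gr S \<gamma>)" using comps_singletonD[OF con] S by blast
      from conn_invariant[where f = "\<lambda>x. x \<in> V", OF edge this]
      show False using zy V(1) dis by blast
    qed
    have side: "(V \<in> cyc Z (perm_restrict \<pi> Z) \<and> V \<subseteq> Z) \<or> (V \<in> cyc Y (perm_restrict \<pi> Y) \<and> V \<subseteq> Y)"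
      if "V \<in> cyc S \<pi>" for V
      using that s(3) partition_onD1[OF pA(1)] partition_onD1[OF pA(2)] by blast
    have "\<exists>A\<in>cyc Z (perm_restrict \<pi> Z). \<exists>B\<in>cyc Y (perm_restrict \<pi> Y). U = insert (A \<union> B) (cyc S \<pi> - {A, B})"
    proof (cases "A \<subseteq> Z")
      case True
      then have "A \<in> cyc Z (perm_restrict \<pi> Z)" "B \<in> cyc Y (perm_restrict \<pi> Y)"
        using side[OF AB(1)] side[OF AB(2)] inv[of Z] inv[of Y] by blast+
      then show ?thesis using AB(4) by blast
    next
      case False
      then have "A \<in> cyc Y (perm_restrict \<pi> Y)" "B \<in> cyc Z (perm_restrict \<pi> Z)"
        using side[OF AB(1)] side[OF AB(2)] inv[of Z] inv[of Y] by blast+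
      moreover have "U = insert (B \<union> A) (cyc S \<pi> - {B, A})" using AB(4) by (simp add: Un_commute insert_commute)
      ultimately show ?thesis by blast
    qed
    then show ?thesis unfolding split_pairs_def S[symmetric] using \<pi> p d by blast
  qed
  show "PS S \<gamma> = (\<lambda>\<pi>. (cyc S \<pi>, \<pi>)) ` annulus S \<gamma> \<union> split_pairs Z Y \<gamma>"
  proof (intro equalityI subsetI)
    fix p assume p: "p \<in> PS S \<gamma>"
    obtain U \<pi> where U\<pi>: "p = (U, \<pi>)" by (cases p)
    have "\<pi> permutes S" using p by (simp add: PS_def U\<pi>)
    then show "p \<in> (\<lambda>\<pi>. (cyc S \<pi>, \<pi>)) ` annulus S \<gamma> \<union> split_pairs Z Y \<gamma>"
      using ann in_split p unfolding U\<pi> by (cases "U = cyc S \<pi>") auto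
  next
    fix p assume p: "p \<in> (\<lambda>\<pi>. (cyc S \<pi>, \<pi>)) ` annulus S \<gamma> \<union> split_pairs Z Y \<gamma>"
    then show "p \<in> PS S \<gamma>"
    proof
      assume "p \<in> (\<lambda>\<pi>. (cyc S \<pi>, \<pi>)) ` annulus S \<gamma>"
      then obtain \<pi> where \<pi>: "\<pi> \<in> annulus S \<gamma>" "p = (cyc S \<pi>, \<pi>)" by blast
      then show ?thesis using ann by (auto simp: annulus_def)
    next
      assume "p \<in> split_pairs Z Y \<gamma>"
      then show ?thesis using split_in by (cases p) auto
    qed
  qed
  show "(\<lambda>\<pi>. (cyc S \<pi>, \<pi>)) ` annulus S \<gamma> \<inter> split_pairs Z Y \<gamma> = {}"
    using split_in by blast
qed

section \<open>Non-crossing partitions\<close>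

text \<open>The permutation with the single cycle S in increasing order: the maximum returns to the
  minimum and points outside S are fixed.\<close>

definition csucc :: "nat set \<Rightarrow> nat \<Rightarrow> nat" where
  "csucc S x = (if x \<in> S then (if \<exists>y\<in>S. x < y then Min {y \<in> S. x < y} else Min S) else x)"

lemma csucc_next:
  assumes "finite S" "x \<in> S" "z \<in> S" "x < z" "\<And>y. y \<in> S \<Longrightarrow> x < y \<Longrightarrow> z \<le> y"
  shows "csucc S x = z"
  using assms by (auto simp: csucc_def intro!: Min_eqI)

lemma csucc_last: "x \<in> S \<Longrightarrow> (\<And>y. y \<in> S \<Longrightarrow> y \<le> x) \<Longrightarrow> csucc S x = Min S"
  by (force simp: csucc_def)

lemma csucc_nextD:
  assumes "finite S" "x \<in> S" "y \<in> S" "x < y"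
  shows "csucc S x \<in> S" "x < csucc S x" "\<And>z. z \<in> S \<Longrightarrow> x < z \<Longrightarrow> csucc S x \<le> z"
proof -
  have e: "csucc S x = Min {y \<in> S. x < y}" using assms by (auto simp: csucc_def)
  have "Min {y \<in> S. x < y} \<in> {y \<in> S. x < y}" using assms by (intro Min_in) auto
  then show "csucc S x \<in> S" "x < csucc S x" unfolding e by auto
  show "csucc S x \<le> z" if "z \<in> S" "x < z" for z unfolding e using assms that by (intro Min_le) auto
qed

lemma csucc_pred:
  assumes "finite S" "x \<in> S" "x \<noteq> Min S"
  shows "\<exists>y\<in>S. y < x \<and> csucc S y = x"
proof -
  let ?A = "{y \<in> S. y < x}"
  have "Min S \<in> S" using assms by (intro Min_in) auto
  moreover have "Min S \<le> x" using assms by (intro Min_le)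
  ultimately have "Min S \<in> ?A" using assms(3) by auto
  then have ne: "?A \<noteq> {}" by blast
  have fin: "finite ?A" using assms by simp
  have m: "Max ?A \<in> ?A" using Max_in[OF fin ne] .
  have "csucc S (Max ?A) = x"
  proof (rule csucc_next)
    fix y assume y: "y \<in> S" "Max ?A < y"
    show "x \<le> y" using y Max_ge[OF fin, of y] by fastforce
  qed (use assms m in auto)
  then show ?thesis using m by auto
qed

lemma csucc_permutes:
  assumes "finite S" shows "csucc S permutes S"
proof (rule bij_imp_permutes)
  have "S \<subseteq> csucc S ` S"
  proof
    fix x assume x: "x \<in> S"
    show "x \<in> csucc S ` S"
    proof (cases "x = Min S")
      case True
      have m: "Max S \<in> S" using x assms by (intro Max_in) auto
      have "csucc S (Max S) = Min S" using assms by (intro csucc_last m) simp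
      then show ?thesis using m True by (metis imageI)
    next
      case False
      then show ?thesis using csucc_pred[OF assms x] by auto
    qed
  qed
  moreover have "csucc S ` S \<subseteq> S"
  proof clarify
    fix x assume x: "x \<in> S"
    show "csucc S x \<in> S"
    proof (cases "\<exists>y\<in>S. x < y")
      case True
      then show ?thesis using csucc_nextD(1)[OF assms x] by blast
    next
      case False
      then have "csucc S x = Min S" using x by (simp add: csucc_def)
      moreover have "Min S \<in> S" using x assms by (intro Min_in) auto
      ultimately show ?thesis by simp
    qed
  qed
  ultimately show "bij_betw (csucc S) S S"
    using finite_surj_inj[OF assms] by (auto simp: bij_betw_def)
qed (simp add: csucc_def)

lemma cyc_csucc:
  assumes "finite S" "S \<noteq> {}" shows "cyc S (csucc S) = {S}"
  unfolding cyc_def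
proof (rule comps_singletonI)
  show "gr S (csucc S) \<subseteq> S \<times> S" by (rule gr_subset[OF csucc_permutes[OF assms(1)]])
  have "(Min S, x) \<in> conn (gr S (csucc S))" if "x \<in> S" for x
    using that
  proof (induction x rule: less_induct)
    case (less x)
    show ?case
    proof (cases "x = Min S")
      case False
      then obtain y where y: "y \<in> S" "y < x" "csucc S y = x" using csucc_pred[OF assms(1) less.prems] by blast
      then show ?thesis using less.IH[of y] conn_gr_step[of y S "csucc S"] by (auto intro: conn_trans)
    qed simp
  qed
  then show "(x, y) \<in> conn (gr S (csucc S))" if "x \<in> S" "y \<in> S" for x y
    using that by (blast intro: conn_trans conn_sym)
qed (use assms in auto)

text \<open>After the swap j goes to the successor of i, which is the least element of C, and i goes
  where j went, past the end of C. Both cycles therefore stay increasing.\<close>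

lemma csucc_split:
  assumes fin: "finite S" and ij: "i \<in> S" "j \<in> S" "i < j"
  defines "C \<equiv> {x \<in> S. i < x \<and> x \<le> j}"
  defines "\<rho> \<equiv> csucc S \<circ> transpose i j"
  shows "perm_restrict \<rho> C = csucc C" and "perm_restrict \<rho> (S - C) = csucc (S - C)"
    and "\<rho> ` C \<subseteq> C" and "\<rho> ` (S - C) \<subseteq> S - C"
proof -
  have finC: "finite C" "finite (S - C)" using fin by (auto simp: C_def)
  have jC: "j \<in> C" and iC: "i \<in> S - C" using ij by (auto simp: C_def)
  have \<rho>: "\<rho> i = csucc S j" "\<rho> j = csucc S i" "\<And>x. x \<noteq> i \<Longrightarrow> x \<noteq> j \<Longrightarrow> \<rho> x = csucc S x"
    by (simp_all add: \<rho>_def)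
  have 1: "\<rho> x = csucc C x" if x: "x \<in> C" for x
  proof (cases "x = j")
    case True
    have m: "Min C \<in> C" using finC jC by (intro Min_in) auto
    have "csucc S i = Min C"
    proof (rule csucc_next[OF fin ij(1)])
      fix y assume y: "y \<in> S" "i < y"
      show "Min C \<le> y"
      proof (cases "y \<le> j")
        case True
        then show ?thesis using y finC by (intro Min_le) (auto simp: C_def)
      next
        case False
        then show ?thesis using m by (auto simp: C_def)
      qed
    qed (use m in \<open>auto simp: C_def\<close>)
    moreover have "csucc C j = Min C" using jC by (intro csucc_last) (auto simp: C_def)
    ultimately show ?thesis using True \<rho>(2) by simp
  next
    case False
    then have xj: "x < j" and xi: "x \<noteq> i" using x by (auto simp: C_def)
    note z = csucc_nextD[OF finC(1) x jC xj]
    have "csucc S x = csucc C x"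
    proof (rule csucc_next[OF fin])
      fix y assume y: "y \<in> S" "x < y"
      show "csucc C x \<le> y"
      proof (cases "y \<le> j")
        case True
        then have "y \<in> C" using y x by (auto simp: C_def)
        then show ?thesis using z(3) y by blast
      next
        case False
        then show ?thesis using z(1) by (auto simp: C_def)
      qed
    qed (use x z in \<open>auto simp: C_def\<close>)
    then show ?thesis using \<rho>(3) xi False by simp
  qed
  have Min: "Min S = Min (S - C)"
  proof (rule Min_eqI)
    show "Min (S - C) \<le> y" if y: "y \<in> S" for y
    proof (cases "y \<in> C")
      case True
      have "Min (S - C) \<le> i" using finC iC by (intro Min_le) auto
      then show ?thesis using True by (auto simp: C_def)
    qed (use y finC in auto)
    have "Min (S - C) \<in> S - C" using finC iC by (intro Min_in) auto
    then show "Min (S - C) \<in> S" by blast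
  qed (use fin in auto)
  have 2: "\<rho> x = csucc (S - C) x" if x: "x \<in> S - C" for x
  proof -
    \<comment> \<open>After the swap i takes the image of j. The points of S - C above u are the
      same as those above x, so the two successors agree.\<close>
    define u where "u = (if x = i then j else x)"
    have u: "u \<in> S" "\<rho> x = csucc S u" using x ij jC \<rho> by (auto simp: u_def)
    have gt: "u < y \<longleftrightarrow> x < y" if "y \<in> S - C" for y
      using that ij by (auto simp: u_def C_def)
    have gtC: "i \<in> S - C \<and> x < i" if "y \<in> C" "u < y" for y
      using that x ij iC by (auto simp: u_def C_def split: if_splits)
    show ?thesis
    proof (cases "\<exists>y\<in>S - C. x < y")
      case True
      then obtain y0 where "y0 \<in> S - C" "x < y0" by blast
      note z = csucc_nextD[OF finC(2) x this]
      have "csucc S u = csucc (S - C) x"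
      proof (rule csucc_next[OF fin u(1)])
        show "u < csucc (S - C) x" using gt z by blast
        fix y assume y: "y \<in> S" "u < y"
        show "csucc (S - C) x \<le> y"
        proof (cases "y \<in> C")
          case True
          then have "csucc (S - C) x \<le> i" using gtC[OF True y(2)] z(3) by blast
          then show ?thesis using True by (auto simp: C_def)
        next
          case False
          then show ?thesis using y gt z(3) by blast
        qed
      qed (use z in auto)
      then show ?thesis using u by simp
    next
      case False
      have "csucc S u = Min S"
      proof (rule csucc_last[OF u(1)])
        fix y assume y: "y \<in> S"
        show "y \<le> u"
        proof (rule ccontr)
          assume "\<not> y \<le> u"
          then show False using False gt[of y] gtC[of y] y iC by (cases "y \<in> C") auto
        qed
      qed
      moreover have "csucc (S - C) x = Min (S - C)" using False x by (intro csucc_last) (auto simp: not_less)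
      ultimately show ?thesis using u Min by simp
    qed
  qed
  show "perm_restrict \<rho> C = csucc C" "perm_restrict \<rho> (S - C) = csucc (S - C)"
    using 1 2 by (auto simp: perm_restrict_def fun_eq_iff csucc_def)
  show "\<rho> ` C \<subseteq> C" "\<rho> ` (S - C) \<subseteq> S - C"
    using 1 2 permutes_in_image[OF csucc_permutes[OF finC(1)]] permutes_in_image[OF csucc_permutes[OF finC(2)]]
    by (metis image_subsetI)+
qed

section \<open>Cutting at an interval: disc permutations are non-crossing partitions\<close>

lemma card_cyc_complement_sum:
  assumes fin: "finite S" and p: "partition_on S \<V>" and \<pi>: "\<pi> permutes S"
    and \<pi>V: "\<And>V. V \<in> \<V> \<Longrightarrow> \<pi> ` V \<subseteq> V" and \<gamma>V: "\<And>V. V \<in> \<V> \<Longrightarrow> \<gamma> ` V \<subseteq> V"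
  shows "card (cyc S (inv \<pi> \<circ> \<gamma>)) = (\<Sum>V\<in>\<V>. card (cyc V (inv (perm_restrict \<pi> V) \<circ> perm_restrict \<gamma> V)))"
proof -
  have finV: "finite V" if "V \<in> \<V>" for V
    using that fin partition_onD1[OF p] by (meson Union_upper finite_subset)
  have "(inv \<pi> \<circ> \<gamma>) ` V \<subseteq> V" if "V \<in> \<V>" for V
    unfolding image_comp[symmetric]
    by (rule order_trans[OF image_mono[OF \<gamma>V[OF that]] inv_image_subset[OF finV[OF that] \<pi> \<pi>V[OF that]]])
  then have "card (cyc S (inv \<pi> \<circ> \<gamma>)) = (\<Sum>V\<in>\<V>. card (cyc V (perm_restrict (inv \<pi> \<circ> \<gamma>) V)))"
    by (rule card_cyc_sum[OF fin p])
  also have "\<dots> = (\<Sum>V\<in>\<V>. card (cyc V (inv (perm_restrict \<pi> V) \<circ> perm_restrict \<gamma> V)))"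
    using perm_restrict_comp_subset[OF \<gamma>V] perm_restrict_inv[OF finV \<pi> \<pi>V] by (intro sum.cong refl) simp
  finally show ?thesis .
qed

lemma preserves_of_conn:
  assumes "partition_on S \<V>" "gr S \<pi> \<subseteq> conn (prel \<V>)" "V \<in> \<V>"
  shows "\<pi> ` V \<subseteq> V"
proof clarify
  fix x assume x: "x \<in> V"
  then have "x \<in> S" using assms partition_onD1 by blast
  then have "(x, \<pi> x) \<in> conn (prel \<V>)" using assms(2) by auto
  then show "\<pi> x \<in> V" using conn_prel[OF assms(1,3) x] by auto
qed

text \<open>Cutting \<open>csucc S\<close> at i and j gives \<rho>, over which the complement of
  \<pi> has one cycle more and splits between C and S - C. So the genus defect of \<pi> is the sum
  of the defects of its restrictions, and these are non-negative by
  \<open>disc_inequality\<close>.\<close>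

lemma disc_split:
  assumes fin: "finite S" and ij: "i \<in> S" "j \<in> S" "i < j" and \<pi>: "\<pi> permutes S"
  defines "C \<equiv> {x \<in> S. i < x \<and> x \<le> j}"
  assumes pC: "\<pi> ` C \<subseteq> C" and pD: "\<pi> ` (S - C) \<subseteq> S - C"
  shows "\<pi> \<in> disc S (csucc S) \<longleftrightarrow>
    perm_restrict \<pi> C \<in> disc C (csucc C) \<and> perm_restrict \<pi> (S - C) \<in> disc (S - C) (csucc (S - C))"
proof -
  define \<rho> where "\<rho> = csucc S \<circ> transpose i j"
  have \<rho>: "perm_restrict \<rho> C = csucc C" "perm_restrict \<rho> (S - C) = csucc (S - C)"
    "\<rho> ` C \<subseteq> C" "\<rho> ` (S - C) \<subseteq> S - C"
    using csucc_split[OF fin ij] by (simp_all add: \<rho>_def C_def)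
  have CS: "C \<subseteq> S" "j \<in> C" "i \<in> S - C" using ij by (auto simp: C_def)
  have finC: "finite C" "finite (S - C)" using fin CS finite_subset by auto
  have p: "partition_on S {C, S - C}"
    by (rule partition_onI) (use CS in \<open>auto simp: disjnt_def\<close>)
  have ne: "C \<noteq> S - C" using CS by blast
  have \<rho>p: "\<rho> permutes S" unfolding \<rho>_def using csucc_permutes[OF fin] ij by (intro transpose_permutes)
  have Lp: "inv \<pi> \<circ> \<rho> permutes S" using \<pi> \<rho>p by (intro permutes_compose permutes_inv)
  have rp: "perm_restrict \<pi> C permutes C" "perm_restrict \<pi> (S - C) permutes (S - C)"
    using perm_restrict_permutes[OF _ \<pi>] finC pC pD by auto
  have "(i, j) \<notin> conn (gr S (inv \<pi> \<circ> \<rho>))"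
  proof
    assume "(i, j) \<in> conn (gr S (inv \<pi> \<circ> \<rho>))"
    then have "(i \<in> C) = (j \<in> C)"
    proof (rule conn_invariant[rotated])
      fix x y assume "(x, y) \<in> gr S (inv \<pi> \<circ> \<rho>)"
      then have xy: "x \<in> S" "y = inv \<pi> (\<rho> x)" by auto
      have "inv \<pi> ` C \<subseteq> C" "inv \<pi> ` (S - C) \<subseteq> S - C"
        using inv_image_subset[OF _ \<pi>] finC pC pD by auto
      then show "(x \<in> C) = (y \<in> C)" using xy \<rho>(3,4) by blast
    qed
    then show False using CS by blast
  qed
  then have "Suc (card (cyc S ((inv \<pi> \<circ> \<rho>) \<circ> transpose i j))) = card (cyc S (inv \<pi> \<circ> \<rho>))"
    using fin Lp ij by (intro card_cyc_join)
  moreover have "(inv \<pi> \<circ> \<rho>) \<circ> transpose i j = inv \<pi> \<circ> csucc S"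
    by (simp add: \<rho>_def fun_eq_iff)
  ultimately have "Suc (card (cyc S (inv \<pi> \<circ> csucc S))) = card (cyc S (inv \<pi> \<circ> \<rho>))" by simp
  also have "\<dots> = (\<Sum>V\<in>{C, S - C}. card (cyc V (inv (perm_restrict \<pi> V) \<circ> perm_restrict \<rho> V)))"
    by (rule card_cyc_complement_sum[OF fin p \<pi>]) (use pC pD \<rho> in blast)+
  also have "\<dots> = card (cyc C (inv (perm_restrict \<pi> C) \<circ> csucc C)) +
      card (cyc (S - C) (inv (perm_restrict \<pi> (S - C)) \<circ> csucc (S - C)))"
    using \<rho> ne by simp
  finally have K: "Suc (card (cyc S (inv \<pi> \<circ> csucc S))) = card (cyc C (inv (perm_restrict \<pi> C) \<circ> csucc C)) +
      card (cyc (S - C) (inv (perm_restrict \<pi> (S - C)) \<circ> csucc (S - C)))" .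
  have "card (cyc S \<pi>) = (\<Sum>V\<in>{C, S - C}. card (cyc V (perm_restrict \<pi> V)))"
    by (rule card_cyc_sum[OF fin p]) (use pC pD in blast)
  then have P: "card (cyc S \<pi>) = card (cyc C (perm_restrict \<pi> C)) + card (cyc (S - C) (perm_restrict \<pi> (S - C)))"
    using ne by simp
  have "card (cyc C (perm_restrict \<pi> C)) + card (cyc C (inv (perm_restrict \<pi> C) \<circ> csucc C)) \<le> card C + 1"
    using finC rp CS by (intro disc_inequality csucc_permutes cyc_csucc) auto
  moreover have "card (cyc (S - C) (perm_restrict \<pi> (S - C))) +
      card (cyc (S - C) (inv (perm_restrict \<pi> (S - C)) \<circ> csucc (S - C))) \<le> card (S - C) + 1"
    using finC rp CS by (intro disc_inequality csucc_permutes cyc_csucc) auto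
  moreover have "card S = card C + card (S - C)" using fin CS by (simp add: card_Diff_subset card_mono finC)
  ultimately show ?thesis using K P \<pi> rp unfolding disc_def by auto
qed

text \<open>Cut \<open>csucc S\<close> at two points in one cycle of the complement of \<pi>. The
  complement gains a cycle, and the genus inequality then forces \<pi> and the cut permutation
  \<rho> to have two components, so \<pi> preserves both cycles of \<rho>.\<close>

lemma disc_split_exists:
  assumes fin: "finite S" and \<pi>: "\<pi> \<in> disc S (csucc S)" and neq: "\<pi> \<noteq> csucc S"
  shows "\<exists>i\<in>S. \<exists>j\<in>S. i < j \<and> \<pi> ` {x \<in> S. i < x \<and> x \<le> j} \<subseteq> {x \<in> S. i < x \<and> x \<le> j} \<and>
    \<pi> ` (S - {x \<in> S. i < x \<and> x \<le> j}) \<subseteq> S - {x \<in> S. i < x \<and> x \<le> j}"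
proof -
  have \<pi>p: "\<pi> permutes S" and cnt: "card (cyc S \<pi>) + card (cyc S (inv \<pi> \<circ> csucc S)) = card S + 1"
    using \<pi> by (auto simp: disc_def)
  define K where "K = inv \<pi> \<circ> csucc S"
  have Kp: "K permutes S" unfolding K_def using \<pi>p csucc_permutes[OF fin] by (intro permutes_compose permutes_inv)
  have "K \<noteq> id" using neq inv_comp_cancel[OF \<pi>p, of "csucc S"] by (auto simp: K_def)
  then obtain x where x: "K x \<noteq> x" by (auto simp: fun_eq_iff)
  then have xS: "x \<in> S" "K x \<in> S" using permutes_not_in[OF Kp] permutes_in_image[OF Kp] by blast+
  have xK: "(x, K x) \<in> conn (gr S K)" using xS by (intro conn_gr_step)
  \<comment> \<open>The complement moves x, so x and its image are two points of one cycle; i and j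
    are these two points in order.\<close>
  define i where "i = min x (K x)" define j where "j = max x (K x)"
  have ij: "i \<in> S" "j \<in> S" "i < j" "(i, j) \<in> conn (gr S K)"
    using xS x xK conn_sym[OF xK] by (auto simp: i_def j_def min_def max_def)
  define C where "C = {x \<in> S. i < x \<and> x \<le> j}"
  define \<rho> where "\<rho> = csucc S \<circ> transpose i j"
  have \<rho>: "perm_restrict \<rho> C = csucc C" "perm_restrict \<rho> (S - C) = csucc (S - C)"
    "\<rho> ` C \<subseteq> C" "\<rho> ` (S - C) \<subseteq> S - C"
    using csucc_split[OF fin ij(1-3)] by (simp_all add: \<rho>_def C_def)
  have CS: "C \<subseteq> S" "j \<in> C" "i \<in> S - C" using ij by (auto simp: C_def)
  have finC: "finite C" "finite (S - C)" using fin CS finite_subset by auto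
  have p: "partition_on S {C, S - C}"
    by (rule partition_onI) (use CS in \<open>auto simp: disjnt_def\<close>)
  have \<rho>p: "\<rho> permutes S" unfolding \<rho>_def using csucc_permutes[OF fin] ij by (intro transpose_permutes)
  have cyc\<rho>: "cyc S \<rho> = {C, S - C}"
  proof -
    have "cyc S \<rho> = (\<Union>V\<in>{C, S - C}. cyc V (perm_restrict \<rho> V))"
      by (rule cyc_UN[OF p]) (use \<rho>(3,4) in blast)
    also have "\<dots> = cyc C (csucc C) \<union> cyc (S - C) (csucc (S - C))" using \<rho>(1,2) by simp
    also have "\<dots> = {C, S - C}"
      using cyc_csucc[OF finC(1)] cyc_csucc[OF finC(2)] CS by blast
    finally show ?thesis .
  qed
  have "inv \<pi> \<circ> \<rho> = K \<circ> transpose i j" by (simp add: \<rho>_def K_def fun_eq_iff)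
  moreover have "card (cyc S (K \<circ> transpose i j)) = Suc (card (cyc S K))"
    using fin Kp ij by (intro card_cyc_split) auto
  ultimately have "card (cyc S (inv \<pi> \<circ> \<rho>)) = Suc (card (cyc S (inv \<pi> \<circ> csucc S)))"
    by (simp add: K_def)
  moreover have c2: "card (cyc S \<rho>) = 2" 
  proof -
    have "C \<noteq> S - C" using CS by blast
    then show ?thesis unfolding cyc\<rho> by simp
  qed
  ultimately have "card (cyc S \<rho>) \<le> card (comps S (gr S \<pi> \<union> gr S \<rho>))"
    using genus_inequality_perm[OF fin \<pi>p \<rho>p] cnt by linarith
  then have "gr S \<pi> \<subseteq> conn (gr S \<rho>)"
    unfolding cyc_def by (intro comps_eq_imp_subset[OF fin gr_subset[OF \<pi>p]])
  also have "\<dots> = conn (prel {C, S - C})" using conn_prel_cyc[OF \<rho>p] cyc\<rho> by simp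
  finally have "\<pi> ` C \<subseteq> C" "\<pi> ` (S - C) \<subseteq> S - C" using preserves_of_conn[OF p] by auto
  then show ?thesis using ij unfolding C_def by blast
qed

lemma csucc_in_disc:
  assumes "finite S" "S \<noteq> {}" shows "csucc S \<in> disc S (csucc S)"
  using csucc_permutes[OF assms(1)] cyc_csucc[OF assms] card_cyc_id[of S]
  by (simp add: disc_def permutes_inv_o)

lemma noncrossingD:
  "noncrossing P \<Longrightarrow> V \<in> P \<Longrightarrow> W \<in> P \<Longrightarrow> V \<noteq> W \<Longrightarrow> a \<in> V \<Longrightarrow> b \<in> W \<Longrightarrow> c \<in> V \<Longrightarrow> d \<in> W \<Longrightarrow>
    a < b \<Longrightarrow> b < c \<Longrightarrow> c < d \<Longrightarrow> False"
  unfolding noncrossing_def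
  by (erule notE, rule bexI[of _ V], rule bexI[of _ W], intro conjI, assumption,
      rule bexI[of _ a], rule bexI[of _ b], rule bexI[of _ c], rule bexI[of _ d]) simp_all

text \<open>A crossing between the two families would put a point outside the interval between two
  points of it.\<close>

lemma noncrossing_interval_Un:
  assumes P: "noncrossing P" "\<Union>P \<subseteq> {x \<in> S. i < x \<and> x \<le> j}"
    and Q: "noncrossing Q" "\<Union>Q \<subseteq> S - {x \<in> S. i < x \<and> x \<le> j}"
  shows "noncrossing (P \<union> Q)"
  unfolding noncrossing_def
proof (intro notI, elim bexE conjE)
  fix V W a b c d assume *: "V \<in> P \<union> Q" "W \<in> P \<union> Q" "V \<noteq> W" "a \<in> V" "b \<in> W" "c \<in> V" "d \<in> W"
    "a < b" "b < c" "c < d"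
  consider "V \<in> P" "W \<in> P" | "V \<in> Q" "W \<in> Q" | "V \<in> P" "W \<in> Q" | "V \<in> Q" "W \<in> P" using * by blast
  then show False
  proof cases
    case 1
    then show ?thesis using noncrossingD[OF P(1) _ _ *(3-10)] by blast
  next
    case 2
    then show ?thesis using noncrossingD[OF Q(1) _ _ *(3-10)] by blast
  next
    case 3
    then have "a \<in> {x \<in> S. i < x \<and> x \<le> j}" "c \<in> {x \<in> S. i < x \<and> x \<le> j}"
      "b \<in> S - {x \<in> S. i < x \<and> x \<le> j}" using * P(2) Q(2) by blast+
    then show ?thesis using * by auto
  next
    case 4
    then have "b \<in> {x \<in> S. i < x \<and> x \<le> j}" "d \<in> {x \<in> S. i < x \<and> x \<le> j}"
      "c \<in> S - {x \<in> S. i < x \<and> x \<le> j}" using * P(2) Q(2) by blast+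
    then show ?thesis using * by auto
  qed
qed

lemma noncrossing_subset:
  assumes "noncrossing P" "Q \<subseteq> P" shows "noncrossing Q"
  unfolding noncrossing_def
proof (intro notI, elim bexE conjE)
  fix V W a b c d assume *: "V \<in> Q" "W \<in> Q" "V \<noteq> W" "a \<in> V" "b \<in> W" "c \<in> V" "d \<in> W"
    "a < b" "b < c" "c < d"
  then have "V \<in> P" "W \<in> P" using assms(2) by blast+
  then show False using noncrossingD[OF assms(1) _ _ *(3-10)] by blast
qed

text \<open>A maximal gap of the block containing the minimum is an interval
  which is a union of blocks.\<close>

lemma NC_split_exists:
  assumes fin: "finite S" and ne: "S \<noteq> {}" and P: "P \<in> NC S" and neq: "P \<noteq> {S}"
  shows "\<exists>i\<in>S. \<exists>j\<in>S. i < j \<and> (\<forall>W\<in>P. W \<subseteq> {x \<in> S. i < x \<and> x \<le> j} \<or> W \<subseteq> S - {x \<in> S. i < x \<and> x \<le> j})"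
proof -
  have pP: "partition_on S P" and nc: "noncrossing P" using P by (auto simp: NC_def)
  have mS: "Min S \<in> S" using fin ne by simp
  then obtain V where V: "V \<in> P" "Min S \<in> V" using partition_onD1[OF pP] by blast
  have VS: "V \<subseteq> S" using V partition_onD1[OF pP] by blast
  have "V \<noteq> S"
  proof
    assume VS: "V = S"
    have "W = S" if W: "W \<in> P" for W
    proof -
      have "W \<noteq> {}" using W partition_onD3[OF pP] by auto
      then obtain x where x: "x \<in> W" by auto
      then have "x \<in> V" using W partition_onD1[OF pP] VS by blast
      then show ?thesis using partition_on_unique[OF pP V(1) W _ x] VS by simp
    qed
    then show False using neq V(1) by blast
  qed
  then obtain x where x: "x \<in> S" "x \<notin> V" using VS by blast
  have finV: "finite V" using VS fin finite_subset by blast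
  \<comment> \<open>The last element of V before the missed point x: the gap around x starts right
    after it.\<close>
  define i where "i = Max {v \<in> V. v < x}"
  have mx: "Min S < x" using x V fin Min_le[of S x] by (metis le_neq_implies_less)
  have "i \<in> {v \<in> V. v < x}" unfolding i_def using finV V mx by (intro Max_in) auto
  then have i: "i \<in> V" "i < x" by auto
  have imax: "v \<le> i" if "v \<in> V" "v < x" for v unfolding i_def using finV that by (intro Max_ge) auto
  define T where "T = {y \<in> S. i < y \<and> (\<forall>v\<in>V. x < v \<longrightarrow> y < v)}"
  define j where "j = Max T"
  have finT: "finite T" and xT: "x \<in> T" using fin x i by (auto simp: T_def)
  have jT: "j \<in> T" unfolding j_def using finT xT by (intro Max_in) auto
  have C: "{x \<in> S. i < x \<and> x \<le> j} = T"
  proof (intro equalityI subsetI)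
    fix y assume "y \<in> T"
    then show "y \<in> {x \<in> S. i < x \<and> x \<le> j}" using finT by (auto simp: j_def T_def)
  next
    fix y assume "y \<in> {x \<in> S. i < x \<and> x \<le> j}"
    then show "y \<in> T" using jT by (fastforce simp: T_def)
  qed
  have VT: "v \<notin> T" if "v \<in> V" for v
    using that imax[OF that] x by (cases v x rule: linorder_cases) (auto simp: T_def)
  have "W \<subseteq> T \<or> W \<subseteq> S - T" if W: "W \<in> P" for W
  proof (rule ccontr)
    assume "\<not> ?thesis"
    moreover have "W \<subseteq> S" using W partition_onD1[OF pP] by blast
    ultimately obtain u w where uw: "u \<in> W" "u \<in> T" "w \<in> W" "w \<notin> T" "w \<in> S" by blast
    have WV: "W \<noteq> V" using uw VT by blast
    then have nV: "w \<notin> V" using uw V W partition_on_unique[OF pP] by blast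
    have cr: False if "p \<in> V" "q \<in> W" "r \<in> V" "s \<in> W" "p < q" "q < r" "r < s" for p q r s
      using noncrossingD[OF nc V(1) W WV[symmetric] that] .
    \<comment> \<open>W would cross V: along Min S < w < i < u if w lies before the gap, and along i
      < u < v < w, with v an element of V past the gap, if w lies after it.\<close>
    show False
    proof (cases "w < i")
      case True
      have "Min S < w" using uw nV V fin Min_le[of S w] by (metis le_neq_implies_less)
      then show False using cr[of "Min S" w i u] uw V i True by (auto simp: T_def)
    next
      case False
      then have "i < w" using i nV by (metis linorder_neqE_nat)
      then obtain v where v: "v \<in> V" "x < v" "\<not> w < v" using uw by (auto simp: T_def)
      then have "v < w" using nV by (metis linorder_neqE_nat)
      then show False using cr[of i u v w] uw v i by (auto simp: T_def)
    qed
  qed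
  moreover have "j \<in> S" "i < j" "i \<in> S" using jT i VS by (auto simp: T_def)
  ultimately show ?thesis unfolding C[symmetric] by blast
qed

lemma combine_perms:
  assumes "\<pi>1 permutes Z" "\<pi>2 permutes Y" "Z \<inter> Y = {}"
  defines "\<pi> \<equiv> \<pi>1 \<circ> \<pi>2"
  shows "\<pi> permutes (Z \<union> Y)" and "perm_restrict \<pi> Z = \<pi>1" and "perm_restrict \<pi> Y = \<pi>2"
    and "\<pi> ` Z \<subseteq> Z" and "\<pi> ` Y \<subseteq> Y"
proof -
  show "\<pi> permutes (Z \<union> Y)" unfolding \<pi>_def
    using permutes_subset[OF assms(1)] permutes_subset[OF assms(2)] by (intro permutes_compose) auto
  have Z: "\<pi> x = \<pi>1 x" "\<pi>1 x \<in> Z" if "x \<in> Z" for x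
  proof -
    have "x \<notin> Y" using that assms(3) by blast
    then show "\<pi> x = \<pi>1 x" using permutes_not_in[OF assms(2)] by (simp add: \<pi>_def)
    show "\<pi>1 x \<in> Z" using that permutes_in_image[OF assms(1)] by blast
  qed
  have Y: "\<pi> x = \<pi>2 x" "\<pi>2 x \<in> Y" if "x \<in> Y" for x
  proof -
    show "\<pi>2 x \<in> Y" using that permutes_in_image[OF assms(2)] by blast
    then have "\<pi>2 x \<notin> Z" using assms(3) by blast
    then show "\<pi> x = \<pi>2 x" using permutes_not_in[OF assms(1)] by (simp add: \<pi>_def)
  qed
  show "perm_restrict \<pi> Z = \<pi>1" "perm_restrict \<pi> Y = \<pi>2"
    using Z Y permutes_not_in[OF assms(1)] permutes_not_in[OF assms(2)]
    by (auto simp: perm_restrict_def fun_eq_iff)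
  show "\<pi> ` Z \<subseteq> Z" "\<pi> ` Y \<subseteq> Y" using Z Y by auto
qed

lemma cyc_two_blocks:
  assumes "\<pi> ` Z \<subseteq> Z" "\<pi> ` Y \<subseteq> Y" "Z \<inter> Y = {}" "Z \<noteq> {}" "Y \<noteq> {}"
  shows "cyc (Z \<union> Y) \<pi> = cyc Z (perm_restrict \<pi> Z) \<union> cyc Y (perm_restrict \<pi> Y)"
proof -
  have p: "partition_on (Z \<union> Y) {Z, Y}"
    by (rule partition_onI) (use assms in \<open>auto simp: disjnt_def\<close>)
  show ?thesis using cyc_UN[OF p, of \<pi>] assms by auto
qed

lemma cyc_restrict_eq:
  assumes "finite Z" "finite Y" "\<pi> permutes (Z \<union> Y)" "\<pi> ` Z \<subseteq> Z" "\<pi> ` Y \<subseteq> Y" "Z \<inter> Y = {}" "Z \<noteq> {}" "Y \<noteq> {}"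
  shows "cyc Z (perm_restrict \<pi> Z) = {W \<in> cyc (Z \<union> Y) \<pi>. W \<subseteq> Z}"
proof -
  have p: "partition_on Z (cyc Z (perm_restrict \<pi> Z))" "partition_on Y (cyc Y (perm_restrict \<pi> Y))"
    using perm_restrict_permutes[OF _ assms(3)] assms by (auto intro!: partition_on_cyc)
  have "\<forall>W\<in>cyc Z (perm_restrict \<pi> Z). W \<subseteq> Z" using partition_onD1[OF p(1)] by blast
  moreover have "\<forall>W\<in>cyc Y (perm_restrict \<pi> Y). W \<subseteq> Y \<and> W \<noteq> {}"
    using partition_onD1[OF p(2)] partition_onD3[OF p(2)] by blast
  ultimately show ?thesis unfolding cyc_two_blocks[OF assms(4-8)] using assms(6) by blast
qed

text \<open>Strong induction on |S| for three claims at once: cycles are non-crossing, every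
  non-crossing partition occurs, and the cycles determine the permutation. Each is reduced to an
  interval and its complement; what cannot be cut is \<open>csucc S\<close> on one side and the
  one-block partition on the other.\<close>

theorem bij_betw_disc_NC:
  assumes "finite S" "S \<noteq> {}"
  shows "bij_betw (cyc S) (disc S (csucc S)) (NC S)"
proof -
  have "(\<forall>\<pi>\<in>disc S (csucc S). noncrossing (cyc S \<pi>)) \<and>
      (\<forall>P\<in>NC S. \<exists>\<pi>\<in>disc S (csucc S). cyc S \<pi> = P) \<and>
      (\<forall>\<pi>\<in>disc S (csucc S). \<forall>\<sigma>\<in>disc S (csucc S). cyc S \<pi> = cyc S \<sigma> \<longrightarrow> \<pi> = \<sigma>)"
    using assms
  proof (induction "card S" arbitrary: S rule: less_induct)
    case less
    note fin = \<open>finite S\<close>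
    define C where "C i j = {x \<in> S. i < x \<and> x \<le> j}" for i j
    have CS: "C i j \<subseteq> S" "finite (C i j)" "finite (S - C i j)" "C i j \<noteq> {}" "S - C i j \<noteq> {}"
      "card (C i j) < card S" "card (S - C i j) < card S" "C i j \<union> (S - C i j) = S"
      if "i \<in> S" "j \<in> S" "i < j" for i j
    proof -
      show s: "C i j \<subseteq> S" by (auto simp: C_def)
      show f: "finite (C i j)" "finite (S - C i j)" using s fin finite_subset by auto
      show n: "C i j \<noteq> {}" "S - C i j \<noteq> {}" using that by (auto simp: C_def)
      show "card (C i j) < card S" using s n fin by (intro psubset_card_mono) auto
      show "card (S - C i j) < card S" using s n fin by (intro psubset_card_mono) auto
      show "C i j \<union> (S - C i j) = S" using s by blast
    qed
    have split: "\<exists>i\<in>S. \<exists>j\<in>S. i < j \<and> \<pi> ` C i j \<subseteq> C i j \<and> \<pi> ` (S - C i j) \<subseteq> S - C i j"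
      if "\<pi> \<in> disc S (csucc S)" "\<pi> \<noteq> csucc S" for \<pi>
      using disc_split_exists[OF fin that] by (simp add: C_def)
    have parts: "perm_restrict \<pi> (C i j) \<in> disc (C i j) (csucc (C i j))"
      "perm_restrict \<pi> (S - C i j) \<in> disc (S - C i j) (csucc (S - C i j))"
      if "\<pi> \<in> disc S (csucc S)" "i \<in> S" "j \<in> S" "i < j" "\<pi> ` C i j \<subseteq> C i j" "\<pi> ` (S - C i j) \<subseteq> S - C i j" for \<pi> i j
      using disc_split[OF fin that(2-4), of \<pi>] that unfolding C_def disc_def by auto
    have pS: "\<pi> permutes S" if "\<pi> \<in> disc S (csucc S)" for \<pi> using that by (simp add: disc_def)
    have "noncrossing (cyc S \<pi>)" if \<pi>: "\<pi> \<in> disc S (csucc S)" for \<pi>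
    proof (cases "\<pi> = csucc S")
      case True
      then show ?thesis using cyc_csucc[OF less.prems] by (simp add: noncrossing_def)
    next
      case False
      then obtain i j where ij: "i \<in> S" "j \<in> S" "i < j" and p: "\<pi> ` C i j \<subseteq> C i j" "\<pi> ` (S - C i j) \<subseteq> S - C i j"
        using split[OF \<pi>] by blast
      note c = CS[OF ij] and d = parts[OF \<pi> ij p]
      have "cyc S \<pi> = cyc (C i j) (perm_restrict \<pi> (C i j)) \<union> cyc (S - C i j) (perm_restrict \<pi> (S - C i j))"
        using cyc_two_blocks[OF p] c by auto
      moreover have un: "\<Union> (cyc (C i j) (perm_restrict \<pi> (C i j))) = C i j"
        "\<Union> (cyc (S - C i j) (perm_restrict \<pi> (S - C i j))) = S - C i j"
        using d partition_onD1[OF partition_on_cyc] by (auto simp: disc_def)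
      moreover have "noncrossing (cyc (C i j) (perm_restrict \<pi> (C i j)))"
        by (rule bspec[OF conjunct1[OF less.hyps[OF c(6,2,4)]] d(1)])
      moreover have "noncrossing (cyc (S - C i j) (perm_restrict \<pi> (S - C i j)))"
        by (rule bspec[OF conjunct1[OF less.hyps[OF c(7,3,5)]] d(2)])
      ultimately show ?thesis
        using noncrossing_interval_Un[OF _ un(1)[THEN equalityD1, unfolded C_def] _ un(2)[THEN equalityD1, unfolded C_def]]
        unfolding C_def by simp
    qed
    moreover have "\<exists>\<pi>\<in>disc S (csucc S). cyc S \<pi> = P" if P: "P \<in> NC S" for P
    proof (cases "P = {S}")
      case True
      then show ?thesis using csucc_in_disc[OF less.prems] cyc_csucc[OF less.prems] by blast
    next
      case False
      obtain i j where ij: "i \<in> S" "j \<in> S" "i < j" and W: "\<And>W. W \<in> P \<Longrightarrow> W \<subseteq> C i j \<or> W \<subseteq> S - C i j"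
        using NC_split_exists[OF less.prems P False] unfolding C_def[symmetric] by (elim bexE conjE) simp
      note c = CS[OF ij]
      have pP: "partition_on S P" and nc: "noncrossing P" using P by (auto simp: NC_def)
      have pC: "partition_on S {C i j, S - C i j}"
        by (rule partition_onI) (use c in \<open>auto simp: disjnt_def\<close>)
      have "{W \<in> P. W \<subseteq> V} \<in> NC V" if "V \<in> {C i j, S - C i j}" for V
        unfolding NC_def using partition_on_refining[OF pP pC _ that] W noncrossing_subset[OF nc] by auto
      then have nc12: "{W \<in> P. W \<subseteq> C i j} \<in> NC (C i j)" "{W \<in> P. W \<subseteq> S - C i j} \<in> NC (S - C i j)" by auto
      obtain \<pi>1 \<pi>2 where \<pi>12: "\<pi>1 \<in> disc (C i j) (csucc (C i j))" "\<pi>2 \<in> disc (S - C i j) (csucc (S - C i j))"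
        and cy: "cyc (C i j) \<pi>1 = {W \<in> P. W \<subseteq> C i j}" "cyc (S - C i j) \<pi>2 = {W \<in> P. W \<subseteq> S - C i j}"
        using bspec[OF conjunct1[OF conjunct2[OF less.hyps[OF c(6,2,4)]]] nc12(1)]
          bspec[OF conjunct1[OF conjunct2[OF less.hyps[OF c(7,3,5)]]] nc12(2)] by blast
      have pp: "\<pi>1 permutes C i j" "\<pi>2 permutes (S - C i j)" using \<pi>12 by (auto simp: disc_def)
      have dis: "C i j \<inter> (S - C i j) = {}" by blast
      note cp = combine_perms[OF pp dis, unfolded c(8)]
      have "\<pi>1 \<circ> \<pi>2 \<in> disc S (csucc S)"
        using disc_split[OF fin ij cp(1)] cp \<pi>12 unfolding C_def by auto
      moreover have "cyc S (\<pi>1 \<circ> \<pi>2) = P"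
      proof -
        have "cyc S (\<pi>1 \<circ> \<pi>2) = {W \<in> P. W \<subseteq> C i j} \<union> {W \<in> P. W \<subseteq> S - C i j}"
          using cyc_two_blocks[OF cp(4,5) dis c(4,5)] unfolding c(8) cp(2,3) cy .
        then show ?thesis using W by blast
      qed
      ultimately show ?thesis by blast
    qed
    moreover have "\<pi> = \<sigma>" if \<pi>: "\<pi> \<in> disc S (csucc S)" and \<sigma>: "\<sigma> \<in> disc S (csucc S)" and eq: "cyc S \<pi> = cyc S \<sigma>" for \<pi> \<sigma>
    proof (cases "\<pi> = csucc S")
      case True
      then have "cyc S \<sigma> = {S}" using eq cyc_csucc[OF less.prems] by metis
      then have "card (cyc S (inv \<sigma> \<circ> csucc S)) = card S"
        using \<sigma> by (simp add: disc_def)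
      moreover have "inv \<sigma> \<circ> csucc S permutes S"
        using pS[OF \<sigma>] csucc_permutes[OF fin] by (intro permutes_compose permutes_inv)
      ultimately have "inv \<sigma> \<circ> csucc S = id" using card_cyc_eq_imp_id[OF fin] by blast
      then show ?thesis using True inv_comp_cancel[OF pS[OF \<sigma>], of "csucc S"] by simp
    next
      case False
      then obtain i j where ij: "i \<in> S" "j \<in> S" "i < j" and p: "\<pi> ` C i j \<subseteq> C i j" "\<pi> ` (S - C i j) \<subseteq> S - C i j"
        using split[OF \<pi>] by blast
      note c = CS[OF ij] and d = parts[OF \<pi> ij p]
      have pC: "partition_on S {C i j, S - C i j}"
        by (rule partition_onI) (use c in \<open>auto simp: disjnt_def\<close>)
      have "gr S \<pi> \<subseteq> prel {C i j, S - C i j}" using gr_subset_prel_iff[OF pC] p by simp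
      then have "conn (gr S \<pi>) \<subseteq> conn (prel {C i j, S - C i j})" by (rule conn_mono)
      \<comment> \<open>\<sigma> has the same cycles as \<pi>, so the cut found for \<pi> is also
        preserved by \<sigma>.\<close>
      then have "gr S \<sigma> \<subseteq> conn (prel {C i j, S - C i j})"
        using conn_prel_cyc[OF pS[OF \<pi>]] conn_prel_cyc[OF pS[OF \<sigma>]] eq by (auto intro: conn_incl)
      then have q: "\<sigma> ` C i j \<subseteq> C i j" "\<sigma> ` (S - C i j) \<subseteq> S - C i j"
        using preserves_of_conn[OF pC] by auto
      note e = parts[OF \<sigma> ij q]
      have dis: "C i j \<inter> (S - C i j) = {}" "(S - C i j) \<inter> C i j = {}" by blast+
      have u: "(S - C i j) \<union> C i j = S" using c(8) by blast
      have "cyc (C i j) (perm_restrict \<pi> (C i j)) = cyc (C i j) (perm_restrict \<sigma> (C i j))"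
        using cyc_restrict_eq[OF c(2,3) _ p dis(1) c(4,5)] cyc_restrict_eq[OF c(2,3) _ q dis(1) c(4,5)]
          pS[OF \<pi>] pS[OF \<sigma>] eq unfolding c(8) by simp
      then have 1: "perm_restrict \<pi> (C i j) = perm_restrict \<sigma> (C i j)"
        using bspec[OF bspec[OF conjunct2[OF conjunct2[OF less.hyps[OF c(6,2,4)]]] d(1)] e(1)] by simp
      have "cyc (S - C i j) (perm_restrict \<pi> (S - C i j)) = cyc (S - C i j) (perm_restrict \<sigma> (S - C i j))"
        using cyc_restrict_eq[OF c(3,2) _ p(2,1) dis(2) c(5,4)] cyc_restrict_eq[OF c(3,2) _ q(2,1) dis(2) c(5,4)]
          pS[OF \<pi>] pS[OF \<sigma>] eq unfolding u by simp
      then have 2: "perm_restrict \<pi> (S - C i j) = perm_restrict \<sigma> (S - C i j)"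
        using bspec[OF bspec[OF conjunct2[OF conjunct2[OF less.hyps[OF c(7,3,5)]]] d(2)] e(2)] by simp
      show ?thesis
      proof
        fix x
        consider "x \<in> C i j" | "x \<in> S - C i j" | "x \<notin> S" by blast
        then show "\<pi> x = \<sigma> x"
        proof cases
          case 1
          then show ?thesis using fun_cong[OF \<open>perm_restrict \<pi> (C i j) = perm_restrict \<sigma> (C i j)\<close>, of x]
            by (simp add: perm_restrict_def)
        next
          case 2
          then show ?thesis using fun_cong[OF \<open>perm_restrict \<pi> (S - C i j) = perm_restrict \<sigma> (S - C i j)\<close>, of x]
            by (simp add: perm_restrict_def)
        next
          case 3
          then show ?thesis using permutes_not_in[OF pS[OF \<pi>]] permutes_not_in[OF pS[OF \<sigma>]] by simp
        qed
      qed
    qed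
    ultimately show ?case by blast
  qed
  then show ?thesis
    unfolding bij_betw_def inj_on_def NC_def using partition_on_cyc by (auto simp: disc_def image_iff)
qed

section \<open>Annular permutations\<close>

lemma cycle_of_list_upt: "cycle_of_list [a..<b] = csucc {a..<b}"
proof
  fix x
  show "cycle_of_list [a..<b] x = csucc {a..<b} x"
  proof (cases "x \<in> {a..<b}")
    case False
    then have "x \<notin> set [a..<b]" by simp
    then show ?thesis using False id_outside_supp by (metis csucc_def)
  next
    case True
    define k where "k = x - a"
    have k: "k < length [a..<b]" "[a..<b] ! k = x" using True by (auto simp: k_def)
    \<comment> \<open>The cycle of a list moves each entry to the next position, cyclically.\<close>
    have "map (cycle_of_list [a..<b]) [a..<b] = rotate1 [a..<b]"
      using cyclic_rotation[of "[a..<b]" 1] by simp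
    then have "cycle_of_list [a..<b] x = rotate1 [a..<b] ! k" using k by (metis nth_map)
    also have "\<dots> = [a..<b] ! (Suc k mod (b - a))" using k by (simp add: nth_rotate1)
    also have "\<dots> = csucc {a..<b} x"
    proof (cases "Suc x < b")
      case True
      then have "csucc {a..<b} x = Suc x" using \<open>x \<in> {a..<b}\<close> by (intro csucc_next) auto
      then show ?thesis using True \<open>x \<in> {a..<b}\<close> by (simp add: k_def Suc_diff_le)
    next
      case False
      then have xb: "b = Suc x" using True by auto
      have "csucc {a..<b} x = Min {a..<b}" using xb True by (intro csucc_last) auto
      also have "\<dots> = a" using True by (intro Min_eqI) auto
      finally have "csucc {a..<b} x = a" .
      moreover have "Suc k mod (b - a) = 0" using xb True by (simp add: k_def Suc_diff_le)
      ultimately show ?thesis using nth_upt[of a 0 b] True by simp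
    qed
    finally show ?thesis .
  qed
qed

lemma cycles_eq_cyc: "\<pi> permutes {1..k} \<Longrightarrow> cycles k \<pi> = cyc {1..k} \<pi>"
  by (simp add: cycles_def cyc_orbit)

text \<open>Links \<open>partition_join\<close>, which is built with a transitive closure, to
  \<open>conn\<close>: reflexivity at x supplies the missing empty path.\<close>

lemma trancl_image_conn:
  assumes "sym r" "(x, x) \<in> r" shows "r\<^sup>+ `` {x} = conn r `` {x}"
proof -
  have "conn r = r\<^sup>*" using assms(1) by (simp add: conn_def sym_conv_converse_eq)
  moreover have "(x, y) \<in> r\<^sup>+" if "(x, y) \<in> r\<^sup>*" for y
    using rtranclD[OF that] r_into_trancl[OF assms(2)] by blast
  ultimately show ?thesis by (auto intro: trancl_into_rtrancl)
qed

locale two_circles =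
  fixes p q :: nat
  assumes p: "p \<ge> 1" and q: "q \<ge> 1"
begin

abbreviation "Z \<equiv> {1..p}"
abbreviation "Y \<equiv> {p+1..p+q}"
abbreviation "\<gamma> \<equiv> annular_perm p q"

lemma ZY: "Z \<inter> Y = {}" "Z \<union> Y = {1..p+q}" "Z \<noteq> {}" "Y \<noteq> {}" "Z \<noteq> Y"
  using p q by (auto simp: set_eq_iff)

lemma annular_perm_csucc: "\<gamma> = csucc Z \<circ> csucc Y"
proof -
  have "{1..<p+1} = Z" "{p+1..<p+q+1} = Y" by auto
  then show ?thesis unfolding annular_perm_def cycle_of_list_upt by simp
qed

lemma annular_perm_facts:
  "\<gamma> permutes {1..p+q}" "perm_restrict \<gamma> Z = csucc Z" "perm_restrict \<gamma> Y = csucc Y"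
  "\<gamma> ` Z \<subseteq> Z" "\<gamma> ` Y \<subseteq> Y" "cyc {1..p+q} \<gamma> = {Z, Y}"
proof -
  have c: "csucc Z permutes Z" "csucc Y permutes Y" by (auto intro: csucc_permutes)
  note f = combine_perms[OF c ZY(1), folded annular_perm_csucc, unfolded ZY(2)]
  show "\<gamma> permutes {1..p+q}" "perm_restrict \<gamma> Z = csucc Z" "perm_restrict \<gamma> Y = csucc Y"
    "\<gamma> ` Z \<subseteq> Z" "\<gamma> ` Y \<subseteq> Y" by (fact f)+
  have "cyc {1..p+q} \<gamma> = cyc Z (csucc Z) \<union> cyc Y (csucc Y)"
    using cyc_two_blocks[OF f(4,5) ZY(1,3,4)] unfolding ZY(2) f(2,3) .
  then show "cyc {1..p+q} \<gamma> = {Z, Y}" using cyc_csucc[of Z] cyc_csucc[of Y] ZY(3,4) by auto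
qed

text \<open>The join with the cycles of \<gamma> has the components of the two graphs as its blocks,
  since a partition into cycles and the graph of the permutation generate the same
  equivalence.\<close>

lemma S_NC_annulus: "S_NC p q = annulus {1..p+q} \<gamma>"
proof -
  let ?S = "{1..p+q}"
  have "partition_join ?S (cycles (p+q) \<pi>) (cycles (p+q) \<gamma>) = comps ?S (gr ?S \<pi> \<union> gr ?S \<gamma>)"
    if \<pi>: "\<pi> permutes ?S" for \<pi>
  proof -
    let ?r = "\<Union>V\<in>cyc ?S \<pi> \<union> cyc ?S \<gamma>. V \<times> V"
    have r: "?r = prel (cyc ?S \<pi>) \<union> prel (cyc ?S \<gamma>)" by (auto simp: prel_def)
    have "sym ?r" by (auto simp: sym_def)
    moreover have "(x, x) \<in> ?r" if "x \<in> ?S" for x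
      using that partition_onD1[OF partition_on_cyc[OF \<pi>]] by blast
    ultimately have "?r\<^sup>+ `` {x} = conn ?r `` {x}" if "x \<in> ?S" for x
      using that by (intro trancl_image_conn)
    then have "?S // ?r\<^sup>+ = comps ?S ?r" unfolding comps_image quotient_def by blast
    also have "\<dots> = comps ?S (gr ?S \<pi> \<union> gr ?S \<gamma>)"
    proof (rule comps_cong)
      have "conn ?r = conn (gr ?S \<pi> \<union> prel (cyc ?S \<gamma>))"
        unfolding r by (rule conn_Un_cong[OF conn_prel_cyc[OF \<pi>]])
      also have "\<dots> = conn (gr ?S \<gamma> \<union> gr ?S \<pi>)"
        using conn_Un_cong[OF conn_prel_cyc[OF annular_perm_facts(1)]] by (simp add: Un_commute)
      finally show "conn ?r = conn (gr ?S \<pi> \<union> gr ?S \<gamma>)" by (simp add: Un_commute)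
    qed
    finally show ?thesis
      unfolding partition_join_def cycles_eq_cyc[OF \<pi>] cycles_eq_cyc[OF annular_perm_facts(1)] .
  qed
  moreover have "cycles (p+q) (inv \<pi> \<circ> \<gamma>) = cyc ?S (inv \<pi> \<circ> \<gamma>)" if "\<pi> permutes ?S" for \<pi>
    using that annular_perm_facts(1) by (intro cycles_eq_cyc permutes_compose permutes_inv)
  ultimately show ?thesis unfolding S_NC_def annulus_def using cycles_eq_cyc by auto
qed

lemma split_pairs_facts:
  assumes "(U, \<pi>) \<in> split_pairs Z Y \<gamma>"
  defines "P \<equiv> cycles (p+q) \<pi>"
  obtains A B where "\<pi> permutes {1..p+q}" "P = cyc {1..p+q} \<pi>" "P = cyc Z (perm_restrict \<pi> Z) \<union> cyc Y (perm_restrict \<pi> Y)"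
    "A \<in> cyc Z (perm_restrict \<pi> Z)" "B \<in> cyc Y (perm_restrict \<pi> Y)"
    "U = insert (A \<union> B) (P - {A, B})" "merged_left p U P = A" "merged_right p U P = B"
    "A \<subseteq> Z" "B \<subseteq> Y" "A \<noteq> B" "A \<noteq> {}" "B \<noteq> {}" "\<pi> ` Z \<subseteq> Z" "\<pi> ` Y \<subseteq> Y"
proof -
  have \<pi>: "\<pi> permutes (Z \<union> Y)" "\<pi> ` Z \<subseteq> Z" "\<pi> ` Y \<subseteq> Y"
    using assms unfolding split_pairs_def by auto
  have \<pi>': "\<pi> permutes {1..p+q}" using \<pi>(1) ZY(2) by simp
  have P: "P = cyc {1..p+q} \<pi>" unfolding P_def by (rule cycles_eq_cyc[OF \<pi>'])
  have P12: "P = cyc Z (perm_restrict \<pi> Z) \<union> cyc Y (perm_restrict \<pi> Y)"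
    using cyc_two_blocks[OF \<pi>(2,3) ZY(1,3,4)] unfolding ZY(2) P .
  from assms(1) obtain A B where AB: "A \<in> cyc Z (perm_restrict \<pi> Z)" "B \<in> cyc Y (perm_restrict \<pi> Y)"
    "U = insert (A \<union> B) (P - {A, B})"
    unfolding split_pairs_def P ZY(2) by blast
  have pp: "partition_on Z (cyc Z (perm_restrict \<pi> Z))" "partition_on Y (cyc Y (perm_restrict \<pi> Y))"
    using perm_restrict_permutes[OF _ \<pi>(1)] \<pi> by (auto intro!: partition_on_cyc)
  have sub: "A \<subseteq> Z" "B \<subseteq> Y" "A \<noteq> {}" "B \<noteq> {}"
    using AB partition_onD1[OF pp(1)] partition_onD1[OF pp(2)] partition_onD3[OF pp(1)] partition_onD3[OF pp(2)] by blast+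
  then have "A \<noteq> B" using ZY(1) by blast
  then show ?thesis
    using that[OF \<pi>' P P12 AB] merged_eq[OF pp AB(1,2)] AB(3) sub P12 \<pi> by blast
qed

lemma disc_NC:
  "cyc Z ` disc Z (csucc Z) = NC Z" "cyc Y ` disc Y (csucc Y) = NC Y"
  "inj_on (cyc Z) (disc Z (csucc Z))" "inj_on (cyc Y) (disc Y (csucc Y))"
  using bij_betw_disc_NC[OF _ ZY(3)] bij_betw_disc_NC[OF _ ZY(4)] by (simp_all only: bij_betw_def finite_atLeastAtMost simp_thms)

text \<open>\<open>S_NC'\<close> remembers only the cycles; the bijection between disc permutations
  and non-crossing partitions on each circle restores the permutation.\<close>

lemma S_NC'_eq: "S_NC' p q = (\<lambda>(U, \<pi>). (U, cycles (p+q) \<pi>)) ` split_pairs Z Y \<gamma>"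
proof (intro equalityI subsetI)
  fix x assume "x \<in> S_NC' p q"
  then obtain U P P1 P2 A B where x: "x = (U, P)" "P1 \<in> NC Z" "P2 \<in> NC Y" "A \<in> P1" "B \<in> P2"
    "P = P1 \<union> P2" "U = insert (A \<union> B) (P - {A, B})"
    unfolding S_NC'_def by blast
  obtain \<pi>1 where \<pi>1: "P1 = cyc Z \<pi>1" "\<pi>1 \<in> disc Z (csucc Z)"
    using x(2) unfolding disc_NC(1)[symmetric] by (rule imageE)
  obtain \<pi>2 where \<pi>2: "P2 = cyc Y \<pi>2" "\<pi>2 \<in> disc Y (csucc Y)"
    using x(3) unfolding disc_NC(2)[symmetric] by (rule imageE)
  note \<pi>12 = \<pi>1(2) \<pi>1(1)[symmetric] \<pi>2(2) \<pi>2(1)[symmetric]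
  have pp: "\<pi>1 permutes Z" "\<pi>2 permutes Y" using \<pi>12 by (auto simp: disc_def)
  note c = combine_perms[OF pp ZY(1)]
  have P: "cyc (Z \<union> Y) (\<pi>1 \<circ> \<pi>2) = P"
    using cyc_two_blocks[OF c(4,5) ZY(1,3,4)] unfolding c(2,3) \<pi>12(2,4) x(6) .
  then have "(U, \<pi>1 \<circ> \<pi>2) \<in> split_pairs Z Y \<gamma>"
    unfolding split_pairs_def mem_Collect_eq case_prod_conv annular_perm_facts(2,3) c(2,3)
    using c(1,4,5) \<pi>12 x(4,5,7) by blast
  moreover have "P = cycles (p+q) (\<pi>1 \<circ> \<pi>2)" using P c(1) unfolding ZY(2) by (simp add: cycles_eq_cyc)
  ultimately show "x \<in> (\<lambda>(U, \<pi>). (U, cycles (p+q) \<pi>)) ` split_pairs Z Y \<gamma>" using x(1) by force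
next
  fix x assume "x \<in> (\<lambda>(U, \<pi>). (U, cycles (p+q) \<pi>)) ` split_pairs Z Y \<gamma>"
  then obtain U \<pi> where x: "x = (U, cycles (p+q) \<pi>)" "(U, \<pi>) \<in> split_pairs Z Y \<gamma>" by auto
  have "perm_restrict \<pi> Z \<in> disc Z (csucc Z)" "perm_restrict \<pi> Y \<in> disc Y (csucc Y)"
    using x(2) unfolding split_pairs_def annular_perm_facts(2,3) by auto
  then have "cyc Z (perm_restrict \<pi> Z) \<in> NC Z" "cyc Y (perm_restrict \<pi> Y) \<in> NC Y"
    using disc_NC(1,2) by blast+
  moreover obtain A B where "cycles (p+q) \<pi> = cyc Z (perm_restrict \<pi> Z) \<union> cyc Y (perm_restrict \<pi> Y)"
    "A \<in> cyc Z (perm_restrict \<pi> Z)" "B \<in> cyc Y (perm_restrict \<pi> Y)"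
    "U = insert (A \<union> B) (cycles (p+q) \<pi> - {A, B})"
    by (rule split_pairs_facts[OF x(2)])
  ultimately show "x \<in> S_NC' p q"
    unfolding x(1) S_NC'_def mem_Collect_eq case_prod_conv by (intro bexI conjI)
qed

text \<open>On each circle a disc permutation is determined by its cycles, and those are the cycles
  of \<pi> contained in that circle.\<close>

lemma inj_on_split_pairs: "inj_on (\<lambda>(U, \<pi>). (U, cycles (p+q) \<pi>)) (split_pairs Z Y \<gamma>)"
proof -
  have key: "\<pi> = \<sigma>" if \<pi>: "(U, \<pi>) \<in> split_pairs Z Y \<gamma>" and \<sigma>: "(U, \<sigma>) \<in> split_pairs Z Y \<gamma>"
    and eq: "cycles (p+q) \<pi> = cycles (p+q) \<sigma>" for U \<pi> \<sigma>
  proof -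
  have 1: "\<tau> permutes (Z \<union> Y)" "\<tau> ` Z \<subseteq> Z" "\<tau> ` Y \<subseteq> Y"
    "perm_restrict \<tau> Z \<in> disc Z (csucc Z)" "perm_restrict \<tau> Y \<in> disc Y (csucc Y)"
    "cycles (p+q) \<tau> = cyc (Z \<union> Y) \<tau>"
    if "(U, \<tau>) \<in> split_pairs Z Y \<gamma>" for \<tau>
    using that cycles_eq_cyc[of \<tau> "p+q"] unfolding split_pairs_def annular_perm_facts(2,3) ZY(2) by auto
  have YZ: "Y \<inter> Z = {}" using ZY(1) by blast
  have f: "finite Z" "finite Y" by simp_all
  note a = 1[OF \<pi>] and b = 1[OF \<sigma>]
  have "cyc Z (perm_restrict \<pi> Z) = cyc Z (perm_restrict \<sigma> Z)"
    using cyc_restrict_eq[OF f a(1-3) ZY(1,3,4)] cyc_restrict_eq[OF f b(1-3) ZY(1,3,4)] eq a(6) b(6) by simp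
  then have rZ: "perm_restrict \<pi> Z = perm_restrict \<sigma> Z"
    using inj_onD[OF disc_NC(3)] a(4) b(4) by blast
  have "cyc Y (perm_restrict \<pi> Y) = cyc Y (perm_restrict \<sigma> Y)"
    using cyc_restrict_eq[OF f(2,1) a(1)[unfolded Un_commute[of Z Y]] a(3,2) YZ ZY(4,3)]
      cyc_restrict_eq[OF f(2,1) b(1)[unfolded Un_commute[of Z Y]] b(3,2) YZ ZY(4,3)] eq a(6) b(6)
    by (simp add: Un_commute)
  then have rY: "perm_restrict \<pi> Y = perm_restrict \<sigma> Y"
    using inj_onD[OF disc_NC(4)] a(5) b(5) by blast
  show "\<pi> = \<sigma>"
  proof
    fix x
    show "\<pi> x = \<sigma> x"
      using fun_cong[OF rZ, of x] fun_cong[OF rY, of x] permutes_not_in[OF a(1), of x] permutes_not_in[OF b(1), of x]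
      by (cases "x \<in> Z"; cases "x \<in> Y") (simp_all add: perm_restrict_def)
  qed
  qed
  then show ?thesis by (auto simp: inj_on_def)
qed

lemma PS_annular_perm:
  "PS {1..p+q} \<gamma> = (\<lambda>\<pi>. (cycles (p+q) \<pi>, \<pi>)) ` S_NC p q \<union> split_pairs Z Y \<gamma>"
  "(\<lambda>\<pi>. (cycles (p+q) \<pi>, \<pi>)) ` S_NC p q \<inter> split_pairs Z Y \<gamma> = {}"
proof -
  have "(\<lambda>\<pi>. (cycles (p+q) \<pi>, \<pi>)) ` S_NC p q = (\<lambda>\<pi>. (cyc {1..p+q} \<pi>, \<pi>)) ` annulus {1..p+q} \<gamma>"
    unfolding S_NC_annulus by (rule image_cong) (auto simp: annulus_def cycles_eq_cyc)
  then show "PS {1..p+q} \<gamma> = (\<lambda>\<pi>. (cycles (p+q) \<pi>, \<pi>)) ` S_NC p q \<union> split_pairs Z Y \<gamma>"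
    "(\<lambda>\<pi>. (cycles (p+q) \<pi>, \<pi>)) ` S_NC p q \<inter> split_pairs Z Y \<gamma> = {}"
    using PS_two_cycles[OF _ annular_perm_facts(1,6) ZY(5)] by auto
qed

text \<open>F may use the permutation while G sees its cycles only; the premise says that on merged
  pairs the cycles suffice.\<close>

lemma PS_annular_sum:
  fixes F :: "nat set set \<times> (nat \<Rightarrow> nat) \<Rightarrow> 'b::comm_monoid_add"
  assumes "\<And>U \<pi>. (U, \<pi>) \<in> split_pairs Z Y \<gamma> \<Longrightarrow> F (U, \<pi>) = G (U, cycles (p+q) \<pi>)"
  shows "sum F (PS {1..p+q} \<gamma>) = (\<Sum>\<pi>\<in>S_NC p q. F (cycles (p+q) \<pi>, \<pi>)) + sum G (S_NC' p q)"
proof -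
  have fin: "finite (PS {1..p+q} \<gamma>)" by simp
  have "sum F (PS {1..p+q} \<gamma>) = sum F ((\<lambda>\<pi>. (cycles (p+q) \<pi>, \<pi>)) ` S_NC p q) + sum F (split_pairs Z Y \<gamma>)"
    using fin PS_annular_perm(2) unfolding PS_annular_perm(1) finite_Un
    by (intro sum.union_disjoint) simp_all
  also have "sum F ((\<lambda>\<pi>. (cycles (p+q) \<pi>, \<pi>)) ` S_NC p q) = (\<Sum>\<pi>\<in>S_NC p q. F (cycles (p+q) \<pi>, \<pi>))"
    by (subst sum.reindex) (auto simp: inj_on_def)
  also have "sum F (split_pairs Z Y \<gamma>) = sum G (S_NC' p q)"
    unfolding S_NC'_eq using assms by (subst sum.reindex[OF inj_on_split_pairs]) (auto intro!: sum.cong)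
  finally show ?thesis .
qed

end

section \<open>Block weights\<close>

text \<open>A block of a planar pair is one cycle or two merged cycles; the count decides whether it
  carries the first order weight f or the second order weight g.\<close>

definition wt :: "('a set \<Rightarrow> 'b) \<Rightarrow> ('a set \<Rightarrow> 'b) \<Rightarrow> 'a set \<Rightarrow> ('a \<Rightarrow> 'a) \<Rightarrow> 'b" where
  "wt f g V \<sigma> = (if card (cyc V \<sigma>) = 1 then f V else g V)"

lemma wt_cycle:
  assumes "finite S" "\<pi> permutes S" "V \<in> cyc S \<pi>"
  shows "wt f g V (perm_restrict \<pi> V) = f V"
  using cyc_restrict_singleton(2)[OF assms] by (simp add: wt_def)

lemma prod_wt_cyc:
  assumes "finite S" "\<pi> permutes S"
  shows "(\<Prod>V\<in>cyc S \<pi>. wt f g V (perm_restrict \<pi> V)) = (\<Prod>V\<in>cyc S \<pi>. f V)"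
  by (rule prod.cong[OF refl wt_cycle[OF assms]])

lemma cyc_restrict_pair:
  assumes "finite S" "\<pi> permutes S" "A \<in> cyc S \<pi>" "B \<in> cyc S \<pi>"
  shows "cyc (A \<union> B) (perm_restrict \<pi> (A \<union> B)) = {A, B}"
proof -
  note p = partition_on_cyc[OF assms(2)]
  have pAB: "partition_on (A \<union> B) {A, B}"
  proof (rule partition_onI)
    show "{} \<notin> {A, B}" using partition_onD3[OF p] assms(3,4) by auto
    show "disjnt P Q" if "P \<in> {A, B}" "Q \<in> {A, B}" "P \<noteq> Q" for P Q
      using that assms(3,4) partition_on_unique[OF p, of P Q] by (auto simp: disjnt_def)
  qed auto
  have "perm_restrict \<pi> (A \<union> B) ` V \<subseteq> V" if "V \<in> {A, B}" for V
    using that cyc_restrict_singleton(1)[OF assms(1,2)] assms(3,4) by (auto simp: perm_restrict_def)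
  then have "cyc (A \<union> B) (perm_restrict \<pi> (A \<union> B)) =
      (\<Union>V\<in>{A, B}. cyc V (perm_restrict (perm_restrict \<pi> (A \<union> B)) V))"
    by (rule cyc_UN[OF pAB])
  also have "\<dots> = (\<Union>V\<in>{A, B}. {V})"
    using cyc_restrict_singleton(2)[OF assms(1,2)] assms(3,4)
    by (intro SUP_cong refl) (auto simp: perm_restrict_subset)
  also have "\<dots> = {A, B}" by blast
  finally show ?thesis .
qed

lemma prod_wt_merge:
  fixes f g :: "'a set \<Rightarrow> 'b::comm_monoid_mult"
  assumes "finite S" "\<pi> permutes S" "A \<in> cyc S \<pi>" "B \<in> cyc S \<pi>" "A \<noteq> B"
  shows "(\<Prod>V\<in>insert (A \<union> B) (cyc S \<pi> - {A, B}). wt f g V (perm_restrict \<pi> V)) =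
    g (A \<union> B) * (\<Prod>V\<in>cyc S \<pi> - {A, B}. f V)"
proof -
  have "A \<union> B \<notin> cyc S \<pi> - {A, B}"
    using Un_notin_partition[OF partition_on_cyc[OF assms(2)] assms(3-5)] by blast
  then have "(\<Prod>V\<in>insert (A \<union> B) (cyc S \<pi> - {A, B}). wt f g V (perm_restrict \<pi> V)) =
      wt f g (A \<union> B) (perm_restrict \<pi> (A \<union> B)) * (\<Prod>V\<in>cyc S \<pi> - {A, B}. wt f g V (perm_restrict \<pi> V))"
    using assms(1) by (intro prod.insert) auto
  also have "wt f g (A \<union> B) (perm_restrict \<pi> (A \<union> B)) = g (A \<union> B)"
    using cyc_restrict_pair[OF assms(1-4)] assms(5) by (simp add: wt_def)
  also have "(\<Prod>V\<in>cyc S \<pi> - {A, B}. wt f g V (perm_restrict \<pi> V)) = (\<Prod>V\<in>cyc S \<pi> - {A, B}. f V)"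
    by (rule prod.cong[OF refl]) (use wt_cycle[OF assms(1,2)] in auto)
  finally show ?thesis .
qed

lemma PS_disc_sum:
  fixes f g :: "nat set \<Rightarrow> complex"
  assumes "finite S" "S \<noteq> {}"
  shows "(\<Sum>(U, \<pi>)\<in>PS S (csucc S). \<Prod>V\<in>U. wt f g V (perm_restrict \<pi> V)) = (\<Sum>P\<in>NC S. \<Prod>V\<in>P. f V)"
proof -
  have "(\<Sum>(U, \<pi>)\<in>PS S (csucc S). \<Prod>V\<in>U. wt f g V (perm_restrict \<pi> V)) =
      (\<Sum>\<pi>\<in>disc S (csucc S). \<Prod>V\<in>cyc S \<pi>. wt f g V (perm_restrict \<pi> V))"
    unfolding PS_one_cycle[OF assms(1) csucc_permutes[OF assms(1)] cyc_csucc[OF assms]]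
    by (subst sum.reindex) (auto simp: inj_on_def)
  also have "\<dots> = (\<Sum>\<pi>\<in>disc S (csucc S). \<Prod>V\<in>cyc S \<pi>. f V)"
    by (rule sum.cong[OF refl], rule prod_wt_cyc[OF assms(1)]) (auto simp: disc_def)
  also have "\<dots> = (\<Sum>P\<in>NC S. \<Prod>V\<in>P. f V)"
    by (rule sum.reindex_bij_betw[OF bij_betw_disc_NC[OF assms]])
  finally show ?thesis .
qed

text \<open>The right-hand side has the shape of the second order moment-cumulant relation, with f
  and g in place of the cumulants.\<close>

lemma (in two_circles) PS_annular_wt_sum:
  fixes f g :: "nat set \<Rightarrow> complex"
  shows "(\<Sum>(U, \<pi>)\<in>PS {1..p+q} \<gamma>. \<Prod>V\<in>U. wt f g V (perm_restrict \<pi> V)) =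
    (\<Sum>\<pi>\<in>S_NC p q. \<Prod>V\<in>cycles (p+q) \<pi>. f V) +
    (\<Sum>(U, P)\<in>S_NC' p q. g (merged_left p U P \<union> merged_right p U P) *
      (\<Prod>V\<in>P - {merged_left p U P, merged_right p U P}. f V))"
proof -
  let ?F = "\<lambda>(U, \<pi>). \<Prod>V\<in>U. wt f g V (perm_restrict \<pi> V)"
  let ?G = "\<lambda>(U, P). g (merged_left p U P \<union> merged_right p U P) *
      (\<Prod>V\<in>P - {merged_left p U P, merged_right p U P}. f V)"
  have "sum ?F (PS {1..p+q} \<gamma>) = (\<Sum>\<pi>\<in>S_NC p q. ?F (cycles (p+q) \<pi>, \<pi>)) + sum ?G (S_NC' p q)"
  proof (rule PS_annular_sum)
    fix U \<pi> assume "(U, \<pi>) \<in> split_pairs Z Y \<gamma>"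
    then show "?F (U, \<pi>) = ?G (U, cycles (p+q) \<pi>)"
    proof (rule split_pairs_facts)
      fix A B assume *: "\<pi> permutes {1..p+q}" "cycles (p+q) \<pi> = cyc {1..p+q} \<pi>"
        "cycles (p+q) \<pi> = cyc Z (perm_restrict \<pi> Z) \<union> cyc Y (perm_restrict \<pi> Y)"
        "A \<in> cyc Z (perm_restrict \<pi> Z)" "B \<in> cyc Y (perm_restrict \<pi> Y)"
        "U = insert (A \<union> B) (cycles (p+q) \<pi> - {A, B})"
        "merged_left p U (cycles (p+q) \<pi>) = A" "merged_right p U (cycles (p+q) \<pi>) = B" "A \<noteq> B"
      have "A \<in> cyc {1..p+q} \<pi>" "B \<in> cyc {1..p+q} \<pi>" using * by auto
      from prod_wt_merge[OF _ *(1) this *(9), of f g]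
      show ?thesis using *(6-8) by (simp add: *(2))
    qed
  qed
  also have "(\<Sum>\<pi>\<in>S_NC p q. ?F (cycles (p+q) \<pi>, \<pi>)) = (\<Sum>\<pi>\<in>S_NC p q. \<Prod>V\<in>cycles (p+q) \<pi>. f V)"
  proof (rule sum.cong[OF refl])
    fix \<pi> assume "\<pi> \<in> S_NC p q"
    then have "\<pi> permutes {1..p+q}" by (simp add: S_NC_def)
    then show "?F (cycles (p+q) \<pi>, \<pi>) = (\<Prod>V\<in>cycles (p+q) \<pi>. f V)"
      using prod_wt_cyc[of "{1..p+q}" \<pi> f g] by (simp add: cycles_eq_cyc)
  qed
  finally show ?thesis .
qed

section \<open>Relabelling\<close>

text \<open>Conjugation by a map that is injective on S only. It serves to number the doubled points
  and to carry a cycle, or a pair of cycles, to the standard one on an initial interval.\<close>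

definition relabel :: "('a \<Rightarrow> 'b) \<Rightarrow> 'a set \<Rightarrow> ('a \<Rightarrow> 'a) \<Rightarrow> 'b \<Rightarrow> 'b" where
  "relabel f S \<pi> y = (if y \<in> f ` S then f (\<pi> (inv_into S f y)) else y)"

lemma relabel_apply: "inj_on f S \<Longrightarrow> x \<in> S \<Longrightarrow> relabel f S \<pi> (f x) = f (\<pi> x)"
  by (simp add: relabel_def)

lemma relabel_outside: "y \<notin> f ` S \<Longrightarrow> relabel f S \<pi> y = y"
  by (simp add: relabel_def)

lemma relabel_unique:
  assumes "inj_on f S" "\<sigma> permutes f ` S" "\<And>x. x \<in> S \<Longrightarrow> \<sigma> (f x) = f (\<pi> x)"
  shows "relabel f S \<pi> = \<sigma>"
proof
  fix y show "relabel f S \<pi> y = \<sigma> y"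
    using assms relabel_apply[OF assms(1)] relabel_outside[of y f S \<pi>] permutes_not_in[OF assms(2), of y]
    by (cases "y \<in> f ` S") auto
qed

lemma relabel_comp:
  assumes "inj_on f S" "\<sigma> permutes S"
  shows "relabel f S (\<pi> \<circ> \<sigma>) = relabel f S \<pi> \<circ> relabel f S \<sigma>"
proof
  fix y show "relabel f S (\<pi> \<circ> \<sigma>) y = (relabel f S \<pi> \<circ> relabel f S \<sigma>) y"
    using relabel_apply[OF assms(1)] relabel_outside[of y f S] permutes_in_image[OF assms(2)]
    by (cases "y \<in> f ` S") auto
qed

lemma relabel_id: "inj_on f S \<Longrightarrow> relabel f S id = id"
  by (auto simp: relabel_def fun_eq_iff f_inv_into_f)

lemma relabel_inverse:
  assumes "inj_on f S" "\<pi> permutes S"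
  shows "relabel f S \<pi> \<circ> relabel f S (inv \<pi>) = id" "relabel f S (inv \<pi>) \<circ> relabel f S \<pi> = id"
  using relabel_comp[OF assms(1) permutes_inv[OF assms(2)], of \<pi>] relabel_comp[OF assms, of "inv \<pi>"]
    permutes_inv_o[OF assms(2)] relabel_id[OF assms(1)] by simp_all

lemma relabel_permutes:
  assumes "inj_on f S" "\<pi> permutes S" shows "relabel f S \<pi> permutes f ` S"
  unfolding permutes_def
proof (intro conjI allI impI)
  show "relabel f S \<pi> y = y" if "y \<notin> f ` S" for y using that by (rule relabel_outside)
  have "bij (relabel f S \<pi>)" using relabel_inverse[OF assms] by (intro o_bij)
  then show "\<exists>!x. relabel f S \<pi> x = y" for y by (simp add: bij_iff)
qed

lemma relabel_inv:
  assumes "inj_on f S" "\<pi> permutes S" shows "inv (relabel f S \<pi>) = relabel f S (inv \<pi>)"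
  using relabel_inverse[OF assms] by (rule inv_unique_comp)

lemma gr_relabel:
  assumes "inj_on f S" shows "gr (f ` S) (relabel f S \<pi>) = map_prod f f ` gr S \<pi>"
  using relabel_apply[OF assms] by (force simp: gr_def)

lemma prel_image: "prel ((`) f ` U) = map_prod f f ` prel U"
  unfolding prel_def by force

lemma conn_map_image:
  assumes "inj_on f S" "r \<subseteq> S \<times> S" "x \<in> S"
  shows "conn (map_prod f f ` r) `` {f x} = f ` (conn r `` {x})"
proof (intro equalityI subsetI)
  let ?R = "map_prod f f ` r"
  fix z assume "z \<in> conn ?R `` {f x}"
  then have z: "(f x, z) \<in> conn ?R" by simp
  have "?R \<subseteq> f ` S \<times> f ` S" using assms(2) by auto
  from conn_closed[OF this z] have zS: "z \<in> f ` S" using assms(3) by simp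
  from z have "conn r `` {inv_into S f (f x)} = conn r `` {inv_into S f z}"
  proof (rule conn_invariant[rotated])
    fix u v assume "(u, v) \<in> ?R"
    then obtain a b where ab: "(a, b) \<in> r" "u = f a" "v = f b" by auto
    then have "a \<in> S" "b \<in> S" using assms(2) by auto
    then show "conn r `` {inv_into S f u} = conn r `` {inv_into S f v}"
      using ab assms(1) by (simp add: conn_image_eq_iff conn_incl)
  qed
  then have "(x, inv_into S f z) \<in> conn r" using assms by (simp add: conn_image_eq_iff)
  then show "z \<in> f ` (conn r `` {x})" using f_inv_into_f[OF zS] by (metis Image_singleton_iff imageI)
next
  let ?R = "map_prod f f ` r"
  fix z assume "z \<in> f ` (conn r `` {x})"
  then obtain y where y: "(x, y) \<in> conn r" "z = f y" by auto
  from y(1) have "conn ?R `` {f x} = conn ?R `` {f y}"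
  proof (rule conn_invariant[rotated])
    fix u v assume "(u, v) \<in> r"
    then have "(f u, f v) \<in> ?R" by force
    then show "conn ?R `` {f u} = conn ?R `` {f v}" by (simp add: conn_image_eq_iff conn_incl)
  qed
  then show "z \<in> conn ?R `` {f x}" using y(2) by (simp add: conn_image_eq_iff)
qed

lemma comps_map_image:
  assumes "inj_on f S" "r \<subseteq> S \<times> S"
  shows "comps (f ` S) (map_prod f f ` r) = (`) f ` comps S r"
  using conn_map_image[OF assms] unfolding comps_image image_image by (intro image_cong refl) simp

lemma cyc_relabel:
  assumes "inj_on f S" "\<pi> permutes S"
  shows "cyc (f ` S) (relabel f S \<pi>) = (`) f ` cyc S \<pi>"
  unfolding cyc_def gr_relabel[OF assms(1)] by (rule comps_map_image[OF assms(1) gr_subset[OF assms(2)]])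

lemma inj_on_image_Pow: "inj_on f S \<Longrightarrow> inj_on ((`) f) (Pow S)"
  by (rule inj_onI) (auto simp: inj_on_image_eq_iff)

lemma inj_on_image_partition:
  assumes "inj_on f S" "partition_on S U" shows "inj_on ((`) f) U"
  using inj_on_image_Pow[OF assms(1)] by (rule inj_on_subset) (use partition_onD1[OF assms(2)] in auto)

lemma card_cyc_relabel:
  assumes "inj_on f S" "\<pi> permutes S"
  shows "card (cyc (f ` S) (relabel f S \<pi>)) = card (cyc S \<pi>)"
  unfolding cyc_relabel[OF assms]
  by (rule card_image[OF inj_on_image_partition[OF assms(1) partition_on_cyc[OF assms(2)]]])

lemma partition_on_image:
  assumes "inj_on f S" "partition_on S U" shows "partition_on (f ` S) ((`) f ` U)"
proof (rule partition_onI)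
  show "\<Union> ((`) f ` U) = f ` S" using partition_onD1[OF assms(2)] by blast
  show "{} \<notin> (`) f ` U" using partition_onD3[OF assms(2)] by auto
  show "disjnt P Q" if PQ: "P \<in> (`) f ` U" "Q \<in> (`) f ` U" "P \<noteq> Q" for P Q
  proof -
    obtain V W where VW: "V \<in> U" "W \<in> U" "P = f ` V" "Q = f ` W" using PQ by blast
    then have "V \<inter> W = {}" using PQ(3) partition_on_unique[OF assms(2) VW(1,2)] by blast
    moreover have "V \<subseteq> S" "W \<subseteq> S" using VW partition_onD1[OF assms(2)] by auto
    ultimately show ?thesis using VW(3,4) inj_on_image_Int[OF assms(1), of V W] by (simp add: disjnt_def)
  qed
qed

lemma PS_relabel:
  assumes inj: "inj_on f S" and \<gamma>: "\<gamma> permutes S" and mem: "(U, \<pi>) \<in> PS S \<gamma>"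
  shows "((`) f ` U, relabel f S \<pi>) \<in> PS (f ` S) (relabel f S \<gamma>)"
proof -
  have \<pi>: "\<pi> permutes S" and U: "partition_on S U" and le: "gr S \<pi> \<subseteq> prel U"
    and con: "comps S (prel U \<union> gr S \<gamma>) = {S}"
    and eq: "2 * card U + card (cyc S (inv \<pi> \<circ> \<gamma>)) + card (cyc S \<gamma>) = card S + 2 + card (cyc S \<pi>)"
    using mem by (auto simp: PS_def)
  have "prel U \<union> gr S \<gamma> \<subseteq> S \<times> S" using prel_subset[OF U] gr_subset[OF \<gamma>] by blast
  from comps_map_image[OF inj this]
  have "comps (f ` S) (prel ((`) f ` U) \<union> gr (f ` S) (relabel f S \<gamma>)) = {f ` S}"
    unfolding prel_image gr_relabel[OF inj] con by (simp add: image_Un)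
  moreover have "inv (relabel f S \<pi>) \<circ> relabel f S \<gamma> = relabel f S (inv \<pi> \<circ> \<gamma>)"
    using relabel_inv[OF inj \<pi>] relabel_comp[OF inj \<gamma>] by simp
  moreover have "card ((`) f ` U) = card U" by (rule card_image[OF inj_on_image_partition[OF inj U]])
  moreover have "card (f ` S) = card S" by (rule card_image[OF inj])
  moreover have "inv \<pi> \<circ> \<gamma> permutes S" using \<pi> \<gamma> by (intro permutes_compose permutes_inv)
  ultimately show ?thesis
    unfolding PS_def mem_Collect_eq case_prod_conv
    using relabel_permutes[OF inj \<pi>] partition_on_image[OF inj U] image_mono[OF le, of "map_prod f f"] eq
      card_cyc_relabel[OF inj] \<pi> \<gamma> by (simp add: prel_image gr_relabel[OF inj])
qed

lemma relabel_inv_into: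
  assumes "inj_on f S" "\<pi> permutes S"
  shows "relabel (inv_into S f) (f ` S) (relabel f S \<pi>) = \<pi>"
proof (rule relabel_unique)
  show "inj_on (inv_into S f) (f ` S)" by (rule inj_on_inv_into) simp
  show "\<pi> permutes inv_into S f ` f ` S" using assms by simp
  show "\<pi> (inv_into S f y) = inv_into S f (relabel f S \<pi> y)" if "y \<in> f ` S" for y
    using that assms relabel_apply[OF assms(1)] permutes_in_image[OF assms(2)] by auto
qed

lemma bij_betw_PS_relabel:
  assumes inj: "inj_on f S" and \<gamma>: "\<gamma> permutes S"
  shows "bij_betw (\<lambda>(U, \<pi>). ((`) f ` U, relabel f S \<pi>)) (PS S \<gamma>) (PS (f ` S) (relabel f S \<gamma>))"
proof (rule bij_betw_byWitness)
  let ?g = "inv_into S f"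
  let ?j = "\<lambda>(U, \<pi>). ((`) ?g ` U, relabel ?g (f ` S) \<pi>)"
  have ginj: "inj_on ?g (f ` S)" by (rule inj_on_inv_into) simp
  have gS: "?g ` f ` S = S" using inj by simp
  show "\<forall>p\<in>PS S \<gamma>. ?j (case p of (U, \<pi>) \<Rightarrow> ((`) f ` U, relabel f S \<pi>)) = p"
  proof
    fix p assume "p \<in> PS S \<gamma>"
    then obtain U \<pi> where p: "p = (U, \<pi>)" and \<pi>: "\<pi> permutes S" and U: "partition_on S U"
      by (cases p) (auto simp: PS_def)
    have "?g ` f ` V = V" if "V \<in> U" for V
      using that partition_onD1[OF U] inv_into_image_cancel[OF inj] by blast
    then have "(`) ?g ` (`) f ` U = U" by (simp add: image_image[of "(`) ?g"])
    then show "?j (case p of (U, \<pi>) \<Rightarrow> ((`) f ` U, relabel f S \<pi>)) = p"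
      using relabel_inv_into[OF inj \<pi>] unfolding p by simp
  qed
  have fg: "relabel f S (relabel ?g (f ` S) \<pi>) = \<pi>" if "\<pi> permutes f ` S" for \<pi>
  proof (rule relabel_unique[OF inj that])
    fix x assume x: "x \<in> S"
    have "relabel ?g (f ` S) \<pi> (?g (f x)) = ?g (\<pi> (f x))" using x by (intro relabel_apply[OF ginj]) auto
    moreover have "\<pi> (f x) \<in> f ` S" using x permutes_in_image[OF that] by auto
    ultimately show "\<pi> (f x) = f (relabel ?g (f ` S) \<pi> x)" using x inj by (simp add: f_inv_into_f)
  qed
  show "\<forall>p\<in>PS (f ` S) (relabel f S \<gamma>). (case ?j p of (U, \<pi>) \<Rightarrow> ((`) f ` U, relabel f S \<pi>)) = p"
  proof
    fix p assume "p \<in> PS (f ` S) (relabel f S \<gamma>)"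
    then obtain U \<pi> where p: "p = (U, \<pi>)" and \<pi>: "\<pi> permutes f ` S" and U: "partition_on (f ` S) U"
      by (cases p) (auto simp: PS_def)
    have "f ` ?g ` V = V" if "V \<in> U" for V
      using that partition_onD1[OF U] image_inv_into_cancel[of f S "f ` S" V] by blast
    then have "(`) f ` (`) ?g ` U = U" by (simp add: image_image[of "(`) f"])
    then show "(case ?j p of (U, \<pi>) \<Rightarrow> ((`) f ` U, relabel f S \<pi>)) = p"
      using fg[OF \<pi>] unfolding p by simp
  qed
  show "(\<lambda>(U, \<pi>). ((`) f ` U, relabel f S \<pi>)) ` PS S \<gamma> \<subseteq> PS (f ` S) (relabel f S \<gamma>)"
    using PS_relabel[OF inj \<gamma>] by auto
  show "?j ` PS (f ` S) (relabel f S \<gamma>) \<subseteq> PS S \<gamma>"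
    using PS_relabel[OF ginj relabel_permutes[OF inj \<gamma>]] unfolding gS relabel_inv_into[OF inj \<gamma>] by auto
qed

lemma sum_PS_relabel:
  assumes "inj_on f S" "\<gamma> permutes S"
  shows "sum H (PS (f ` S) (relabel f S \<gamma>)) = (\<Sum>(U, \<pi>)\<in>PS S \<gamma>. H ((`) f ` U, relabel f S \<pi>))"
  using sum.reindex_bij_betw[OF bij_betw_PS_relabel[OF assms], of H] by (simp add: case_prod_unfold)

lemma perm_restrict_relabel:
  assumes "inj_on f S" "V \<subseteq> S" "\<pi> ` V \<subseteq> V"
  shows "perm_restrict (relabel f S \<pi>) (f ` V) = relabel f V (perm_restrict \<pi> V)"
proof
  have inj: "inj_on f V" using assms inj_on_subset by blast
  fix y show "perm_restrict (relabel f S \<pi>) (f ` V) y = relabel f V (perm_restrict \<pi> V) y"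
    using relabel_apply[OF assms(1)] relabel_apply[OF inj] relabel_outside[of y f V] assms(2)
    by (cases "y \<in> f ` V") (auto simp: perm_restrict_def subset_iff)
qed

lemma wt_relabel:
  assumes fin: "finite S" and inj: "inj_on f S" and mem: "(U, \<pi>) \<in> PS S \<gamma>"
    and V: "V \<in> U"
  shows "wt F G (f ` V) (perm_restrict (relabel f S \<pi>) (f ` V)) =
    wt (\<lambda>X. F (f ` X)) (\<lambda>X. G (f ` X)) V (perm_restrict \<pi> V)"
proof -
  have \<pi>: "\<pi> permutes S" and U: "partition_on S U" and le: "gr S \<pi> \<subseteq> prel U"
    using mem by (auto simp: PS_def)
  have VS: "V \<subseteq> S" using V partition_onD1[OF U] by blast
  have \<pi>V: "\<pi> ` V \<subseteq> V" using le V gr_subset_prel_iff[OF U] by blast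
  have "perm_restrict \<pi> V permutes V"
    using perm_restrict_permutes[OF _ \<pi> \<pi>V] VS fin finite_subset by blast
  then have "card (cyc (f ` V) (perm_restrict (relabel f S \<pi>) (f ` V))) = card (cyc V (perm_restrict \<pi> V))"
    unfolding perm_restrict_relabel[OF inj VS \<pi>V] using inj VS
    by (intro card_cyc_relabel) (auto intro: inj_on_subset)
  then show ?thesis by (simp add: wt_def)
qed

lemma prod_wt_relabel:
  fixes F G :: "'b set \<Rightarrow> 'c::comm_monoid_mult"
  assumes "finite S" "inj_on f S" "(U, \<pi>) \<in> PS S \<gamma>"
  shows "(\<Prod>V\<in>(`) f ` U. wt F G V (perm_restrict (relabel f S \<pi>) V)) =
    (\<Prod>V\<in>U. wt (\<lambda>X. F (f ` X)) (\<lambda>X. G (f ` X)) V (perm_restrict \<pi> V))"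
proof -
  have U: "partition_on S U" using assms by (auto simp: PS_def)
  show ?thesis
    unfolding prod.reindex[OF inj_on_image_partition[OF assms(2) U]] comp_def
    by (rule prod.cong[OF refl]) (erule wt_relabel[OF assms])
qed

lemma dbl_relabel:
  assumes inj: "inj_on f S" and fin: "finite S" and \<gamma>: "\<gamma> permutes S"
  shows "relabel (map_prod f id) (dset S) (dbl S \<gamma>) = dbl (f ` S) (relabel f S \<gamma>)"
proof (rule relabel_unique)
  show "inj_on (map_prod f id) (dset S)" using inj by (auto simp: inj_on_def)
  have "map_prod f id ` dset S = dset (f ` S)" by force
  then show "dbl (f ` S) (relabel f S \<gamma>) permutes map_prod f id ` dset S"
    using dbl_permutes[OF _ relabel_permutes[OF inj \<gamma>]] fin by simp
  fix z assume "z \<in> dset S"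
  then show "dbl (f ` S) (relabel f S \<gamma>) (map_prod f id z) = map_prod f id (dbl S \<gamma> z)"
    using relabel_apply[OF inj] by (cases z) (auto simp: dbl_def)
qed

lemma sep_relabel:
  assumes "inj_on f S" "finite S" "L permutes dset S"
  shows "sep (f ` S) (relabel (map_prod f id) (dset S) L) \<longleftrightarrow> sep S L"
proof -
  have inj: "inj_on (map_prod f id) (dset S)" using assms(1) by (auto simp: inj_on_def)
  have img: "dset (f ` S) = map_prod f id ` dset S" by force
  have "((f x, True), (f y, True)) \<in> conn (gr (dset (f ` S)) (relabel (map_prod f id) (dset S) L)) \<longleftrightarrow>
      ((x, True), (y, True)) \<in> conn (gr (dset S) L)" if "x \<in> S" "y \<in> S" for x y
  proof -
    have sub: "conn (gr (dset S) L) `` {(x, True)} \<subseteq> dset S"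
      using conn_closed[OF gr_subset[OF assms(3)]] that by blast
    have "conn (gr (dset (f ` S)) (relabel (map_prod f id) (dset S) L)) `` {map_prod f id (x, True)} =
        map_prod f id ` (conn (gr (dset S) L) `` {(x, True)})"
      unfolding img gr_relabel[OF inj] using that by (intro conn_map_image[OF inj gr_subset[OF assms(3)]]) auto
    moreover have "map_prod f id (y, True) \<in> map_prod f id ` (conn (gr (dset S) L) `` {(x, True)}) \<longleftrightarrow>
        (y, True) \<in> conn (gr (dset S) L) `` {(x, True)}"
      using that sub by (intro inj_on_image_mem_iff[OF inj]) auto
    ultimately have "map_prod f id (y, True) \<in> conn (gr (dset (f ` S)) (relabel (map_prod f id) (dset S) L)) `` {map_prod f id (x, True)}
        \<longleftrightarrow> (y, True) \<in> conn (gr (dset S) L) `` {(x, True)}" by (simp only:)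
    then show ?thesis by simp
  qed
  then show ?thesis using assms(1) by (auto simp: sep_def inj_on_eq_iff)
qed

section \<open>The sum over colourings\<close>

text \<open>E collects the factors \<open>ab + ba\<close> from which \<open>ab\<close> is taken, and
  \<open>True\<close> stands for the letter a. The odd point of a factor is its first letter and the
  even point its second.\<close>

definition col :: "'a set \<Rightarrow> 'a \<times> bool \<Rightarrow> bool" where
  "col E = (\<lambda>(x, s). (x \<in> E) \<noteq> s)"

text \<open>The vanishing of mixed cumulants as a weight: u for a block all in a, v for a block all
  in b, and 0 otherwise. Blocks are non-empty, so the first two cases exclude each other
  there.\<close>

definition mono_weight :: "('c \<Rightarrow> bool) \<Rightarrow> 'c set \<Rightarrow> complex \<Rightarrow> complex \<Rightarrow> complex" where
  "mono_weight c X u v = (if \<forall>z\<in>X. c z then u else if \<forall>z\<in>X. \<not> c z then v else 0)"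

lemma mono_weight_image: "mono_weight c (f ` X) u v = mono_weight (\<lambda>x. c (f x)) X u v"
  by (simp add: mono_weight_def)

lemma mono_weight_cong: "(\<And>z. z \<in> X \<Longrightarrow> c z = d z) \<Longrightarrow> mono_weight c X u v = mono_weight d X u v"
  by (simp add: mono_weight_def)

text \<open>A subset of S amounts to a subset of every block, so the sum distributes over the
  product.\<close>

lemma sum_Pow_prod:
  fixes h :: "'a set \<Rightarrow> 'a set \<Rightarrow> complex"
  assumes fin: "finite S" and p: "partition_on S \<V>"
  shows "(\<Sum>E\<in>Pow S. \<Prod>V\<in>\<V>. h V (E \<inter> V)) = (\<Prod>V\<in>\<V>. \<Sum>E\<in>Pow V. h V E)"
proof -
  have S: "S = \<Union>\<V>" using partition_onD1[OF p] .
  have "(\<Prod>V\<in>\<V>. \<Sum>E\<in>Pow V. h V E) = (\<Sum>g\<in>PiE \<V> Pow. \<Prod>V\<in>\<V>. h V (g V))"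
    using finite_elements[OF fin p] fin S by (intro prod_sum_PiE) (auto intro: finite_subset)
  also have "\<dots> = (\<Sum>E\<in>Pow S. \<Prod>V\<in>\<V>. h V (E \<inter> V))"
  proof (rule sum.reindex_bij_witness[of _ "\<lambda>E. \<lambda>V\<in>\<V>. E \<inter> V" "\<lambda>g. \<Union>V\<in>\<V>. g V"])
    fix g assume g: "g \<in> PiE \<V> Pow"
    have gV: "(\<Union>W\<in>\<V>. g W) \<inter> V = g V" if V: "V \<in> \<V>" for V
    proof (intro equalityI subsetI)
      fix x assume "x \<in> (\<Union>W\<in>\<V>. g W) \<inter> V"
      then obtain W where W: "W \<in> \<V>" "x \<in> g W" "x \<in> V" by blast
      then have "x \<in> W" using g by blast
      then have "W = V" using partition_on_unique[OF p] W V by blast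
      then show "x \<in> g V" using W by simp
    qed (use V g in blast)
    show "(\<lambda>V\<in>\<V>. (\<Union>V\<in>\<V>. g V) \<inter> V) = g"
      by (rule extensionalityI[of _ \<V>]) (use g gV in \<open>auto simp: PiE_def\<close>)
    show "(\<Union>V\<in>\<V>. g V) \<in> Pow S" using g S by blast
    show "(\<Prod>V\<in>\<V>. h V ((\<Union>V\<in>\<V>. g V) \<inter> V)) = (\<Prod>V\<in>\<V>. h V (g V))"
      by (rule prod.cong[OF refl]) (simp add: gV)
  next
    fix E assume E: "E \<in> Pow S"
    show "(\<Union>V\<in>\<V>. (\<lambda>V\<in>\<V>. E \<inter> V) V) = E" using E S by auto
    show "(\<lambda>V\<in>\<V>. E \<inter> V) \<in> PiE \<V> Pow" by auto
  qed
  finally show ?thesis by simp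
qed

text \<open>Arbitrary numbers stand for the cumulants of a (\<alpha>) and of b (\<beta>), which
  keeps the regrouping independent of the algebra.\<close>

locale weights =
  fixes \<alpha> \<beta> :: "nat \<Rightarrow> complex" and \<alpha>2 \<beta>2 :: "nat \<Rightarrow> nat \<Rightarrow> complex"
begin

definition w1 :: "('c \<Rightarrow> bool) \<Rightarrow> 'c set \<Rightarrow> complex" where
  "w1 c X = mono_weight c X (\<alpha> (card X)) (\<beta> (card X))"

text \<open>Z marks the first circle, so the two cycles merged in a block X are recovered as
  \<open>X \<inter> Z\<close> and \<open>X - Z\<close>.\<close>

definition w2 :: "('c \<Rightarrow> bool) \<Rightarrow> 'c set \<Rightarrow> 'c set \<Rightarrow> complex" where
  "w2 c Z X = mono_weight c X (\<alpha>2 (card (X \<inter> Z)) (card (X - Z))) (\<beta>2 (card (X \<inter> Z)) (card (X - Z)))"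

definition block_prod :: "('c \<Rightarrow> bool) \<Rightarrow> 'c set \<Rightarrow> 'c set set \<times> ('c \<Rightarrow> 'c) \<Rightarrow> complex" where
  "block_prod c Z = (\<lambda>(U, \<pi>). \<Prod>V\<in>U. wt (w1 c) (w2 c Z) V (perm_restrict \<pi> V))"

text \<open>The candidate for the cumulant of \<open>ab + ba\<close> that belongs to \<gamma>: of
  first order if \<gamma> is one cycle on S, of second order if it is two cycles separated by
  Z.\<close>

definition theta :: "'a set \<Rightarrow> ('a \<Rightarrow> 'a) \<Rightarrow> 'a set \<Rightarrow> complex" where
  "theta S \<gamma> Z = (\<Sum>E\<in>Pow S. sum (block_prod (col E) (dset Z)) (PSsep S \<gamma>))"

lemma w_image:
  assumes "inj_on f S" "X \<subseteq> S" "\<And>x. x \<in> S \<Longrightarrow> f x \<in> Z' \<longleftrightarrow> x \<in> Z"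
  shows "w1 c (f ` X) = w1 (\<lambda>x. c (f x)) X" and "w2 c Z' (f ` X) = w2 (\<lambda>x. c (f x)) Z X"
proof -
  have inj: "inj_on f X" using assms inj_on_subset by blast
  show "w1 c (f ` X) = w1 (\<lambda>x. c (f x)) X" by (simp add: w1_def card_image[OF inj] mono_weight_image)
  have "f ` X \<inter> Z' = f ` (X \<inter> Z)" "f ` X - Z' = f ` (X - Z)" using assms(2,3) by auto
  moreover have "card (f ` (X \<inter> Z)) = card (X \<inter> Z)" "card (f ` (X - Z)) = card (X - Z)"
    by (rule card_image[OF inj_on_subset[OF inj]], blast)+
  ultimately show "w2 c Z' (f ` X) = w2 (\<lambda>x. c (f x)) Z X" by (simp add: w2_def mono_weight_image)
qed

lemma w_cong:
  assumes "\<And>x. x \<in> X \<Longrightarrow> c x = d x"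
  shows "w1 c X = w1 d X" and "w2 c Z X = w2 d Z X"
  using mono_weight_cong[OF assms] by (simp_all add: w1_def w2_def)

lemma block_prod_cong:
  assumes "(U, \<pi>) \<in> PS S \<gamma>" "\<And>x. x \<in> S \<Longrightarrow> c x = d x"
  shows "block_prod c Z (U, \<pi>) = block_prod d Z (U, \<pi>)"
proof -
  have U: "partition_on S U" using assms(1) by (auto simp: PS_def)
  have "w1 c V = w1 d V" "w2 c Z V = w2 d Z V" if "V \<in> U" for V
    using that partition_onD1[OF U] assms(2) by (auto intro!: w_cong)
  then show ?thesis
    unfolding block_prod_def case_prod_conv by (intro prod.cong refl) (simp add: wt_def)
qed

lemma block_prod_relabel:
  assumes "finite S" "inj_on f S" "(U, \<pi>) \<in> PS S \<gamma>" "\<And>x. x \<in> S \<Longrightarrow> f x \<in> Z' \<longleftrightarrow> x \<in> Z"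
  shows "block_prod c Z' ((`) f ` U, relabel f S \<pi>) = block_prod (\<lambda>x. c (f x)) Z (U, \<pi>)"
proof -
  have U: "partition_on S U" using assms(3) by (auto simp: PS_def)
  have "w1 c (f ` V) = w1 (\<lambda>x. c (f x)) V" "w2 c Z' (f ` V) = w2 (\<lambda>x. c (f x)) Z V" if "V \<in> U" for V
    using that partition_onD1[OF U] by (auto intro!: w_image[OF assms(2) _ assms(4)])
  then show ?thesis
    unfolding block_prod_def case_prod_conv prod_wt_relabel[OF assms(1-3)]
    by (intro prod.cong refl) (simp add: wt_def)
qed

text \<open>The weights see only sizes, colours and membership in Z. An injection transports all of
  these, so theta need only be known for standard cycles.\<close>

lemma theta_relabel:
  assumes fin: "finite S" and inj: "inj_on f S" and \<gamma>: "\<gamma> permutes S"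
    and Z: "\<And>x. x \<in> S \<Longrightarrow> f x \<in> Z' \<longleftrightarrow> x \<in> Z"
  shows "theta (f ` S) (relabel f S \<gamma>) Z' = theta S \<gamma> Z"
proof -
  let ?f = "map_prod f id :: _ \<times> bool \<Rightarrow> _"
  have injd: "inj_on ?f (dset S)" using inj by (auto simp: inj_on_def)
  have img: "dset (f ` S) = ?f ` dset S" by force
  have d: "dbl S \<gamma> permutes dset S" using fin \<gamma> by (rule dbl_permutes)
  have dr: "dbl (f ` S) (relabel f S \<gamma>) = relabel ?f (dset S) (dbl S \<gamma>)"
    by (rule dbl_relabel[OF inj fin \<gamma>, symmetric])
  have Zd: "?f z \<in> dset Z' \<longleftrightarrow> z \<in> dset Z" if "z \<in> dset S" for z
    using that Z by (cases z) auto
  have PSs: "sum H (PSsep (f ` S) (relabel f S \<gamma>)) = (\<Sum>(U, \<pi>)\<in>PSsep S \<gamma>. H ((`) ?f ` U, relabel ?f (dset S) \<pi>))"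
    for H :: "('b \<times> bool) set set \<times> ('b \<times> bool \<Rightarrow> 'b \<times> bool) \<Rightarrow> complex"
  proof -
    let ?Q = "\<lambda>p. sep (f ` S) (inv (snd p) \<circ> dbl (f ` S) (relabel f S \<gamma>))"
    have "PSsep (f ` S) (relabel f S \<gamma>) = {p \<in> PS (?f ` dset S) (relabel ?f (dset S) (dbl S \<gamma>)). ?Q p}"
      unfolding PSsep_def dr img by auto
    then have "sum H (PSsep (f ` S) (relabel f S \<gamma>)) =
        (\<Sum>p\<in>PS (?f ` dset S) (relabel ?f (dset S) (dbl S \<gamma>)). if ?Q p then H p else 0)"
      using fin by (simp add: sum.inter_filter)
    also have "\<dots> = (\<Sum>(U, \<pi>)\<in>PS (dset S) (dbl S \<gamma>). if ?Q ((`) ?f ` U, relabel ?f (dset S) \<pi>)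
        then H ((`) ?f ` U, relabel ?f (dset S) \<pi>) else 0)"
      by (subst sum_PS_relabel[OF injd d]) simp
    also have "\<dots> = (\<Sum>(U, \<pi>)\<in>PS (dset S) (dbl S \<gamma>). if sep S (inv \<pi> \<circ> dbl S \<gamma>)
        then H ((`) ?f ` U, relabel ?f (dset S) \<pi>) else 0)"
    proof (intro sum.cong refl, clarify)
      fix U \<pi> assume "(U, \<pi>) \<in> PS (dset S) (dbl S \<gamma>)"
      then have \<pi>: "\<pi> permutes dset S" by (simp add: PS_def)
      have "inv (relabel ?f (dset S) \<pi>) \<circ> dbl (f ` S) (relabel f S \<gamma>) = relabel ?f (dset S) (inv \<pi> \<circ> dbl S \<gamma>)"
        unfolding dr relabel_inv[OF injd \<pi>] relabel_comp[OF injd d] ..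
      moreover have "inv \<pi> \<circ> dbl S \<gamma> permutes dset S" using d \<pi> by (intro permutes_compose permutes_inv)
      ultimately show "(if ?Q ((`) ?f ` U, relabel ?f (dset S) \<pi>) then H ((`) ?f ` U, relabel ?f (dset S) \<pi>) else 0) =
        (if sep S (inv \<pi> \<circ> dbl S \<gamma>) then H ((`) ?f ` U, relabel ?f (dset S) \<pi>) else 0)"
        using sep_relabel[OF inj fin] by simp
    qed
    also have "\<dots> = (\<Sum>(U, \<pi>)\<in>PSsep S \<gamma>. H ((`) ?f ` U, relabel ?f (dset S) \<pi>))"
    proof -
      have "PSsep S \<gamma> = {p \<in> PS (dset S) (dbl S \<gamma>). sep S (inv (snd p) \<circ> dbl S \<gamma>)}" by (auto simp: PSsep_def)
      then show ?thesis using fin by (simp add: sum.inter_filter case_prod_unfold)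
    qed
    finally show ?thesis .
  qed
  have "theta (f ` S) (relabel f S \<gamma>) Z' =
      (\<Sum>E\<in>Pow S. sum (block_prod (col (f ` E)) (dset Z')) (PSsep (f ` S) (relabel f S \<gamma>)))"
    unfolding theta_def image_Pow_surj[OF refl, of f S, symmetric]
    by (subst sum.reindex[OF inj_on_image_Pow[OF inj]]) simp
  also have "\<dots> = theta S \<gamma> Z"
    unfolding theta_def PSs
  proof (intro sum.cong refl, clarify)
    fix E U \<pi> assume E: "E \<subseteq> S" and mem: "(U, \<pi>) \<in> PSsep S \<gamma>"
    have m: "(U, \<pi>) \<in> PS (dset S) (dbl S \<gamma>)" using mem PSsep_subset by blast
    have "block_prod (col (f ` E)) (dset Z') ((`) ?f ` U, relabel ?f (dset S) \<pi>) =
        block_prod (\<lambda>z. col (f ` E) (?f z)) (dset Z) (U, \<pi>)"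
      using fin by (intro block_prod_relabel[OF _ injd m Zd]) auto
    also have "\<dots> = block_prod (col E) (dset Z) (U, \<pi>)"
    proof (rule block_prod_cong[OF m])
      fix z assume "z \<in> dset S"
      then show "col (f ` E) (?f z) = col E z"
        using inj_on_image_mem_iff[OF inj _ E] by (cases z) (auto simp: col_def)
    qed
    finally show "block_prod (col (f ` E)) (dset Z') ((`) ?f ` U, relabel ?f (dset S) \<pi>) = block_prod (col E) (dset Z) (U, \<pi>)" .
  qed
  finally show ?thesis .
qed

text \<open>For a fixed colouring this is \<open>PS_double_sum\<close>. Colourings of S are
  independent choices on the blocks of U, so summing over them turns each factor into theta.\<close>

theorem double_moment:
  assumes fin: "finite S" and \<gamma>: "\<gamma> permutes S"
  shows "(\<Sum>E\<in>Pow S. sum (block_prod (col E) (dset Z)) (PS (dset S) (dbl S \<gamma>))) =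
    (\<Sum>(U, \<tau>)\<in>PS S \<gamma>. \<Prod>V\<in>U. theta V (perm_restrict \<tau> V) Z)"
proof -
  define h where "h \<tau> V E = sum (block_prod (col E) (dset Z)) (PSsep V (perm_restrict \<tau> V))" for \<tau> V E
  have "sum (block_prod (col E) (dset Z)) (PS (dset S) (dbl S \<gamma>)) = (\<Sum>(U, \<tau>)\<in>PS S \<gamma>. \<Prod>V\<in>U. h \<tau> V E)" for E
    unfolding block_prod_def h_def by (rule PS_double_sum[OF fin \<gamma>])
  then have "(\<Sum>E\<in>Pow S. sum (block_prod (col E) (dset Z)) (PS (dset S) (dbl S \<gamma>))) =
      (\<Sum>(U, \<tau>)\<in>PS S \<gamma>. \<Sum>E\<in>Pow S. \<Prod>V\<in>U. h \<tau> V E)"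
    by (simp add: case_prod_unfold sum.swap[of _ "PS S \<gamma>"])
  also have "\<dots> = (\<Sum>(U, \<tau>)\<in>PS S \<gamma>. \<Prod>V\<in>U. theta V (perm_restrict \<tau> V) Z)"
  proof (intro sum.cong refl, clarify)
    fix U \<tau> assume "(U, \<tau>) \<in> PS S \<gamma>"
    then have U: "partition_on S U" by (simp add: PS_def)
    \<comment> \<open>The factor of the block V sees only the colours of points over V.\<close>
    have hV: "h \<tau> V E = h \<tau> V (E \<inter> V)" for V E
      unfolding h_def
    proof (intro sum.cong refl)
      fix p assume "p \<in> PSsep V (perm_restrict \<tau> V)"
      then have "(fst p, snd p) \<in> PS (dset V) (dbl V (perm_restrict \<tau> V))" using PSsep_subset by auto
      then have "block_prod (col E) (dset Z) (fst p, snd p) = block_prod (col (E \<inter> V)) (dset Z) (fst p, snd p)"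
        by (rule block_prod_cong) (auto simp: col_def)
      then show "block_prod (col E) (dset Z) p = block_prod (col (E \<inter> V)) (dset Z) p" by simp
    qed
    have "(\<Sum>E\<in>Pow S. \<Prod>V\<in>U. h \<tau> V E) = (\<Sum>E\<in>Pow S. \<Prod>V\<in>U. h \<tau> V (E \<inter> V))"
      by (intro sum.cong prod.cong refl) (rule hV)
    also have "\<dots> = (\<Prod>V\<in>U. \<Sum>E\<in>Pow V. h \<tau> V E)" by (rule sum_Pow_prod[OF fin U])
    finally show "(\<Sum>E\<in>Pow S. \<Prod>V\<in>U. h \<tau> V E) = (\<Prod>V\<in>U. theta V (perm_restrict \<tau> V) Z)"
      by (simp add: theta_def h_def)
  qed
  finally show ?thesis .
qed

end

section \<open>Moment-cumulant relations over planar partitioned permutations\<close>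

lemma support_orbit:
  assumes "permutation \<pi>"
  shows "distinct (support \<pi> x)" "set (support \<pi> x) = orbit \<pi> x"
  using cycle_of_permutation[OF assms] support_set[OF assms, of x] orbit_altdef_permutation[OF assms, of x]
  by auto

text \<open>Meant for arguments whose cumulants depend only on the set of positions: words in a and
  b, where mixed cumulants vanish, and powers of a single element.\<close>

lemma moment_PS:
  fixes as :: "'a::ring_1 list" and F G :: "nat set \<Rightarrow> complex"
  assumes ne: "as \<noteq> []"
    and F: "\<And>is. is \<noteq> [] \<Longrightarrow> distinct is \<Longrightarrow> set is \<subseteq> {1..length as} \<Longrightarrow> free_cumulant \<phi> (pick as is) = F (set is)"
  shows "\<phi> (prod_list as) =
    (\<Sum>(U, \<pi>)\<in>PS {1..length as} (csucc {1..length as}). \<Prod>V\<in>U. wt F G V (perm_restrict \<pi> V))"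
proof -
  let ?S = "{1..length as}"
  have S: "?S \<noteq> {}" using ne by (auto simp: Suc_le_eq)
  have "\<phi> (prod_list as) = (\<Sum>P\<in>NC ?S. \<Prod>V\<in>P. free_cumulant \<phi> (pick as (sorted_list_of_set V)))"
    by (rule moment_cumulant[OF ne])
  also have "\<dots> = (\<Sum>P\<in>NC ?S. \<Prod>V\<in>P. F V)"
  proof (intro sum.cong prod.cong refl)
    fix P V assume P: "P \<in> NC ?S" and V: "V \<in> P"
    then have p: "partition_on ?S P" by (simp add: NC_def)
    have VS: "V \<subseteq> ?S" "V \<noteq> {}" using V partition_onD1[OF p] partition_onD3[OF p] by auto
    then have "finite V" using finite_subset by blast
    then show "free_cumulant \<phi> (pick as (sorted_list_of_set V)) = F V"
      using F[of "sorted_list_of_set V"] VS by auto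
  qed
  also have "\<dots> = (\<Sum>(U, \<pi>)\<in>PS ?S (csucc ?S). \<Prod>V\<in>U. wt F G V (perm_restrict \<pi> V))"
    by (rule PS_disc_sum[symmetric]) (use S in auto)
  finally show ?thesis .
qed

text \<open>A cycle of an annular permutation is listed in its own cyclic order, which need not be
  increasing, so F has to give the cumulant of every distinct list with a given set of
  positions.\<close>

lemma moment2_PS:
  fixes as bs :: "'a::ring_1 list" and F G :: "nat set \<Rightarrow> complex"
  assumes ne: "as \<noteq> []" "bs \<noteq> []"
  defines "p \<equiv> length as" and "q \<equiv> length bs"
  assumes F: "\<And>is. is \<noteq> [] \<Longrightarrow> distinct is \<Longrightarrow> set is \<subseteq> {1..p+q} \<Longrightarrow> free_cumulant \<phi> (pick (as @ bs) is) = F (set is)"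
    and G: "\<And>is js. is \<noteq> [] \<Longrightarrow> js \<noteq> [] \<Longrightarrow> distinct is \<Longrightarrow> distinct js \<Longrightarrow> set is \<subseteq> {1..p} \<Longrightarrow> set js \<subseteq> {p+1..p+q} \<Longrightarrow>
      second_order_cumulant \<phi> \<phi>2 (pick (as @ bs) is) (pick (as @ bs) js) = G (set is \<union> set js)"
  shows "\<phi>2 (prod_list as) (prod_list bs) =
    (\<Sum>(U, \<pi>)\<in>PS {1..p+q} (annular_perm p q). \<Prod>V\<in>U. wt F G V (perm_restrict \<pi> V))"
proof -
  interpret two_circles p q by unfold_locales (use ne in \<open>auto simp: p_def q_def Suc_le_eq\<close>)
  have "annular_cumulant_sum \<phi> as bs = (\<Sum>\<pi>\<in>S_NC p q. \<Prod>V\<in>cycles (p+q) \<pi>. F V)"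
    unfolding annular_cumulant_sum_def p_def[symmetric] q_def[symmetric]
  proof (intro sum.cong prod.cong refl)
    fix \<pi> V assume "\<pi> \<in> S_NC p q" and V: "V \<in> cycles (p+q) \<pi>"
    then have \<pi>: "\<pi> permutes {1..p+q}" by (simp add: S_NC_def)
    then have perm: "permutation \<pi>" using permutation_permutes by blast
    note pp = partition_on_cyc[OF \<pi>]
    have VS: "V \<subseteq> {1..p+q}" "V \<noteq> {}"
      using V partition_onD1[OF pp] partition_onD3[OF pp] cycles_eq_cyc[OF \<pi>] by auto
    then have "finite V" using finite_subset by blast
    then have m: "Min V \<in> V" using VS by simp
    have "V = orbit \<pi> (Min V)"
    proof -
      obtain x where "V = conn (gr {1..p+q} \<pi>) `` {x}"
        using V cycles_eq_cyc[OF \<pi>] by (auto simp: cyc_def comps_iff)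
      then have "V = conn (gr {1..p+q} \<pi>) `` {Min V}"
        using m by (metis Image_singleton_iff conn_image_eq_iff)
      then show ?thesis using conn_gr_orbit[of "{1..p+q}" \<pi>] \<pi> by simp
    qed
    then show "free_cumulant \<phi> (pick (as @ bs) (support \<pi> (Min V))) = F V"
      using F[of "support \<pi> (Min V)"] support_orbit[OF perm, of "Min V"] VS
      by (metis empty_set)
  qed
  moreover have "(\<Sum>(U, P)\<in>S_NC' p q.
      second_order_cumulant \<phi> \<phi>2
        (pick (as @ bs) (sorted_list_of_set (merged_left p U P)))
        (pick (as @ bs) (sorted_list_of_set (merged_right p U P))) *
      (\<Prod>V\<in>P - {merged_left p U P, merged_right p U P}.
        free_cumulant \<phi> (pick (as @ bs) (sorted_list_of_set V)))) =
    (\<Sum>(U, P)\<in>S_NC' p q. G (merged_left p U P \<union> merged_right p U P) *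
      (\<Prod>V\<in>P - {merged_left p U P, merged_right p U P}. F V))"
  proof (intro sum.cong refl, clarify)
    fix U P assume "(U, P) \<in> S_NC' p q"
    then obtain \<pi> where P: "P = cycles (p+q) \<pi>" and \<pi>: "(U, \<pi>) \<in> split_pairs Z Y \<gamma>"
      unfolding S_NC'_eq by auto
    obtain A B where *: "\<pi> permutes {1..p+q}" "P = cyc {1..p+q} \<pi>"
      "merged_left p U P = A" "merged_right p U P = B" "A \<subseteq> Z" "B \<subseteq> Y" "A \<noteq> {}" "B \<noteq> {}"
      unfolding P by (rule split_pairs_facts[OF \<pi>])
    note pp = partition_on_cyc[OF *(1)]
    have fin: "finite A" "finite B" using *(5,6) finite_subset by blast+
    have "second_order_cumulant \<phi> \<phi>2 (pick (as @ bs) (sorted_list_of_set A)) (pick (as @ bs) (sorted_list_of_set B)) = G (A \<union> B)"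
      using G[of "sorted_list_of_set A" "sorted_list_of_set B"] * fin by simp
    moreover have "free_cumulant \<phi> (pick (as @ bs) (sorted_list_of_set V)) = F V" if "V \<in> P" for V
    proof -
      have VS: "V \<subseteq> {1..p+q}" "V \<noteq> {}"
        using that *(2) partition_onD1[OF pp] partition_onD3[OF pp] by auto
      then have "finite V" using finite_subset by blast
      then show ?thesis using F[of "sorted_list_of_set V"] VS by auto
    qed
    ultimately show "second_order_cumulant \<phi> \<phi>2
        (pick (as @ bs) (sorted_list_of_set (merged_left p U P)))
        (pick (as @ bs) (sorted_list_of_set (merged_right p U P))) *
      (\<Prod>V\<in>P - {merged_left p U P, merged_right p U P}.
        free_cumulant \<phi> (pick (as @ bs) (sorted_list_of_set V))) =
      G (merged_left p U P \<union> merged_right p U P) *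
      (\<Prod>V\<in>P - {merged_left p U P, merged_right p U P}. F V)"
      unfolding *(3,4) by simp
  qed
  ultimately show ?thesis
    using second_order_moment_cumulant[OF ne, of \<phi>2 \<phi>] PS_annular_wt_sum[of F G]
    unfolding p_def[symmetric] q_def[symmetric] by simp
qed

section \<open>Isolating the top term\<close>

lemma full_in_PS:
  assumes "finite S" "S \<noteq> {}" "\<gamma> permutes S" shows "({S}, \<gamma>) \<in> PS S \<gamma>"
proof -
  have "comps S (prel {S} \<union> gr S \<gamma>) = {S}"
  proof (rule comps_singletonI)
    show "prel {S} \<union> gr S \<gamma> \<subseteq> S \<times> S" using gr_subset[OF assms(3)] by (auto simp: prel_def)
    show "(x, y) \<in> conn (prel {S} \<union> gr S \<gamma>)" if "x \<in> S" "y \<in> S" for x y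
      using that by (intro conn_incl) (simp add: prel_def)
  qed (fact assms)
  moreover have "gr S \<gamma> \<subseteq> prel {S}" using gr_subset[OF assms(3)] by (simp add: prel_def)
  moreover have "card (cyc S (inv \<gamma> \<circ> \<gamma>)) = card S"
    using permutes_inv_o(2)[OF assms(3)] card_cyc_id[of S] by simp
  ultimately show ?thesis
    using assms partition_on_space[OF assms(2)] by (simp add: PS_def)
qed

text \<open>With the single block S the defining equality gives the complement |S| + #\<pi> -
  #\<gamma> cycles. Equal cycle numbers thus make the complement the identity.\<close>

lemma PS_full_perm:
  assumes "finite S" "\<gamma> permutes S" "({S}, \<pi>) \<in> PS S \<gamma>" "card (cyc S \<pi>) = card (cyc S \<gamma>)"
  shows "\<pi> = \<gamma>"
proof -
  have \<pi>: "\<pi> permutes S" using assms(3) by (simp add: PS_def)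
  have "card (cyc S (inv \<pi> \<circ> \<gamma>)) = card S" using assms(3,4) by (simp add: PS_def)
  then have "inv \<pi> \<circ> \<gamma> = id"
    using assms(1,2) \<pi> by (intro card_cyc_eq_imp_id permutes_compose permutes_inv)
  then show ?thesis using inv_comp_cancel[OF \<pi>, of \<gamma>] by simp
qed

lemma partition_on_top:
  assumes U: "partition_on S U" and S: "S \<in> U" shows "U = {S}"
proof -
  have "V = S" if V: "V \<in> U" for V
  proof -
    have "V \<noteq> {}" using V partition_onD3[OF U] by auto
    then obtain x where x: "x \<in> V" by auto
    then have "x \<in> S" using V partition_onD1[OF U] by blast
    then show ?thesis using partition_on_unique[OF U V S x] by blast
  qed
  then show ?thesis using S by blast
qed

text \<open>The value at (S, \<gamma>) occurs in the term of ({S}, \<gamma>) only, and there it is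
  the whole term. All other terms agree by assumption, so the equality of the sums passes to this
  value.\<close>

lemma PS_compare:
  fixes A B :: "'a set \<Rightarrow> ('a \<Rightarrow> 'a) \<Rightarrow> complex"
  assumes fin: "finite S" and ne: "S \<noteq> {}" and \<gamma>: "\<gamma> permutes S"
    and eq: "(\<Sum>(U, \<pi>)\<in>PS S \<gamma>. \<Prod>V\<in>U. A V (perm_restrict \<pi> V)) =
      (\<Sum>(U, \<pi>)\<in>PS S \<gamma>. \<Prod>V\<in>U. B V (perm_restrict \<pi> V))"
    and AB: "\<And>U \<pi> V. (U, \<pi>) \<in> PS S \<gamma> \<Longrightarrow> V \<in> U \<Longrightarrow> \<not> (V = S \<and> \<pi> = \<gamma>) \<Longrightarrow>
      A V (perm_restrict \<pi> V) = B V (perm_restrict \<pi> V)"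
  shows "A S \<gamma> = B S \<gamma>"
proof -
  let ?a = "\<lambda>(U, \<pi>). \<Prod>V\<in>U. A V (perm_restrict \<pi> V)"
  let ?b = "\<lambda>(U, \<pi>). \<Prod>V\<in>U. B V (perm_restrict \<pi> V)"
  have mem: "({S}, \<gamma>) \<in> PS S \<gamma>" by (rule full_in_PS[OF fin ne \<gamma>])
  have "sum ?a (PS S \<gamma> - {({S}, \<gamma>)}) = sum ?b (PS S \<gamma> - {({S}, \<gamma>)})"
  proof (intro sum.cong refl)
    fix z assume z: "z \<in> PS S \<gamma> - {({S}, \<gamma>)}"
    obtain U \<pi> where zU: "z = (U, \<pi>)" by (cases z)
    have m: "(U, \<pi>) \<in> PS S \<gamma>" and n: "\<not> (U = {S} \<and> \<pi> = \<gamma>)" using z zU by auto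
    have "U = {S}" if "S \<in> U" using m that by (intro partition_on_top) (simp_all add: PS_def)
    then have "\<not> (V = S \<and> \<pi> = \<gamma>)" if "V \<in> U" for V using that n by blast
    then have "(\<Prod>V\<in>U. A V (perm_restrict \<pi> V)) = (\<Prod>V\<in>U. B V (perm_restrict \<pi> V))"
      using AB[OF m] by (intro prod.cong refl) blast
    then show "?a z = ?b z" by (simp add: zU)
  qed
  then show ?thesis
    using eq fin sum.remove[OF _ mem, of ?a] sum.remove[OF _ mem, of ?b]
    by (simp add: perm_restrict_self[OF \<gamma>])
qed

section \<open>Enumerating cycles\<close>

lemma csucc_interval:
  assumes "i \<in> {s+1..s+n}"
  shows "csucc {s+1..s+n} i = (if i < s + n then Suc i else Suc s)"
proof (cases "i < s + n")
  case True
  then show ?thesis using assms by (auto intro!: csucc_next)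
next
  case False
  have "csucc {s+1..s+n} i = Min {s+1..s+n}" using assms False by (intro csucc_last) auto
  also have "\<dots> = s + 1" using assms by (intro Min_eqI) auto
  finally show ?thesis using False by simp
qed

text \<open>Powers of \<gamma> at a point of the cycle enumerate it; the offset s allows the second
  circle to be numbered after the first.\<close>

lemma one_cycle_enum:
  assumes fin: "finite V" and \<gamma>: "\<gamma> permutes T" and T: "finite T" and V: "V \<in> cyc T \<gamma>"
  shows "\<exists>f. bij_betw f {s+1..s + card V} V \<and>
    (\<forall>i\<in>{s+1..s + card V}. \<gamma> (f i) = f (csucc {s+1..s + card V} i))"
proof -
  have perm: "permutation \<gamma>" using \<gamma> T permutation_permutes by blast
  obtain x where x: "V = orbit \<gamma> x" using V cyc_orbit[OF T \<gamma>] by auto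
  have xx: "x \<in> orbit \<gamma> x" by (rule permutation_self_in_orbit[OF perm])
  define n where "n = funpow_dist1 \<gamma> x x"
  have im: "(\<lambda>k. (\<gamma> ^^ k) x) ` {0..<n} = V"
    unfolding n_def x by (rule orbit_conv_funpow_dist1[OF xx, symmetric])
  have inj: "inj_on (\<lambda>k. (\<gamma> ^^ k) x) {0..<n}" unfolding n_def by (rule inj_on_funpow_dist1[OF xx])
  have per: "(\<gamma> ^^ n) x = x" unfolding n_def by (rule funpow_dist1_prop[OF xx])
  have n: "card V = n" using card_image[OF inj] im by simp
  have npos: "n > 0" by (simp add: n_def)
  define f where "f i = (\<gamma> ^^ (i - Suc s)) x" for i
  have b: "bij_betw (\<lambda>i. i - Suc s) {s+1..s+n} {0..<n}"
    by (rule bij_betw_byWitness[of _ "\<lambda>k. k + Suc s"]) auto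
  have "bij_betw (\<lambda>k. (\<gamma> ^^ k) x) {0..<n} V" using inj im by (simp add: bij_betw_def)
  from bij_betw_trans[OF b this] have "bij_betw f {s+1..s+n} V" by (simp add: f_def[abs_def] comp_def)
  moreover have "\<gamma> (f i) = f (csucc {s+1..s+n} i)" if i: "i \<in> {s+1..s+n}" for i
  proof (cases "i < s + n")
    case True
    moreover have "Suc i - Suc s = Suc (i - Suc s)" using i by auto
    ultimately have "f (csucc {s+1..s+n} i) = (\<gamma> ^^ Suc (i - Suc s)) x"
      by (simp only: csucc_interval[OF i] f_def if_True)
    then show ?thesis by (simp add: f_def)
  next
    case False
    then have "i - Suc s = n - 1" using i by auto
    then have "\<gamma> (f i) = (\<gamma> ^^ Suc (n - 1)) x" by (simp add: f_def)
    also have "\<dots> = x" using per npos by simp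
    also have "\<dots> = f (Suc s)" by (simp add: f_def)
    finally show ?thesis using False by (simp only: csucc_interval[OF i] if_False)
  qed
  ultimately show ?thesis unfolding n by blast
qed

lemma one_cycle_relabel:
  assumes "finite S" "\<gamma> permutes S" "cyc S \<gamma> = {S}"
  shows "\<exists>f. inj_on f {1..card S} \<and> f ` {1..card S} = S \<and> relabel f {1..card S} (csucc {1..card S}) = \<gamma>"
proof -
  have "S \<in> cyc S \<gamma>" using assms(3) by simp
  from one_cycle_enum[OF assms(1,2,1) this, of 0] obtain f where f: "bij_betw f {1..card S} S"
    "\<And>i. i \<in> {1..card S} \<Longrightarrow> \<gamma> (f i) = f (csucc {1..card S} i)" by auto
  have inj: "inj_on f {1..card S}" and im: "f ` {1..card S} = S" using f(1) by (auto simp: bij_betw_def)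
  have "relabel f {1..card S} (csucc {1..card S}) = \<gamma>"
    using f(2) assms(2) im by (intro relabel_unique[OF inj]) simp_all
  then show ?thesis using inj im by blast
qed

lemma two_cycle_relabel:
  assumes fin: "finite S" and \<gamma>: "\<gamma> permutes S" and two: "cyc S \<gamma> = {S \<inter> Z, S - Z}"
    and ne: "S \<inter> Z \<noteq> {}" "S - Z \<noteq> {}"
  defines "p \<equiv> card (S \<inter> Z)" and "q \<equiv> card (S - Z)"
  shows "\<exists>f. inj_on f {1..p+q} \<and> f ` {1..p+q} = S \<and> relabel f {1..p+q} (annular_perm p q) = \<gamma> \<and>
    (\<forall>i\<in>{1..p+q}. f i \<in> Z \<longleftrightarrow> i \<in> {1..p})"
proof -
  interpret two_circles p q
    by unfold_locales (use fin ne in \<open>auto simp: p_def q_def Suc_le_eq card_gt_0_iff\<close>)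
  obtain f1 where f1: "bij_betw f1 {1..p} (S \<inter> Z)" "\<And>i. i \<in> {1..p} \<Longrightarrow> \<gamma> (f1 i) = f1 (csucc {1..p} i)"
    using one_cycle_enum[OF _ \<gamma> fin, of "S \<inter> Z" 0] fin two by (auto simp: p_def)
  obtain f2 where f2: "bij_betw f2 {p+1..p+q} (S - Z)" "\<And>i. i \<in> {p+1..p+q} \<Longrightarrow> \<gamma> (f2 i) = f2 (csucc {p+1..p+q} i)"
    using one_cycle_enum[OF _ \<gamma> fin, of "S - Z" p] fin two by (auto simp: q_def)
  define f where "f i = (if i \<in> {1..p} then f1 i else f2 i)" for i
  have a: "bij_betw f {1..p} (S \<inter> Z)" using f1(1) by (subst bij_betw_cong[of _ _ f1]) (auto simp: f_def)
  have b: "bij_betw f {p+1..p+q} (S - Z)" using f2(1) by (subst bij_betw_cong[of _ _ f2]) (auto simp: f_def)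
  have "bij_betw f ({1..p} \<union> {p+1..p+q}) ((S \<inter> Z) \<union> (S - Z))"
    by (rule bij_betw_combine[OF a b]) blast
  then have bij: "bij_betw f {1..p+q} S" unfolding ZY(2) by (simp add: Int_Diff_Un)
  have inj: "inj_on f {1..p+q}" and im: "f ` {1..p+q} = S" using bij by (auto simp: bij_betw_def)
  have c: "csucc {1..p} permutes {1..p}" "csucc {p+1..p+q} permutes {p+1..p+q}" by (auto intro: csucc_permutes)
  have "\<gamma> (f i) = f (annular_perm p q i)" if i: "i \<in> {1..p+q}" for i
  proof (cases "i \<in> {1..p}")
    case True
    then have "annular_perm p q i = csucc {1..p} i"
      using fun_cong[OF annular_perm_facts(2), of i] by (simp add: perm_restrict_def)
    moreover have "csucc {1..p} i \<in> {1..p}" using True permutes_in_image[OF c(1)] by blast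
    ultimately show ?thesis using True f1(2) by (simp add: f_def)
  next
    case False
    then have i2: "i \<in> {p+1..p+q}" using i by auto
    then have "annular_perm p q i = csucc {p+1..p+q} i"
      using fun_cong[OF annular_perm_facts(3), of i] by (simp add: perm_restrict_def)
    moreover have "csucc {p+1..p+q} i \<in> {p+1..p+q}" using i2 permutes_in_image[OF c(2)] by blast
    ultimately show ?thesis using False f2(2)[OF i2] by (auto simp: f_def)
  qed
  then have "relabel f {1..p+q} (annular_perm p q) = \<gamma>"
    using relabel_unique[OF inj, of \<gamma> "annular_perm p q"] \<gamma> im by simp
  moreover have "f i \<in> Z \<longleftrightarrow> i \<in> {1..p}" if i: "i \<in> {1..p+q}" for i
  proof (cases "i \<in> {1..p}")
    case True
    then show ?thesis using bij_betwE[OF a] by blast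
  next
    case False
    then have "i \<in> {p+1..p+q}" using i by auto
    then show ?thesis using bij_betwE[OF b] False by blast
  qed
  ultimately show ?thesis using inj im by blast
qed

text \<open>Drives the induction for second order cumulants: a block with two cycles has the same
  shape as the whole set with \<gamma>, so the claim can be applied to it.\<close>

lemma (in two_circles) PS_annular_blocks:
  assumes "(U, \<pi>) \<in> PS {1..p+q} \<gamma>" "V \<in> U"
  shows "cyc V (perm_restrict \<pi> V) = {V} \<or>
    (V \<inter> Z \<noteq> {} \<and> V - Z \<noteq> {} \<and> cyc V (perm_restrict \<pi> V) = {V \<inter> Z, V - Z})"
proof -
  consider "\<pi> \<in> S_NC p q" "U = cycles (p+q) \<pi>" | "(U, \<pi>) \<in> split_pairs Z Y \<gamma>"
    using assms(1) unfolding PS_annular_perm(1) by blast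
  then show ?thesis
  proof cases
    case 1
    then have "\<pi> permutes {1..p+q}" by (simp add: S_NC_def)
    then show ?thesis using cyc_restrict_singleton(2)[of "{1..p+q}" \<pi> V] 1(2) assms(2) by (simp add: cycles_eq_cyc)
  next
    case 2
    obtain A B where *: "\<pi> permutes {1..p+q}" "cycles (p+q) \<pi> = cyc {1..p+q} \<pi>"
      "cycles (p+q) \<pi> = cyc Z (perm_restrict \<pi> Z) \<union> cyc Y (perm_restrict \<pi> Y)"
      "A \<in> cyc Z (perm_restrict \<pi> Z)" "B \<in> cyc Y (perm_restrict \<pi> Y)"
      "U = insert (A \<union> B) (cycles (p+q) \<pi> - {A, B})" "A \<subseteq> Z" "B \<subseteq> Y" "A \<noteq> {}" "B \<noteq> {}"
      by (rule split_pairs_facts[OF 2])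
    show ?thesis
    proof (cases "V = A \<union> B")
      case True
      have "A \<in> cyc {1..p+q} \<pi>" "B \<in> cyc {1..p+q} \<pi>" using * by auto
      then have "cyc V (perm_restrict \<pi> V) = {A, B}"
        unfolding True by (intro cyc_restrict_pair[OF _ *(1)]) auto
      moreover have "V \<inter> Z = A" "V - Z = B" using True *(7,8) ZY(1) by blast+
      ultimately show ?thesis using *(9,10) by simp
    next
      case False
      then have "V \<in> cyc {1..p+q} \<pi>" using assms(2) *(2,6) by blast
      then show ?thesis using cyc_restrict_singleton(2)[OF _ *(1)] by simp
    qed
  qed
qed

section \<open>Words in two variables\<close>

text \<open>The letters of the chosen word, two for each factor: \<open>True, False\<close> for
  \<open>ab\<close> and \<open>False, True\<close> for \<open>ba\<close>.\<close>

definition labels :: "nat set \<Rightarrow> nat list \<Rightarrow> bool list" where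
  "labels E ks = concat (map (\<lambda>k. [k \<in> E, k \<notin> E]) ks)"

lemma length_labels [simp]: "length (labels E ks) = 2 * length ks"
  by (induction ks) (auto simp: labels_def)

lemma labels_append: "labels E (ks @ ls) = labels E ks @ labels E ls"
  by (simp add: labels_def)

lemma labels_cong: "(\<And>k. k \<in> set ks \<Longrightarrow> k \<in> E \<longleftrightarrow> k \<in> F) \<Longrightarrow> labels E ks = labels F ks"
  unfolding labels_def by (intro arg_cong[of _ _ concat] map_cong) auto

lemma nth_labels: "i < length ks \<Longrightarrow> labels E ks ! (2 * i + of_bool s) = ((ks ! i \<in> E) \<noteq> s)"
proof (induction ks arbitrary: i)
  case (Cons k ks)
  show ?case
  proof (cases i)
    case 0
    then show ?thesis by (cases s) (auto simp: labels_def)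
  next
    case (Suc j)
    then have "labels E (k # ks) ! (2 * i + of_bool s) = labels E ks ! (2 * j + of_bool s)"
      by (simp add: labels_def)
    then show ?thesis using Cons Suc by simp
  qed
qed simp

text \<open>Numbers the doubled points by the positions of the letters, counted from 1 while list
  indices count from 0; hence the \<open>pos z - 1\<close> in what follows.\<close>

definition pos :: "nat \<times> bool \<Rightarrow> nat" where
  "pos = (\<lambda>(k, s). if s then 2 * k else 2 * k - 1)"

lemma inj_on_pos: "inj_on pos (dset {1..N})"
  by (rule inj_onI) (auto simp: pos_def split: if_splits; presburger)

lemma pos_image: "pos ` dset {1..N} = {1..2*N}"
proof (intro equalityI subsetI)
  fix x assume x: "x \<in> {1..2*N}"
  have "x = pos ((x + 1) div 2, even x)" using x by (auto simp: pos_def elim!: evenE oddE)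
  moreover have "((x + 1) div 2, even x) \<in> dset {1..N}" using x by auto
  ultimately show "x \<in> pos ` dset {1..N}" by blast
qed (auto simp: pos_def)

lemma pos_le: "z \<in> dset {1..N} \<Longrightarrow> pos z \<in> {1..2*n} \<longleftrightarrow> z \<in> dset {1..n}"
  by (cases z) (auto simp: pos_def)

lemma nth_labels_pos:
  assumes "z \<in> dset {1..N}" shows "labels E [1..<N+1] ! (pos z - 1) = col E z"
proof -
  obtain k s where z: "z = (k, s)" "1 \<le> k" "k \<le> N" using assms by auto
  have "pos z - 1 = 2 * (k - 1) + of_bool s" using z by (auto simp: pos_def)
  then show ?thesis using nth_labels[of "k - 1" "[1..<N+1]" E s] z by (simp add: col_def del: upt_Suc)
qed

lemma dbl_pos_disc: "relabel pos (dset {1..n}) (dbl {1..n} (csucc {1..n})) = csucc {1..2*n}"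
proof (rule relabel_unique[OF inj_on_pos])
  show "csucc {1..2*n} permutes pos ` dset {1..n}" unfolding pos_image by (intro csucc_permutes) simp
  fix z assume "z \<in> dset {1..n}"
  then obtain k s where z: "z = (k, s)" "1 \<le> k" "k \<le> n" by auto
  have "pos z \<in> {0+1..0+2*n}" using z by (auto simp: pos_def)
  from csucc_interval[OF this] have 1: "csucc {1..2*n} (pos z) = (if pos z < 2 * n then Suc (pos z) else 1)" by simp
  have "k \<in> {0+1..0+n}" using z by auto
  from csucc_interval[OF this] have 2: "csucc {1..n} k = (if k < n then Suc k else 1)" by simp
  show "csucc {1..2*n} (pos z) = pos (dbl {1..n} (csucc {1..n}) z)"
    using z unfolding 1 by (cases s) (auto simp: pos_def dbl_def 2 simp del: One_nat_def)
qed

lemma (in two_circles) dbl_pos_annulus: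
  "relabel pos (dset {1..p+q}) (dbl {1..p+q} \<gamma>) = annular_perm (2*p) (2*q)"
proof (rule relabel_unique[OF inj_on_pos])
  interpret d: two_circles "2*p" "2*q" by unfold_locales (use p q in auto)
  have e: "2 * (p + q) = 2 * p + 2 * q" by simp
  show "annular_perm (2*p) (2*q) permutes pos ` dset {1..p+q}"
    unfolding pos_image e by (rule d.annular_perm_facts)
  fix z assume "z \<in> dset {1..p+q}"
  then obtain k s where z: "z = (k, s)" "1 \<le> k" "k \<le> p + q" by auto
  show "annular_perm (2*p) (2*q) (pos z) = pos (dbl {1..p+q} \<gamma> z)"
  proof (cases "k \<le> p")
    case True
    have zp: "pos z \<in> {0+1..0+2*p}" using z True by (auto simp: pos_def)
    from csucc_interval[OF this] have 1: "csucc {1..2*p} (pos z) = (if pos z < 2 * p then Suc (pos z) else 1)" by simp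
    have kp: "k \<in> {0+1..0+p}" using z True by auto
    from csucc_interval[OF this] have 2: "csucc {1..p} k = (if k < p then Suc k else 1)" by simp
    have 3: "annular_perm (2*p) (2*q) (pos z) = csucc {1..2*p} (pos z)"
      using fun_cong[OF d.annular_perm_facts(2), of "pos z"] zp by (simp add: perm_restrict_def)
    have 4: "\<gamma> k = csucc {1..p} k"
      using fun_cong[OF annular_perm_facts(2), of k] kp by (simp add: perm_restrict_def)
    show ?thesis using z True unfolding 3 1 by (cases s) (auto simp: pos_def dbl_def 2 4 simp del: One_nat_def)
  next
    case False
    have zp: "pos z \<in> {2*p+1..2*p+2*q}" using z False by (auto simp: pos_def)
    from csucc_interval[OF this] have 1: "csucc {2*p+1..2*p+2*q} (pos z) = (if pos z < 2 * p + 2 * q then Suc (pos z) else Suc (2*p))" .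
    have kp: "k \<in> {p+1..p+q}" using z False by auto
    from csucc_interval[OF this] have 2: "csucc {p+1..p+q} k = (if k < p + q then Suc k else Suc p)" .
    have 3: "annular_perm (2*p) (2*q) (pos z) = csucc {2*p+1..2*p+2*q} (pos z)"
      using fun_cong[OF d.annular_perm_facts(3), of "pos z"] zp by (simp add: perm_restrict_def)
    have 4: "\<gamma> k = csucc {p+1..p+q} k"
      using fun_cong[OF annular_perm_facts(3), of k] kp by (simp add: perm_restrict_def)
    show ?thesis using z False unfolding 3 1 by (cases s) (auto simp: pos_def dbl_def 2 4 simp del: One_nat_def)
  qed
qed

lemma sum_Pow_Un:
  fixes f :: "'a set \<Rightarrow> 'a set \<Rightarrow> complex"
  assumes "finite A" "finite B" "A \<inter> B = {}"
  shows "(\<Sum>E\<in>Pow A. \<Sum>F\<in>Pow B. f E F) = (\<Sum>E\<in>Pow (A \<union> B). f (E \<inter> A) (E \<inter> B))"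
proof -
  have "(\<Sum>E\<in>Pow A. \<Sum>F\<in>Pow B. f E F) = (\<Sum>(E, F)\<in>Pow A \<times> Pow B. f E F)"
    by (rule sum.cartesian_product)
  also have "\<dots> = (\<Sum>E\<in>Pow (A \<union> B). f (E \<inter> A) (E \<inter> B))"
    by (rule sum.reindex_bij_witness[of _ "\<lambda>E. (E \<inter> A, E \<inter> B)" "\<lambda>(E, F). E \<union> F"])
      (use assms(3) in \<open>auto intro!: arg_cong2[of _ _ _ _ f]\<close>)
  finally show ?thesis .
qed

definition word :: "'a \<Rightarrow> 'a \<Rightarrow> nat set \<Rightarrow> nat list \<Rightarrow> 'a list" where
  "word a b E ks = map (\<lambda>e. if e then a else b) (labels E ks)"

text \<open>Induction on the factors: subsets without k contribute \<open>b * a\<close> in front,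
  subsets with k contribute \<open>a * b\<close>. Distinctness keeps the later letters independent
  of the choice at k.\<close>

lemma power_expand:
  fixes a b :: "'a::ring_1"
  assumes "distinct ks"
  shows "prod_list (replicate (length ks) (a * b + b * a)) = (\<Sum>E\<in>Pow (set ks). prod_list (word a b E ks))"
  using assms
proof (induction ks)
  case Nil
  then show ?case by (simp add: word_def labels_def)
next
  case (Cons k ks)
  have step: "prod_list (word a b E (k # ks)) = (if k \<in> E then a * b else b * a) * prod_list (word a b E ks)" for E
    by (simp add: word_def labels_def mult.assoc)
  have cg: "word a b (insert k E) ks = word a b E ks" for E
    unfolding word_def using Cons.prems by (intro arg_cong[of _ _ "map _"] labels_cong) auto
  have "(\<Sum>E\<in>Pow (set (k # ks)). prod_list (word a b E (k # ks))) =
    (\<Sum>E\<in>Pow (set ks). prod_list (word a b E (k # ks))) + (\<Sum>E\<in>insert k ` Pow (set ks). prod_list (word a b E (k # ks)))"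
    unfolding list.set Pow_insert using Cons.prems by (intro sum.union_disjoint) auto
  also have "(\<Sum>E\<in>Pow (set ks). prod_list (word a b E (k # ks))) = (\<Sum>E\<in>Pow (set ks). b * a * prod_list (word a b E ks))"
    using Cons.prems by (intro sum.cong refl) (auto simp: step)
  also have "(\<Sum>E\<in>insert k ` Pow (set ks). prod_list (word a b E (k # ks))) = (\<Sum>E\<in>Pow (set ks). a * b * prod_list (word a b E ks))"
  proof (subst sum.reindex)
    show "inj_on (insert k) (Pow (set ks))" using Cons.prems by (auto simp: inj_on_def)
  qed (simp add: step cg)
  finally show ?case using Cons by (simp add: sum_distrib_left[symmetric] distrib_right add.commute)
qed

section \<open>Cumulants of the anticommutator as sums over separating pairs\<close>

locale free_pair = second_order_ncps scale \<phi> \<phi>2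
  for scale :: "complex \<Rightarrow> 'a::ring_1 \<Rightarrow> 'a" and \<phi> :: "'a \<Rightarrow> complex" and \<phi>2 :: "'a \<Rightarrow> 'a \<Rightarrow> complex" +
  fixes a b :: 'a
  assumes free: "second_order_free \<phi> \<phi>2 a b"
begin

sublocale weights "cumulant_pow \<phi> a" "cumulant_pow \<phi> b" "cumulant_pow2 \<phi> \<phi>2 a" "cumulant_pow2 \<phi> \<phi>2 b" .

abbreviation "var \<equiv> \<lambda>e. if e then a else b"
abbreviation "c \<equiv> a * b + b * a"
abbreviation "\<kappa> \<equiv> cumulant_pow \<phi> c"
abbreviation "\<kappa>2 \<equiv> cumulant_pow2 \<phi> \<phi>2 c"

lemma map_var_const:
  "\<forall>e\<in>set es. e \<Longrightarrow> map var es = replicate (length es) a"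
  "\<forall>e\<in>set es. \<not> e \<Longrightarrow> map var es = replicate (length es) b"
  by (induction es) auto

lemma mixed_set: "\<not> (\<forall>e\<in>set es. e) \<Longrightarrow> \<not> (\<forall>e\<in>set es. \<not> e) \<Longrightarrow> set es = {True, False}"
  by auto

lemma free_cumulant_labels:
  assumes "is \<noteq> []" "distinct is"
  shows "free_cumulant \<phi> (map var (map f is)) = w1 f (set is)"
proof -
  let ?es = "map f is"
  have len: "length ?es = card (set is)" using distinct_card[OF assms(2)] by simp
  consider "\<forall>e\<in>set ?es. e" | "\<not> (\<forall>e\<in>set ?es. e)" "\<forall>e\<in>set ?es. \<not> e"
    | "\<not> (\<forall>e\<in>set ?es. e)" "\<not> (\<forall>e\<in>set ?es. \<not> e)" by blast
  then show ?thesis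
  proof cases
    case 1
    then show ?thesis unfolding map_var_const(1)[OF 1] len w1_def mono_weight_def cumulant_pow_def by simp
  next
    case 2
    then show ?thesis unfolding map_var_const(2)[OF 2(2)] len w1_def mono_weight_def cumulant_pow_def by simp
  next
    case 3
    then have s: "set ?es = {True, False}" by (rule mixed_set)
    \<comment> \<open>Two different labels occur, so the list is long enough for freeness to
      apply.\<close>
    then have "length ?es \<ge> 2" using card_length[of ?es] by (metis card_2_iff bool.simps(3))
    then have "free_cumulant \<phi> (map var ?es) = 0" using free s unfolding second_order_free_def by blast
    then show ?thesis using 3 by (auto simp: w1_def mono_weight_def)
  qed
qed

lemma second_order_cumulant_labels:
  assumes ne: "is \<noteq> []" "js \<noteq> []" and d: "distinct is" "distinct js" and Z: "set is \<subseteq> Z" "set js \<inter> Z = {}"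
  shows "second_order_cumulant \<phi> \<phi>2 (map var (map f is)) (map var (map f js)) = w2 f Z (set is \<union> set js)"
proof -
  let ?es = "map f is" and ?fs = "map f js"
  have "(set is \<union> set js) \<inter> Z = set is" "(set is \<union> set js) - Z = set js" using Z by blast+
  then have len: "length ?es = card ((set is \<union> set js) \<inter> Z)" "length ?fs = card ((set is \<union> set js) - Z)"
    using distinct_card[OF d(1)] distinct_card[OF d(2)] by simp_all
  consider "\<forall>e\<in>set (?es @ ?fs). e" | "\<not> (\<forall>e\<in>set (?es @ ?fs). e)" "\<forall>e\<in>set (?es @ ?fs). \<not> e"
    | "\<not> (\<forall>e\<in>set (?es @ ?fs). e)" "\<not> (\<forall>e\<in>set (?es @ ?fs). \<not> e)" by blast
  then show ?thesis
  proof cases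
    case 1
    then have "\<forall>e\<in>set ?es. e" "\<forall>e\<in>set ?fs. e" by auto
    note m = map_var_const(1)[OF this(1)] map_var_const(1)[OF this(2)]
    have "\<forall>z\<in>set is \<union> set js. f z" using 1 by auto
    then show ?thesis unfolding m len w2_def mono_weight_def cumulant_pow2_def by simp
  next
    case 2
    then have "\<forall>e\<in>set ?es. \<not> e" "\<forall>e\<in>set ?fs. \<not> e" by auto
    note m = map_var_const(2)[OF this(1)] map_var_const(2)[OF this(2)]
    have "\<not> (\<forall>z\<in>set is \<union> set js. f z)" "\<forall>z\<in>set is \<union> set js. \<not> f z" using 2 by auto
    then show ?thesis unfolding m len w2_def mono_weight_def cumulant_pow2_def by simp
  next
    case 3
    then have s: "set (?es @ ?fs) = {True, False}" by (rule mixed_set)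
    have "length ?es \<ge> 1" "length ?fs \<ge> 1" using ne by (simp_all add: Suc_le_eq)
    then have "second_order_cumulant \<phi> \<phi>2 (map var ?es) (map var ?fs) = 0"
      using free s unfolding second_order_free_def by blast
    moreover have "\<not> (\<forall>z\<in>set is \<union> set js. f z)" "\<not> (\<forall>z\<in>set is \<union> set js. \<not> f z)" using 3 by auto
    ultimately show ?thesis unfolding w2_def mono_weight_def by (simp only: if_False)
  qed
qed

lemma pick_map:
  "set is \<subseteq> {1..length xs} \<Longrightarrow> pick (map f xs) is = map f (map (\<lambda>i. xs ! (i - 1)) is)"
  unfolding pick_def by (auto simp: subset_iff)

abbreviation lab :: "nat set \<Rightarrow> nat \<Rightarrow> nat \<Rightarrow> bool" where
  "lab E N i \<equiv> labels E [1..<N+1] ! (i - 1)"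

text \<open>On one circle no block is merged, so this holds for every Z. That freedom returns when
  the one-cycle result is applied to blocks of an annular pair.\<close>

lemma word_moment:
  assumes n: "n \<ge> 1"
  shows "\<phi> (prod_list (word a b E [1..<n+1])) =
    sum (block_prod (col E) (dset Z)) (PS (dset {1..n}) (dbl {1..n} (csucc {1..n})))"
proof -
  let ?w = "word a b E [1..<n+1]"
  let ?S = "{1..n}"
  define Z' where "Z' = pos ` (dset ?S \<inter> dset Z)"
  have len: "length ?w = 2 * n" by (simp add: word_def)
  have dp: "dbl ?S (csucc ?S) permutes dset ?S" by (intro dbl_permutes csucc_permutes) auto
  have "\<phi> (prod_list ?w) = (\<Sum>(U, \<pi>)\<in>PS {1..length ?w} (csucc {1..length ?w}).
      \<Prod>V\<in>U. wt (w1 (lab E n)) (w2 (lab E n) Z') V (perm_restrict \<pi> V))"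
  proof (rule moment_PS)
    show "?w \<noteq> []" using len n by auto
    fix "is" :: "nat list" assume "is": "is \<noteq> []" "distinct is" "set is \<subseteq> {1..length ?w}"
    then have "pick ?w is = map var (map (lab E n) is)"
      unfolding word_def by (intro pick_map) simp
    then show "free_cumulant \<phi> (pick ?w is) = w1 (lab E n) (set is)"
      using free_cumulant_labels[OF "is"(1,2)] by (simp only:)
  qed
  also have "\<dots> = sum (block_prod (lab E n) Z') (PS (pos ` dset ?S) (relabel pos (dset ?S) (dbl ?S (csucc ?S))))"
    unfolding len dbl_pos_disc pos_image by (simp add: block_prod_def)
  also have "\<dots> = (\<Sum>(U, \<pi>)\<in>PS (dset ?S) (dbl ?S (csucc ?S)). block_prod (lab E n) Z' ((`) pos ` U, relabel pos (dset ?S) \<pi>))"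
    by (rule sum_PS_relabel[OF inj_on_pos dp])
  also have "\<dots> = sum (block_prod (col E) (dset Z)) (PS (dset ?S) (dbl ?S (csucc ?S)))"
  proof (intro sum.cong refl, clarify)
    fix U \<pi> assume m: "(U, \<pi>) \<in> PS (dset ?S) (dbl ?S (csucc ?S))"
    have "block_prod (lab E n) Z' ((`) pos ` U, relabel pos (dset ?S) \<pi>) = block_prod (\<lambda>z. lab E n (pos z)) (dset Z) (U, \<pi>)"
    proof (rule block_prod_relabel[OF _ inj_on_pos m])
      show "pos z \<in> Z' \<longleftrightarrow> z \<in> dset Z" if z: "z \<in> dset ?S" for z
        unfolding Z'_def using inj_on_image_mem_iff[OF inj_on_pos[of n] z, of "dset ?S \<inter> dset Z"] z by blast
    qed simp
    also have "\<dots> = block_prod (col E) (dset Z) (U, \<pi>)"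
      by (rule block_prod_cong[OF m]) (rule nth_labels_pos)
    finally show "block_prod (lab E n) Z' ((`) pos ` U, relabel pos (dset ?S) \<pi>) = block_prod (col E) (dset Z) (U, \<pi>)" .
  qed
  finally show ?thesis .
qed

lemma phi_sum: "\<phi> (sum f A) = (\<Sum>x\<in>A. \<phi> (f x))"
proof -
  interpret l: Vector_Spaces.linear scale "(*)" \<phi> by (rule linear_phi)
  show ?thesis by (rule l.sum)
qed

lemma phi2_sum: "\<phi>2 (sum f A) (sum g B) = (\<Sum>x\<in>A. \<Sum>y\<in>B. \<phi>2 (f x) (g y))"
proof -
  have l: "\<phi>2 (sum f A) z = (\<Sum>x\<in>A. \<phi>2 (f x) z)" for z
  proof -
    interpret l: Vector_Spaces.linear scale "(*)" "\<lambda>x. \<phi>2 x z" by (rule linear_phi2_left)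
    show ?thesis by (rule l.sum)
  qed
  have r: "\<phi>2 z (sum g B) = (\<Sum>y\<in>B. \<phi>2 z (g y))" for z
  proof -
    interpret l: Vector_Spaces.linear scale "(*)" "\<lambda>y. \<phi>2 z y" by (rule linear_phi2_right)
    show ?thesis by (rule l.sum)
  qed
  show ?thesis unfolding l by (intro sum.cong refl) (rule r)
qed

lemma moment_theta:
  assumes n: "n \<ge> 1"
  shows "\<phi> (prod_list (replicate n c)) =
    (\<Sum>(U, \<tau>)\<in>PS {1..n} (csucc {1..n}). \<Prod>V\<in>U. theta V (perm_restrict \<tau> V) Z)"
proof -
  have S: "set [1..<n+1] = {1..n}" by auto
  have "prod_list (replicate n c) = (\<Sum>E\<in>Pow {1..n}. prod_list (word a b E [1..<n+1]))"
    using power_expand[of "[1..<n+1]" a b] unfolding S by (simp del: upt_Suc)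
  then have "\<phi> (prod_list (replicate n c)) = (\<Sum>E\<in>Pow {1..n}. \<phi> (prod_list (word a b E [1..<n+1])))"
    by (simp only: phi_sum)
  also have "\<dots> = (\<Sum>E\<in>Pow {1..n}. sum (block_prod (col E) (dset Z)) (PS (dset {1..n}) (dbl {1..n} (csucc {1..n}))))"
    by (simp only: word_moment[OF n, of _ Z])
  also have "\<dots> = (\<Sum>(U, \<tau>)\<in>PS {1..n} (csucc {1..n}). \<Prod>V\<in>U. theta V (perm_restrict \<tau> V) Z)"
    by (rule double_moment) (auto intro: csucc_permutes)
  finally show ?thesis .
qed

lemma pick_replicate: "set is \<subseteq> {1..n} \<Longrightarrow> pick (replicate n x) is = replicate (length is) x"
  by (auto simp: pick_def map_replicate_const[symmetric] subset_iff Suc_le_eq intro!: map_cong)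

lemma free_cumulant_replicate:
  assumes "distinct is" "set is \<subseteq> {1..n}"
  shows "free_cumulant \<phi> (pick (replicate n x) is) = cumulant_pow \<phi> x (card (set is))"
  unfolding pick_replicate[OF assms(2)] distinct_card[OF assms(1)] cumulant_pow_def ..

text \<open>Strong induction on |S|, after carrying \<gamma> to an increasing cycle. Theta and the
  cumulants of \<open>ab + ba\<close> satisfy the same moment relation and agree on smaller blocks,
  so their top terms agree.\<close>

theorem theta_one_cycle:
  fixes S :: "nat set"
  assumes "finite S" "\<gamma> permutes S" "cyc S \<gamma> = {S}"
  shows "theta S \<gamma> Z = \<kappa> (card S)"
  using assms
proof (induction "card S" arbitrary: S \<gamma> Z rule: less_induct)
  case less
  define n where "n = card S"
  let ?S = "{1..n}" and ?\<gamma> = "csucc {1..n}"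
  obtain f where f: "inj_on f ?S" "f ` ?S = S" "relabel f ?S ?\<gamma> = \<gamma>"
    using one_cycle_relabel[OF less.prems] unfolding n_def by blast
  have "S \<noteq> {}" using partition_onD3[OF partition_on_cyc[OF less.prems(2)]] less.prems(3) by auto
  then have n: "n \<ge> 1" using less.prems(1) by (simp add: n_def Suc_le_eq card_gt_0_iff)
  define Z' where "Z' = {i \<in> ?S. f i \<in> Z}"
  have \<gamma>: "?\<gamma> permutes ?S" by (intro csucc_permutes) simp
  have cyc\<gamma>: "cyc ?S ?\<gamma> = {?S}" using n by (intro cyc_csucc) auto
  have "theta S \<gamma> Z = theta ?S ?\<gamma> Z'"
    using theta_relabel[OF _ f(1) \<gamma>, of Z Z'] unfolding f(2,3) Z'_def by simp
  also have "\<dots> = wt (\<lambda>V. \<kappa> (card V)) (\<lambda>_. 0) ?S ?\<gamma>"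
  proof (rule PS_compare[where A = "\<lambda>V \<sigma>. theta V \<sigma> Z'"])
    have "\<phi> (prod_list (replicate n c)) = (\<Sum>(U, \<pi>)\<in>PS {1..length (replicate n c)} (csucc {1..length (replicate n c)}).
        \<Prod>V\<in>U. wt (\<lambda>V. \<kappa> (card V)) (\<lambda>_. 0) V (perm_restrict \<pi> V))"
      by (rule moment_PS) (use n in \<open>auto intro!: free_cumulant_replicate\<close>)
    then show "(\<Sum>(U, \<pi>)\<in>PS ?S ?\<gamma>. \<Prod>V\<in>U. theta V (perm_restrict \<pi> V) Z') =
        (\<Sum>(U, \<pi>)\<in>PS ?S ?\<gamma>. \<Prod>V\<in>U. wt (\<lambda>V. \<kappa> (card V)) (\<lambda>_. 0) V (perm_restrict \<pi> V))"
      using moment_theta[OF n, of Z'] by simp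
    fix U \<pi> V assume m: "(U, \<pi>) \<in> PS ?S ?\<gamma>" and V: "V \<in> U" and nt: "\<not> (V = ?S \<and> \<pi> = ?\<gamma>)"
    have \<pi>: "\<pi> permutes ?S" and U: "partition_on ?S U" using m by (auto simp: PS_def)
    have Uc: "U = cyc ?S \<pi>" using m unfolding PS_one_cycle[OF finite_atLeastAtMost \<gamma> cyc\<gamma>] by auto
    have VS: "V \<subseteq> ?S" using V partition_onD1[OF U] by blast
    have cV: "\<pi> ` V \<subseteq> V" "cyc V (perm_restrict \<pi> V) = {V}"
      using cyc_restrict_singleton[OF _ \<pi>] V Uc by auto
    \<comment> \<open>A block equal to the whole set would be a single cycle, as \<gamma> is, and
      would therefore be the excluded top term.\<close>
    have "V \<noteq> ?S"
    proof
      assume VS: "V = ?S"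
      then have "U = {?S}" using partition_on_top[OF U] V by simp
      then have "\<pi> = ?\<gamma>" using PS_full_perm[OF _ \<gamma>, of \<pi>] m Uc cyc\<gamma> by simp
      then show False using nt VS by simp
    qed
    then have "card V < card S"
      using VS psubset_card_mono[of ?S V] by (auto simp: n_def)
    moreover have "finite V" using VS finite_subset by blast
    moreover have "perm_restrict \<pi> V permutes V"
      using perm_restrict_permutes[OF \<open>finite V\<close> \<pi> cV(1)] .
    ultimately have "theta V (perm_restrict \<pi> V) Z' = \<kappa> (card V)" by (rule less.hyps[OF _ _ _ cV(2)])
    then show "theta V (perm_restrict \<pi> V) Z' = wt (\<lambda>V. \<kappa> (card V)) (\<lambda>_. 0) V (perm_restrict \<pi> V)"
      using cV(2) by (simp add: wt_def)
  qed (use n \<gamma> in auto)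
  also have "\<dots> = \<kappa> (card S)" using cyc\<gamma> by (simp add: wt_def n_def)
  finally show ?case .
qed

lemma word_moment2:
  assumes p: "p \<ge> 1" and q: "q \<ge> 1"
  shows "\<phi>2 (prod_list (word a b E [1..<p+1])) (prod_list (word a b E [p+1..<p+q+1])) =
    sum (block_prod (col E) (dset {1..p})) (PS (dset {1..p+q}) (dbl {1..p+q} (annular_perm p q)))"
proof -
  interpret two_circles p q by unfold_locales (use p q in auto)
  let ?v = "word a b E [1..<p+1]" and ?w = "word a b E [p+1..<p+q+1]"
  let ?S = "{1..p+q}" and ?Z = "{1..2*p}"
  let ?l = "lab E (p+q)"
  have len: "length ?v = 2 * p" "length ?w = 2 * q" by (simp_all add: word_def)
  have dp: "dbl ?S \<gamma> permutes dset ?S" by (intro dbl_permutes annular_perm_facts) auto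
  have e: "2 * (p + q) = 2 * p + 2 * q" by simp
  have "[1..<p+1] @ [p+1..<p+q+1] = [1..<p+q+1]"
    using upt_add_eq_append[of 1 "p+1" q] by simp
  then have app: "?v @ ?w = word a b E [1..<p+q+1]"
    by (simp only: word_def map_append[symmetric] labels_append[symmetric])
  have pk: "pick (?v @ ?w) is = map var (map ?l is)" if "set is \<subseteq> {1..2*p+2*q}" for "is"
    unfolding app unfolding word_def using that by (intro pick_map) (simp del: upt_Suc)
  have "\<phi>2 (prod_list ?v) (prod_list ?w) =
      (\<Sum>(U, \<pi>)\<in>PS {1..length ?v + length ?w} (annular_perm (length ?v) (length ?w)).
        \<Prod>V\<in>U. wt (w1 ?l) (w2 ?l ?Z) V (perm_restrict \<pi> V))"
  proof (rule moment2_PS)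
    show "?v \<noteq> []" "?w \<noteq> []" using len p q by auto
    show "free_cumulant \<phi> (pick (?v @ ?w) is) = w1 ?l (set is)"
      if "is \<noteq> []" "distinct is" "set is \<subseteq> {1..length ?v + length ?w}" for "is"
      using free_cumulant_labels[OF that(1,2), of ?l] pk[of "is"] that(3) unfolding len by (simp only:)
    show "second_order_cumulant \<phi> \<phi>2 (pick (?v @ ?w) is) (pick (?v @ ?w) js) = w2 ?l ?Z (set is \<union> set js)"
      if "is \<noteq> []" "js \<noteq> []" "distinct is" "distinct js" "set is \<subseteq> {1..length ?v}"
        "set js \<subseteq> {length ?v + 1..length ?v + length ?w}" for "is" js
    proof -
      have 1: "set is \<subseteq> ?Z" "set js \<inter> ?Z = {}" using that(5,6) unfolding len by auto
      have "set is \<subseteq> {1..2*p+2*q}" "set js \<subseteq> {1..2*p+2*q}" using that(5,6) unfolding len by auto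
      then show ?thesis using second_order_cumulant_labels[OF that(1-4) 1, of ?l] pk by (simp only:)
    qed
  qed
  also have "\<dots> = sum (block_prod ?l ?Z) (PS (pos ` dset ?S) (relabel pos (dset ?S) (dbl ?S \<gamma>)))"
    unfolding len dbl_pos_annulus pos_image e by (simp add: block_prod_def)
  also have "\<dots> = (\<Sum>(U, \<pi>)\<in>PS (dset ?S) (dbl ?S \<gamma>). block_prod ?l ?Z ((`) pos ` U, relabel pos (dset ?S) \<pi>))"
    by (rule sum_PS_relabel[OF inj_on_pos dp])
  also have "\<dots> = sum (block_prod (col E) (dset {1..p})) (PS (dset ?S) (dbl ?S \<gamma>))"
  proof (intro sum.cong refl, clarify)
    fix U \<pi> assume m: "(U, \<pi>) \<in> PS (dset ?S) (dbl ?S \<gamma>)"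
    have "block_prod ?l ?Z ((`) pos ` U, relabel pos (dset ?S) \<pi>) = block_prod (\<lambda>z. ?l (pos z)) (dset {1..p}) (U, \<pi>)"
      by (rule block_prod_relabel[OF _ inj_on_pos m]) (simp, rule pos_le)
    also have "\<dots> = block_prod (col E) (dset {1..p}) (U, \<pi>)"
      by (rule block_prod_cong[OF m]) (rule nth_labels_pos)
    finally show "block_prod ?l ?Z ((`) pos ` U, relabel pos (dset ?S) \<pi>) = block_prod (col E) (dset {1..p}) (U, \<pi>)" .
  qed
  finally show ?thesis .
qed

lemma moment2_theta:
  assumes p: "p \<ge> 1" and q: "q \<ge> 1"
  shows "\<phi>2 (prod_list (replicate p c)) (prod_list (replicate q c)) =
    (\<Sum>(U, \<tau>)\<in>PS {1..p+q} (annular_perm p q). \<Prod>V\<in>U. theta V (perm_restrict \<tau> V) {1..p})"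
proof -
  interpret two_circles p q by unfold_locales (use p q in auto)
  let ?ks = "[1..<p+1]" and ?ls = "[p+1..<p+q+1]"
  have S: "set ?ks = Z" "set ?ls = Y" by auto
  have "prod_list (replicate p c) = (\<Sum>E\<in>Pow Z. prod_list (word a b E ?ks))"
    using power_expand[of ?ks a b] unfolding S by (simp del: upt_Suc)
  moreover have "prod_list (replicate q c) = (\<Sum>E\<in>Pow Y. prod_list (word a b E ?ls))"
    using power_expand[of ?ls a b] unfolding S by (simp del: upt_Suc)
  ultimately have "\<phi>2 (prod_list (replicate p c)) (prod_list (replicate q c)) =
      (\<Sum>E\<in>Pow Z. \<Sum>F\<in>Pow Y. \<phi>2 (prod_list (word a b E ?ks)) (prod_list (word a b F ?ls)))"
    by (simp only: phi2_sum)
  also have "\<dots> = (\<Sum>E\<in>Pow (Z \<union> Y). \<phi>2 (prod_list (word a b (E \<inter> Z) ?ks)) (prod_list (word a b (E \<inter> Y) ?ls)))"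
    by (rule sum_Pow_Un[OF _ _ ZY(1)]) simp_all
  also have "\<dots> = (\<Sum>E\<in>Pow {1..p+q}. \<phi>2 (prod_list (word a b E ?ks)) (prod_list (word a b E ?ls)))"
    unfolding ZY(2)
  proof (intro sum.cong refl)
    fix E
    have "labels (E \<inter> Z) ?ks = labels E ?ks" "labels (E \<inter> Y) ?ls = labels E ?ls"
      by (intro labels_cong; auto)+
    then show "\<phi>2 (prod_list (word a b (E \<inter> Z) ?ks)) (prod_list (word a b (E \<inter> Y) ?ls)) =
        \<phi>2 (prod_list (word a b E ?ks)) (prod_list (word a b E ?ls))"
      unfolding word_def by (simp only:)
  qed
  also have "\<dots> = (\<Sum>E\<in>Pow {1..p+q}. sum (block_prod (col E) (dset Z)) (PS (dset {1..p+q}) (dbl {1..p+q} \<gamma>)))"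
    by (simp only: word_moment2[OF p q])
  also have "\<dots> = (\<Sum>(U, \<tau>)\<in>PS {1..p+q} \<gamma>. \<Prod>V\<in>U. theta V (perm_restrict \<tau> V) Z)"
    by (rule double_moment) (simp, rule annular_perm_facts)
  finally show ?thesis .
qed

text \<open>The same comparison on two circles. Blocks with one cycle, possibly the whole set, are
  settled by \<open>theta_one_cycle\<close>; blocks with two cycles other than the top one are
  smaller and fall under the induction hypothesis.\<close>

theorem theta_two_cycles:
  fixes S :: "nat set"
  assumes "finite S" "\<gamma> permutes S" "cyc S \<gamma> = {S \<inter> Z, S - Z}" "S \<inter> Z \<noteq> {}" "S - Z \<noteq> {}"
  shows "theta S \<gamma> Z = \<kappa>2 (card (S \<inter> Z)) (card (S - Z))"
  using assms
proof (induction "card S" arbitrary: S \<gamma> Z rule: less_induct)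
  case less
  define p q where "p = card (S \<inter> Z)" and "q = card (S - Z)"
  interpret t: two_circles p q
    by unfold_locales (use less.prems in \<open>auto simp: p_def q_def Suc_le_eq card_gt_0_iff\<close>)
  note pq = t.p t.q
  let ?S = "{1..p+q}" and ?Z = "{1..p}"
  obtain f where f: "inj_on f ?S" "f ` ?S = S" "relabel f ?S t.\<gamma> = \<gamma>" "\<And>i. i \<in> ?S \<Longrightarrow> f i \<in> Z \<longleftrightarrow> i \<in> ?Z"
    using two_cycle_relabel[OF less.prems] unfolding p_def q_def by blast
  have cS: "card S = p + q" using card_image[OF f(1)] f(2) by simp
  note \<gamma> = t.annular_perm_facts(1)
  define W where "W = (\<lambda>V. \<kappa>2 (card (V \<inter> ?Z)) (card (V - ?Z)))"
  have "theta S \<gamma> Z = theta ?S t.\<gamma> ?Z"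
    using theta_relabel[OF _ f(1) \<gamma>, of Z ?Z] f(4) unfolding f(2,3) by simp
  also have "\<dots> = wt (\<lambda>V. \<kappa> (card V)) W ?S t.\<gamma>"
  proof (rule PS_compare[where A = "\<lambda>V \<sigma>. theta V \<sigma> ?Z"])
    let ?r = "replicate p c" and ?r' = "replicate q c"
    have "\<phi>2 (prod_list ?r) (prod_list ?r') = (\<Sum>(U, \<pi>)\<in>PS {1..length ?r + length ?r'} (annular_perm (length ?r) (length ?r')).
        \<Prod>V\<in>U. wt (\<lambda>V. \<kappa> (card V)) W V (perm_restrict \<pi> V))"
    proof (rule moment2_PS)
      show "?r \<noteq> []" "?r' \<noteq> []" using pq by auto
      have rr: "?r @ ?r' = replicate (p + q) c" by (simp add: replicate_add)
      show "free_cumulant \<phi> (pick (?r @ ?r') is) = \<kappa> (card (set is))"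
        if "distinct is" "set is \<subseteq> {1..length ?r + length ?r'}" for "is"
        using free_cumulant_replicate[OF that(1), of "p+q" c] that(2) unfolding rr by simp
      show "second_order_cumulant \<phi> \<phi>2 (pick (?r @ ?r') is) (pick (?r @ ?r') js) = W (set is \<union> set js)"
        if "distinct is" "distinct js" "set is \<subseteq> {1..length ?r}" "set js \<subseteq> {length ?r + 1..length ?r + length ?r'}" for "is" js
      proof -
        have s: "set is \<subseteq> {1..p+q}" "set js \<subseteq> {1..p+q}" using that by auto
        have "(set is \<union> set js) \<inter> ?Z = set is" "(set is \<union> set js) - ?Z = set js" using that(3,4) by auto
        then show ?thesis
          unfolding rr W_def pick_replicate[OF s(1)] pick_replicate[OF s(2)]
          using distinct_card[OF that(1)] distinct_card[OF that(2)] by (simp add: cumulant_pow2_def)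
      qed
    qed
    then show "(\<Sum>(U, \<pi>)\<in>PS ?S t.\<gamma>. \<Prod>V\<in>U. theta V (perm_restrict \<pi> V) ?Z) =
        (\<Sum>(U, \<pi>)\<in>PS ?S t.\<gamma>. \<Prod>V\<in>U. wt (\<lambda>V. \<kappa> (card V)) W V (perm_restrict \<pi> V))"
      using moment2_theta[OF pq] by simp
    fix U \<pi> V assume m: "(U, \<pi>) \<in> PS ?S t.\<gamma>" and V: "V \<in> U" and nt: "\<not> (V = ?S \<and> \<pi> = t.\<gamma>)"
    have \<pi>: "\<pi> permutes ?S" and U: "partition_on ?S U" and le: "gr ?S \<pi> \<subseteq> prel U" using m by (auto simp: PS_def)
    have VS: "V \<subseteq> ?S" using V partition_onD1[OF U] by blast
    then have finV: "finite V" using finite_subset by blast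
    have "\<pi> ` V \<subseteq> V" using le V gr_subset_prel_iff[OF U] by blast
    then have pV: "perm_restrict \<pi> V permutes V" by (rule perm_restrict_permutes[OF finV \<pi>])
    consider "cyc V (perm_restrict \<pi> V) = {V}"
      | "V \<inter> ?Z \<noteq> {}" "V - ?Z \<noteq> {}" "cyc V (perm_restrict \<pi> V) = {V \<inter> ?Z, V - ?Z}"
      using t.PS_annular_blocks[OF m V] by blast
    then show "theta V (perm_restrict \<pi> V) ?Z = wt (\<lambda>V. \<kappa> (card V)) W V (perm_restrict \<pi> V)"
    proof cases
      case 1
      then show ?thesis using theta_one_cycle[OF finV pV 1] by (simp add: wt_def)
    next
      case 2
      have c2: "card (cyc V (perm_restrict \<pi> V)) = 2"
      proof -
        have "V \<inter> ?Z \<noteq> V - ?Z" using 2(1) by blast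
        then show ?thesis unfolding 2(3) by simp
      qed
      \<comment> \<open>The whole set with two cycles has as many cycles as \<gamma> and would be
        the excluded top term by \<open>PS_full_perm\<close>.\<close>
      have "V \<noteq> ?S"
      proof
        assume VS: "V = ?S"
        then have "U = {?S}" using partition_on_top[OF U] V by simp
        moreover have "card (cyc ?S \<pi>) = card (cyc ?S t.\<gamma>)"
          using c2 t.annular_perm_facts(6) t.ZY(5) unfolding VS perm_restrict_self[OF \<pi>] by simp
        ultimately have "\<pi> = t.\<gamma>" using PS_full_perm[OF _ \<gamma>, of \<pi>] m by simp
        then show False using nt VS by simp
      qed
      then have "card V < card S"
        using VS psubset_card_mono[of ?S V] by (auto simp: cS)
      then have "theta V (perm_restrict \<pi> V) ?Z = \<kappa>2 (card (V \<inter> ?Z)) (card (V - ?Z))"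
        by (rule less.hyps[OF _ finV pV 2(3,1,2)])
      then show ?thesis using c2 by (simp add: wt_def W_def)
    qed
  qed (use pq \<gamma> in auto)
  also have "\<dots> = W ?S" using t.annular_perm_facts(6) t.ZY(5) by (simp add: wt_def)
  also have "\<dots> = \<kappa>2 p q"
  proof -
    have "?S \<inter> ?Z = ?Z" "?S - ?Z = {p+1..p+q}" by auto
    then show ?thesis by (simp add: W_def)
  qed
  finally show ?case by (simp add: p_def q_def)
qed

lemma cumulant_theta:
  assumes "n \<ge> 1" "m \<ge> 1"
  shows "\<kappa>2 n m = theta {1..n+m} (annular_perm n m) {1..n}"
proof -
  interpret two_circles n m by unfold_locales (use assms in auto)
  have "{1..n+m} \<inter> Z = Z" "{1..n+m} - Z = Y" by auto
  then show ?thesis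
    using theta_two_cycles[of "{1..n+m}" \<gamma> Z] annular_perm_facts(1,6) ZY(3,4) by simp
qed

end

section \<open>Bipartite colourings\<close>

lemma block_of_eq: "partition_on S U \<Longrightarrow> V \<in> U \<Longrightarrow> i \<in> V \<Longrightarrow> block_of U i = V"
  unfolding block_of_def by (rule the_equality) (auto dest: partition_on_unique)

lemma block_of_mem:
  assumes "partition_on S U" "i \<in> S" shows "block_of U i \<in> U" "i \<in> block_of U i"
proof -
  obtain V where "V \<in> U" "i \<in> V" using assms partition_onD1 by blast
  then show "block_of U i \<in> U" "i \<in> block_of U i" using block_of_eq[OF assms(1)] by simp_all
qed

definition proper :: "nat \<Rightarrow> nat set set \<Rightarrow> (nat set \<Rightarrow> bool) \<Rightarrow> bool" where
  "proper N U \<chi> \<longleftrightarrow> (\<forall>k\<in>{1..N}. \<chi> (block_of U (2 * k - 1)) \<noteq> \<chi> (block_of U (2 * k)))"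

lemma adj_iff:
  "(u, v) \<in> adj_rel (partition_graph N U) \<longleftrightarrow>
    (\<exists>k\<in>{1..N}. {block_of U (2 * k - 1), block_of U (2 * k)} = {u, v})"
  by (simp add: adj_rel_def partition_graph_def)

lemma edge_points:
  assumes "partition_on {1..2*N} U" "k \<in> {1..N}"
  shows "block_of U (2 * k - 1) \<in> U" "2 * k - 1 \<in> block_of U (2 * k - 1)"
    "block_of U (2 * k) \<in> U" "2 * k \<in> block_of U (2 * k)"
proof -
  have k: "2 * k - 1 \<in> {1..2*N}" "2 * k \<in> {1..2*N}" using assms(2) by auto
  show "block_of U (2 * k - 1) \<in> U" "2 * k - 1 \<in> block_of U (2 * k - 1)"
    "block_of U (2 * k) \<in> U" "2 * k \<in> block_of U (2 * k)"
    using block_of_mem[OF assms(1) k(1)] block_of_mem[OF assms(1) k(2)] by simp_all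
qed

lemma bipartite_iff_proper:
  assumes U: "partition_on {1..2*N} U"
  shows "graph_bipartite (partition_graph N U) \<longleftrightarrow> (\<exists>\<chi>. proper N U \<chi>)"
proof
  assume "graph_bipartite (partition_graph N U)"
  then obtain X Y where XY: "X \<inter> Y = {}"
    "\<And>k. k \<in> {1..N} \<Longrightarrow> \<exists>x\<in>X. \<exists>y\<in>Y. {block_of U (2 * k - 1), block_of U (2 * k)} = {x, y}"
    by (auto simp: graph_bipartite_def partition_graph_def)
  have "(block_of U (2 * k - 1) \<in> X) \<noteq> (block_of U (2 * k) \<in> X)" if "k \<in> {1..N}" for k
    using XY(2)[OF that] XY(1) by (auto simp: doubleton_eq_iff)
  then show "\<exists>\<chi>. proper N U \<chi>" unfolding proper_def by (intro exI[of _ "\<lambda>V. V \<in> X"]) blast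
next
  assume "\<exists>\<chi>. proper N U \<chi>"
  then obtain \<chi> where \<chi>: "proper N U \<chi>" by blast
  have "\<exists>x\<in>{V \<in> U. \<chi> V}. \<exists>y\<in>{V \<in> U. \<not> \<chi> V}. {block_of U (2 * k - 1), block_of U (2 * k)} = {x, y}"
    if k: "k \<in> {1..N}" for k
  proof (cases "\<chi> (block_of U (2 * k - 1))")
    case True
    then show ?thesis using \<chi> k edge_points[OF U k] unfolding proper_def
      by (intro bexI[of _ "block_of U (2 * k - 1)"] bexI[of _ "block_of U (2 * k)"]) auto
  next
    case False
    then show ?thesis using \<chi> k edge_points[OF U k] unfolding proper_def
      by (intro bexI[of _ "block_of U (2 * k)"] bexI[of _ "block_of U (2 * k - 1)"]) auto
  qed
  then show "graph_bipartite (partition_graph N U)"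
    unfolding graph_bipartite_def partition_graph_def
    by (intro exI[of _ "{V \<in> U. \<chi> V}"] exI[of _ "{V \<in> U. \<not> \<chi> V}"]) auto
qed

text \<open>Each step of a walk switches the colour.\<close>

lemma proper_relpow:
  assumes "proper N U \<chi>" "(u, v) \<in> adj_rel (partition_graph N U) ^^ d"
  shows "(\<chi> u = \<chi> v) = even d"
  using assms(2)
proof (induction d arbitrary: v)
  case (Suc d)
  then obtain w where w: "(u, w) \<in> adj_rel (partition_graph N U) ^^ d" "(w, v) \<in> adj_rel (partition_graph N U)" by auto
  then have "\<chi> w \<noteq> \<chi> v" using assms(1) unfolding adj_iff proper_def by (auto simp: doubleton_eq_iff)
  then show ?case using Suc.IH[OF w(1)] by auto
qed simp

lemma proper_dist:
  assumes "proper N U \<chi>" "graph_connected (partition_graph N U)" "r \<in> U" "V \<in> U"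
  shows "(\<chi> r = \<chi> V) = even (graph_dist (partition_graph N U) r V)"
proof -
  have "(r, V) \<in> (adj_rel (partition_graph N U))\<^sup>*"
    using assms(2-4) by (simp add: graph_connected_def partition_graph_def)
  then obtain d where "(r, V) \<in> adj_rel (partition_graph N U) ^^ d" by (auto simp: rtrancl_power)
  then have "(r, V) \<in> adj_rel (partition_graph N U) ^^ graph_dist (partition_graph N U) r V"
    unfolding graph_dist_def by (rule LeastI)
  then show ?thesis by (rule proper_relpow[OF assms(1)])
qed

text \<open>\<open>col\<close> read on the numbers 1, ..., 2N; both quotients give the index of the
  edge that contains i.\<close>

definition pcol :: "nat set \<Rightarrow> nat \<Rightarrow> bool" where
  "pcol E i = (if odd i then (i + 1) div 2 \<in> E else i div 2 \<notin> E)"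

lemma pcol_points:
  assumes "k \<ge> 1" shows "pcol E (2 * k - 1) \<longleftrightarrow> k \<in> E" "pcol E (2 * k) \<longleftrightarrow> k \<notin> E"
  using assms by (cases k; simp add: pcol_def)+

lemma pcol_pos:
  assumes "z \<in> dset {1..N}" shows "pcol E (pos z) = col E z"
proof -
  obtain k s where z: "z = (k, s)" "k \<ge> 1" using assms by auto
  then show ?thesis using pcol_points[of k E] by (cases s) (simp_all add: pos_def col_def)
qed

lemma prod_if_parts:
  fixes x y :: "nat set \<Rightarrow> complex"
  assumes "finite U"
  shows "(\<Prod>V\<in>U. if even (graph_dist G r V) then x V else y V) = (\<Prod>V\<in>even_part G r U. x V) * (\<Prod>V\<in>odd_part G r U. y V)"
proof -
  have "U \<inter> {V. even (graph_dist G r V)} = even_part G r U" "U \<inter> - {V. even (graph_dist G r V)} = odd_part G r U"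
    by (auto simp: even_part_def odd_part_def)
  then show ?thesis using assms by (simp add: prod.If_cases)
qed

text \<open>A connected bipartite graph has exactly two proper colourings, given by the parity of
  the distance to a root.\<close>

lemma colour_sum:
  fixes x y :: "nat set \<Rightarrow> complex"
  assumes U: "partition_on {1..2*N} U" and N: "N \<ge> 1" and con: "graph_connected (partition_graph N U)" and r: "r \<in> U"
  shows "(\<Sum>E\<in>Pow {1..N}. \<Prod>V\<in>U. mono_weight (pcol E) V (x V) (y V)) =
    (if graph_bipartite (partition_graph N U) then
      (\<Prod>V\<in>even_part (partition_graph N U) r U. x V) * (\<Prod>V\<in>odd_part (partition_graph N U) r U. y V) +
      (\<Prod>V\<in>even_part (partition_graph N U) r U. y V) * (\<Prod>V\<in>odd_part (partition_graph N U) r U. x V)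
    else 0)"
proof -
  let ?G = "partition_graph N U"
  define \<chi>0 where "\<chi>0 V = even (graph_dist ?G r V)" for V
  define b where "b i = block_of U i" for i
  have finU: "finite U" using finite_elements[OF _ U] by simp
  have ne: "\<exists>i. i \<in> V" if "V \<in> U" for V using that partition_onD3[OF U] by (metis ex_in_conv)
  \<comment> \<open>The colourings of points that are constant on blocks, outside of which the
    product vanishes. Since the two ends of an edge always differ, these are the proper colourings
    of the graph.\<close>
  define valid where "valid E \<longleftrightarrow> (\<forall>V\<in>U. (\<forall>i\<in>V. pcol E i) \<or> (\<forall>i\<in>V. \<not> pcol E i))" for E
  define \<chi> where "\<chi> E V = (\<forall>i\<in>V. pcol E i)" for E V
  have \<chi>i: "\<chi> E V = pcol E i" if "valid E" "V \<in> U" "i \<in> V" for E V i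
    using that unfolding valid_def \<chi>_def by blast
  have e: "b (2 * k - 1) \<in> U" "2 * k - 1 \<in> b (2 * k - 1)" "b (2 * k) \<in> U" "2 * k \<in> b (2 * k)"
    if "k \<in> {1..N}" for k using edge_points[OF U that] by (simp_all add: b_def)
  have pr: "proper N U (\<chi> E)" if "valid E" for E
    unfolding proper_def b_def[symmetric]
  proof
    fix k assume k: "k \<in> {1..N}"
    then have "k \<ge> 1" by simp
    then show "\<chi> E (b (2 * k - 1)) \<noteq> \<chi> E (b (2 * k))"
      using \<chi>i[OF that e(1,2)[OF k]] \<chi>i[OF that e(3,4)[OF k]] pcol_points[of k E] by simp
  qed
  have inv: "(\<Prod>V\<in>U. mono_weight (pcol E) V (x V) (y V)) = 0" if "\<not> valid E" for E
  proof -
    obtain V where V: "V \<in> U" "\<not> (\<forall>i\<in>V. pcol E i)" "\<not> (\<forall>i\<in>V. \<not> pcol E i)" using \<open>\<not> valid E\<close> unfolding valid_def by blast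
    then have "mono_weight (pcol E) V (x V) (y V) = 0" unfolding mono_weight_def by (simp only: if_False)
    then show ?thesis using V(1) finU by (intro prod_zero) auto
  qed
  have val: "(\<Prod>V\<in>U. mono_weight (pcol E) V (x V) (y V)) = (\<Prod>V\<in>U. if \<chi> E V then x V else y V)" if E: "valid E" for E
  proof (rule prod.cong[OF refl])
    fix V assume V: "V \<in> U"
    show "mono_weight (pcol E) V (x V) (y V) = (if \<chi> E V then x V else y V)"
      using E V unfolding valid_def mono_weight_def \<chi>_def by auto
  qed
  show ?thesis
  proof (cases "graph_bipartite ?G")
    case False
    then have "\<not> valid E" for E using pr bipartite_iff_proper[OF U] by blast
    then have "(\<Sum>E\<in>Pow {1..N}. \<Prod>V\<in>U. mono_weight (pcol E) V (x V) (y V)) = 0"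
      using inv by (intro sum.neutral) blast
    then show ?thesis using False by (simp only: if_False)
  next
    case True
    then obtain \<chi>' where \<chi>': "proper N U \<chi>'" using bipartite_iff_proper[OF U] by blast
    have p0: "\<chi>0 (b (2 * k - 1)) \<noteq> \<chi>0 (b (2 * k))" if k: "k \<in> {1..N}" for k
      using proper_dist[OF \<chi>' con r e(1)[OF k]] proper_dist[OF \<chi>' con r e(3)[OF k]] \<chi>' k
      unfolding proper_def b_def[symmetric] \<chi>0_def by metis
    \<comment> \<open>A set E records the colour of the odd end of each edge. E0 gives the weight x
      to the blocks at even distance from r, E1 to those at odd distance.\<close>
    define E0 where "E0 = {k \<in> {1..N}. \<chi>0 (b (2 * k - 1))}"
    define E1 where "E1 = {k \<in> {1..N}. \<not> \<chi>0 (b (2 * k - 1))}"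
    have pc: "pcol E0 i = \<chi>0 V" "pcol E1 i = (\<not> \<chi>0 V)" if V: "V \<in> U" "i \<in> V" for V i
    proof -
      have i: "i \<in> {1..2*N}" using V partition_onD1[OF U] by blast
      have bi: "b i = V" unfolding b_def by (rule block_of_eq[OF U V])
      show "pcol E0 i = \<chi>0 V" "pcol E1 i = (\<not> \<chi>0 V)"
      proof -
        have "pcol E0 i = \<chi>0 V \<and> pcol E1 i = (\<not> \<chi>0 V)"
        proof (cases "odd i")
          case True
          then obtain k where k: "i = 2 * k - 1" "k \<in> {1..N}"
            using i by (intro that[of "(i + 1) div 2"]) (auto elim!: oddE)
          then show ?thesis using pcol_points(1)[of k] bi by (auto simp: E0_def E1_def)
        next
          case False
          then obtain k where k: "i = 2 * k" "k \<in> {1..N}"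
            using i by (intro that[of "i div 2"]) (auto elim!: evenE)
          then show ?thesis using pcol_points(2)[of k] p0[OF k(2)] bi by (auto simp: E0_def E1_def)
        qed
        then show "pcol E0 i = \<chi>0 V" "pcol E1 i = (\<not> \<chi>0 V)" by auto
      qed
    qed
    have v01: "valid E0" "valid E1" unfolding valid_def using pc by blast+
    have \<chi>01: "\<chi> E0 V = \<chi>0 V" "\<chi> E1 V = (\<not> \<chi>0 V)" if V: "V \<in> U" for V
    proof -
      obtain i where i: "i \<in> V" using ne[OF V] by blast
      show "\<chi> E0 V = \<chi>0 V" "\<chi> E1 V = (\<not> \<chi>0 V)"
        using \<chi>i[OF v01(1) V i] \<chi>i[OF v01(2) V i] pc[OF V i] by simp_all
    qed
    have only: "E = E0 \<or> E = E1" if E: "valid E" "E \<subseteq> {1..N}" for E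
    proof -
      have "k \<in> E \<longleftrightarrow> (\<chi> E r = \<chi>0 (b (2 * k - 1)))" if k: "k \<in> {1..N}" for k
      proof -
        have "k \<in> E \<longleftrightarrow> \<chi> E (b (2 * k - 1))"
          using \<chi>i[OF E(1) e(1,2)[OF k]] pcol_points(1)[of k E] k by simp
        then show ?thesis using proper_dist[OF pr[OF E(1)] con r e(1)[OF k]] unfolding \<chi>0_def by auto
      qed
      then show ?thesis using E(2) by (cases "\<chi> E r") (auto simp: E0_def E1_def)
    qed
    \<comment> \<open>As N is positive, the first edge tells the two colourings apart, so they
      contribute two separate terms.\<close>
    have "1 \<in> E0 \<longleftrightarrow> 1 \<notin> E1" using N by (auto simp: E0_def E1_def)
    then have ne01: "E0 \<noteq> E1" by blast
    have "(\<Sum>E\<in>Pow {1..N}. \<Prod>V\<in>U. mono_weight (pcol E) V (x V) (y V)) =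
        (\<Sum>E\<in>{E0, E1}. \<Prod>V\<in>U. mono_weight (pcol E) V (x V) (y V))"
      using inv only by (intro sum.mono_neutral_right) (auto simp: E0_def E1_def)
    also have "\<dots> = (\<Prod>V\<in>U. if \<chi>0 V then x V else y V) + (\<Prod>V\<in>U. if \<chi>0 V then y V else x V)"
    proof -
      have "(\<Prod>V\<in>U. if \<chi> E0 V then x V else y V) = (\<Prod>V\<in>U. if \<chi>0 V then x V else y V)"
        "(\<Prod>V\<in>U. if \<chi> E1 V then x V else y V) = (\<Prod>V\<in>U. if \<chi>0 V then y V else x V)"
        using \<chi>01 by (auto intro!: prod.cong)
      then show ?thesis using ne01 val v01 by simp
    qed
    also have "\<dots> = (\<Prod>V\<in>even_part ?G r U. x V) * (\<Prod>V\<in>odd_part ?G r U. y V) +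
        (\<Prod>V\<in>even_part ?G r U. y V) * (\<Prod>V\<in>odd_part ?G r U. x V)"
      unfolding \<chi>0_def prod_if_parts[OF finU] ..
    finally show ?thesis using True by simp
  qed
qed

section \<open>Connectedness of the graph\<close>

definition pairs :: "nat \<Rightarrow> (nat \<times> nat) set" where
  "pairs N = {(2 * k - 1, 2 * k) |k. k \<in> {1..N}}"

text \<open>A walk between blocks is the same as a chain of points that alternates between moving
  inside a block and crossing an edge.\<close>

lemma graph_connected_iff:
  assumes U: "partition_on {1..2*N} U" and N: "N \<ge> 1"
  shows "graph_connected (partition_graph N U) \<longleftrightarrow> comps {1..2*N} (prel U \<union> pairs N) = {{1..2*N}}"
proof
  let ?R = "prel U \<union> pairs N" and ?A = "adj_rel (partition_graph N U)"
  assume "graph_connected (partition_graph N U)"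
  then have con: "(u, v) \<in> ?A\<^sup>*" if "u \<in> U" "v \<in> U" for u v
    using that by (simp add: graph_connected_def partition_graph_def)
  have p: "(i, j) \<in> conn ?R" if "V \<in> U" "i \<in> V" "j \<in> V" for V i j
    using that by (intro conn_incl) (auto simp: prel_def)
  have walk: "v \<in> U \<and> (\<forall>i\<in>u. \<forall>j\<in>v. (i, j) \<in> conn ?R)" if "(u, v) \<in> ?A\<^sup>*" "u \<in> U" for u v
    using that
  proof (induction rule: rtrancl_induct)
    case base
    then show ?case using p by blast
  next
    case (step v w)
    then obtain k where k: "k \<in> {1..N}" "{block_of U (2 * k - 1), block_of U (2 * k)} = {v, w}"
      unfolding adj_iff by blast
    note e = edge_points[OF U k(1)]
    have pk: "(2 * k - 1, 2 * k) \<in> conn ?R" using k(1) by (intro conn_incl) (auto simp: pairs_def)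
    obtain s t where st: "s \<in> v" "t \<in> w" "(s, t) \<in> conn ?R" "w \<in> U"
      using k(2) e pk conn_sym[OF pk] unfolding doubleton_eq_iff by blast
    have "(i, j) \<in> conn ?R" if "i \<in> u" "j \<in> w" for i j
      using step.IH[OF step.prems] st that p[OF st(4,2) that(2)] conn_trans by meson
    then show ?case using st(4) by blast
  qed
  show "comps {1..2*N} ?R = {{1..2*N}}"
  proof (rule comps_singletonI)
    show "?R \<subseteq> {1..2*N} \<times> {1..2*N}" using prel_subset[OF U] by (auto simp: pairs_def)
    show "{1..2*N} \<noteq> {}" using N by auto
    fix i j assume "i \<in> {1..2*N}" "j \<in> {1..2*N}"
    note i = block_of_mem[OF U this(1)] and j = block_of_mem[OF U this(2)]
    show "(i, j) \<in> conn ?R" using walk[OF con[OF i(1) j(1)] i(1)] i(2) j(2) by blast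
  qed
next
  let ?R = "prel U \<union> pairs N" and ?A = "adj_rel (partition_graph N U)"
  assume con: "comps {1..2*N} ?R = {{1..2*N}}"
  have symA: "(v, u) \<in> ?A\<^sup>*" if "(u, v) \<in> ?A\<^sup>*" for u v
  proof -
    have "sym ?A" unfolding sym_def adj_iff by (auto simp: insert_commute)
    then show ?thesis using that sym_rtrancl by (metis symD)
  qed
  \<comment> \<open>The class of the block around i; it is constant inside a block and along an
    edge, hence on all points.\<close>
  define f where "f i = ?A\<^sup>* `` {block_of U i}" for i
  have f: "f i = f j" if "(i, j) \<in> ?R" for i j
    using that
  proof
    assume "(i, j) \<in> prel U"
    then obtain V where "V \<in> U" "i \<in> V" "j \<in> V" by (auto simp: prel_def)
    then show ?thesis using block_of_eq[OF U] by (simp add: f_def)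
  next
    assume "(i, j) \<in> pairs N"
    then have "(block_of U i, block_of U j) \<in> ?A" unfolding adj_iff pairs_def by auto
    then have "(block_of U i, block_of U j) \<in> ?A\<^sup>*" by blast
    then show ?thesis unfolding f_def using symA by (auto intro: rtrancl_trans)
  qed
  show "graph_connected (partition_graph N U)"
    unfolding graph_connected_def
  proof (intro ballI)
    fix u v assume "u \<in> verts (partition_graph N U)" "v \<in> verts (partition_graph N U)"
    then have uv: "u \<in> U" "v \<in> U" by (simp_all add: partition_graph_def)
    then have "u \<noteq> {}" "v \<noteq> {}" using partition_onD3[OF U] by auto
    then obtain i j where ij: "i \<in> u" "j \<in> v" by blast
    then have S: "i \<in> {1..2*N}" "j \<in> {1..2*N}" using uv partition_onD1[OF U] by blast+
    have "(i, j) \<in> conn ?R" by (rule comps_singletonD[OF con S])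
    then have "f i = f j" by (rule conn_invariant[rotated]) (rule f)
    moreover have "block_of U i = u" "block_of U j = v" using block_of_eq[OF U] uv ij by simp_all
    ultimately show "(u, v) \<in> ?A\<^sup>*" unfolding f_def by auto
  qed
qed

text \<open>By separation the steps of the doubled \<gamma> can be replaced by steps of \<pi>, which
  stay inside blocks of U, and vertical edges.\<close>

lemma sep_imp_connected:
  assumes fin: "finite S" and ne: "S \<noteq> {}" and \<gamma>: "\<gamma> permutes S"
    and m: "(U, \<pi>) \<in> PS (dset S) (dbl S \<gamma>)" and sep: "sep S (inv \<pi> \<circ> dbl S \<gamma>)"
  shows "comps (dset S) (prel U \<union> vert S) = {dset S}"
proof -
  have \<pi>: "\<pi> permutes dset S" and U: "partition_on (dset S) U" and le: "gr (dset S) \<pi> \<subseteq> prel U"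
    and con: "comps (dset S) (prel U \<union> gr (dset S) (dbl S \<gamma>)) = {dset S}"
    using m by (auto simp: PS_def)
  let ?R = "prel U \<union> vert S"
  have "gr (dset S) (dbl S \<gamma>) \<subseteq> conn (gr (dset S) \<pi> \<union> vert S)" by (rule sep_imp_conn[OF fin \<pi> \<gamma> sep])
  also have "\<dots> \<subseteq> conn ?R" using le by (intro conn_mono) auto
  finally have "prel U \<union> gr (dset S) (dbl S \<gamma>) \<subseteq> conn ?R" by (auto intro: conn_incl)
  then have c: "conn (prel U \<union> gr (dset S) (dbl S \<gamma>)) \<subseteq> conn ?R" by (rule conn_least)
  show ?thesis
  proof (rule comps_singletonI)
    show "?R \<subseteq> dset S \<times> dset S" using prel_subset[OF U] by (auto simp: vert_def)
    show "dset S \<noteq> {}" using ne by auto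
    show "(z, z') \<in> conn ?R" if "z \<in> dset S" "z' \<in> dset S" for z z'
      using comps_singletonD[OF con that] c by blast
  qed
qed

section \<open>Connectedness of the graph against separation of the even points\<close>

context two_circles
begin

text \<open>Let (U', \<tau>) be the pair below (U, \<pi>). Connectedness makes U' the one-block
  partition. Since \<pi> keeps to its circles, so does \<tau>, which rules out a single cycle. So
  \<tau> has two cycles like \<gamma>, hence equals \<gamma>, and \<pi> separates over it.\<close>

lemma connected_imp_sep:
  assumes m: "(U, \<pi>) \<in> PS (dset {1..p+q}) (dbl {1..p+q} \<gamma>)" and Z: "\<pi> ` dset Z \<subseteq> dset Z"
    and con: "comps (dset {1..p+q}) (prel U \<union> vert {1..p+q}) = {dset {1..p+q}}"
  shows "sep {1..p+q} (inv \<pi> \<circ> dbl {1..p+q} \<gamma>)"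
proof -
  let ?S = "{1..p+q}"
  have \<pi>: "\<pi> permutes dset ?S" and U: "partition_on (dset ?S) U" and le: "gr (dset ?S) \<pi> \<subseteq> prel U"
    using m by (auto simp: PS_def)
  obtain \<tau> where \<tau>: "\<tau> permutes ?S" "sep ?S (inv \<pi> \<circ> dbl ?S \<tau>)" using skeleton_exists[OF _ \<pi>] by auto
  let ?R = "prel U \<union> gr (dset ?S) (dbl ?S \<tau>)"
  define U' where "U' = comps ?S (proj ?R)"
  have P: "(U', \<tau>) \<in> PS ?S \<gamma>"
    using PS_double_iff[OF _ annular_perm_facts(1) \<tau>(1) \<pi> U le \<tau>(2) U'_def] m by simp
  have R: "?R \<subseteq> dset ?S \<times> dset ?S"
    using prel_subset[OF U] gr_subset[OF dbl_permutes[OF _ \<tau>(1)]] by auto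
  have v: "vert ?S \<subseteq> conn ?R" using vert_subset_gr by (fast intro: conn_incl)
  have c: "conn (prel U \<union> vert ?S) \<subseteq> conn ?R" using v by (intro conn_least) (auto intro: conn_incl)
  have Sne: "?S \<noteq> {}" using p by auto
  have cR: "comps (dset ?S) ?R = {dset ?S}"
  proof (rule comps_singletonI[OF R])
    show "dset ?S \<noteq> {}" using Sne by blast
    show "(z, z') \<in> conn ?R" if "z \<in> dset ?S" "z' \<in> dset ?S" for z z'
      using comps_singletonD[OF con that] c by blast
  qed
  have "dset ` U' = {dset ?S}" using comps_dset[OF R v] unfolding cR U'_def by (rule sym)
  then have U'S: "U' = {?S}" by (rule iffD1[OF dset_image_singleton])
  \<comment> \<open>A step of \<tau> is a chain of \<pi>-steps and vertical edges, none of which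
    leaves its circle.\<close>
  have \<tau>Z: "x \<in> Z \<longleftrightarrow> \<tau> x \<in> Z" if x: "x \<in> ?S" for x
  proof -
    have "((x, True), (\<tau> x, False)) \<in> gr (dset ?S) (dbl ?S \<tau>)" using x by (simp add: dbl_def)
    then have "((x, True), (\<tau> x, False)) \<in> conn (gr (dset ?S) \<pi> \<union> vert ?S)"
      using sep_imp_conn[OF _ \<pi> \<tau>] by auto
    then have "(fst (x, True) \<in> Z) = (fst (\<tau> x, False) \<in> Z)"
    proof (rule conn_invariant[rotated])
      have \<pi>Z: "\<pi> ` dset Z = dset Z" by (rule image_eq_of_subset[OF _ \<pi> Z]) simp
      fix u w assume "(u, w) \<in> gr (dset ?S) \<pi> \<union> vert ?S"
      then show "(fst u \<in> Z) = (fst w \<in> Z)"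
      proof
        assume "(u, w) \<in> gr (dset ?S) \<pi>"
        then have w: "w = \<pi> u" by simp
        have "u \<in> dset Z \<longleftrightarrow> \<pi> u \<in> dset Z"
          using \<pi>Z inj_image_mem_iff[OF permutes_inj[OF \<pi>], of u "dset Z"] by simp
        then show ?thesis unfolding w by (simp only: mem_Times_iff UNIV_I simp_thms)
      qed (auto simp: vert_def)
    qed
    then show ?thesis by simp
  qed
  have "cyc ?S \<tau> \<noteq> {?S}"
  proof
    assume one: "cyc ?S \<tau> = {?S}"
    obtain z y where zy: "z \<in> Z" "y \<in> Y" using ZY by blast
    then have "z \<in> ?S" "y \<in> ?S" by auto
    then have "(z, y) \<in> conn (gr ?S \<tau>)" by (rule comps_singletonD[OF one[unfolded cyc_def]])
    then have "(z \<in> Z) = (y \<in> Z)" by (rule conn_invariant[rotated]) (use \<tau>Z in auto)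
    then show False using zy ZY(1) by blast
  qed
  moreover have "?S \<in> U'" using U'S by simp
  ultimately have c: "cyc ?S \<tau> = {?S \<inter> Z, ?S - Z}" "?S \<inter> Z \<noteq> {}" "?S - Z \<noteq> {}"
    using PS_annular_blocks[OF P, of ?S] unfolding perm_restrict_self[OF \<tau>(1)] by blast+
  then have "?S \<inter> Z \<noteq> ?S - Z" by blast
  then have "card (cyc ?S \<tau>) = card (cyc ?S \<gamma>)"
    unfolding c(1) annular_perm_facts(6) using ZY(5) by simp
  then have "\<tau> = \<gamma>" using PS_full_perm[OF _ annular_perm_facts(1), of \<tau>] P U'S by simp
  then show ?thesis using \<tau>(2) by simp
qed

abbreviation "\<Gamma> \<equiv> annular_perm (2 * p) (2 * q)"
abbreviation "T \<equiv> {1..2 * p + 2 * q}"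

lemma pos_T: "pos ` dset {1..p+q} = T"
  using pos_image[of "p+q"] by simp

lemma pos_pairs: "pairs (p+q) = map_prod pos pos ` vert {1..p+q}"
proof -
  have "vert {1..p+q} = (\<lambda>k. ((k, False), (k, True))) ` {1..p+q}" by (auto simp: vert_def)
  moreover have "pairs (p+q) = (\<lambda>k. (2 * k - 1, 2 * k)) ` {1..p+q}" by (auto simp: pairs_def)
  ultimately show ?thesis by (simp add: image_image pos_def)
qed

lemma PS_pos_cases:
  assumes "(U, \<pi>) \<in> PS T \<Gamma>"
  obtains U0 \<pi>0 where "(U0, \<pi>0) \<in> PS (dset {1..p+q}) (dbl {1..p+q} \<gamma>)"
    "U = (`) pos ` U0" "\<pi> = relabel pos (dset {1..p+q}) \<pi>0"
proof -
  have "dbl {1..p+q} \<gamma> permutes dset {1..p+q}" by (intro dbl_permutes annular_perm_facts) simp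
  from bij_betw_imp_surj_on[OF bij_betw_PS_relabel[OF inj_on_pos this]]
  have "(U, \<pi>) \<in> (\<lambda>(U, \<pi>). ((`) pos ` U, relabel pos (dset {1..p+q}) \<pi>)) ` PS (dset {1..p+q}) (dbl {1..p+q} \<gamma>)"
    unfolding dbl_pos_annulus pos_T using assms by simp
  then show ?thesis using that by auto
qed

lemma separates_even_iff:
  assumes "(U, \<pi>) \<in> PS (dset {1..p+q}) (dbl {1..p+q} \<gamma>)"
  shows "separates_even (2 * p + 2 * q) (inv (relabel pos (dset {1..p+q}) \<pi>) \<circ> \<Gamma>) \<longleftrightarrow>
    sep {1..p+q} (inv \<pi> \<circ> dbl {1..p+q} \<gamma>)"
proof -
  let ?S = "{1..p+q}"
  define L where "L = inv \<pi> \<circ> dbl ?S \<gamma>"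
  have \<pi>: "\<pi> permutes dset ?S" using assms by (simp add: PS_def)
  have d: "dbl ?S \<gamma> permutes dset ?S" by (intro dbl_permutes annular_perm_facts) simp
  have L: "L permutes dset ?S" unfolding L_def using \<pi> d by (intro permutes_compose permutes_inv)
  have eq: "inv (relabel pos (dset ?S) \<pi>) \<circ> \<Gamma> = relabel pos (dset ?S) L"
    unfolding relabel_inv[OF inj_on_pos \<pi>] dbl_pos_annulus[symmetric] L_def
    by (rule relabel_comp[OF inj_on_pos d, symmetric])
  have "relabel pos (dset ?S) L permutes T" using relabel_permutes[OF inj_on_pos L] unfolding pos_T .
  then have cy: "cycles (2 * p + 2 * q) (relabel pos (dset ?S) L) = (`) pos ` cyc (dset ?S) L"
    using cycles_eq_cyc cyc_relabel[OF inj_on_pos L] unfolding pos_T by simp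
  have VS: "V \<subseteq> dset ?S" if "V \<in> cyc (dset ?S) L" for V
    using that partition_onD1[OF partition_on_cyc[OF L]] by blast
  have cyT: "(\<exists>V\<in>cyc (dset ?S) L. z \<in> V \<and> z' \<in> V) \<longleftrightarrow> (z, z') \<in> conn (gr (dset ?S) L)" if "z \<in> dset ?S" for z z'
  proof
    assume "\<exists>V\<in>cyc (dset ?S) L. z \<in> V \<and> z' \<in> V"
    then show "(z, z') \<in> conn (gr (dset ?S) L)"
      unfolding cyc_def comps_image by (auto intro: conn_trans conn_sym)
  next
    assume "(z, z') \<in> conn (gr (dset ?S) L)"
    then show "\<exists>V\<in>cyc (dset ?S) L. z \<in> V \<and> z' \<in> V"
      using that unfolding cyc_def comps_image by (intro bexI[OF _ imageI[of z]]) simp_all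
  qed
  show ?thesis
    unfolding L_def[symmetric] eq
  proof
    assume s: "separates_even (2 * p + 2 * q) (relabel pos (dset ?S) L)"
    show "sep ?S L" unfolding sep_def
    proof (intro ballI impI)
      fix x y assume xy: "x \<in> ?S" "y \<in> ?S" "((x, True), (y, True)) \<in> conn (gr (dset ?S) L)"
      then obtain V where V: "V \<in> cyc (dset ?S) L" "(x, True) \<in> V" "(y, True) \<in> V"
        using cyT[of "(x, True)" "(y, True)"] by auto
      have xyV: "2 * x \<in> pos ` V" "2 * y \<in> pos ` V"
        using imageI[OF V(2), of pos] imageI[OF V(3), of pos] by (simp_all add: pos_def)
      have "pos ` V \<in> cycles (2 * p + 2 * q) (relabel pos (dset ?S) L)" using V(1) cy by blast
      then have "\<not> (\<exists>i\<in>pos ` V. \<exists>j\<in>pos ` V. even i \<and> even j \<and> i \<noteq> j)"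
        using s unfolding separates_even_def by (rule bspec[rotated])
      moreover have "\<exists>i\<in>pos ` V. \<exists>j\<in>pos ` V. even i \<and> even j \<and> i \<noteq> j" if "x \<noteq> y"
        using that by (intro bexI[OF _ xyV(1)] bexI[OF _ xyV(2)]) simp
      ultimately show "x = y" by blast
    qed
  next
    assume s: "sep ?S L"
    show "separates_even (2 * p + 2 * q) (relabel pos (dset ?S) L)"
      unfolding separates_even_def cy
    proof (intro ballI notI, elim bexE conjE)
      fix V' i j assume V': "V' \<in> (`) pos ` cyc (dset ?S) L" and ij: "i \<in> V'" "j \<in> V'" "even i" "even j" "i \<noteq> j"
      obtain V where V: "V \<in> cyc (dset ?S) L" "V' = pos ` V" using V' by blast
      obtain x s' y t where xy: "(x, s') \<in> V" "i = pos (x, s')" "(y, t) \<in> V" "j = pos (y, t)"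
        using ij(1,2) V(2) by auto
      have S: "x \<in> ?S" "y \<in> ?S" using xy VS[OF V(1)] by auto
      then have st: "s'" "t" using xy ij(3,4) by (auto simp: pos_def split: if_splits)
      then have "((x, True), (y, True)) \<in> conn (gr (dset ?S) L)"
        using cyT[of "(x, True)" "(y, True)"] V(1) xy S by auto
      then have "x = y" using s S unfolding sep_def by blast
      then show False using xy st ij(5) by simp
    qed
  qed
qed

lemma graph_connected_pos:
  assumes "(U, \<pi>) \<in> PS (dset {1..p+q}) (dbl {1..p+q} \<gamma>)"
  shows "graph_connected (partition_graph (p+q) ((`) pos ` U)) \<longleftrightarrow>
    comps (dset {1..p+q}) (prel U \<union> vert {1..p+q}) = {dset {1..p+q}}"
proof -
  let ?S = "{1..p+q}"
  have U: "partition_on (dset ?S) U" using assms by (simp add: PS_def)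
  have sub: "prel U \<union> vert ?S \<subseteq> dset ?S \<times> dset ?S" using prel_subset[OF U] by (auto simp: vert_def)
  have "partition_on {1..2 * (p+q)} ((`) pos ` U)"
    using partition_on_image[OF inj_on_pos U] unfolding pos_image .
  then have "graph_connected (partition_graph (p+q) ((`) pos ` U)) \<longleftrightarrow>
      comps (pos ` dset ?S) (map_prod pos pos ` (prel U \<union> vert ?S)) = {pos ` dset ?S}"
    using graph_connected_iff[of "p+q" "(`) pos ` U"] p unfolding pos_image prel_image pos_pairs image_Un by simp
  also have "\<dots> \<longleftrightarrow> (`) pos ` comps (dset ?S) (prel U \<union> vert ?S) = (`) pos ` {dset ?S}"
    unfolding comps_map_image[OF inj_on_pos sub] by simp
  also have "\<dots> \<longleftrightarrow> comps (dset ?S) (prel U \<union> vert ?S) = {dset ?S}"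
  proof (rule inj_on_image_eq_iff[OF inj_on_image_Pow[OF inj_on_pos]])
    show "comps (dset ?S) (prel U \<union> vert ?S) \<subseteq> Pow (dset ?S)"
      using partition_onD1[OF partition_on_comps[OF sub]] by blast
  qed simp
  finally show ?thesis .
qed

lemma separates_imp_connected:
  assumes "(U, \<pi>) \<in> PS T \<Gamma>" "separates_even (2 * p + 2 * q) (inv \<pi> \<circ> \<Gamma>)"
  shows "graph_connected (partition_graph (p+q) U)"
proof -
  obtain U0 \<pi>0 where 0: "(U0, \<pi>0) \<in> PS (dset {1..p+q}) (dbl {1..p+q} \<gamma>)"
    "U = (`) pos ` U0" "\<pi> = relabel pos (dset {1..p+q}) \<pi>0"
    by (rule PS_pos_cases[OF assms(1)])
  have "comps (dset {1..p+q}) (prel U0 \<union> vert {1..p+q}) = {dset {1..p+q}}"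
    using separates_even_iff[OF 0(1)] assms(2) 0(3) p
    by (intro sep_imp_connected[OF _ _ annular_perm_facts(1) 0(1)]) auto
  then show ?thesis using graph_connected_pos[OF 0(1)] 0(2) by simp
qed

text \<open>Explains why the second sum of the theorem asks for connectedness where the first asks
  for separation.\<close>

lemma separates_iff_connected:
  assumes m: "(U, \<pi>) \<in> PS T \<Gamma>" and Z2: "\<pi> ` {1..2*p} \<subseteq> {1..2*p}"
  shows "separates_even (2 * p + 2 * q) (inv \<pi> \<circ> \<Gamma>) \<longleftrightarrow> graph_connected (partition_graph (p+q) U)"
proof
  assume con: "graph_connected (partition_graph (p+q) U)"
  obtain U0 \<pi>0 where 0: "(U0, \<pi>0) \<in> PS (dset {1..p+q}) (dbl {1..p+q} \<gamma>)"
    "U = (`) pos ` U0" "\<pi> = relabel pos (dset {1..p+q}) \<pi>0"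
    by (rule PS_pos_cases[OF m])
  have \<pi>0: "\<pi>0 permutes dset {1..p+q}" using 0(1) by (simp add: PS_def)
  have "\<pi>0 ` dset Z \<subseteq> dset Z"
  proof
    fix w assume "w \<in> \<pi>0 ` dset Z"
    then obtain z where z: "z \<in> dset Z" "w = \<pi>0 z" by blast
    have zS: "z \<in> dset {1..p+q}" using z(1) by auto
    have wS: "w \<in> dset {1..p+q}" using z(2) zS permutes_in_image[OF \<pi>0] by blast
    have "\<pi> (pos z) = pos w" unfolding 0(3) z(2) by (rule relabel_apply[OF inj_on_pos zS])
    moreover have "pos z \<in> {1..2*p}" using pos_le[OF zS] z(1) by blast
    ultimately have "pos w \<in> {1..2*p}" using Z2 by (metis image_subset_iff)
    then show "w \<in> dset Z" using pos_le[OF wS] by blast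
  qed
  moreover have "comps (dset {1..p+q}) (prel U0 \<union> vert {1..p+q}) = {dset {1..p+q}}"
    using con graph_connected_pos[OF 0(1)] 0(2) by simp
  ultimately have "sep {1..p+q} (inv \<pi>0 \<circ> dbl {1..p+q} \<gamma>)" by (rule connected_imp_sep[OF 0(1)])
  then show "separates_even (2 * p + 2 * q) (inv \<pi> \<circ> \<Gamma>)" using separates_even_iff[OF 0(1)] 0(3) by simp
qed (rule separates_imp_connected[OF m])

end

text \<open>Interchanges colourings and pairs, so that for each pair a sum over colourings of the
  edges remains, and passes from doubled points to numbers.\<close>

lemma (in weights) theta_annular:
  assumes "p \<ge> 1" "q \<ge> 1"
  shows "theta {1..p+q} (annular_perm p q) {1..p} =
    (\<Sum>(U, \<pi>)\<in>PS {1..2*p+2*q} (annular_perm (2*p) (2*q)).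
      if separates_even (2*p+2*q) (inv \<pi> \<circ> annular_perm (2*p) (2*q))
      then \<Sum>E\<in>Pow {1..p+q}. block_prod (pcol E) {1..2*p} (U, \<pi>) else 0)"
proof -
  interpret two_circles p q by unfold_locales (use assms in auto)
  let ?S = "{1..p+q}"
  have d: "dbl ?S \<gamma> permutes dset ?S" by (intro dbl_permutes annular_perm_facts) simp
  have "theta ?S \<gamma> Z = (\<Sum>x\<in>PSsep ?S \<gamma>. \<Sum>E\<in>Pow ?S. block_prod (col E) (dset Z) x)"
    unfolding theta_def by (rule sum.swap)
  also have "\<dots> = (\<Sum>x\<in>PS (dset ?S) (dbl ?S \<gamma>). if sep ?S (inv (snd x) \<circ> dbl ?S \<gamma>)
      then \<Sum>E\<in>Pow ?S. block_prod (col E) (dset Z) x else 0)"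
  proof -
    have "PSsep ?S \<gamma> = {x \<in> PS (dset ?S) (dbl ?S \<gamma>). sep ?S (inv (snd x) \<circ> dbl ?S \<gamma>)}" by (auto simp: PSsep_def)
    then show ?thesis by (simp only: sum.inter_filter finite_PS finite_dset finite_atLeastAtMost)
  qed
  also have "\<dots> = (\<Sum>(U, \<pi>)\<in>PS (dset ?S) (dbl ?S \<gamma>).
      (\<lambda>(U, \<pi>). if separates_even (2*p+2*q) (inv \<pi> \<circ> \<Gamma>)
        then \<Sum>E\<in>Pow ?S. block_prod (pcol E) {1..2*p} (U, \<pi>) else 0) ((`) pos ` U, relabel pos (dset ?S) \<pi>))"
  proof (intro sum.cong refl)
    fix x assume x: "x \<in> PS (dset ?S) (dbl ?S \<gamma>)"
    obtain U \<pi> where xU: "x = (U, \<pi>)" by (cases x)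
    note m = x[unfolded xU]
    have "block_prod (pcol E) {1..2*p} ((`) pos ` U, relabel pos (dset ?S) \<pi>) = block_prod (col E) (dset Z) (U, \<pi>)" for E
    proof -
      have "block_prod (pcol E) {1..2*p} ((`) pos ` U, relabel pos (dset ?S) \<pi>) = block_prod (\<lambda>z. pcol E (pos z)) (dset Z) (U, \<pi>)"
        by (rule block_prod_relabel[OF _ inj_on_pos m]) (simp, rule pos_le)
      also have "\<dots> = block_prod (col E) (dset Z) (U, \<pi>)" by (rule block_prod_cong[OF m]) (rule pcol_pos)
      finally show ?thesis .
    qed
    then show "(if sep ?S (inv (snd x) \<circ> dbl ?S \<gamma>) then \<Sum>E\<in>Pow ?S. block_prod (col E) (dset Z) x else 0) =
      (case x of (U, \<pi>) \<Rightarrow> (\<lambda>(U, \<pi>). if separates_even (2*p+2*q) (inv \<pi> \<circ> \<Gamma>)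
        then \<Sum>E\<in>Pow ?S. block_prod (pcol E) {1..2*p} (U, \<pi>) else 0) ((`) pos ` U, relabel pos (dset ?S) \<pi>))"
      unfolding xU using separates_even_iff[OF m] by simp
  qed
  also have "\<dots> = (\<Sum>(U, \<pi>)\<in>PS T \<Gamma>. if separates_even (2*p+2*q) (inv \<pi> \<circ> \<Gamma>)
      then \<Sum>E\<in>Pow ?S. block_prod (pcol E) {1..2*p} (U, \<pi>) else 0)"
    unfolding sum_PS_relabel[OF inj_on_pos d, symmetric] dbl_pos_annulus pos_T ..
  finally show ?thesis .
qed

section \<open>Evaluation of the terms on the two index sets\<close>

context free_pair
begin

text \<open>Every block is a cycle here. Separation supplies the connectedness that the colour sum
  needs, and the cycle of 1 serves as its root.\<close>

lemma annular_term:
  assumes n: "n \<ge> 1" and m: "m \<ge> 1" and \<pi>: "\<pi> \<in> S_NC (2*n) (2*m)"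
    and sep: "separates_even (2*n+2*m) (inv \<pi> \<circ> annular_perm (2*n) (2*m))"
  shows "(\<Sum>E\<in>Pow {1..n+m}. block_prod (pcol E) {1..2*n} (cycles (2*n+2*m) \<pi>, \<pi>)) =
    (if graph_bipartite (partition_graph (n+m) (cycles (2*n+2*m) \<pi>)) then
      cumulant_blocks \<phi> a (J_even n m \<pi>) * cumulant_blocks \<phi> b (J_odd n m \<pi>) +
      cumulant_blocks \<phi> b (J_even n m \<pi>) * cumulant_blocks \<phi> a (J_odd n m \<pi>) else 0)"
proof -
  interpret t: two_circles n m by unfold_locales (use n m in auto)
  interpret d: two_circles "2*n" "2*m" by unfold_locales (use n m in auto)
  let ?P = "cycles (2*n+2*m) \<pi>"
  have p: "\<pi> permutes {1..2*n+2*m}" using \<pi> by (simp add: S_NC_def)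
  have mem: "(?P, \<pi>) \<in> PS t.T t.\<Gamma>" using \<pi> unfolding d.PS_annular_perm(1) by blast
  have P: "partition_on {1..2*(n+m)} ?P" using partition_on_cyc[OF p] cycles_eq_cyc[OF p] by simp
  have con: "graph_connected (partition_graph (n+m) ?P)" by (rule t.separates_imp_connected[OF mem sep])
  have r: "orbit \<pi> 1 \<in> ?P" unfolding cycles_def using n by auto
  have "block_prod (pcol E) {1..2*n} (?P, \<pi>) =
      (\<Prod>V\<in>?P. mono_weight (pcol E) V (cumulant_pow \<phi> a (card V)) (cumulant_pow \<phi> b (card V)))" for E
    unfolding block_prod_def case_prod_conv cycles_eq_cyc[OF p]
    using prod_wt_cyc[OF _ p, of "w1 (pcol E)" "w2 (pcol E) {1..2*n}"] by (simp add: w1_def)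
  then show ?thesis
    using colour_sum[OF P _ con r, of "\<lambda>V. cumulant_pow \<phi> a (card V)" "\<lambda>V. cumulant_pow \<phi> b (card V)"] n
    by (simp add: J_even_def J_odd_def cumulant_blocks_def)
qed

text \<open>Connectedness decides whether a merged pair contributes. Rooting the colour sum at the
  merged block lets the colour of the root say which variable carries the second order
  cumulant.\<close>

lemma split_term:
  assumes n: "n \<ge> 1" and m: "m \<ge> 1"
    and U: "(U, \<pi>) \<in> split_pairs {1..2*n} {2*n+1..2*n+2*m} (annular_perm (2*n) (2*m))"
  defines "P \<equiv> cycles (2*n+2*m) \<pi>"
  shows "(if separates_even (2*n+2*m) (inv \<pi> \<circ> annular_perm (2*n) (2*m))
      then \<Sum>E\<in>Pow {1..n+m}. block_prod (pcol E) {1..2*n} (U, \<pi>) else 0) =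
    (if graph_connected (partition_graph (n+m) U) \<and> graph_bipartite (partition_graph (n+m) U) then
      cumulant_pow2 \<phi> \<phi>2 a (card (X_left n U P)) (card (X_right n U P)) *
         cumulant_blocks \<phi> a (X_even n m U P) * cumulant_blocks \<phi> b (X_odd n m U P) +
      cumulant_pow2 \<phi> \<phi>2 b (card (X_left n U P)) (card (X_right n U P)) *
         cumulant_blocks \<phi> b (X_even n m U P) * cumulant_blocks \<phi> a (X_odd n m U P) else 0)"
proof -
  interpret t: two_circles n m by unfold_locales (use n m in auto)
  interpret d: two_circles "2*n" "2*m" by unfold_locales (use n m in auto)
  let ?G = "partition_graph (n+m) U"
  obtain A B where *: "\<pi> permutes {1..2*n+2*m}" "P = cyc {1..2*n+2*m} \<pi>"
    "P = cyc d.Z (perm_restrict \<pi> d.Z) \<union> cyc d.Y (perm_restrict \<pi> d.Y)"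
    "A \<in> cyc d.Z (perm_restrict \<pi> d.Z)" "B \<in> cyc d.Y (perm_restrict \<pi> d.Y)"
    "U = insert (A \<union> B) (P - {A, B})" "merged_left (2*n) U P = A" "merged_right (2*n) U P = B"
    "A \<subseteq> d.Z" "B \<subseteq> d.Y" "A \<noteq> B" "\<pi> ` d.Z \<subseteq> d.Z"
    unfolding P_def by (rule d.split_pairs_facts[OF U])
  have mem: "(U, \<pi>) \<in> PS t.T t.\<Gamma>" using U unfolding d.PS_annular_perm(1) by blast
  have pU: "partition_on {1..2*(n+m)} U" using mem by (simp add: PS_def)
  have AB: "A \<in> cyc {1..2*n+2*m} \<pi>" "B \<in> cyc {1..2*n+2*m} \<pi>" using * by auto
  have ABP: "A \<union> B \<notin> P - {A, B}"
    using Un_notin_partition[OF partition_on_cyc[OF *(1)] AB *(11)] *(2) by blast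
  have rU: "A \<union> B \<in> U" using *(6) by blast
  have finP: "finite (P - {A, B})" using *(2) by simp
  have "(A \<union> B) \<inter> d.Z = A" "(A \<union> B) - d.Z = B" using *(9,10) d.ZY(1) by blast+
  note AB2 = this
  \<comment> \<open>The merged block gets the second order cumulant and all other blocks the first
    order one, so that the colour sum applies to the blocks of U.\<close>
  define x where "x V = (if V = A \<union> B then cumulant_pow2 \<phi> \<phi>2 a (card A) (card B) else cumulant_pow \<phi> a (card V))" for V
  define y where "y V = (if V = A \<union> B then cumulant_pow2 \<phi> \<phi>2 b (card A) (card B) else cumulant_pow \<phi> b (card V))" for V
  have bp: "block_prod (pcol E) {1..2*n} (U, \<pi>) = (\<Prod>V\<in>U. mono_weight (pcol E) V (x V) (y V))" for E
  proof -
    have "block_prod (pcol E) {1..2*n} (U, \<pi>) = w2 (pcol E) d.Z (A \<union> B) * (\<Prod>V\<in>P - {A, B}. w1 (pcol E) V)"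
      unfolding block_prod_def case_prod_conv *(6) *(2) by (rule prod_wt_merge[OF _ *(1) AB *(11)]) simp
    also have "w2 (pcol E) d.Z (A \<union> B) = mono_weight (pcol E) (A \<union> B) (x (A \<union> B)) (y (A \<union> B))"
      unfolding w2_def AB2 x_def y_def by simp
    also have "(\<Prod>V\<in>P - {A, B}. w1 (pcol E) V) = (\<Prod>V\<in>P - {A, B}. mono_weight (pcol E) V (x V) (y V))"
    proof (rule prod.cong[OF refl])
      fix V assume "V \<in> P - {A, B}"
      then have "V \<noteq> A \<union> B" using ABP by blast
      then show "w1 (pcol E) V = mono_weight (pcol E) V (x V) (y V)" by (simp add: w1_def x_def y_def)
    qed
    also have "mono_weight (pcol E) (A \<union> B) (x (A \<union> B)) (y (A \<union> B)) * (\<Prod>V\<in>P - {A, B}. mono_weight (pcol E) V (x V) (y V)) =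
        (\<Prod>V\<in>U. mono_weight (pcol E) V (x V) (y V))"
      unfolding *(6) by (rule prod.insert[OF finP ABP, symmetric])
    finally show ?thesis .
  qed
  \<comment> \<open>The root is at distance 0 and so lies in the even part, while
    \<open>X_even\<close> runs over unmerged cycles only; its factor is split off.\<close>
  have d0: "graph_dist ?G (A \<union> B) (A \<union> B) = 0" unfolding graph_dist_def by (rule Least_eq_0) simp
  have parts: "even_part ?G (A \<union> B) U = insert (A \<union> B) (X_even n m U P)" "odd_part ?G (A \<union> B) U = X_odd n m U P"
    unfolding even_part_def odd_part_def X_even_def X_odd_def *(7,8) using d0 *(6) by auto
  have XP: "X_even n m U P \<subseteq> P - {A, B}" "X_odd n m U P \<subseteq> P - {A, B}"
    unfolding even_part_def odd_part_def X_even_def X_odd_def *(7,8) by auto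
  have ev: "(\<Prod>V\<in>even_part ?G (A \<union> B) U. f V) = f (A \<union> B) * (\<Prod>V\<in>X_even n m U P. f V)" for f :: "nat set \<Rightarrow> complex"
    unfolding parts(1) using XP ABP finP finite_subset by (intro prod.insert) blast+
  have xb: "(\<Prod>V\<in>X. x V) = cumulant_blocks \<phi> a X" "(\<Prod>V\<in>X. y V) = cumulant_blocks \<phi> b X" if "X \<subseteq> P - {A, B}" for X
    using that ABP unfolding cumulant_blocks_def x_def y_def by (auto intro!: prod.cong)
  show ?thesis
  proof (cases "graph_connected ?G")
    case False
    then show ?thesis using t.separates_iff_connected[OF mem *(12)] by simp
  next
    case True
    then have s: "separates_even (2*n+2*m) (inv \<pi> \<circ> annular_perm (2*n) (2*m))"
      using t.separates_iff_connected[OF mem *(12)] by simp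
    have "(\<Sum>E\<in>Pow {1..n+m}. block_prod (pcol E) {1..2*n} (U, \<pi>)) =
      (if graph_bipartite ?G then
        x (A \<union> B) * cumulant_blocks \<phi> a (X_even n m U P) * cumulant_blocks \<phi> b (X_odd n m U P) +
        y (A \<union> B) * cumulant_blocks \<phi> b (X_even n m U P) * cumulant_blocks \<phi> a (X_odd n m U P) else 0)"
      using colour_sum[OF pU _ True rU, of x y] n unfolding bp ev parts(2) xb[OF XP(1)] xb[OF XP(2)] by simp
    then show ?thesis using True s unfolding *(7,8) by (simp add: x_def y_def)
  qed
qed

end

theorem theorem1p3:
  fixes scale :: "complex \<Rightarrow> 'a::ring_1 \<Rightarrow> 'a"
    and \<phi> :: "'a \<Rightarrow> complex" and \<phi>2 :: "'a \<Rightarrow> 'a \<Rightarrow> complex"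
    and a b :: 'a and n m :: nat
  assumes "second_order_ncps scale \<phi> \<phi>2"
    and "second_order_free \<phi> \<phi>2 a b"
    and "n \<ge> 1" and "m \<ge> 1"
  shows "cumulant_pow2 \<phi> \<phi>2 (a * b + b * a) n m =
    (\<Sum>\<pi>\<in>J_set n m.
       cumulant_blocks \<phi> a (J_even n m \<pi>) * cumulant_blocks \<phi> b (J_odd n m \<pi>) +
       cumulant_blocks \<phi> b (J_even n m \<pi>) * cumulant_blocks \<phi> a (J_odd n m \<pi>)) +
    (\<Sum>(U, P)\<in>X_set n m.
       cumulant_pow2 \<phi> \<phi>2 a (card (X_left n U P)) (card (X_right n U P)) *
         cumulant_blocks \<phi> a (X_even n m U P) * cumulant_blocks \<phi> b (X_odd n m U P) +
       cumulant_pow2 \<phi> \<phi>2 b (card (X_left n U P)) (card (X_right n U P)) *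
         cumulant_blocks \<phi> b (X_even n m U P) * cumulant_blocks \<phi> a (X_odd n m U P))"
proof -
  interpret free_pair scale \<phi> \<phi>2 a b
    using assms(1,2) by (intro free_pair.intro free_pair_axioms.intro)
  interpret d: two_circles "2*n" "2*m" by unfold_locales (use assms(3,4) in auto)
  let ?sep = "\<lambda>\<pi>. separates_even (2*n+2*m) (inv \<pi> \<circ> annular_perm (2*n) (2*m))"
  let ?bip = "\<lambda>U. graph_bipartite (partition_graph (n+m) U)"
  let ?con = "\<lambda>U. graph_connected (partition_graph (n+m) U)"
  let ?F = "\<lambda>(U, \<pi>). if ?sep \<pi> then \<Sum>E\<in>Pow {1..n+m}. block_prod (pcol E) {1..2*n} (U, \<pi>) else 0"
  let ?j = "\<lambda>\<pi>. cumulant_blocks \<phi> a (J_even n m \<pi>) * cumulant_blocks \<phi> b (J_odd n m \<pi>) +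
       cumulant_blocks \<phi> b (J_even n m \<pi>) * cumulant_blocks \<phi> a (J_odd n m \<pi>)"
  let ?x = "\<lambda>(U, P). cumulant_pow2 \<phi> \<phi>2 a (card (X_left n U P)) (card (X_right n U P)) *
         cumulant_blocks \<phi> a (X_even n m U P) * cumulant_blocks \<phi> b (X_odd n m U P) +
       cumulant_pow2 \<phi> \<phi>2 b (card (X_left n U P)) (card (X_right n U P)) *
         cumulant_blocks \<phi> b (X_even n m U P) * cumulant_blocks \<phi> a (X_odd n m U P)"
  let ?X = "\<lambda>(U, P). if ?con U \<and> ?bip U then ?x (U, P) else 0"
  have "\<kappa>2 n m = sum ?F (PS {1..2*n+2*m} (annular_perm (2*n) (2*m)))"
    unfolding cumulant_theta[OF assms(3,4)] by (rule theta_annular[OF assms(3,4)])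
  \<comment> \<open>Once evaluated, the term of a merged pair depends on \<pi> through its cycles
    only, so it can be summed over \<open>S_NC'\<close>.\<close>
  also have "\<dots> = (\<Sum>\<pi>\<in>S_NC (2*n) (2*m). ?F (cycles (2*n+2*m) \<pi>, \<pi>)) + sum ?X (S_NC' (2*n) (2*m))"
  proof (rule d.PS_annular_sum)
    fix U \<pi> assume "(U, \<pi>) \<in> split_pairs d.Z d.Y d.\<gamma>"
    from split_term[OF assms(3,4) this]
    show "?F (U, \<pi>) = ?X (U, cycles (2*n+2*m) \<pi>)" by simp
  qed
  also have "(\<Sum>\<pi>\<in>S_NC (2*n) (2*m). ?F (cycles (2*n+2*m) \<pi>, \<pi>)) = sum ?j (J_set n m)"
  proof -
    have fin: "finite (S_NC (2*n) (2*m))"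
      by (rule finite_subset[OF _ finite_permutations[of "{1..2*n+2*m}"]]) (auto simp: S_NC_def)
    have "(\<Sum>\<pi>\<in>S_NC (2*n) (2*m). ?F (cycles (2*n+2*m) \<pi>, \<pi>)) =
        (\<Sum>\<pi>\<in>S_NC (2*n) (2*m). if ?bip (cycles (2*n+2*m) \<pi>) \<and> ?sep \<pi> then ?j \<pi> else 0)"
      using annular_term[OF assms(3,4)] by (intro sum.cong refl) auto
    also have "\<dots> = sum ?j (J_set n m)" unfolding J_set_def by (rule sum.inter_filter[OF fin, symmetric])
    finally show ?thesis .
  qed
  also have "sum ?X (S_NC' (2*n) (2*m)) = sum ?x (X_set n m)"
  proof -
    have "X_set n m = {z \<in> S_NC' (2*n) (2*m). ?con (fst z) \<and> ?bip (fst z)}" by (auto simp: X_set_def)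
    then have "sum ?x (X_set n m) = (\<Sum>z\<in>S_NC' (2*n) (2*m). if ?con (fst z) \<and> ?bip (fst z) then ?x z else 0)"
      by (simp only: sum.inter_filter[OF finite_S_NC'])
    also have "\<dots> = sum ?X (S_NC' (2*n) (2*m))" by (intro sum.cong refl) auto
    finally show ?thesis by simp
  qed
  finally show ?thesis .
qed

end
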